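(* Let $(G,A,\alpha)$ be a locally $C^*$-dynamical system, let $u$ be a unitary representation of $G$ on a Hilbert module $E$ over a locally $C^*$-algebra $B$, and let $\rho$ be a $u$-covariant, non-degenerate, continuous completely positive linear map from $A$ to $L_B(E)$. (1) There is a covariant representation $(\Phi_\rho,v^\rho,E_\rho)$ of $(G,A,\alpha)$ on a Hilbert $B$-module $E_\rho$ and an element $V_\rho\in L_B(E,E_\rho)$ such that (a) $\rho(a)=V_\rho^*\Phi_\rho(a)V_\rho$ for all $a\in A$; (b) $\{\Phi_\rho(a)V_\rho\xi : a\in A,\ \xi\in E\}$ spans a dense submodule of $E_\rho$; (c) $v^\rho_gV_\rho=V_\rho u_g$ for all $g\in G$. (2) For $(\Phi_\rho,v^\rho,E_\rho)$ and $V_\rho$ as in (1): if $F$ is a Hilbert $B$-module, $(\Phi,v,F)$ is a covariant representation of $(G,A,\alpha)$ and $W\in L_B(E,F)$ is such that (a) $\rho(a)=W^*\Phi(a)W$ for all $a\in A$; (b) $\{\Phi(a)W\xi : a\in A,\ \xi\in E\}$ spans a dense submodule of $F$; (c) $v_gW=Wu_g$ for all $g\in G$, then there is a unitary operator $U\in L_B(E_\rho,F)$ such that (i) $\Phi(a)U=U\Phi_\rho(a)$ for all $a\in A$; (ii) $v_gU=Uv^\rho_g$ for all $g\in G$; (iii) $W=UV_\rho$.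
   Context: A locally $C^*$-algebra is a complete complex Hausdorff topological $*$-algebra whose topology is determined by a directed family of $C^*$-seminorms. $S(A)$ is the set of all continuous $C^*$-seminorms on $A$; for $p\in S(A)$, $A_p=A/\ker p$ is a $C^*$-algebra, $\pi_p:A\to A_p$ is the quotient map, and $A=\varprojlim_p A_p$. A morphism of locally $C^*$-algebras is a continuous $*$-morphism; an isomorphism is a bijective map that is a morphism and whose inverse is a morphism. An approximate unit of $A$ is an increasing net $\{e_\lambda\}$ of positive elements of $A$ with $p(e_\lambda)\le 1$ for all $p\in S(A)$ and all $\lambda$, and $p(ae_\lambda-a)\to0$, $p(e_\lambda a-a)\to0$ for all $p\in S(A)$, $a\in A$. $M_n(A)$ is the $*$-algebra of $n\times n$ matrices over $A$ with the topology of a direct sum of $n^2$ copies of $A$; it is a locally $C^*$-algebra. A linear map $\rho:A\to B$ between locally $C^*$-algebras is completely positive if for every $n\ge1$ the map $\rho^{(n)}:M_n(A)\to M_n(B)$, $[a_{ij}]\mapsto[\rho(a_{ij})]$, is positive. A pre-Hilbert $B$-module is a complex vector space $E$ that is a right $B$-module (compatibly with the complex structure) with a $B$-valued inner product $\langle\cdot,\cdot\rangle$, $\mathbb{C}$- and $B$-linear in the second variable, with $\langle\xi,\eta\rangle^*=\langle\eta,\xi\rangle$, $\langle\xi,\xi\rangle\ge0$, and $\langle\xi,\xi\rangle=0$ iff $\xi=0$. It is a Hilbert $B$-module if it is complete for the seminorms $\|\xi\|_q=\sqrt{q(\langle\xi,\xi\rangle)}$, $q\in S(B)$. For $q\in S(B)$,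 $\mathcal{E}_q=\{\xi\in E: q(\langle\xi,\xi\rangle)=0\}$, and $E_q=E/\mathcal{E}_q$ is a Hilbert $B_q$-module with $(\xi+\mathcal E_q)\pi_q(b)=\xi b+\mathcal E_q$ and $\langle\xi+\mathcal E_q,\eta+\mathcal E_q\rangle=\pi_q(\langle\xi,\eta\rangle)$. $L_B(E,F)$ is the set of adjointable $B$-module morphisms $T:E\to F$ (i.e. there is a $B$-module morphism $T^*:F\to E$ with $\langle T\xi,\eta\rangle=\langle\xi,T^*\eta\rangle$ for all $\xi\in E,\eta\in F$), topologized by the seminorms $\widetilde q(T)=\|(\pi_q)_*(T)\|$, $q\in S(B)$, where $(\pi_q)_*(T)\in L_{B_q}(E_q,F_q)$ is $\xi+\mathcal E_q\mapsto T\xi+\mathcal F_q$. $L_B(E)=L_B(E,E)$ is a locally $C^*$-algebra. The strict topology on $L_B(E)$ is given by the seminorms $T\mapsto\|T\xi\|_q+\|T^*\xi\|_q$, $q\in S(B)$, $\xi\in E$. A non-degenerate representation of $A$ on a Hilbert $B$-module $E$ is a morphism of locally $C^*$-algebras $\Phi:A\to L_B(E)$ such that $\Phi(A)E$ is dense in $E$. A continuous completely positive linear map $\rho:A\to L_B(E)$ is non-degenerate if, for some approximate unit $\{e_\lambda\}$ of $A$, $\{\rho(e_\lambda)\}$ converges strictly to the identity map on $E$. A locally $C^*$-dynamical system $(G,A,\alpha)$ consists of a locally compact group $G$, a locally $C^*$-algebra $A$, and a continuous action $\alpha$ of $G$ on $A$, i.e. a group morphism $\alpha$ from $G$ to the group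 of isomorphisms of locally $C^*$-algebras $A\to A$ such that $(t,a)\mapsto\alpha_t(a)$ is jointly continuous $G\times A\to A$. A unitary representation of $G$ on $E$ is a map $u:G\to L_B(E)$ such that each $u_g$ is unitary, $u_{gt}=u_gu_t$ for all $g,t\in G$, and $g\mapsto u_g\xi$ is continuous for every $\xi\in E$. A covariant representation of $(G,A,\alpha)$ on a Hilbert $B$-module $E$ is a triple $(\Phi,v,E)$ where $\Phi$ is a non-degenerate representation of $A$ on $E$, $v$ is a unitary representation of $G$ on $E$, and $\Phi(\alpha_g(a))=v_g\Phi(a)v_g^*$ for all $g\in G$, $a\in A$. A completely positive linear map $\rho:A\to L_B(E)$ is $u$-covariant with respect to $(G,A,\alpha)$ if $\rho(\alpha_g(a))=u_g\rho(a)u_g^*$ for all $a\in A$, $g\in G$. *)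

theory Defs
  imports "HOL-Analysis.Analysis" "HOL-Algebra.Module" "HOL-Algebra.Algebraic_Closure_Type"
begin

text \<open>
  All structures are records with explicit carriers in the style of HOL-Algebra. Complex vector
  spaces are modules (in the sense of HOL-Algebra) over the field of complex numbers. As usual for
  modules in HOL-Algebra, record fields not mentioned in the axioms are irrelevant: algebras need
  not be unital and their field \<^const>\<open>one\<close> is never used; for Hilbert modules, neither
  \<^const>\<open>mult\<close> nor \<^const>\<open>one\<close> is used.
\<close>

abbreviation complex_ring :: "complex ring"
  where "complex_ring \<equiv> ring_of_type_algebra"


section \<open>Topologies given by families of seminorms\<close>

definition seminorm_topology :: "('a, 'm) ring_scheme \<Rightarrow> ('a \<Rightarrow> real) set \<Rightarrow> 'a topology"
  where "seminorm_topology M P = topology (\<lambda>U. U \<subseteq> carrier M \<and>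
    (\<forall>x\<in>U. \<exists>F \<epsilon>. finite F \<and> F \<subseteq> P \<and> \<epsilon> > 0 \<and>
       {y \<in> carrier M. \<forall>p\<in>F. p (y \<ominus>\<^bsub>M\<^esub> x) < \<epsilon>} \<subseteq> U))"

lemma openin_seminorm_topology:
  "openin (seminorm_topology M P) U \<longleftrightarrow> U \<subseteq> carrier M \<and>
    (\<forall>x\<in>U. \<exists>F \<epsilon>. finite F \<and> F \<subseteq> P \<and> \<epsilon> > 0 \<and>
       {y \<in> carrier M. \<forall>p\<in>F. p (y \<ominus>\<^bsub>M\<^esub> x) < \<epsilon>} \<subseteq> U)"
proof -
  define nb where "nb x U \<longleftrightarrow> (\<exists>F \<epsilon>. finite F \<and> F \<subseteq> P \<and> (\<epsilon>::real) > 0 \<and>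
       {y \<in> carrier M. \<forall>p\<in>F. p (y \<ominus>\<^bsub>M\<^esub> x) < \<epsilon>} \<subseteq> U)" for x U
  have mono: "nb x V" if "nb x U" "U \<subseteq> V" for x U V
    using that unfolding nb_def by (meson order_trans)
  have int: "nb x (U \<inter> V)" if U: "nb x U" and V: "nb x V" for x U V
  proof -
    from U obtain F \<epsilon> where F: "finite F" "F \<subseteq> P" "\<epsilon> > 0"
      "{y \<in> carrier M. \<forall>p\<in>F. p (y \<ominus>\<^bsub>M\<^esub> x) < \<epsilon>} \<subseteq> U"
      unfolding nb_def by blast
    from V obtain F' \<epsilon>' where F': "finite F'" "F' \<subseteq> P" "\<epsilon>' > 0"
      "{y \<in> carrier M. \<forall>p\<in>F'. p (y \<ominus>\<^bsub>M\<^esub> x) < \<epsilon>'} \<subseteq> V"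
      unfolding nb_def by blast
    have "{y \<in> carrier M. \<forall>p\<in>F \<union> F'. p (y \<ominus>\<^bsub>M\<^esub> x) < min \<epsilon> \<epsilon>'} \<subseteq> U \<inter> V"
      using F(4) F'(4) by auto
    then show ?thesis
      unfolding nb_def using F(1-3) F'(1-3)
      by (intro exI[of _ "F \<union> F'"] exI[of _ "min \<epsilon> \<epsilon>'"]) auto
  qed
  have "istopology (\<lambda>U. U \<subseteq> carrier M \<and> (\<forall>x\<in>U. nb x U))"
    unfolding istopology_def
  proof (intro conjI allI impI)
    fix K assume K: "\<forall>k\<in>K. k \<subseteq> carrier M \<and> (\<forall>x\<in>k. nb x k)"
    show "\<Union>K \<subseteq> carrier M" using K by blast
    show "\<forall>x\<in>\<Union>K. nb x (\<Union>K)"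
    proof
      fix x assume "x \<in> \<Union>K"
      then obtain k where "k \<in> K" "x \<in> k" by blast
      then show "nb x (\<Union>K)" using K mono[of x k "\<Union>K"] by blast
    qed
  qed (use int in auto)
  then show ?thesis
    unfolding seminorm_topology_def nb_def by simp
qed

lemma topspace_seminorm_topology: "topspace (seminorm_topology M P) = carrier M"
proof
  show "topspace (seminorm_topology M P) \<subseteq> carrier M"
    using openin_seminorm_topology[of M P "topspace (seminorm_topology M P)"] by simp
  have "openin (seminorm_topology M P) (carrier M)"
    unfolding openin_seminorm_topology
    by (auto intro!: exI[of _ "{}::('a \<Rightarrow> real) set"] exI[of _ "1::real"])
  then show "carrier M \<subseteq> topspace (seminorm_topology M P)"
    by (rule openin_subset)
qed

text \<open>Every Cauchy filter on the carrier (equivalently, every Cauchy net) converges.\<close>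

definition seminorm_complete :: "('a, 'm) ring_scheme \<Rightarrow> ('a \<Rightarrow> real) set \<Rightarrow> bool"
  where "seminorm_complete M P \<longleftrightarrow>
    (\<forall>\<F>. \<F> \<noteq> bot \<longrightarrow> \<F> \<le> principal (carrier M) \<longrightarrow>
       (\<forall>p\<in>P. \<forall>\<epsilon>>0. \<forall>\<^sub>F (x, y) in \<F> \<times>\<^sub>F \<F>. p (x \<ominus>\<^bsub>M\<^esub> y) < \<epsilon>) \<longrightarrow>
       (\<exists>x\<in>carrier M. \<forall>p\<in>P. ((\<lambda>y. p (y \<ominus>\<^bsub>M\<^esub> x)) \<longlongrightarrow> 0) \<F>))"

definition dense_in :: "'a topology \<Rightarrow> 'a set \<Rightarrow> bool"
  where "dense_in T D \<longleftrightarrow> D \<subseteq> topspace T \<and> T closure_of D = topspace T"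

definition linear_on ::
  "(complex, 'a, 'm) module_scheme \<Rightarrow> (complex, 'b, 'n) module_scheme \<Rightarrow> ('a \<Rightarrow> 'b) \<Rightarrow> bool"
  where "linear_on M N f \<longleftrightarrow> f \<in> carrier M \<rightarrow> carrier N \<and>
    (\<forall>x\<in>carrier M. \<forall>y\<in>carrier M. f (x \<oplus>\<^bsub>M\<^esub> y) = f x \<oplus>\<^bsub>N\<^esub> f y) \<and>
    (\<forall>c. \<forall>x\<in>carrier M. f (c \<odot>\<^bsub>M\<^esub> x) = c \<odot>\<^bsub>N\<^esub> f x)"

text \<open>
  The complex linear span. For sets closed under the right action of the algebra, such as the sets
  $\{\Phi(a)V\xi\}$ below, it is also the Hilbert module's submodule generated by the set.
\<close>

definition linear_span :: "(complex, 'a, 'm) module_scheme \<Rightarrow> 'a set \<Rightarrow> 'a set"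
  where "linear_span M S = \<Inter>{H. submodule H complex_ring M \<and> S \<subseteq> H}"


section \<open>Locally $C^*$-algebras\<close>

record 'a star_algebra = "(complex, 'a) module" +
  star :: "'a \<Rightarrow> 'a"
  topo :: "'a topology"

locale star_algebra = Module.module complex_ring A for A :: "'a star_algebra" (structure) +
  assumes mult_closed: "\<lbrakk>a \<in> carrier A; b \<in> carrier A\<rbrakk> \<Longrightarrow> a \<otimes>\<^bsub>A\<^esub> b \<in> carrier A"
    and mult_assoc: "\<lbrakk>a \<in> carrier A; b \<in> carrier A; c \<in> carrier A\<rbrakk> \<Longrightarrow>
      (a \<otimes>\<^bsub>A\<^esub> b) \<otimes>\<^bsub>A\<^esub> c = a \<otimes>\<^bsub>A\<^esub> (b \<otimes>\<^bsub>A\<^esub> c)"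
    and mult_distr_left: "\<lbrakk>a \<in> carrier A; b \<in> carrier A; c \<in> carrier A\<rbrakk> \<Longrightarrow>
      (a \<oplus>\<^bsub>A\<^esub> b) \<otimes>\<^bsub>A\<^esub> c = a \<otimes>\<^bsub>A\<^esub> c \<oplus>\<^bsub>A\<^esub> b \<otimes>\<^bsub>A\<^esub> c"
    and mult_distr_right: "\<lbrakk>a \<in> carrier A; b \<in> carrier A; c \<in> carrier A\<rbrakk> \<Longrightarrow>
      a \<otimes>\<^bsub>A\<^esub> (b \<oplus>\<^bsub>A\<^esub> c) = a \<otimes>\<^bsub>A\<^esub> b \<oplus>\<^bsub>A\<^esub> a \<otimes>\<^bsub>A\<^esub> c"
    and smult_mult_left: "\<lbrakk>a \<in> carrier A; b \<in> carrier A\<rbrakk> \<Longrightarrow>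
      (z \<odot>\<^bsub>A\<^esub> a) \<otimes>\<^bsub>A\<^esub> b = z \<odot>\<^bsub>A\<^esub> (a \<otimes>\<^bsub>A\<^esub> b)"
    and smult_mult_right: "\<lbrakk>a \<in> carrier A; b \<in> carrier A\<rbrakk> \<Longrightarrow>
      a \<otimes>\<^bsub>A\<^esub> (z \<odot>\<^bsub>A\<^esub> b) = z \<odot>\<^bsub>A\<^esub> (a \<otimes>\<^bsub>A\<^esub> b)"
    and star_closed: "a \<in> carrier A \<Longrightarrow> star A a \<in> carrier A"
    and star_star: "a \<in> carrier A \<Longrightarrow> star A (star A a) = a"
    and star_add: "\<lbrakk>a \<in> carrier A; b \<in> carrier A\<rbrakk> \<Longrightarrow>
      star A (a \<oplus>\<^bsub>A\<^esub> b) = star A a \<oplus>\<^bsub>A\<^esub> star A b"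
    and star_smult: "a \<in> carrier A \<Longrightarrow> star A (z \<odot>\<^bsub>A\<^esub> a) = cnj z \<odot>\<^bsub>A\<^esub> star A a"
    and star_mult: "\<lbrakk>a \<in> carrier A; b \<in> carrier A\<rbrakk> \<Longrightarrow>
      star A (a \<otimes>\<^bsub>A\<^esub> b) = star A b \<otimes>\<^bsub>A\<^esub> star A a"

definition cstar_seminorm :: "'a star_algebra \<Rightarrow> ('a \<Rightarrow> real) \<Rightarrow> bool"
  where "cstar_seminorm A p \<longleftrightarrow>
    (\<forall>a\<in>carrier A. 0 \<le> p a) \<and>
    (\<forall>a\<in>carrier A. \<forall>b\<in>carrier A. p (a \<oplus>\<^bsub>A\<^esub> b) \<le> p a + p b) \<and>
    (\<forall>z. \<forall>a\<in>carrier A. p (z \<odot>\<^bsub>A\<^esub> a) = cmod z * p a) \<and>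
    (\<forall>a\<in>carrier A. \<forall>b\<in>carrier A. p (a \<otimes>\<^bsub>A\<^esub> b) \<le> p a * p b) \<and>
    (\<forall>a\<in>carrier A. p (star A a \<otimes>\<^bsub>A\<^esub> a) = (p a)\<^sup>2)"

text \<open>The set $S(A)$ of continuous $C^*$-seminorms. Only the values on the carrier matter.\<close>

definition cont_seminorms :: "'a star_algebra \<Rightarrow> ('a \<Rightarrow> real) set"
  where "cont_seminorms A = {p. cstar_seminorm A p \<and> continuous_map (topo A) euclideanreal p}"

locale locally_cstar_algebra = star_algebra A for A :: "'a star_algebra" (structure) +
  assumes continuous_add:
      "continuous_map (prod_topology (topo A) (topo A)) (topo A) (\<lambda>(a, b). a \<oplus>\<^bsub>A\<^esub> b)"
    and continuous_smult:
      "continuous_map (prod_topology euclidean (topo A)) (topo A) (\<lambda>(z, a). z \<odot>\<^bsub>A\<^esub> a)"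
    and continuous_mult:
      "continuous_map (prod_topology (topo A) (topo A)) (topo A) (\<lambda>(a, b). a \<otimes>\<^bsub>A\<^esub> b)"
    and continuous_star: "continuous_map (topo A) (topo A) (star A)"
    and Hausdorff: "Hausdorff_space (topo A)"
    and topology_from_seminorms: "\<exists>P. P \<noteq> {} \<and> (\<forall>p\<in>P. cstar_seminorm A p) \<and>
      (\<forall>p\<in>P. \<forall>q\<in>P. \<exists>r\<in>P. \<forall>a\<in>carrier A. p a \<le> r a \<and> q a \<le> r a) \<and>
      topo A = seminorm_topology A P"
    and complete: "seminorm_complete A (cont_seminorms A)"

definition lc_morphism :: "'a star_algebra \<Rightarrow> 'b star_algebra \<Rightarrow> ('a \<Rightarrow> 'b) \<Rightarrow> bool"
  where "lc_morphism A B \<phi> \<longleftrightarrow> linear_on A B \<phi> \<and>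
    (\<forall>a\<in>carrier A. \<forall>b\<in>carrier A. \<phi> (a \<otimes>\<^bsub>A\<^esub> b) = \<phi> a \<otimes>\<^bsub>B\<^esub> \<phi> b) \<and>
    (\<forall>a\<in>carrier A. \<phi> (star A a) = star B (\<phi> a)) \<and>
    continuous_map (topo A) (topo B) \<phi>"

definition lc_isomorphism :: "'a star_algebra \<Rightarrow> 'b star_algebra \<Rightarrow> ('a \<Rightarrow> 'b) \<Rightarrow> bool"
  where "lc_isomorphism A B \<phi> \<longleftrightarrow> bij_betw \<phi> (carrier A) (carrier B) \<and>
    lc_morphism A B \<phi> \<and> lc_morphism B A (inv_into (carrier A) \<phi>)"

text \<open>
  In a locally $C^*$-algebra, the elements $b^*b$ are exactly the self-adjoint elements with
  spectrum in $[0, \infty)$.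
\<close>

definition positive :: "'a star_algebra \<Rightarrow> 'a \<Rightarrow> bool"
  where "positive A a \<longleftrightarrow> (\<exists>b\<in>carrier A. a = star A b \<otimes>\<^bsub>A\<^esub> b)"

text \<open>
  The filter generated by the tails of a directed index set, so that convergence of nets is
  convergence along this filter.
\<close>

definition net_filter :: "'i set \<Rightarrow> ('i \<Rightarrow> 'i \<Rightarrow> bool) \<Rightarrow> 'i filter"
  where "net_filter I prec = (INF i\<in>I. principal {j\<in>I. prec i j})"

definition directed_index :: "'i set \<Rightarrow> ('i \<Rightarrow> 'i \<Rightarrow> bool) \<Rightarrow> bool"
  where "directed_index I prec \<longleftrightarrow> I \<noteq> {} \<and> (\<forall>i\<in>I. prec i i) \<and>
    (\<forall>i\<in>I. \<forall>j\<in>I. \<forall>k\<in>I. prec i j \<longrightarrow> prec j k \<longrightarrow> prec i k) \<and>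
    (\<forall>i\<in>I. \<forall>j\<in>I. \<exists>k\<in>I. prec i k \<and> prec j k)"

definition approximate_unit ::
  "'a star_algebra \<Rightarrow> 'i set \<Rightarrow> ('i \<Rightarrow> 'i \<Rightarrow> bool) \<Rightarrow> ('i \<Rightarrow> 'a) \<Rightarrow> bool"
  where "approximate_unit A I prec e \<longleftrightarrow> directed_index I prec \<and>
    (\<forall>i\<in>I. e i \<in> carrier A \<and> positive A (e i)) \<and>
    (\<forall>i\<in>I. \<forall>j\<in>I. prec i j \<longrightarrow> positive A (e j \<ominus>\<^bsub>A\<^esub> e i)) \<and>
    (\<forall>p\<in>cont_seminorms A. \<forall>i\<in>I. p (e i) \<le> 1) \<and>
    (\<forall>p\<in>cont_seminorms A. \<forall>a\<in>carrier A.
       ((\<lambda>i. p (a \<otimes>\<^bsub>A\<^esub> e i \<ominus>\<^bsub>A\<^esub> a)) \<longlongrightarrow> 0) (net_filter I prec) \<and>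
       ((\<lambda>i. p (e i \<otimes>\<^bsub>A\<^esub> a \<ominus>\<^bsub>A\<^esub> a)) \<longlongrightarrow> 0) (net_filter I prec))"

text \<open>An $n\times n$ matrix is an extensional function on \<open>{..<n} \<times> {..<n}\<close>.\<close>

definition matrix_algebra :: "nat \<Rightarrow> 'a star_algebra \<Rightarrow> (nat \<times> nat \<Rightarrow> 'a) star_algebra"
  where "matrix_algebra n A = \<lparr>
    carrier = ({..<n} \<times> {..<n}) \<rightarrow>\<^sub>E carrier A,
    mult = (\<lambda>M N. \<lambda>(i, k)\<in>{..<n} \<times> {..<n}. \<Oplus>\<^bsub>A\<^esub>j\<in>{..<n}. M (i, j) \<otimes>\<^bsub>A\<^esub> N (j, k)),
    one = (\<lambda>(i, j)\<in>{..<n} \<times> {..<n}. if i = j then \<one>\<^bsub>A\<^esub> else \<zero>\<^bsub>A\<^esub>),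
    zero = (\<lambda>_\<in>{..<n} \<times> {..<n}. \<zero>\<^bsub>A\<^esub>),
    add = (\<lambda>M N. \<lambda>ij\<in>{..<n} \<times> {..<n}. M ij \<oplus>\<^bsub>A\<^esub> N ij),
    smult = (\<lambda>z M. \<lambda>ij\<in>{..<n} \<times> {..<n}. z \<odot>\<^bsub>A\<^esub> M ij),
    star = (\<lambda>M. \<lambda>(i, j)\<in>{..<n} \<times> {..<n}. star A (M (j, i))),
    topo = product_topology (\<lambda>_. topo A) ({..<n} \<times> {..<n})\<rparr>"

definition completely_positive :: "'a star_algebra \<Rightarrow> 'b star_algebra \<Rightarrow> ('a \<Rightarrow> 'b) \<Rightarrow> bool"
  where "completely_positive A B \<rho> \<longleftrightarrow> linear_on A B \<rho> \<and>
    (\<forall>n\<ge>1. \<forall>M\<in>carrier (matrix_algebra n A). positive (matrix_algebra n A) M \<longrightarrow>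
       positive (matrix_algebra n B) (\<lambda>ij\<in>{..<n} \<times> {..<n}. \<rho> (M ij)))"


section \<open>Hilbert modules\<close>

record ('b, 'e) hilbert_module = "(complex, 'e) module" +
  ract :: "'e \<Rightarrow> 'b \<Rightarrow> 'e"
  ip :: "'e \<Rightarrow> 'e \<Rightarrow> 'b"

locale pre_hilbert_module = Module.module complex_ring E
  for B :: "'b star_algebra" and E :: "('b, 'e) hilbert_module" +
  assumes ract_closed: "\<lbrakk>\<xi> \<in> carrier E; b \<in> carrier B\<rbrakk> \<Longrightarrow> ract E \<xi> b \<in> carrier E"
    and ract_add_left: "\<lbrakk>\<xi> \<in> carrier E; \<eta> \<in> carrier E; b \<in> carrier B\<rbrakk> \<Longrightarrow>
      ract E (\<xi> \<oplus>\<^bsub>E\<^esub> \<eta>) b = ract E \<xi> b \<oplus>\<^bsub>E\<^esub> ract E \<eta> b"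
    and ract_add_right: "\<lbrakk>\<xi> \<in> carrier E; b \<in> carrier B; c \<in> carrier B\<rbrakk> \<Longrightarrow>
      ract E \<xi> (b \<oplus>\<^bsub>B\<^esub> c) = ract E \<xi> b \<oplus>\<^bsub>E\<^esub> ract E \<xi> c"
    and ract_mult: "\<lbrakk>\<xi> \<in> carrier E; b \<in> carrier B; c \<in> carrier B\<rbrakk> \<Longrightarrow>
      ract E \<xi> (b \<otimes>\<^bsub>B\<^esub> c) = ract E (ract E \<xi> b) c"
    and ract_smult_left: "\<lbrakk>\<xi> \<in> carrier E; b \<in> carrier B\<rbrakk> \<Longrightarrow>
      ract E (z \<odot>\<^bsub>E\<^esub> \<xi>) b = z \<odot>\<^bsub>E\<^esub> ract E \<xi> b"
    and ract_smult_right: "\<lbrakk>\<xi> \<in> carrier E; b \<in> carrier B\<rbrakk> \<Longrightarrow>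
      ract E \<xi> (z \<odot>\<^bsub>B\<^esub> b) = z \<odot>\<^bsub>E\<^esub> ract E \<xi> b"
    and ip_closed: "\<lbrakk>\<xi> \<in> carrier E; \<eta> \<in> carrier E\<rbrakk> \<Longrightarrow> ip E \<xi> \<eta> \<in> carrier B"
    and ip_add: "\<lbrakk>\<xi> \<in> carrier E; \<eta> \<in> carrier E; \<zeta> \<in> carrier E\<rbrakk> \<Longrightarrow>
      ip E \<xi> (\<eta> \<oplus>\<^bsub>E\<^esub> \<zeta>) = ip E \<xi> \<eta> \<oplus>\<^bsub>B\<^esub> ip E \<xi> \<zeta>"
    and ip_smult: "\<lbrakk>\<xi> \<in> carrier E; \<eta> \<in> carrier E\<rbrakk> \<Longrightarrow>
      ip E \<xi> (z \<odot>\<^bsub>E\<^esub> \<eta>) = z \<odot>\<^bsub>B\<^esub> ip E \<xi> \<eta>"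
    and ip_ract: "\<lbrakk>\<xi> \<in> carrier E; \<eta> \<in> carrier E; b \<in> carrier B\<rbrakk> \<Longrightarrow>
      ip E \<xi> (ract E \<eta> b) = ip E \<xi> \<eta> \<otimes>\<^bsub>B\<^esub> b"
    and ip_star: "\<lbrakk>\<xi> \<in> carrier E; \<eta> \<in> carrier E\<rbrakk> \<Longrightarrow> star B (ip E \<xi> \<eta>) = ip E \<eta> \<xi>"
    and ip_positive: "\<xi> \<in> carrier E \<Longrightarrow> positive B (ip E \<xi> \<xi>)"
    and ip_definite: "\<xi> \<in> carrier E \<Longrightarrow> ip E \<xi> \<xi> = \<zero>\<^bsub>B\<^esub> \<longleftrightarrow> \<xi> = \<zero>\<^bsub>E\<^esub>"

definition hm_norm :: "('b, 'e) hilbert_module \<Rightarrow> ('b \<Rightarrow> real) \<Rightarrow> 'e \<Rightarrow> real"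
  where "hm_norm E q \<xi> = sqrt (q (ip E \<xi> \<xi>))"

definition hm_topology :: "'b star_algebra \<Rightarrow> ('b, 'e) hilbert_module \<Rightarrow> 'e topology"
  where "hm_topology B E = seminorm_topology E (hm_norm E ` cont_seminorms B)"

locale hilbert_module = pre_hilbert_module B E
  for B :: "'b star_algebra" and E :: "('b, 'e) hilbert_module" +
  assumes complete: "seminorm_complete E (hm_norm E ` cont_seminorms B)"


section \<open>Adjointable operators\<close>

text \<open>
  Operators between Hilbert modules are extensional functions on the carrier, so that equality of
  operators is equality of functions.
\<close>

definition module_morphisms ::
  "'b star_algebra \<Rightarrow> ('b, 'e) hilbert_module \<Rightarrow> ('b, 'f) hilbert_module \<Rightarrow> ('e \<Rightarrow> 'f) set"
  where "module_morphisms B E F = {T \<in> carrier E \<rightarrow>\<^sub>E carrier F. linear_on E F T \<and>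
    (\<forall>\<xi>\<in>carrier E. \<forall>b\<in>carrier B. T (ract E \<xi> b) = ract F (T \<xi>) b)}"

definition is_adjoint ::
  "'b star_algebra \<Rightarrow> ('b, 'e) hilbert_module \<Rightarrow> ('b, 'f) hilbert_module \<Rightarrow>
    ('e \<Rightarrow> 'f) \<Rightarrow> ('f \<Rightarrow> 'e) \<Rightarrow> bool"
  where "is_adjoint B E F T S \<longleftrightarrow> S \<in> module_morphisms B F E \<and>
    (\<forall>\<xi>\<in>carrier E. \<forall>\<eta>\<in>carrier F. ip F (T \<xi>) \<eta> = ip E \<xi> (S \<eta>))"

definition adjointable ::
  "'b star_algebra \<Rightarrow> ('b, 'e) hilbert_module \<Rightarrow> ('b, 'f) hilbert_module \<Rightarrow> ('e \<Rightarrow> 'f) set"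
  where "adjointable B E F = {T \<in> module_morphisms B E F. \<exists>S. is_adjoint B E F T S}"

definition adjoint ::
  "'b star_algebra \<Rightarrow> ('b, 'e) hilbert_module \<Rightarrow> ('b, 'f) hilbert_module \<Rightarrow> ('e \<Rightarrow> 'f) \<Rightarrow> ('f \<Rightarrow> 'e)"
  where "adjoint B E F T = (THE S. is_adjoint B E F T S)"

definition id_on :: "('b, 'e) hilbert_module \<Rightarrow> 'e \<Rightarrow> 'e"
  where "id_on E = (\<lambda>\<xi>\<in>carrier E. \<xi>)"

text \<open>
  The operator norm of the map $E_q \to F_q$ induced by \<open>T\<close>. The norm of the class of
  $\xi$ in $E_q$ is $\|\xi\|_q$, so the supremum over the unit ball of $E_q$ is written with
  representatives. The set is bounded above whenever \<open>T\<close> is adjointable.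
\<close>

definition op_seminorm ::
  "('b, 'e) hilbert_module \<Rightarrow> ('b, 'f) hilbert_module \<Rightarrow> ('b \<Rightarrow> real) \<Rightarrow> ('e \<Rightarrow> 'f) \<Rightarrow> real"
  where "op_seminorm E F q T = (SUP \<xi>\<in>{\<xi> \<in> carrier E. hm_norm E q \<xi> \<le> 1}. hm_norm F q (T \<xi>))"

definition operator_module ::
  "'b star_algebra \<Rightarrow> ('b, 'e) hilbert_module \<Rightarrow> (complex, 'e \<Rightarrow> 'e) module"
  where "operator_module B E = \<lparr>
    carrier = adjointable B E E,
    mult = compose (carrier E),
    one = id_on E,
    zero = (\<lambda>\<xi>\<in>carrier E. \<zero>\<^bsub>E\<^esub>),
    add = (\<lambda>S T. \<lambda>\<xi>\<in>carrier E. S \<xi> \<oplus>\<^bsub>E\<^esub> T \<xi>),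
    smult = (\<lambda>z T. \<lambda>\<xi>\<in>carrier E. z \<odot>\<^bsub>E\<^esub> T \<xi>)\<rparr>"

definition operator_algebra ::
  "'b star_algebra \<Rightarrow> ('b, 'e) hilbert_module \<Rightarrow> ('e \<Rightarrow> 'e) star_algebra"
  where "operator_algebra B E = module.extend (operator_module B E) (star_algebra.fields
    (adjoint B E E)
    (seminorm_topology (operator_module B E) (op_seminorm E E ` cont_seminorms B)))"

definition strict_topology ::
  "'b star_algebra \<Rightarrow> ('b, 'e) hilbert_module \<Rightarrow> ('e \<Rightarrow> 'e) topology"
  where "strict_topology B E = seminorm_topology (operator_algebra B E)
    {\<lambda>T. hm_norm E q (T \<xi>) + hm_norm E q (adjoint B E E T \<xi>) |q \<xi>.
       q \<in> cont_seminorms B \<and> \<xi> \<in> carrier E}"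

definition unitary_op ::
  "'b star_algebra \<Rightarrow> ('b, 'e) hilbert_module \<Rightarrow> ('b, 'f) hilbert_module \<Rightarrow> ('e \<Rightarrow> 'f) \<Rightarrow> bool"
  where "unitary_op B E F U \<longleftrightarrow> U \<in> adjointable B E F \<and>
    compose (carrier E) (adjoint B E F U) U = id_on E \<and>
    compose (carrier F) U (adjoint B E F U) = id_on F"


section \<open>Representations and completely positive maps\<close>

text \<open>
  The dense set is the set of all $\Phi(a)\xi$ itself. Since \<open>A\<close> has an approximate unit, requiring
  only its linear span to be dense would give the same notion.
\<close>

definition nondegenerate_representation ::
  "'a star_algebra \<Rightarrow> 'b star_algebra \<Rightarrow> ('b, 'e) hilbert_module \<Rightarrow> ('a \<Rightarrow> 'e \<Rightarrow> 'e) \<Rightarrow> bool"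
  where "nondegenerate_representation A B E \<Phi> \<longleftrightarrow> lc_morphism A (operator_algebra B E) \<Phi> \<and>
    dense_in (hm_topology B E) {\<Phi> a \<xi> |a \<xi>. a \<in> carrier A \<and> \<xi> \<in> carrier E}"

text \<open>
  Non-degeneracy of a completely positive map asks for some approximate unit. HOL cannot quantify
  over the type of its index set, so this type is a parameter; a theorem that assumes this property
  for a type variable \<open>'i\<close> covers all index sets.
\<close>

definition nondegenerate_cp ::
  "'i itself \<Rightarrow> 'a star_algebra \<Rightarrow> 'b star_algebra \<Rightarrow> ('b, 'e) hilbert_module \<Rightarrow>
    ('a \<Rightarrow> 'e \<Rightarrow> 'e) \<Rightarrow> bool"
  where "nondegenerate_cp _ A B E \<rho> \<longleftrightarrow> (\<exists>(I :: 'i set) prec e. approximate_unit A I prec e \<and>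
    limitin (strict_topology B E) (\<lambda>i. \<rho> (e i)) (id_on E) (net_filter I prec))"


section \<open>Dynamical systems and covariance\<close>

text \<open>The group is not required to be Hausdorff, so both conventions are covered.\<close>

definition locally_compact_group :: "('g, 'm) monoid_scheme \<Rightarrow> 'g topology \<Rightarrow> bool"
  where "locally_compact_group G \<T> \<longleftrightarrow> group G \<and> topspace \<T> = carrier G \<and>
    continuous_map (prod_topology \<T> \<T>) \<T> (\<lambda>(g, t). g \<otimes>\<^bsub>G\<^esub> t) \<and>
    continuous_map \<T> \<T> (\<lambda>g. inv\<^bsub>G\<^esub> g) \<and>
    locally_compact_space \<T>"

definition dynamical_system ::
  "('g, 'm) monoid_scheme \<Rightarrow> 'g topology \<Rightarrow> 'a star_algebra \<Rightarrow> ('g \<Rightarrow> 'a \<Rightarrow> 'a) \<Rightarrow> bool"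
  where "dynamical_system G \<T> A \<alpha> \<longleftrightarrow> locally_compact_group G \<T> \<and> locally_cstar_algebra A \<and>
    (\<forall>g\<in>carrier G. lc_isomorphism A A (\<alpha> g)) \<and>
    (\<forall>g\<in>carrier G. \<forall>t\<in>carrier G. \<forall>a\<in>carrier A. \<alpha> (g \<otimes>\<^bsub>G\<^esub> t) a = \<alpha> g (\<alpha> t a)) \<and>
    continuous_map (prod_topology \<T> (topo A)) (topo A) (\<lambda>(t, a). \<alpha> t a)"

definition unitary_representation ::
  "('g, 'm) monoid_scheme \<Rightarrow> 'g topology \<Rightarrow> 'b star_algebra \<Rightarrow> ('b, 'e) hilbert_module \<Rightarrow>
    ('g \<Rightarrow> 'e \<Rightarrow> 'e) \<Rightarrow> bool"
  where "unitary_representation G \<T> B E u \<longleftrightarrow>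
    (\<forall>g\<in>carrier G. unitary_op B E E (u g)) \<and>
    (\<forall>g\<in>carrier G. \<forall>t\<in>carrier G. u (g \<otimes>\<^bsub>G\<^esub> t) = u g \<otimes>\<^bsub>operator_algebra B E\<^esub> u t) \<and>
    (\<forall>\<xi>\<in>carrier E. continuous_map \<T> (hm_topology B E) (\<lambda>g. u g \<xi>))"

text \<open>
  The condition $\rho(\alpha_g(a)) = u_g \rho(a) u_g^*$, shared by covariant representations and
  \<open>u\<close>-covariant completely positive maps.
\<close>

definition covariant ::
  "('g, 'm) monoid_scheme \<Rightarrow> 'a star_algebra \<Rightarrow> ('g \<Rightarrow> 'a \<Rightarrow> 'a) \<Rightarrow> 'b star_algebra \<Rightarrow>
    ('b, 'e) hilbert_module \<Rightarrow> ('g \<Rightarrow> 'e \<Rightarrow> 'e) \<Rightarrow> ('a \<Rightarrow> 'e \<Rightarrow> 'e) \<Rightarrow> bool"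
  where "covariant G A \<alpha> B E u \<rho> \<longleftrightarrow> (\<forall>g\<in>carrier G. \<forall>a\<in>carrier A.
    \<rho> (\<alpha> g a) = u g \<otimes>\<^bsub>operator_algebra B E\<^esub> \<rho> a \<otimes>\<^bsub>operator_algebra B E\<^esub> star (operator_algebra B E) (u g))"

definition covariant_representation ::
  "('g, 'm) monoid_scheme \<Rightarrow> 'g topology \<Rightarrow> 'a star_algebra \<Rightarrow> ('g \<Rightarrow> 'a \<Rightarrow> 'a) \<Rightarrow>
    'b star_algebra \<Rightarrow> ('b, 'e) hilbert_module \<Rightarrow> ('a \<Rightarrow> 'e \<Rightarrow> 'e) \<Rightarrow> ('g \<Rightarrow> 'e \<Rightarrow> 'e) \<Rightarrow> bool"
  where "covariant_representation G \<T> A \<alpha> B E \<Phi> v \<longleftrightarrow> hilbert_module B E \<and>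
    nondegenerate_representation A B E \<Phi> \<and> unitary_representation G \<T> B E v \<and>
    covariant G A \<alpha> B E v \<Phi>"

text \<open>
  \<open>(\<Phi>, v, F)\<close> is a covariant representation and \<open>W\<close> an adjointable operator from \<open>E\<close> to \<open>F\<close> with
  $\rho(a) = W^*\Phi(a)W$, with $\{\Phi(a)W\xi\}$ spanning a dense submodule of \<open>F\<close>, and with
  $v_g W = W u_g$. Because of the density condition, a vector $\eta$ of \<open>F\<close> is determined by the
  function $(a, \xi) \mapsto \langle \Phi(a)W\xi, \eta\rangle$. Up to unitary equivalence, \<open>F\<close> can
  therefore always be taken with carrier in the type \<open>'a \<times> 'e \<Rightarrow> 'b\<close>, and no generality is lost when
  existence is stated for that type.
\<close>

definition covariant_dilation ::
  "('g, 'm) monoid_scheme \<Rightarrow> 'g topology \<Rightarrow> 'a star_algebra \<Rightarrow> ('g \<Rightarrow> 'a \<Rightarrow> 'a) \<Rightarrow>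
    'b star_algebra \<Rightarrow> ('b, 'e) hilbert_module \<Rightarrow> ('g \<Rightarrow> 'e \<Rightarrow> 'e) \<Rightarrow> ('a \<Rightarrow> 'e \<Rightarrow> 'e) \<Rightarrow>
    ('b, 'f) hilbert_module \<Rightarrow> ('a \<Rightarrow> 'f \<Rightarrow> 'f) \<Rightarrow> ('g \<Rightarrow> 'f \<Rightarrow> 'f) \<Rightarrow> ('e \<Rightarrow> 'f) \<Rightarrow> bool"
  where "covariant_dilation G \<T> A \<alpha> B E u \<rho> F \<Phi> v W \<longleftrightarrow>
    covariant_representation G \<T> A \<alpha> B F \<Phi> v \<and> W \<in> adjointable B E F \<and>
    (\<forall>a\<in>carrier A. \<rho> a = compose (carrier E) (adjoint B E F W) (compose (carrier E) (\<Phi> a) W)) \<and>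
    dense_in (hm_topology B F)
      (linear_span F {\<Phi> a (W \<xi>) |a \<xi>. a \<in> carrier A \<and> \<xi> \<in> carrier E}) \<and>
    (\<forall>g\<in>carrier G. compose (carrier E) (v g) W = compose (carrier E) W (u g))"

end

theory Submission
  imports Defs "HOL-Computational_Algebra.Fundamental_Theorem_Algebra"
begin

text \<open>
  The theorem is Stinespring's dilation theorem for Hilbert modules over locally $C^*$-algebras, with
  a group action. In any dilation the vectors $\Phi(a)W\xi$ span a dense subspace, and
  $\langle\Phi(a)W\xi,\Phi(b)W\eta\rangle = \langle\xi,\rho(a^*b)\eta\rangle$ depends only on \<open>\<rho>\<close>. Two
  dilations therefore have generators with the same kernel, hence a unitary that matches these
  generators, and it intertwines everything because the operators act on generators by the same
  formulas. This proves uniqueness (\<open>covariant_dilations_equivalent\<close>).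

  For existence (\<open>covariant_dilation_exists\<close>), the kernel
  $((a,\xi),(b,\eta)) \mapsto \langle\xi,\rho(a^*b)\eta\rangle$ is positive definite by complete
  positivity, and a positive definite kernel has a Hilbert module generated by vectors
  $\iota(a,\xi)$ with this kernel (\<open>kernel_realization\<close>). On it, $\Phi(b)\iota(a,\xi) = \iota(ba,\xi)$
  and $v_g\iota(a,\xi) = \iota(\alpha_g(a),u_g\xi)$ define \<open>\<Phi>\<close> and \<open>v\<close>, while $V\xi$ is the limit
  of $\iota(e_i,\xi)$ along an approximate unit.

  Two facts carry the weight. One is the elementary theory of positive elements: $b^*b$ has
  non-negative spectrum, sums and limits of positive elements are positive, and norms are monotone.
  It is developed for all $C^*$-seminorms simultaneously, from polynomials in one self-adjoint element.
  It yields the Cauchy-Schwarz inequality, the limit defining \<open>V\<close>, and the truncations needed to show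
  that adjointable operators are bounded (\<open>adjointable_bounded\<close>). The other is
  \<open>operator_from_generators\<close>, which produces an adjointable operator from its values, and those of its
  adjoint, on generators.
\<close>

notation cont_seminorms ("\<S>")

section \<open>$C^*$-seminorms on polynomials\<close>

text \<open>
 Spectral theory in the algebras at hand, which have no unit, reduces to polynomials in one
 self-adjoint element. A $C^*$-seminorm on polynomials turns out to be a supremum of
 $|p(t)|$ over real \<open>t\<close>; this is proved with the fundamental theorem of algebra alone, without
 Banach algebras.
\<close>

locale poly_cstar_seminorm =
 fixes N :: "complex poly => real"
 assumes triangle: "N (p + r) \<le> N p + N r"
  and homogeneous: "N (Polynomial.smult z p) = cmod z * N p"
  and submultiplicative: "N (p * r) \<le> N p * N r"
  and cstar: "N (map_poly cnj p * p) = (N p)\<^sup>2"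
  and N_one: "N 1 = 1"
begin

abbreviation conj :: "complex poly => complex poly" where "conj \<equiv> map_poly cnj"

definition bounded_below_at :: "complex poly => bool"
 where "bounded_below_at p \<longleftrightarrow> (\<exists>del>0. \<forall>f. del * N f \<le> N (p * f))"

definition character_at :: "complex => bool"
 where "character_at z \<longleftrightarrow> (\<forall>f. cmod (poly f z) \<le> N f)"

lemma N_0 [simp]: "N 0 = 0" using homogeneous[of 0 0] by simp

lemma N_neg [simp]: "N (- p) = N p" using homogeneous[of "-1" p] by simp

lemma N_nonneg: "0 \<le> N p" using triangle[of p "- p"] by simp

lemma N_diff: "N (p - r) \<le> N p + N r" using triangle[of p "- r"] by simp

lemma conj_mult: "conj (p * r) = conj p * conj r" by (intro poly_eqI) (simp add: coeff_map_poly coeff_mult)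

lemma conj_add: "conj (p + r) = conj p + conj r" by (intro poly_eqI) (simp add: coeff_map_poly)

lemma conj_diff: "conj (p - r) = conj p - conj r" by (intro poly_eqI) (simp add: coeff_map_poly)

lemma conj_smult: "conj (Polynomial.smult z p) = Polynomial.smult (cnj z) (conj p)"
 by (intro poly_eqI) (simp add: coeff_map_poly)

lemma conj_conj [simp]: "conj (conj p) = p" by (intro poly_eqI) (simp add: coeff_map_poly)

lemma conj_1 [simp]: "conj 1 = 1" by (simp add: map_poly_1)

lemma conj_power: "conj (p ^ n) = conj p ^ n" by (induction n) (simp_all add: conj_mult)

lemma N_conj [simp]: "N (conj p) = N p"
proof -
 have le: "N r \<le> N (conj r)" for r
 proof (cases "N r = 0")
  case False
  have "N r * N r \<le> N (conj r) * N r" using submultiplicative[of "conj r" r] cstar[of r] by (simp add: power2_eq_square)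
  with False N_nonneg[of r] show ?thesis by (simp add: mult_le_cancel_right)
 qed (use N_nonneg in simp)
 from le[of p] le[of "conj p"] show ?thesis by simp
qed

lemma N_square: "conj w = w ==> N (w * w) = (N w)\<^sup>2" using cstar[of w] by simp

lemma N_le_sum_of_squares:
 assumes x: "conj x = x" and y: "conj y = y"
 shows "(N x)\<^sup>2 \<le> N (x * x + y * y)"
proof -
 define z where "z = x + Polynomial.smult \<i> y"
 have cz: "conj z = x - Polynomial.smult \<i> y" by (simp add: z_def conj_add conj_smult x y)
 have "conj z * z = x * x + y * y" by (subst cz) (simp add: z_def algebra_simps)
 then have "(N z)\<^sup>2 = N (x * x + y * y)" using cstar[of z] by simp
 moreover have "N x \<le> N z"
 proof -
  have "z + conj z = Polynomial.smult 2 x" by (subst cz) (simp add: z_def numeral_poly)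
  then have "2 * N x = N (z + conj z)" using homogeneous[of 2 x] by simp
  also have "... \<le> N z + N z" using triangle[of z "conj z"] by simp
  finally show ?thesis by simp
 qed
 ultimately show ?thesis using N_nonneg power_mono[of "N x" "N z" 2] by simp
qed

lemma N_one_plus_square:
 assumes z: "conj z = z" and c: "conj c = c"
 shows "2 * N (z * c) \<le> N ((1 + z * z) * c)"
proof -
 let ?w = "(1 + z * z) * c" and ?x = "Polynomial.smult 2 (z * c)" and ?y = "(1 - z * z) * c"
 have two: "Polynomial.smult 2 r = 2 * r" for r :: "complex poly" by (simp add: numeral_poly)
 have "?w * ?w = ?x * ?x + ?y * ?y" unfolding two by (simp add: algebra_simps)
 moreover have "(N ?x)\<^sup>2 \<le> N (?x * ?x + ?y * ?y)" by (rule N_le_sum_of_squares)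
   (simp_all only: conj_smult conj_mult conj_diff z c conj_1 complex_cnj_numeral)
 moreover have "N (?w * ?w) = (N ?w)\<^sup>2" by (rule N_square) (simp only: conj_mult conj_add z c conj_1)
 ultimately have "(2 * N (z * c))\<^sup>2 \<le> (N ?w)\<^sup>2" using homogeneous[of 2 "z * c"] by simp
 then show ?thesis using N_nonneg by (rule power2_le_imp_le)
qed

text \<open>
 The norm of $\prod_{i<r}(1+k^{2\cdot 2^i})$ is at least $2^r$, because
 $\|(1+z^2)c\| \ge 2\|zc\|$ for self-adjoint \<open>z\<close> and \<open>c\<close>. Multiplied by $1-k^2$ the product telescopes
 to $1-k^{2\cdot 2^r}$, whose norm is at most 2.
\<close>

lemma not_bounded_below_one_minus_square:
 assumes k: "conj k = k" "N k = 1"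
 shows "\<not> bounded_below_at (1 - k * k)"
proof
 assume "bounded_below_at (1 - k * k)"
 then obtain del where del: "del > 0" "!!f. del * N f \<le> N ((1 - k * k) * f)" unfolding bounded_below_at_def by blast
 define g where "g r = (\<Prod>i<r. 1 + k ^ 2 ^ i * k ^ 2 ^ i)" for r :: nat
 have conj_g: "conj (g r) = g r" for r unfolding g_def by (induction r) (simp_all add: conj_mult conj_add conj_power k)
 have lower: "2 ^ r * N (k ^ (2 ^ r - 1) * c) \<le> N (g r * c)" if "conj c = c" for r c using that
 proof (induction r arbitrary: c)
  case 0
  then show ?case by (simp add: g_def)
 next
  case (Suc r)
  let ?z = "k ^ 2 ^ r"
  have ck: "conj ?z = ?z" by (simp add: conj_power k)
  have "2 ^ Suc r * N (k ^ (2 ^ Suc r - 1) * c) = 2 * (2 ^ r * N (k ^ (2 ^ r - 1) * (?z * c)))"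
  proof -
   have "(2::nat) ^ Suc r - 1 = (2 ^ r - 1) + 2 ^ r" by simp
   then have "k ^ (2 ^ Suc r - 1) = k ^ (2 ^ r - 1) * ?z" by (metis power_add)
   then show ?thesis by (simp add: mult.assoc)
  qed
  also have "... \<le> 2 * N (g r * (?z * c))" using Suc.IH[of "?z * c"] Suc.prems by (simp add: conj_mult ck)
  also have "g r * (?z * c) = ?z * (g r * c)" by (simp add: algebra_simps)
  also have "2 * N (?z * (g r * c)) \<le> N ((1 + ?z * ?z) * (g r * c))"
   by (rule N_one_plus_square) (simp_all add: conj_mult ck conj_g Suc.prems)
  also have "(1 + ?z * ?z) * (g r * c) = g (Suc r) * c" by (simp add: g_def algebra_simps)
  finally show ?case .
 qed
 have pow2: "N (k ^ 2 ^ r) = 1" for r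
 proof (induction r)
  case (Suc r)
  have "k ^ 2 ^ Suc r = k ^ 2 ^ r * k ^ 2 ^ r" by (simp add: power_add mult_2)
  then show ?case using N_square[of "k ^ 2 ^ r"] Suc by (simp add: conj_power k)
 qed (use k in simp)
 have ge1: "1 \<le> N (k ^ (2 ^ r - 1))" for r
 proof -
  have "k ^ 2 ^ r = k ^ (2 ^ r - 1) * k" by (metis One_nat_def Suc_pred pos2 power_Suc2 zero_less_power)
  then show ?thesis using submultiplicative[of "k ^ (2 ^ r - 1)" k] pow2[of r] k by simp
 qed
 have lower': "2 ^ r \<le> N (g r)" for r
 proof -
  have "2 ^ r * 1 \<le> 2 ^ r * N (k ^ (2 ^ r - 1))" by (rule mult_left_mono[OF ge1]) simp
  also have "... \<le> N (g r * 1)" using lower[of 1 r] by simp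
  finally show ?thesis by simp
 qed
 \<comment> \<open>The product telescopes.\<close>
 have tele: "(1 - k * k) * g r = 1 - k ^ 2 ^ r * k ^ 2 ^ r" for r
 proof (induction r)
  case 0
  show ?case unfolding g_def by simp
 next
  case (Suc r)
  let ?z = "k ^ 2 ^ r"
  have "(1 - k * k) * g (Suc r) = ((1 - k * k) * g r) * (1 + ?z * ?z)" by (simp add: g_def algebra_simps)
  also have "... = 1 - (?z * ?z) * (?z * ?z)" unfolding Suc by (simp add: algebra_simps)
  also have "?z * ?z = k ^ 2 ^ Suc r" by (simp add: power_add mult_2)
  finally show ?case .
 qed
 have "del * 2 ^ r \<le> 2" for r
 proof -
  have "del * 2 ^ r \<le> del * N (g r)" using lower' del(1) by simp
  also have "... \<le> N (1 - k ^ 2 ^ r * k ^ 2 ^ r)" using del(2)[of "g r"] tele by simp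
  also have "... \<le> N 1 + N (k ^ 2 ^ r * k ^ 2 ^ r)" by (rule N_diff)
  also have "... \<le> 2" using submultiplicative[of "k ^ 2 ^ r" "k ^ 2 ^ r"] pow2[of r] N_one by simp
  finally show ?thesis .
 qed
 moreover obtain r :: nat where "2 / del < 2 ^ r" using real_arch_pow[of 2 "2 / del"] by auto
 ultimately show False using del(1) by (metis not_le pos_divide_less_eq mult.commute)
qed

lemma not_bounded_below_root:
 assumes "P \<noteq> 0" "\<not> bounded_below_at P"
 shows "\<exists>z. poly P z = 0 \<and> \<not> bounded_below_at [:- z, 1:]" using assms
proof (induction "Polynomial.degree P" arbitrary: P)
 case 0
 then obtain c where c: "P = [:c:]" using degree_eq_zeroE[of P] by metis
 with 0 have "c \<noteq> 0" by auto
 have "\<forall>f. cmod c * N f \<le> N (P * f)" using c homogeneous by simp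
 then have "bounded_below_at P"  unfolding bounded_below_at_def using \<open>c \<noteq> 0\<close> zero_less_norm_iff by blast
 with 0 show ?case by simp
next
 case (Suc n)
 then obtain z where z: "poly P z = 0" using fundamental_theorem_of_algebra[of P] by (auto simp: constant_degree)
 then obtain Q where Q: "P = [:- z, 1:] * Q" by (metis dvdE poly_eq_0_iff_dvd)
 with Suc.prems have Q0: "Q \<noteq> 0" by auto
 then have deg: "Polynomial.degree Q = n" using Suc.hyps(2) Q by (simp add: degree_mult_eq del: mult_pCons_left)
 show ?case
 proof (cases "bounded_below_at [:- z, 1:]")
  case True
  have "\<not> bounded_below_at Q"
  proof
   assume "bounded_below_at Q"
   then obtain d where d: "d > 0" "!!f. d * N f \<le> N (Q * f)" unfolding bounded_below_at_def by blast
   from True obtain e where e: "e > 0" "!!f. e * N f \<le> N ([:- z, 1:] * f)" unfolding bounded_below_at_def by blast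
   have "e * d * N f \<le> N (P * f)" for f
   proof -
    have "e * d * N f \<le> e * N (Q * f)" using d(2)[of f] e(1) by simp
    also have "... \<le> N ([:- z, 1:] * (Q * f))" by (rule e(2))
    finally show ?thesis by (simp add: Q mult.assoc del: mult_pCons_left)
   qed
   moreover have "e * d > 0" using d(1) e(1) by simp
   ultimately have "bounded_below_at P" unfolding bounded_below_at_def by blast
   with Suc.prems show False by blast
  qed
  with Suc.hyps(1)[of Q] deg Q0 obtain z' where "poly Q z' = 0" "\<not> bounded_below_at [:- z', 1:]" by blast
  then show ?thesis unfolding Q poly_mult by auto
 qed (use z in blast)
qed

lemma not_bounded_below_imp_real:
 assumes "\<not> bounded_below_at [:- z, 1:]"
 shows "Im z = 0"
proof (rule ccontr)
 assume im: "Im z \<noteq> 0"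
 have "\<bar>Im z\<bar> * N f \<le> N ([:- z, 1:] * f)" for f
 proof -
  let ?m = "[:- z, 1:]"
  have conjm: "conj ?m = [:- cnj z, 1:]" by (simp add: map_poly_pCons)
  have "(N (conj ?m * f))\<^sup>2 = N (conj (conj ?m * f) * (conj ?m * f))" by (rule cstar[symmetric])
  also have "conj (conj ?m * f) * (conj ?m * f) = conj (?m * f) * (?m * f)"
   unfolding conj_mult conj_conj by (simp only: mult_ac)
  also have "N ... = (N (?m * f))\<^sup>2" by (rule cstar)
  finally have eq: "N (conj ?m * f) = N (?m * f)" using N_nonneg by (simp add: power2_eq_iff_nonneg)
  have "conj ?m * f - ?m * f = Polynomial.smult (2 * \<i> * Im z) f" unfolding conjm
   by (simp add: algebra_simps complex_diff_cnj flip: smult_diff_left smult_add_left)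
  then have "2 * \<bar>Im z\<bar> * N f = N (conj ?m * f - ?m * f)" using homogeneous[of "2 * \<i> * Im z" f] by (simp add: norm_mult)
  also have "... \<le> 2 * N (?m * f)" using N_diff[of "conj ?m * f" "?m * f"] eq by simp
  finally show ?thesis by simp
 qed
 moreover have "\<bar>Im z\<bar> > 0" using im by simp
 ultimately show False using assms unfolding bounded_below_at_def by blast
qed

text \<open>
 Polynomials \<open>f\<close> with $\|(X-z)f\|$ small against $\|f\|$ are approximate eigenvectors, on which
 multiplication by \<open>g\<close> acts almost as the scalar $g(z)$.
\<close>

lemma not_bounded_below_imp_character:
 assumes "\<not> bounded_below_at [:- z, 1:]"
 shows "character_at z" unfolding character_at_def
proof
 fix g
 have "[:- z, 1:] dvd g - [:poly g z:]" by (simp add: poly_eq_0_iff_dvd[symmetric])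
 then obtain r where r: "g - [:poly g z:] = [:- z, 1:] * r" by (rule dvdE)
 show "cmod (poly g z) \<le> N g"
 proof (rule field_le_epsilon)
  fix e :: real assume e: "e > 0"
  define del where "del = e / (N r + 1)"
  have "del > 0" using e N_nonneg[of r] by (simp add: del_def)
  then obtain f where f: "N ([:- z, 1:] * f) < del * N f" using assms unfolding bounded_below_at_def by (meson not_le)
  then have Nf: "N f > 0"
   using N_nonneg[of "[:- z, 1:] * f"] N_nonneg[of f] \<open>del > 0\<close> by (metis less_eq_real_def linorder_not_le mult_zero_right)
  have "Polynomial.smult (poly g z) f = g * f - r * ([:- z, 1:] * f)"
  proof -
   have "[:poly g z:] = g - r * [:- z, 1:]" using r by (simp add: algebra_simps)
   then have "[:poly g z:] * f = (g - r * [:- z, 1:]) * f" by simp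
   then show ?thesis by (simp add: algebra_simps del: mult_pCons_left mult_pCons_right) simp
  qed
  then have "cmod (poly g z) * N f \<le> N (g * f) + N (r * ([:- z, 1:] * f))" using N_diff homogeneous by metis
  also have "... \<le> N g * N f + N r * N ([:- z, 1:] * f)" using submultiplicative add_mono by blast
  also have "... \<le> N g * N f + N r * (del * N f)" using f N_nonneg[of r] by (simp add: mult_left_mono)
  also have "... = (N g + N r * del) * N f" by (simp add: algebra_simps)
  finally have "cmod (poly g z) \<le> N g + N r * del" using Nf by simp
  also have "N r * del \<le> e" using e N_nonneg[of r] by (simp add: del_def field_simps)
  finally show "cmod (poly g z) \<le> N g + e" by simp
 qed
qed

lemma not_bounded_below_real_character:
 assumes "P \<noteq> 0" "\<not> bounded_below_at P"
 shows "\<exists>t::real. poly P (of_real t) = 0 \<and> character_at (of_real t)"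
proof -
 obtain z where z: "poly P z = 0" "\<not> bounded_below_at [:- z, 1:]" using not_bounded_below_root[OF assms] by blast
 have "z = of_real (Re z)" using not_bounded_below_imp_real[OF z(2)] by (simp add: complex_eq_iff)
 then show ?thesis using z(1) not_bounded_below_imp_character[OF z(2)] by metis
qed

text \<open>
 For $k = p^*p/\|p\|^2$ the polynomial $1-k^2$ is not bounded below, so one of its roots is a real
 character \<open>t\<close>, and $k(t)^2 = 1$ says that $|p(t)| = \|p\|$.
\<close>

lemma norm_attained_at_real_character_nonconst:
 assumes deg: "Polynomial.degree p > 0"
 shows "\<exists>t::real. character_at (of_real t) \<and> cmod (poly p (of_real t)) = N p"
proof (cases "N p = 0")
 case True
 have "\<not> bounded_below_at p"
 proof
  assume "bounded_below_at p"
  then obtain d where "d > 0" "d * N 1 \<le> N (p * 1)" unfolding bounded_below_at_def by blast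
  then show False using True N_one by simp
 qed
 moreover have "p \<noteq> 0" using deg by auto
 ultimately show ?thesis using not_bounded_below_real_character[of p] True by auto
next
 case False
 with N_nonneg[of p] have Np: "N p > 0" by simp
 define k where "k = Polynomial.smult (of_real (1 / (N p)\<^sup>2)) (conj p * p)"
 have ck: "conj k = k" by (simp add: k_def conj_smult conj_mult mult.commute)
 have "N k = 1" using Np by (simp add: k_def homogeneous cstar norm_divide norm_power)
 have dp: "Polynomial.degree (conj p) = Polynomial.degree p" by (rule degree_map_poly) simp
 have "Polynomial.degree k > 0"
 proof -
  have "p \<noteq> 0" "conj p \<noteq> 0" using deg dp by auto
  then show ?thesis using deg Np dp by (simp add: k_def degree_mult_eq)
 qed
 then have "k \<noteq> 0" by auto
 with \<open>Polynomial.degree k > 0\<close> have "Polynomial.degree (k * k) > 0" by (simp add: degree_mult_eq)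
 then have "1 - k * k \<noteq> 0" by auto
 then obtain t :: real where t: "poly (1 - k * k) t = 0" "character_at (of_real t)"
  using not_bounded_below_real_character[OF _ not_bounded_below_one_minus_square[OF ck \<open>N k = 1\<close>]] by blast
 have pc: "poly (conj p) (of_real t) = cnj (poly p (of_real t))" by (induction p) (simp_all add: map_poly_pCons)
 let ?w = "cmod (poly p (of_real t))"
 have "poly k t = of_real (?w\<^sup>2 / (N p)\<^sup>2)" by (simp add: k_def pc complex_norm_square[symmetric] mult.commute)
 then have "complex_of_real ((?w\<^sup>2 / (N p)\<^sup>2)\<^sup>2) = 1"
  using t(1) unfolding poly_diff poly_mult poly_1 right_minus_eq power2_eq_square[of "_ / _"] of_real_mult by metis
 then have "(?w\<^sup>2 / (N p)\<^sup>2)\<^sup>2 = 1" unfolding of_real_eq_1_iff .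
 moreover have "?w\<^sup>2 / (N p)\<^sup>2 \<ge> 0" by simp
 ultimately have "?w\<^sup>2 / (N p)\<^sup>2 = 1" unfolding power2_eq_1_iff by linarith
 then have "?w\<^sup>2 = (N p)\<^sup>2" using Np by simp
 then have "?w = N p" using Np by (simp add: power2_eq_iff_nonneg)
 with t(2) show ?thesis by blast
qed

theorem norm_attained_at_real_character:
 "\<exists>t::real. character_at (of_real t) \<and> cmod (poly p (of_real t)) = N p"
proof (cases "Polynomial.degree p > 0")
 case False
 then obtain c where c: "p = [:c:]" by (metis degree_eq_zeroE gr0I)
 then have "p = Polynomial.smult c 1" by simp
 then have "N p = cmod c" using homogeneous[of c 1] N_one by simp
 moreover have "Polynomial.degree [:0, 1::complex:] > 0" by simp
 ultimately show ?thesis using norm_attained_at_real_character_nonconst[of "[:0, 1:]"] c by auto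
qed (rule norm_attained_at_real_character_nonconst)

end

lemma complex_ring_simps [simp]:
 "carrier complex_ring = UNIV" "\<one>\<^bsub>complex_ring\<^esub> = 1" "\<zero>\<^bsub>complex_ring\<^esub> = 0"
 "z \<oplus>\<^bsub>complex_ring\<^esub> w = z + w" "z \<otimes>\<^bsub>complex_ring\<^esub> w = z * w" by (simp_all add: ring_of_type_algebra_def)

lemma complex_ring_a_inv [simp]: "\<ominus>\<^bsub>complex_ring\<^esub> z = - z"
proof -
 interpret cring complex_ring by (rule cring_from_type_algebra)
 show ?thesis by (rule minus_equality) simp_all
qed

lemma (in abelian_group) diff_split:
 "[|x \<in> carrier G; y \<in> carrier G; z \<in> carrier G|] ==> x \<ominus> z = (x \<ominus> y) \<oplus> (y \<ominus> z)" by (simp add: minus_eq a_assoc r_neg1)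

lemma (in abelian_group) diff_add_diff:
 "[|a \<in> carrier G; b \<in> carrier G; c \<in> carrier G; d \<in> carrier G|] ==>
  (a \<oplus> b) \<ominus> (c \<oplus> d) = (a \<ominus> c) \<oplus> (b \<ominus> d)" by (simp add: minus_eq minus_add a_ac)

lemma (in abelian_group) diff_add_cancel:
 "[|x \<in> carrier G; y \<in> carrier G|] ==> (x \<ominus> y) \<oplus> y = x" by (simp add: minus_eq a_assoc l_neg)

lemma (in abelian_group) diff_eq_zero_iff:
 "[|x \<in> carrier G; y \<in> carrier G|] ==> x \<ominus> y = \<zero> \<longleftrightarrow> x = y" using diff_add_cancel[of x y] by (auto simp: minus_eq r_neg)

lemma (in abelian_group) minus_diff:
 "[|x \<in> carrier G; y \<in> carrier G|] ==> \<ominus> (x \<ominus> y) = y \<ominus> x" by (simp add: minus_eq minus_add a_ac)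

locale complex_module = Module.module complex_ring M for M (structure)
begin

lemma smult_in [simp, intro]: "x \<in> carrier M ==> z \<odot> x \<in> carrier M" using smult_closed[of z x] by simp

lemma smult_add_left: "x \<in> carrier M ==> (z + w) \<odot> x = z \<odot> x \<oplus> w \<odot> x" using smult_l_distr[of z w x] by simp

lemma smult_add_right: "[|x \<in> carrier M; y \<in> carrier M|] ==> z \<odot> (x \<oplus> y) = z \<odot> x \<oplus> z \<odot> y"
 using smult_r_distr[of z x y] by simp

lemma smult_smult: "x \<in> carrier M ==> z \<odot> (w \<odot> x) = (z * w) \<odot> x" using smult_assoc1[of z w x] by simp

lemma smult_zero_left [simp]: "x \<in> carrier M ==> 0 \<odot> x = \<zero>" using smult_l_null[of x] by simp

lemma smult_zero_right [simp]: "z \<odot> \<zero> = \<zero>" using smult_r_null[of z] by simp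

lemma smult_1 [simp]: "x \<in> carrier M ==> 1 \<odot> x = x" using smult_one[of x] by simp

lemma smult_minus_left: "x \<in> carrier M ==> (- z) \<odot> x = \<ominus> (z \<odot> x)" using smult_l_minus[of z x] by simp

lemma smult_minus_right: "x \<in> carrier M ==> z \<odot> (\<ominus> x) = \<ominus> (z \<odot> x)" using smult_r_minus[of z x] by simp

lemma smult_minus_1: "x \<in> carrier M ==> (- 1) \<odot> x = \<ominus> x" by (simp add: smult_minus_left)

lemma smult_diff_right: "[|x \<in> carrier M; y \<in> carrier M|] ==> z \<odot> (x \<ominus> y) = z \<odot> x \<ominus> z \<odot> y"
 by (simp add: M.minus_eq smult_add_right smult_minus_right)

end

locale seminormed_module = complex_module M for M (structure) +
 fixes p :: "'a => real"
 assumes nonneg: "x \<in> carrier M ==> 0 \<le> p x"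
  and triangle: "[|x \<in> carrier M; y \<in> carrier M|] ==> p (x \<oplus> y) \<le> p x + p y"
  and homogeneous: "x \<in> carrier M ==> p (z \<odot> x) = cmod z * p x"
begin

lemma zero [simp]: "p \<zero> = 0" using homogeneous[of \<zero> 0] by simp

lemma minus [simp]: "x \<in> carrier M ==> p (\<ominus> x) = p x" using homogeneous[of x "-1"] by (simp add: smult_minus_1)

lemma diff_le: "[|x \<in> carrier M; y \<in> carrier M|] ==> p (x \<ominus> y) \<le> p x + p y"
 using triangle[of x "\<ominus> y"] by (simp add: M.minus_eq)

lemma diff_self [simp]: "x \<in> carrier M ==> p (x \<ominus> x) = 0" by (simp add: M.minus_eq M.r_neg)

lemma diff_triangle:
 "[|x \<in> carrier M; y \<in> carrier M; z \<in> carrier M|] ==> p (x \<ominus> z) \<le> p (x \<ominus> y) + p (y \<ominus> z)"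
 using triangle[of "x \<ominus> y" "y \<ominus> z"] M.diff_split[of x y z] by simp

lemma diff_sym: "[|x \<in> carrier M; y \<in> carrier M|] ==> p (x \<ominus> y) = p (y \<ominus> x)"
 using minus[of "x \<ominus> y"] by (simp add: M.minus_diff)

lemma le_diff_add: "[|x \<in> carrier M; y \<in> carrier M|] ==> p x \<le> p (x \<ominus> y) + p y"
 using triangle[of "x \<ominus> y" y] by (simp add: M.diff_add_cancel)

lemma add_diff_add_le:
 "[|a \<in> carrier M; b \<in> carrier M; c \<in> carrier M; d \<in> carrier M|] ==>
  p ((a \<oplus> b) \<ominus> (c \<oplus> d)) \<le> p (a \<ominus> c) + p (b \<ominus> d)" using triangle[of "a \<ominus> c" "b \<ominus> d"] by (simp add: M.diff_add_diff)

end

sublocale star_algebra \<subseteq> complex_module A ..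

context star_algebra
begin

declare mult_closed [simp, intro] star_closed [simp, intro] star_star [simp]

lemma mult_zero_left [simp]: "a \<in> carrier A ==> \<zero> \<otimes> a = \<zero>" using smult_mult_left[of \<zero> a 0] by simp

lemma mult_zero_right [simp]: "a \<in> carrier A ==> a \<otimes> \<zero> = \<zero>" using smult_mult_right[of a \<zero> 0] by simp

lemma mult_minus_left: "[|a \<in> carrier A; b \<in> carrier A|] ==> (\<ominus> a) \<otimes> b = \<ominus> (a \<otimes> b)"
 using smult_mult_left[of a b "-1"] by (simp add: smult_minus_1)

lemma mult_minus_right: "[|a \<in> carrier A; b \<in> carrier A|] ==> a \<otimes> (\<ominus> b) = \<ominus> (a \<otimes> b)"
 using smult_mult_right[of a b "-1"] by (simp add: smult_minus_1)

lemma mult_diff_left: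
 "[|a \<in> carrier A; b \<in> carrier A; c \<in> carrier A|] ==> (a \<ominus> b) \<otimes> c = a \<otimes> c \<ominus> b \<otimes> c"
 by (simp add: M.minus_eq mult_distr_left mult_minus_left)

lemma mult_diff_right:
 "[|a \<in> carrier A; b \<in> carrier A; c \<in> carrier A|] ==> a \<otimes> (b \<ominus> c) = a \<otimes> b \<ominus> a \<otimes> c"
 by (simp add: M.minus_eq mult_distr_right mult_minus_right)

lemma star_zero [simp]: "star A \<zero> = \<zero>" using star_smult[of \<zero> 0] by simp

lemma star_minus: "a \<in> carrier A ==> star A (\<ominus> a) = \<ominus> (star A a)" using star_smult[of a "-1"] by (simp add: smult_minus_1)

lemma star_diff: "[|a \<in> carrier A; b \<in> carrier A|] ==> star A (a \<ominus> b) = star A a \<ominus> star A b"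
 by (simp add: M.minus_eq star_add star_minus)

end

locale cstar_seminormed = star_algebra A for A (structure) +
 fixes q :: "'a => real"
 assumes cstar_seminorm: "cstar_seminorm A q"

sublocale cstar_seminormed \<subseteq> seminormed_module A q using cstar_seminorm unfolding cstar_seminorm_def by unfold_locales auto

context cstar_seminormed
begin

lemma submultiplicative: "[|a \<in> carrier A; b \<in> carrier A|] ==> q (a \<otimes> b) \<le> q a * q b"
 using cstar_seminorm unfolding cstar_seminorm_def by blast

lemma cstar: "a \<in> carrier A ==> q (star A a \<otimes> a) = (q a)\<^sup>2" using cstar_seminorm unfolding cstar_seminorm_def by blast

lemma star_isometric [simp]:
 assumes "a \<in> carrier A"
 shows "q (star A a) = q a"
proof -
 have le: "q b \<le> q (star A b)" if b: "b \<in> carrier A" for b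
 proof (cases "q b = 0")
  case False
  have "q b * q b \<le> q (star A b) * q b" using submultiplicative[of "star A b" b] cstar[OF b] b by (simp add: power2_eq_square)
  with False nonneg[OF b] show ?thesis by (simp add: mult_le_cancel_right)
 qed (use nonneg b in simp)
 from le[of a] le[of "star A a"] assms show ?thesis by simp
qed

lemma cstar': "a \<in> carrier A ==> q (a \<otimes> star A a) = (q a)\<^sup>2" using cstar[of "star A a"] by simp

lemma square_selfadjoint: "[|a \<in> carrier A; star A a = a|] ==> q (a \<otimes> a) = (q a)\<^sup>2" using cstar[of a] by simp

lemma mult_diff_mult_le:
 assumes "a \<in> carrier A" "b \<in> carrier A" "c \<in> carrier A" "d \<in> carrier A"
 shows "q (a \<otimes> b \<ominus> c \<otimes> d) \<le> q (a \<ominus> c) * q b + q c * q (b \<ominus> d)"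
proof -
 have "q (a \<otimes> b \<ominus> c \<otimes> d) \<le> q (a \<otimes> b \<ominus> c \<otimes> b) + q (c \<otimes> b \<ominus> c \<otimes> d)" using assms by (intro diff_triangle) auto
 also have "q (a \<otimes> b \<ominus> c \<otimes> b) \<le> q (a \<ominus> c) * q b" using submultiplicative[of "a \<ominus> c" b] assms by (simp add: mult_diff_left)
 also have "q (c \<otimes> b \<ominus> c \<otimes> d) \<le> q c * q (b \<ominus> d)" using submultiplicative[of c "b \<ominus> d"] assms by (simp add: mult_diff_right)
 finally show ?thesis by simp
qed

end

section \<open>Polynomials in a self-adjoint element\<close>

text \<open>
 \<open>pact h p x\<close> is the product $p(h)x$. It makes sense without a unit, also when \<open>p\<close> has a constant
 term.
\<close>

definition (in star_algebra) pact :: "'a => complex poly => 'a => 'a"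
 where "pact h p x = fold_coeffs (\<lambda>z y. z \<odot> x \<oplus> h \<otimes> y) p \<zero>"

context star_algebra
begin

abbreviation conj :: "complex poly => complex poly" where "conj \<equiv> map_poly cnj"

lemma pact_0 [simp]: "pact h 0 x = \<zero>" by (simp add: pact_def)

lemma pact_pCons:
 assumes "h \<in> carrier A" "x \<in> carrier A"
 shows "pact h (pCons a p) x = a \<odot> x \<oplus> h \<otimes> pact h p x"
proof (cases "p = 0 \<and> a = 0")
 case True
 then show ?thesis using assms by (simp add: pact_def)
next
 case False
 then show ?thesis unfolding pact_def by (cases "p = 0") simp_all
qed

lemma pact_closed [simp, intro]:
 assumes "h \<in> carrier A" "x \<in> carrier A"
 shows "pact h p x \<in> carrier A" by (induction p) (use assms in \<open>simp_all add: pact_pCons\<close>)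

lemma pact_add:
 assumes "h \<in> carrier A" "x \<in> carrier A"
 shows "pact h (p + r) x = pact h p x \<oplus> pact h r x"
proof (induction p r rule: poly_induct2)
 case (pCons a p b r)
 then show ?case using assms by (simp add: pact_pCons smult_add_left mult_distr_right M.a_ac)
qed simp

lemma pact_smult:
 assumes "h \<in> carrier A" "x \<in> carrier A"
 shows "pact h (Polynomial.smult z p) x = z \<odot> pact h p x" by (induction p)
  (use assms in \<open>simp_all add: pact_pCons smult_add_right smult_smult smult_mult_right\<close>)

lemma pact_diff:
 assumes "h \<in> carrier A" "x \<in> carrier A"
 shows "pact h (p - r) x = pact h p x \<ominus> pact h r x" using pact_add[OF assms, of p "- r"] pact_smult[OF assms, of "-1" r] assms
 by (simp add: smult_minus_1 M.minus_eq)

lemma pact_mult: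
 assumes "h \<in> carrier A" "x \<in> carrier A"
 shows "pact h (p * r) x = pact h p (pact h r x)" by (induction p)
  (use assms in \<open>simp_all add: pact_pCons pact_add pact_smult\<close>)

lemma pact_const:
 assumes "h \<in> carrier A" "x \<in> carrier A"
 shows "pact h [:z:] x = z \<odot> x" using assms by (simp add: pact_pCons)

lemma pact_1 [simp]:
 assumes "h \<in> carrier A" "x \<in> carrier A"
 shows "pact h 1 x = x" using pact_const[OF assms, of 1] assms by (simp add: one_pCons)

lemma pact_X:
 assumes "h \<in> carrier A" "x \<in> carrier A"
 shows "pact h [:0, 1:] x = h \<otimes> x" using assms by (simp add: pact_pCons)

lemma pact_smult_right:
 assumes "h \<in> carrier A" "x \<in> carrier A"
 shows "pact h p (z \<odot> x) = z \<odot> pact h p x" by (induction p)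
  (use assms in \<open>simp_all add: pact_pCons smult_add_right smult_smult smult_mult_right mult.commute\<close>)

lemma pact_mult_right:
 assumes "h \<in> carrier A" "x \<in> carrier A" "y \<in> carrier A"
 shows "pact h p (x \<otimes> y) = pact h p x \<otimes> y" by (induction p)
  (use assms in \<open>simp_all add: pact_pCons mult_distr_left smult_mult_left mult_assoc\<close>)

lemma pact_commute:
 assumes "h \<in> carrier A" "x \<in> carrier A"
 shows "pact h p (pact h r x) = pact h r (pact h p x)" using assms by (simp add: mult.commute flip: pact_mult)

lemma pact_commute_X:
 assumes "h \<in> carrier A" "x \<in> carrier A"
 shows "pact h p (h \<otimes> x) = h \<otimes> pact h p x" using pact_commute[OF assms, of p "[:0, 1:]"] assms by (simp add: pact_X)

lemma star_pact:
 assumes h: "h \<in> carrier A" "star A h = h" and x: "x \<in> carrier A" and y: "y \<in> carrier A"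
 shows "star A (pact h p x) \<otimes> y = star A x \<otimes> pact h (conj p) y" using y
proof (induction p arbitrary: y)
 case (pCons a p)
 have hy: "star A (pact h p x) \<otimes> (h \<otimes> y) = star A x \<otimes> (h \<otimes> pact h (conj p) y)"
  using pCons.IH[of "h \<otimes> y"] pCons.prems h by (simp add: pact_commute_X)
 have "star A (pact h (pCons a p) x) \<otimes> y
   = cnj a \<odot> (star A x \<otimes> y) \<oplus> star A (pact h p x) \<otimes> (h \<otimes> y)" using h x pCons.prems
  by (simp add: pact_pCons star_add star_smult star_mult mult_distr_left smult_mult_left mult_assoc)
 also have "... = star A x \<otimes> pact h (conj (pCons a p)) y" using h x pCons.prems hy
  by (simp add: map_poly_pCons pact_pCons mult_distr_right smult_mult_right)
 finally show ?case .
qed (use h x in simp)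

lemma star_pact_self:
 assumes h: "h \<in> carrier A" "star A h = h"
 shows "star A (pact h p h) = pact h (conj p) h"
proof (induction p)
 case (pCons a p)
 have "pact h (conj p) h \<otimes> h = h \<otimes> pact h (conj p) h"
  using pact_mult_right[of h h h "conj p"] pact_commute_X[of h h "conj p"] h by simp
 then show ?case using h pCons.IH by (simp add: map_poly_pCons pact_pCons star_add star_smult star_mult)
qed simp

lemma pact_self_mult:
 assumes "h \<in> carrier A" "x \<in> carrier A"
 shows "pact h p h \<otimes> x = pact h (pCons 0 p) x" using assms by (simp add: pact_pCons pact_mult_right[symmetric] pact_commute_X)

end

context cstar_seminormed
begin

lemma pact_bounded:
 assumes h: "h \<in> carrier A"
 shows "\<exists>K\<ge>0. \<forall>x\<in>carrier A. q (pact h p x) \<le> K * q x"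
proof (induction p)
 case 0
 then show ?case by (auto intro: exI[of _ 0])
next
 case (pCons a p)
 then obtain K where K: "K \<ge> 0" "!!x. x \<in> carrier A ==> q (pact h p x) \<le> K * q x" by blast
 have "q (pact h (pCons a p) x) \<le> (cmod a + q h * K) * q x" if x: "x \<in> carrier A" for x
 proof -
  have "q (pact h (pCons a p) x) \<le> q (a \<odot> x) + q (h \<otimes> pact h p x)"
   using triangle[of "a \<odot> x" "h \<otimes> pact h p x"] h x by (simp add: pact_pCons)
  also have "... \<le> cmod a * q x + q h * q (pact h p x)"
   using submultiplicative[of h "pact h p x"] h x by (simp add: homogeneous)
  also have "... \<le> cmod a * q x + q h * (K * q x)" using K(2)[OF x] nonneg[OF h] by (simp add: mult_left_mono)
  finally show ?thesis by (simp add: algebra_simps)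
 qed
 moreover have "cmod a + q h * K \<ge> 0" using K(1) nonneg[OF h] by simp
 ultimately show ?case by blast
qed

definition pact_norm :: "'a => complex poly => real"
 where "pact_norm h p = (SUP x\<in>{x\<in>carrier A. q x \<le> 1}. q (pact h p x))"

lemma pact_norm_bdd:
 assumes "h \<in> carrier A"
 shows "bdd_above ((\<lambda>x. q (pact h p x)) ` {x\<in>carrier A. q x \<le> 1})"
proof -
 obtain K where K: "K \<ge> 0" "!!x. x \<in> carrier A ==> q (pact h p x) \<le> K * q x" using pact_bounded[OF assms] by blast
 have "q (pact h p x) \<le> K" if "x \<in> carrier A" "q x \<le> 1" for x using K(2)[OF that(1)] mult_left_mono[OF that(2) K(1)] by simp
 then show ?thesis by (intro bdd_aboveI[of _ K]) auto
qed

lemma pact_norm_le: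
 assumes "C \<ge> 0" "!!x. x \<in> carrier A ==> q (pact h p x) \<le> C * q x"
 shows "pact_norm h p \<le> C" unfolding pact_norm_def
proof (rule cSUP_least)
 show "{x \<in> carrier A. q x \<le> 1} \<noteq> {}" using zero by (metis (mono_tags, lifting) M.zero_closed empty_iff mem_Collect_eq zero_le_one)
 fix x assume "x \<in> {x \<in> carrier A. q x \<le> 1}"
 then show "q (pact h p x) \<le> C" using assms(2)[of x] mult_left_mono[of "q x" 1 C] assms(1) by auto
qed

lemma pact_norm_ge:
 assumes h: "h \<in> carrier A" and x: "x \<in> carrier A"
 shows "q (pact h p x) \<le> pact_norm h p * q x"
proof (cases "q x = 0")
 case True
 obtain K where "q (pact h p x) \<le> K * q x" using pact_bounded[OF h] x by blast
 with True show ?thesis by simp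
next
 case False
 with nonneg[OF x] have pos: "q x > 0" by simp
 define y where "y = complex_of_real (1 / q x) \<odot> x"
 have y: "y \<in> carrier A" "q y = 1" using x pos by (simp_all add: y_def homogeneous norm_divide)
 have "q (pact h p y) \<le> pact_norm h p" unfolding pact_norm_def by (rule cSUP_upper[OF _ pact_norm_bdd[OF h]]) (use y in simp)
 moreover have "q (pact h p y) = (1 / q x) * q (pact h p x)"
  unfolding y_def using h x pos by (simp add: pact_smult_right homogeneous norm_divide)
 ultimately show ?thesis using pos by (simp add: field_simps)
qed

lemma pact_norm_nonneg:
 assumes h: "h \<in> carrier A"
 shows "0 \<le> pact_norm h p"
proof -
 have "q (pact h p \<zero>) \<le> pact_norm h p" unfolding pact_norm_def by (rule cSUP_upper[OF _ pact_norm_bdd[OF h]]) simp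
 then show ?thesis using nonneg[of "pact h p \<zero>"] h by force
qed

lemma pact_norm_poly_cstar_seminorm:
 assumes h: "h \<in> carrier A" "star A h = h" and nontrivial: "x0 \<in> carrier A" "q x0 > 0"
 shows "poly_cstar_seminorm (pact_norm h)"
proof
 fix p r :: "complex poly" and z :: complex
 note bnd = pact_norm_ge[OF h(1)]
 show "pact_norm h (p + r) \<le> pact_norm h p + pact_norm h r"
 proof (rule pact_norm_le)
  fix x assume x: "x \<in> carrier A"
  have "q (pact h (p + r) x) \<le> q (pact h p x) + q (pact h r x)"
   using triangle[of "pact h p x" "pact h r x"] h x by (simp add: pact_add)
  also have "... \<le> (pact_norm h p + pact_norm h r) * q x" using bnd[OF x, of p] bnd[OF x, of r] by (simp add: algebra_simps)
  finally show "q (pact h (p + r) x) \<le> (pact_norm h p + pact_norm h r) * q x" .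
 qed (use pact_norm_nonneg[OF h(1)] in \<open>simp add: add_nonneg_nonneg\<close>)
 have le: "pact_norm h (Polynomial.smult z p) \<le> cmod z * pact_norm h p" for z p
 proof (rule pact_norm_le)
  fix x assume x: "x \<in> carrier A"
  show "q (pact h (Polynomial.smult z p) x) \<le> (cmod z * pact_norm h p) * q x"
   using bnd[OF x, of p] h x by (simp add: pact_smult homogeneous mult.assoc mult_left_mono)
 qed (use pact_norm_nonneg[OF h(1)] in simp)
 show "pact_norm h (Polynomial.smult z p) = cmod z * pact_norm h p"
 proof (cases "z = 0")
  case True
  then show ?thesis using le[of 0 p] pact_norm_nonneg[OF h(1), of 0] by simp
 next
  case False
  have "pact_norm h (Polynomial.smult (inverse z) (Polynomial.smult z p))
    \<le> cmod (inverse z) * pact_norm h (Polynomial.smult z p)" by (rule le)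
  then have "cmod z * pact_norm h p \<le> cmod z * (cmod (inverse z) * pact_norm h (Polynomial.smult z p))"
   using False by (intro mult_left_mono) simp_all
  also have "... = pact_norm h (Polynomial.smult z p)" using False by (simp add: norm_inverse)
  finally have "cmod z * pact_norm h p \<le> pact_norm h (Polynomial.smult z p)" .
  with le[of z p] show ?thesis by simp
 qed
 have mult: "pact_norm h (p * r) \<le> pact_norm h p * pact_norm h r" for p r
 proof (rule pact_norm_le)
  fix x assume x: "x \<in> carrier A"
  have "q (pact h (p * r) x) \<le> pact_norm h p * q (pact h r x)" using bnd[of "pact h r x" p] h x by (simp add: pact_mult)
  also have "... \<le> pact_norm h p * (pact_norm h r * q x)"
   using bnd[OF x, of r] pact_norm_nonneg[OF h(1), of p] by (simp add: mult_left_mono)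
  finally show "q (pact h (p * r) x) \<le> pact_norm h p * pact_norm h r * q x" by (simp add: mult.assoc)
 qed (use pact_norm_nonneg[OF h(1)] in simp)
 then show "pact_norm h (p * r) \<le> pact_norm h p * pact_norm h r" .
 have sq: "(pact_norm h p)\<^sup>2 \<le> pact_norm h (conj p * p)" for p
 proof -
  have "pact_norm h p \<le> sqrt (pact_norm h (conj p * p))"
  proof (rule pact_norm_le)
   fix x assume x: "x \<in> carrier A"
   have "(q (pact h p x))\<^sup>2 = q (star A (pact h p x) \<otimes> pact h p x)" using cstar[of "pact h p x"] h x by simp
   also have "... = q (star A x \<otimes> pact h (conj p * p) x)" using h x by (simp add: star_pact pact_mult)
   also have "... \<le> q x * q (pact h (conj p * p) x)"
    using submultiplicative[of "star A x" "pact h (conj p * p) x"] h x by simp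
   also have "... \<le> q x * (pact_norm h (conj p * p) * q x)"
    using bnd[OF x, of "conj p * p"] nonneg[OF x] by (simp add: mult_left_mono)
   also have "... = (sqrt (pact_norm h (conj p * p)) * q x)\<^sup>2"
    using pact_norm_nonneg[OF h(1), of "conj p * p"] by (simp add: power_mult_distrib power2_eq_square)
   finally show "q (pact h p x) \<le> sqrt (pact_norm h (conj p * p)) * q x"
    by (rule power2_le_imp_le) (simp add: nonneg[OF x] pact_norm_nonneg[OF h(1), of "conj p * p"])
  qed (use pact_norm_nonneg[OF h(1)] in simp)
  then have "(pact_norm h p)\<^sup>2 \<le> (sqrt (pact_norm h (conj p * p)))\<^sup>2"
   using pact_norm_nonneg[OF h(1), of p] by (rule power_mono)
  then show ?thesis using pact_norm_nonneg[OF h(1), of "conj p * p"] by simp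
 qed
 have conj_le: "pact_norm h (conj p) \<le> pact_norm h p" for p
 proof (cases "pact_norm h (conj p) = 0")
  case False
  have "conj (conj p) = p" by (intro poly_eqI) (simp add: coeff_map_poly)
  then have "pact_norm h (conj p) * pact_norm h (conj p) \<le> pact_norm h p * pact_norm h (conj p)"
   using sq[of "conj p"] mult[of p "conj p"] by (simp add: power2_eq_square)
  then show ?thesis using False pact_norm_nonneg[OF h(1), of "conj p"] by (simp add: mult_le_cancel_right)
 qed (use pact_norm_nonneg[OF h(1)] in simp)
 have "pact_norm h (conj p * p) \<le> pact_norm h p * pact_norm h p"
  using mult[of "conj p" p] mult_right_mono[OF conj_le[of p] pact_norm_nonneg[OF h(1), of p]] by simp
 with sq[of p] show "pact_norm h (conj p * p) = (pact_norm h p)\<^sup>2" by (simp add: power2_eq_square)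
 have "q x0 \<le> pact_norm h 1 * q x0" using bnd[OF nontrivial(1), of 1] h nontrivial by simp
 then have "1 \<le> pact_norm h 1" using nontrivial(2) by simp
 moreover have "pact_norm h 1 \<le> 1" by (rule pact_norm_le) (use h in simp_all)
 ultimately show "pact_norm h 1 = 1" by simp
qed

text \<open>
 A real number belongs to the spectrum of \<open>h\<close> relative to the seminorm \<open>q\<close> if evaluation there is
 dominated by the norm of $p(h)$ as a multiplier.
\<close>

definition spec :: "'a => real set"
 where "spec h = {t. \<forall>p C. (\<forall>x\<in>carrier A. q (pact h p x) \<le> C * q x) --> cmod (poly p (of_real t)) \<le> C}"

lemma specD:
 assumes "t \<in> spec h" "!!x. x \<in> carrier A ==> q (pact h p x) \<le> C * q x"
 shows "cmod (poly p (of_real t)) \<le> C" using assms unfolding spec_def by blast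

lemma pact_norm_attained:
 assumes h: "h \<in> carrier A" "star A h = h" and x0: "x0 \<in> carrier A" "q x0 > 0"
 shows "\<exists>t\<in>spec h. cmod (poly p (of_real t)) = pact_norm h p"
proof -
 interpret N: poly_cstar_seminorm "pact_norm h" by (rule pact_norm_poly_cstar_seminorm[OF h x0])
 obtain t :: real where t: "N.character_at (of_real t)" "cmod (poly p (of_real t)) = pact_norm h p"
  using N.norm_attained_at_real_character by blast
 have "t \<in> spec h" unfolding spec_def
 proof (intro CollectI allI impI)
  fix p C assume le: "\<forall>x\<in>carrier A. q (pact h p x) \<le> C * q x"
  then have "0 \<le> C * q x0" using x0 nonneg[of "pact h p x0"] h by force
  then have "0 \<le> C" using x0(2) by (simp add: zero_le_mult_iff)
  then have "pact_norm h p \<le> C" using le by (intro pact_norm_le) auto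
  then show "cmod (poly p (of_real t)) \<le> C" using t(1) unfolding N.character_at_def by (meson order_trans)
 qed
 with t(2) show ?thesis by blast
qed

lemma pact_le_if_spec:
 assumes h: "h \<in> carrier A" "star A h = h" and M: "0 \<le> M"
  and le: "!!t. t \<in> spec h ==> cmod (poly p (of_real t)) \<le> M" and x: "x \<in> carrier A"
 shows "q (pact h p x) \<le> M * q x"
proof (cases "\<exists>x0\<in>carrier A. q x0 > 0")
 case True
 then have "pact_norm h p \<le> M" using le pact_norm_attained[OF h] by metis
 then show ?thesis using pact_norm_ge[OF h(1) x, of p] mult_right_mono[of "pact_norm h p" M "q x"] nonneg[OF x] by linarith
next
 case False
 then have "q (pact h p x) = 0" "q x = 0"
  using nonneg[OF x] nonneg[of "pact h p x"] h x by (metis pact_closed less_eq_real_def)+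
 then show ?thesis by simp
qed

lemma pact_self_le_if_spec:
 assumes h: "h \<in> carrier A" "star A h = h" and M: "0 \<le> M"
  and le: "!!t. t \<in> spec h ==> cmod (t * poly p (of_real t)) \<le> M"
 shows "q (pact h p h) \<le> M"
proof (cases "q (pact h p h) = 0")
 case False
 let ?a = "pact h p h"
 have a: "?a \<in> carrier A" using h by simp
 have "q ?a * q ?a = q (?a \<otimes> star A ?a)" using cstar'[OF a] by (simp add: power2_eq_square)
 also have "... = q (pact h (pCons 0 p) (star A ?a))" using h a by (simp add: pact_self_mult)
 also have "... \<le> M * q (star A ?a)" using le by (intro pact_le_if_spec h M) (use a in \<open>simp_all add: norm_mult\<close>)
 finally have "q ?a * q ?a \<le> M * q ?a" using a by simp
 with False nonneg[OF a] show ?thesis by (simp add: mult_le_cancel_right)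
qed (use M in simp)

lemma spec_le_pact_self:
 assumes h: "h \<in> carrier A" and t: "t \<in> spec h"
 shows "cmod (t * poly p (of_real t)) \<le> q (pact h p h)"
proof -
 have "cmod (poly (pCons 0 p) (of_real t)) \<le> q (pact h p h)" by (rule specD[OF t])
   (use h submultiplicative in \<open>simp flip: pact_self_mult\<close>)
 then show ?thesis by simp
qed

lemma spec_le_norm:
 assumes "h \<in> carrier A" "t \<in> spec h"
 shows "\<bar>t\<bar> \<le> q h" using spec_le_pact_self[OF assms, of 1] assms by simp

lemma norm_attained_on_spec:
 assumes h: "h \<in> carrier A" "star A h = h" and pos: "q h > 0"
 shows "\<exists>t\<in>spec h. \<bar>t\<bar> = q h"
proof -
 obtain t where t: "t \<in> spec h" "\<bar>t\<bar> = pact_norm h [:0, 1:]" using pact_norm_attained[OF h h(1) pos, of "[:0, 1:]"] by auto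
 have "q h * q h = q (pact h [:0, 1:] h)" using cstar[OF h(1)] h by (simp add: pact_X power2_eq_square)
 also have "... \<le> pact_norm h [:0, 1:] * q h" by (rule pact_norm_ge) (fact h)+
 finally have "q h \<le> pact_norm h [:0, 1:]" using pos by simp
 with t spec_le_norm[OF h(1) t(1)] show ?thesis by force
qed

end

section \<open>Seminorm topologies\<close>

lemma seminorm_complete_filter:
 assumes complete: "seminorm_complete M P" and F: "F \<noteq> bot"
  and carrier: "eventually (\<lambda>i. f i \<in> carrier M) F"
  and cauchy: "!!p eps. p \<in> P ==> eps > 0 ==>
   \<exists>Q. eventually Q F \<and> (\<forall>i j. Q i --> Q j --> p (f i \<ominus>\<^bsub>M\<^esub> f j) < (eps::real))"
  and nonneg: "!!p x. p \<in> P ==> x \<in> carrier M ==> 0 \<le> p x"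
  and diff: "!!x y. x \<in> carrier M ==> y \<in> carrier M ==> x \<ominus>\<^bsub>M\<^esub> y \<in> carrier M"
 shows "\<exists>x\<in>carrier M. \<forall>p\<in>P. \<forall>eps>0. eventually (\<lambda>i. p (f i \<ominus>\<^bsub>M\<^esub> x) < eps) F"
proof -
 have "\<exists>x\<in>carrier M. \<forall>p\<in>P. ((\<lambda>y. p (y \<ominus>\<^bsub>M\<^esub> x)) \<longlongrightarrow> 0) (filtermap f F)"
 proof (rule complete[unfolded seminorm_complete_def, rule_format])
  show "filtermap f F \<noteq> bot" using F by (simp add: filtermap_bot_iff)
  show "filtermap f F \<le> principal (carrier M)" using carrier by (simp add: le_principal eventually_filtermap)
  fix p eps assume "p \<in> P" "(0::real) < eps"
  then obtain Q where Q: "eventually Q F" "!!i j. Q i ==> Q j ==> p (f i \<ominus>\<^bsub>M\<^esub> f j) < eps" using cauchy by blast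
  have "eventually (\<lambda>x. \<exists>i. Q i \<and> x = f i) (filtermap f F)"
   unfolding eventually_filtermap by (rule eventually_mono[OF Q(1)]) blast
  then show "\<forall>\<^sub>F (x, y) in filtermap f F \<times>\<^sub>F filtermap f F. p (x \<ominus>\<^bsub>M\<^esub> y) < eps" unfolding eventually_prod_filter using Q(2)
   by (intro exI[of _ "\<lambda>x. \<exists>i. Q i \<and> x = f i"] conjI) auto
 qed
 then obtain x where x: "x \<in> carrier M" "!!p. p \<in> P ==> ((\<lambda>y. p (y \<ominus>\<^bsub>M\<^esub> x)) \<longlongrightarrow> 0) (filtermap f F)" by blast
 have "eventually (\<lambda>i. p (f i \<ominus>\<^bsub>M\<^esub> x) < eps) F" if "p \<in> P" "eps > 0" for p eps
  using order_tendstoD(2)[OF x(2)[OF that(1)] that(2)] by (simp add: eventually_filtermap)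
 with x(1) show ?thesis by blast
qed

locale seminorm_family = complex_module M for M (structure) +
 fixes P :: "('a => real) set"
 assumes seminormed: "p \<in> P ==> seminormed_module M p"
begin

lemma openin_seminorm_ball:
 assumes p: "p \<in> P" and x: "x \<in> carrier M"
 shows "openin (seminorm_topology M P) {y \<in> carrier M. p (y \<ominus> x) < eps}" unfolding openin_seminorm_topology
proof (intro conjI ballI)
 interpret seminormed_module M p by (rule seminormed[OF p])
 fix y assume "y \<in> {y \<in> carrier M. p (y \<ominus> x) < eps}"
 then have y: "y \<in> carrier M" "p (y \<ominus> x) < eps" by auto
 have "{z \<in> carrier M. \<forall>p\<in>{p}. p (z \<ominus> y) < eps - p (y \<ominus> x)} \<subseteq> {y \<in> carrier M. p (y \<ominus> x) < eps}"
  using diff_triangle[of _ y x] x y by fastforce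
 then show "\<exists>F del. finite F \<and> F \<subseteq> P \<and> 0 < del \<and>
   {z \<in> carrier M. \<forall>p\<in>F. p (z \<ominus> y) < del} \<subseteq> {y \<in> carrier M. p (y \<ominus> x) < eps}"
  using p y(2) by (intro exI[of _ "{p}"] exI[of _ "eps - p (y \<ominus> x)"]) auto
qed auto

lemma openin_seminorm_balls:
 assumes F: "finite F" "F \<subseteq> P" and x: "x \<in> carrier M"
 shows "openin (seminorm_topology M P) {y \<in> carrier M. \<forall>p\<in>F. p (y \<ominus> x) < eps}" using F
proof (induction F)
 case empty
 then show ?case using openin_topspace[of "seminorm_topology M P"] by (simp add: topspace_seminorm_topology)
next
 case (insert p F)
 have "{y \<in> carrier M. \<forall>r\<in>insert p F. r (y \<ominus> x) < eps} =
   {y \<in> carrier M. p (y \<ominus> x) < eps} \<inter> {y \<in> carrier M. \<forall>p\<in>F. p (y \<ominus> x) < eps}" by auto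
 then show ?case using insert openin_seminorm_ball[of p x eps] x by (simp add: openin_Int)
qed

lemma limitin_seminorm_topologyD:
 assumes "limitin (seminorm_topology M P) f l F" "p \<in> P" "eps > 0"
 shows "eventually (\<lambda>i. f i \<in> carrier M \<and> p (f i \<ominus> l) < eps) F"
proof -
 interpret seminormed_module M p by (rule seminormed[OF assms(2)])
 have l: "l \<in> carrier M" using assms(1) by (simp add: limitin_def topspace_seminorm_topology)
 have "eventually (\<lambda>i. f i \<in> {y \<in> carrier M. p (y \<ominus> l) < eps}) F"
  using assms(1) openin_seminorm_ball[OF assms(2) l, of eps] l assms(3) unfolding limitin_def by auto
 then show ?thesis by simp
qed

lemma continuous_map_into_seminorm_topology:
 assumes f: "!!x. x \<in> topspace Y ==> f x \<in> carrier M"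
  and cont: "!!x p eps. [|x \<in> topspace Y; p \<in> P; eps > 0|] ==>
   \<exists>U. openin Y U \<and> x \<in> U \<and> (\<forall>y\<in>U. p (f y \<ominus> f x) < eps)"
 shows "continuous_map Y (seminorm_topology M P) f" unfolding continuous_map_def topspace_seminorm_topology
proof (intro conjI allI impI)
 show "f \<in> topspace Y \<rightarrow> carrier M" using f by blast
 fix V assume V: "openin (seminorm_topology M P) V"
 have "\<exists>T. openin Y T \<and> x \<in> T \<and> T \<subseteq> {x \<in> topspace Y. f x \<in> V}"
  if x: "x \<in> topspace Y" "f x \<in> V" for x
 proof -
  obtain F eps where F: "finite F" "F \<subseteq> P" "eps > 0"
   "{y \<in> carrier M. \<forall>p\<in>F. p (y \<ominus> f x) < eps} \<subseteq> V" using V x(2) unfolding openin_seminorm_topology by meson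
  have "\<exists>U. openin Y U \<and> x \<in> U \<and> (\<forall>y\<in>U. \<forall>p\<in>F. p (f y \<ominus> f x) < eps)" using F(1,2)
  proof (induction F)
   case empty
   then show ?case using x(1) by auto
  next
   case (insert p F)
   then obtain U where U: "openin Y U" "x \<in> U" "\<forall>y\<in>U. \<forall>p\<in>F. p (f y \<ominus> f x) < eps" by auto
   obtain U' where U': "openin Y U'" "x \<in> U'" "\<forall>y\<in>U'. p (f y \<ominus> f x) < eps"
    using cont[OF x(1) _ F(3), of p] insert.prems by auto
   show ?case using U U' by (intro exI[of _ "U \<inter> U'"]) auto
  qed
  then obtain U where U: "openin Y U" "x \<in> U" "\<forall>y\<in>U. \<forall>p\<in>F. p (f y \<ominus> f x) < eps" by blast
  have "U \<subseteq> {x \<in> topspace Y. f x \<in> V}"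
  proof
   fix y assume y: "y \<in> U"
   then have "y \<in> topspace Y" using openin_subset[OF U(1)] by blast
   with y U(3) F(4) f show "y \<in> {x \<in> topspace Y. f x \<in> V}" by auto
  qed
  with U show ?thesis by blast
 qed
 then show "openin Y {x \<in> topspace Y. f x \<in> V}" by (subst openin_subopen) blast
qed

lemma continuous_map_seminorm:
 assumes p: "p \<in> P"
 shows "continuous_map (seminorm_topology M P) euclideanreal p" unfolding continuous_map_def topspace_seminorm_topology
proof (intro conjI allI impI)
 interpret seminormed_module M p by (rule seminormed[OF p])
 show "p \<in> carrier M \<rightarrow> topspace euclideanreal" by simp
 fix U assume "openin euclideanreal U"
 then have U: "open U" by simp
 show "openin (seminorm_topology M P) {x \<in> carrier M. p x \<in> U}"
 proof (subst openin_subopen, intro ballI)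
  fix x assume "x \<in> {x \<in> carrier M. p x \<in> U}"
  then have x: "x \<in> carrier M" "p x \<in> U" by auto
  then obtain e where e: "e > 0" "!!y. dist y (p x) < e ==> y \<in> U" using U unfolding open_dist by blast
  have "\<bar>p y - p x\<bar> \<le> p (y \<ominus> x)" if "y \<in> carrier M" for y
   using le_diff_add[of y x] le_diff_add[of x y] diff_sym[of x y] that x(1) by linarith
  then have "{y \<in> carrier M. p (y \<ominus> x) < e} \<subseteq> {x \<in> carrier M. p x \<in> U}" using e(2) by (force simp: dist_real_def)
  then show "\<exists>T. openin (seminorm_topology M P) T \<and> x \<in> T \<and> T \<subseteq> {x \<in> carrier M. p x \<in> U}"
   using openin_seminorm_ball[OF p x(1), of e] x(1) e(1) by (intro exI conjI) auto
 qed
qed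

lemma dense_in_seminorm_topology:
 "dense_in (seminorm_topology M P) D \<longleftrightarrow> D \<subseteq> carrier M \<and>
  (\<forall>x\<in>carrier M. \<forall>F eps. finite F --> F \<subseteq> P --> eps > 0 --> (\<exists>d\<in>D. \<forall>p\<in>F. p (d \<ominus> x) < eps))"
 (is "?L \<longleftrightarrow> _ \<and> ?R")
proof (intro iffI conjI ballI allI impI)
 assume L: ?L
 then show D: "D \<subseteq> carrier M" by (simp add: dense_in_def topspace_seminorm_topology)
 fix x F and eps :: real assume x: "x \<in> carrier M" and F: "finite F" "F \<subseteq> P" "eps > 0"
 have "x \<in> (seminorm_topology M P) closure_of D" using L x by (simp add: dense_in_def topspace_seminorm_topology)
 then have cl: "x \<in> T \<and> openin (seminorm_topology M P) T ==> \<exists>y. y \<in> D \<and> y \<in> T" for T by (simp add: in_closure_of)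
 have "p (x \<ominus> x) < eps" if "p \<in> F" for p using seminormed_module.diff_self[OF seminormed, of p x] that F x by auto
 then have "x \<in> {y \<in> carrier M. \<forall>p\<in>F. p (y \<ominus> x) < eps}" using x by simp
 with cl openin_seminorm_balls[OF F(1,2) x, of eps]
 obtain y where "y \<in> D" "y \<in> {y \<in> carrier M. \<forall>p\<in>F. p (y \<ominus> x) < eps}" by meson
 then show "\<exists>d\<in>D. \<forall>p\<in>F. p (d \<ominus> x) < eps" by auto
next
 assume R: "D \<subseteq> carrier M \<and> ?R"
 have "x \<in> (seminorm_topology M P) closure_of D" if x: "x \<in> carrier M" for x
  unfolding in_closure_of topspace_seminorm_topology
 proof (intro conjI allI impI x)
  fix T assume "x \<in> T \<and> openin (seminorm_topology M P) T"
  then obtain F eps where F: "finite F" "F \<subseteq> P" "eps > 0"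
   and T: "{y \<in> carrier M. \<forall>p\<in>F. p (y \<ominus> x) < eps} \<subseteq> T" unfolding openin_seminorm_topology by meson
  from F obtain d where d: "d \<in> D" "\<forall>p\<in>F. p (d \<ominus> x) < eps" using R x by blast
  then have "d \<in> carrier M" using R by blast
  then have "d \<in> T" using d(2) by (intro subsetD[OF T]) simp
  then show "\<exists>y. y \<in> D \<and> y \<in> T" using d(1) by blast
 qed
 then show ?L using R closure_of_subset_topspace[of "seminorm_topology M P" D]
  unfolding dense_in_def topspace_seminorm_topology by blast
qed

end

section \<open>Locally C*-algebras\<close>

context locally_cstar_algebra
begin

lemma cstar_seminormedI: "cstar_seminorm A q ==> cstar_seminormed A q"
 by (intro cstar_seminormed.intro star_algebra_axioms cstar_seminormed_axioms.intro)

lemma cont_seminormD: "q \<in> \<S> A ==> cstar_seminormed A q" by (simp add: cont_seminorms_def cstar_seminormedI)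

lemma cont_seminorm_seminormed: "q \<in> \<S> A ==> seminormed_module A q"
proof -
 assume "q \<in> \<S> A"
 then interpret cstar_seminormed A q by (rule cont_seminormD)
 show "seminormed_module A q" by (rule seminormed_module_axioms)
qed

lemma directed_basis:
 obtains P where "P \<noteq> {}" "P \<subseteq> \<S> A" "topo A = seminorm_topology A P"
  "!!p q. [|p \<in> P; q \<in> P|] ==> \<exists>r\<in>P. \<forall>a\<in>carrier A. p a \<le> r a \<and> q a \<le> r a"
proof -
 obtain P where P: "P \<noteq> {}" "\<forall>p\<in>P. cstar_seminorm A p"
  "\<forall>p\<in>P. \<forall>q\<in>P. \<exists>r\<in>P. \<forall>a\<in>carrier A. p a \<le> r a \<and> q a \<le> r a"
  "topo A = seminorm_topology A P" using topology_from_seminorms by blast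
 have "seminormed_module A p" if "p \<in> P" for p
 proof -
  interpret cstar_seminormed A p by (rule cstar_seminormedI) (use P(2) that in blast)
  show ?thesis by (rule seminormed_module_axioms)
 qed
 then interpret F: seminorm_family A P by (intro seminorm_family.intro complex_module_axioms seminorm_family_axioms.intro)
 have "P \<subseteq> \<S> A" using P(2,4) F.continuous_map_seminorm unfolding cont_seminorms_def by auto
 then show thesis using P by (intro that[of P]) simp_all
qed

lemma topspace_topo [simp]: "topspace (topo A) = carrier A"
proof -
 obtain P where "topo A = seminorm_topology A P" by (rule directed_basis) blast
 then show ?thesis by (simp add: topspace_seminorm_topology)
qed

lemma cont_seminorms_nonempty: "\<S> A \<noteq> {}"
proof -
 obtain P where "P \<noteq> {}" "P \<subseteq> \<S> A" by (rule directed_basis) blast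
 then show ?thesis by blast
qed

lemma separated:
 assumes x: "x \<in> carrier A" and null: "!!q. q \<in> \<S> A ==> q x = 0"
 shows "x = \<zero>"
proof (rule ccontr)
 assume "x \<noteq> \<zero>"
 then obtain U V where UV: "openin (topo A) U" "openin (topo A) V" "x \<in> U" "\<zero> \<in> V" "disjnt U V"
  using Hausdorff[unfolded Hausdorff_space_def, rule_format, of x \<zero>] x by auto
 obtain P where P: "P \<subseteq> \<S> A" "topo A = seminorm_topology A P" by (rule directed_basis) blast
 obtain F eps where F: "finite F" "F \<subseteq> P" "eps > 0" "{y \<in> carrier A. \<forall>p\<in>F. p (y \<ominus> x) < eps} \<subseteq> U"
  using UV(1,3) unfolding P(2) openin_seminorm_topology by meson
 have "\<forall>p\<in>F. p (\<zero> \<ominus> x) < eps"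
 proof
  fix p assume "p \<in> F"
  then have p: "p \<in> \<S> A" using F P by blast
  then interpret seminormed_module A p by (rule cont_seminorm_seminormed)
  show "p (\<zero> \<ominus> x) < eps" using null[OF p] F(3) x diff_sym[of x \<zero>] by (simp add: M.minus_eq)
 qed
 then have "\<zero> \<in> U" using F(4) by auto
 with UV show False by (auto simp: disjnt_def)
qed

lemma eqI:
 assumes xy: "x \<in> carrier A" "y \<in> carrier A"
  and le: "!!q eps. q \<in> \<S> A ==> eps > 0 ==> q (x \<ominus> y) \<le> eps"
 shows "x = y"
proof -
 have "x \<ominus> y = \<zero>"
 proof (rule separated)
  fix q assume q: "q \<in> \<S> A"
  then interpret seminormed_module A q by (rule cont_seminorm_seminormed)
  have "q (x \<ominus> y) \<le> 0" by (rule field_le_epsilon) (use le[OF q] in simp)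
  then show "q (x \<ominus> y) = 0" using nonneg[of "x \<ominus> y"] xy by simp
 qed (use xy in simp)
 then show ?thesis using xy by (simp add: M.diff_eq_zero_iff)
qed

lemma max_cont_seminorms:
 assumes p: "p \<in> \<S> A" and q: "q \<in> \<S> A"
 shows "(\<lambda>a. max (p a) (q a)) \<in> \<S> A"
proof -
 interpret p: cstar_seminormed A p using p by (rule cont_seminormD)
 interpret q: cstar_seminormed A q using q by (rule cont_seminormD)
 have "cstar_seminorm A (\<lambda>a. max (p a) (q a))" unfolding cstar_seminorm_def
 proof (intro conjI ballI allI)
  fix a b z assume a: "a \<in> carrier A" and b: "b \<in> carrier A"
  show "0 \<le> max (p a) (q a)" using p.nonneg[OF a] by simp
  show "max (p (a \<oplus> b)) (q (a \<oplus> b)) \<le> max (p a) (q a) + max (p b) (q b)"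
   using p.triangle[OF a b] q.triangle[OF a b] by linarith
  show "max (p (z \<odot> a)) (q (z \<odot> a)) = cmod z * max (p a) (q a)"
   using p.homogeneous[OF a] q.homogeneous[OF a] by (simp add: max_mult_distrib_left)
  have "p a * p b \<le> max (p a) (q a) * max (p b) (q b)" "q a * q b \<le> max (p a) (q a) * max (p b) (q b)"
   by (rule mult_mono; use p.nonneg[OF a] p.nonneg[OF b] q.nonneg[OF a] q.nonneg[OF b] in \<open>simp add: le_max_iff_disj\<close>)+
  then show "max (p (a \<otimes> b)) (q (a \<otimes> b)) \<le> max (p a) (q a) * max (p b) (q b)"
   using p.submultiplicative[OF a b] q.submultiplicative[OF a b] by simp
  show "max (p (star A a \<otimes> a)) (q (star A a \<otimes> a)) = (max (p a) (q a))\<^sup>2"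
   using p.cstar[OF a] q.cstar[OF a] p.nonneg[OF a] q.nonneg[OF a]
   by (cases "p a \<le> q a") (simp_all add: max.absorb1 max.absorb2 power_mono)
 qed
 moreover have "continuous_map (topo A) euclideanreal (\<lambda>a. max (p a) (q a))"
  using p q by (intro continuous_map_real_max) (auto simp: cont_seminorms_def)
 ultimately show ?thesis by (simp add: cont_seminorms_def)
qed

lemma cont_seminorms_directed:
 assumes "finite F" "F \<subseteq> \<S> A"
 shows "\<exists>q\<in>\<S> A. \<forall>p\<in>F. \<forall>a\<in>carrier A. p a \<le> q a" using assms
proof (induction F)
 case empty
 then show ?case using cont_seminorms_nonempty by auto
next
 case (insert p F)
 then obtain q where q: "q \<in> \<S> A" "\<forall>p\<in>F. \<forall>a\<in>carrier A. p a \<le> q a" by auto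
 show ?case
 proof (rule bexI[of _ "\<lambda>a. max (p a) (q a)"])
  show "(\<lambda>a. max (p a) (q a)) \<in> \<S> A" using insert.prems q(1) by (intro max_cont_seminorms) auto
 qed (use q(2) in \<open>auto simp: le_max_iff_disj\<close>)
qed

lemma openin_cont_seminorm_ball:
 assumes q: "q \<in> \<S> A" and x: "x \<in> carrier A"
 shows "openin (topo A) {y \<in> carrier A. q (y \<ominus> x) < eps}"
proof -
 have "continuous_map (topo A) (prod_topology (topo A) (topo A)) (\<lambda>y. (y, \<ominus> x))"
  using x by (intro continuous_map_pairedI) auto
 from continuous_map_compose[OF this continuous_add]
 have "continuous_map (topo A) (topo A) (\<lambda>y. y \<ominus> x)" by (simp add: o_def M.minus_eq)
 moreover have "continuous_map (topo A) euclideanreal q" using q by (simp add: cont_seminorms_def)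
 ultimately have "continuous_map (topo A) euclideanreal (q \<circ> (\<lambda>y. y \<ominus> x))" by (rule continuous_map_compose)
 then have "continuous_map (topo A) euclideanreal (\<lambda>y. q (y \<ominus> x))" by (simp add: o_def)
 from openin_continuous_map_preimage[OF this, of "{..<eps}"] show ?thesis by simp
qed

lemma complete_filter:
 assumes F: "F \<noteq> bot" and carrier: "eventually (\<lambda>i. f i \<in> carrier A) F"
  and cauchy: "!!q eps. q \<in> \<S> A ==> eps > 0 ==>
   \<exists>Q. eventually Q F \<and> (\<forall>i j. Q i --> Q j --> q (f i \<ominus> f j) < eps)"
 shows "\<exists>x\<in>carrier A. \<forall>q\<in>\<S> A. \<forall>eps>0. eventually (\<lambda>i. q (f i \<ominus> x) < eps) F"
 by (rule seminorm_complete_filter[OF complete F carrier cauchy])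
  (simp_all add: seminormed_module.nonneg[OF cont_seminorm_seminormed])

end

lemma polynomial_approximation_vanishing_at_0:
 fixes f :: "real => real"
 assumes f: "continuous_on UNIV f" "f 0 = 0" and e: "e > 0"
 shows "\<exists>p::complex poly. \<forall>t. \<bar>t\<bar> \<le> R --> cmod (of_real (f t) - t * poly p (of_real t)) \<le> e"
proof -
 obtain g where g: "real_polynomial_function g" "!!t. t \<in> {- \<bar>R\<bar>..\<bar>R\<bar>} ==> \<bar>f t - g t\<bar> < e / 2"
  using Stone_Weierstrass_real_polynomial_function[of "{- \<bar>R\<bar>..\<bar>R\<bar>}" f "e / 2"]
   continuous_on_subset[OF f(1)] e by auto
 obtain a n where a: "g = (\<lambda>t. \<Sum>i\<le>n. a i * t ^ i)" using g(1) unfolding real_polynomial_function_iff_sum by blast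
 define p where "p = (\<Sum>i<n. Polynomial.monom (complex_of_real (a (Suc i))) i)"
 have "cmod (of_real (f t) - t * poly p (of_real t)) \<le> e" if t: "\<bar>t\<bar> \<le> R" for t
 proof -
  have "g t = a 0 + (\<Sum>i<n. a (Suc i) * t ^ Suc i)" unfolding a by (subst sum.atMost_shift) simp
  moreover have "complex_of_real t * poly p (of_real t) = of_real (\<Sum>i<n. a (Suc i) * t ^ Suc i)"
   by (simp add: p_def poly_sum poly_monom sum_distrib_left mult_ac)
  ultimately have eq: "of_real (f t) - t * poly p (of_real t) = complex_of_real (f t - g t + a 0)" by simp
  have "g 0 = a 0" unfolding a by (subst sum.atMost_shift) simp
  then have "\<bar>a 0\<bar> < e / 2" using g(2)[of 0] f(2) by simp
  moreover have "t \<in> {- \<bar>R\<bar>..\<bar>R\<bar>}" using t unfolding atLeastAtMost_iff by linarith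
  then have "\<bar>f t - g t\<bar> < e / 2" by (rule g(2))
  ultimately show ?thesis unfolding eq norm_of_real by linarith
 qed
 then show ?thesis by blast
qed

context locally_cstar_algebra
begin

section \<open>Continuous functional calculus\<close>

abbreviation spectrum :: "('a => real) => 'a => real set"
 where "spectrum q h \<equiv> cstar_seminormed.spec A q h"

text \<open>
 \<open>e\<close> is $f(h)$ for a function with $f(0) = 0$: for each seminorm, \<open>e\<close> and \<open>f\<close> are approximated by the same
 polynomial $t\,p(t)$. A relation that allows all seminorms at once replaces the passage to the
 quotients $A_p$ and their inverse limit.
\<close>

definition cfc_rel :: "'a => (real => real) => 'a => bool"
 where "cfc_rel h f e \<longleftrightarrow> e \<in> carrier A \<and> (\<forall>q\<in>\<S> A. \<forall>eps>0. \<exists>p.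
  (\<forall>t\<in>spectrum q h. cmod (of_real (f t) - of_real t * poly p (of_real t)) \<le> eps) \<and>
  q (e \<ominus> pact h p h) \<le> eps)"

context
 fixes h assumes h: "h \<in> carrier A" "star A h = h"
begin

lemma cfc_rel_closed: "cfc_rel h f e ==> e \<in> carrier A" by (simp add: cfc_rel_def)

lemma cfc_relE:
 assumes "cfc_rel h f e" "q \<in> \<S> A" "eps > 0"
 obtains p where "!!t. t \<in> spectrum q h ==> cmod (of_real (f t) - of_real t * poly p (of_real t)) \<le> eps"
  "q (e \<ominus> pact h p h) \<le> eps"
proof -
 have "\<exists>p. (\<forall>t\<in>spectrum q h. cmod (of_real (f t) - of_real t * poly p (of_real t)) \<le> eps) \<and>
  q (e \<ominus> pact h p h) \<le> eps" using assms unfolding cfc_rel_def by simp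
 then show thesis using that by blast
qed

lemma cfc_rel_norm_le:
 assumes rel: "cfc_rel h f e" and q: "q \<in> \<S> A" and M: "0 \<le> M"
  and le: "!!t. t \<in> spectrum q h ==> \<bar>f t\<bar> \<le> M"
 shows "q e \<le> M"
proof (rule field_le_epsilon)
 interpret cstar_seminormed A q using q by (rule cont_seminormD)
 fix eps :: real assume "eps > 0"
 then have eps2: "eps / 2 > 0" by simp
 obtain p where p: "!!t. t \<in> spec h ==> cmod (of_real (f t) - of_real t * poly p (of_real t)) \<le> eps / 2"
  "q (e \<ominus> pact h p h) \<le> eps / 2" using cfc_relE[OF rel q eps2] by metis
 have "q (pact h p h) \<le> M + eps / 2"
 proof (rule pact_self_le_if_spec[OF h])
  fix t assume t: "t \<in> spec h"
  have "cmod (of_real t * poly p (of_real t)) \<le> cmod (of_real (f t)) + cmod (of_real (f t) - of_real t * poly p (of_real t))"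
   by (metis norm_minus_commute norm_triangle_sub add.commute)
  then show "cmod (of_real t * poly p (of_real t)) \<le> M + eps / 2" using p(1)[OF t] le[OF t] by simp
 qed (use M eps2 in linarith)
 moreover have "q e \<le> q (e \<ominus> pact h p h) + q (pact h p h)" by (rule le_diff_add) (use cfc_rel_closed[OF rel] h in simp_all)
 ultimately show "q e \<le> M + eps" using p(2) by linarith
qed

lemma cfc_rel_le_norm:
 assumes rel: "cfc_rel h f e" and q: "q \<in> \<S> A" and t: "t \<in> spectrum q h"
 shows "\<bar>f t\<bar> \<le> q e"
proof (rule field_le_epsilon)
 interpret cstar_seminormed A q using q by (rule cont_seminormD)
 fix eps :: real assume "eps > 0"
 then have eps2: "eps / 2 > 0" by simp
 obtain p where p: "!!t. t \<in> spec h ==> cmod (of_real (f t) - of_real t * poly p (of_real t)) \<le> eps / 2"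
  "q (e \<ominus> pact h p h) \<le> eps / 2" using cfc_relE[OF rel q eps2] by metis
 have "\<bar>f t\<bar> \<le> cmod (of_real t * poly p (of_real t)) + eps / 2"
  using p(1)[OF t] norm_triangle_sub[of "complex_of_real (f t)" "of_real t * poly p (of_real t)"] by simp
 also have "cmod (of_real t * poly p (of_real t)) \<le> q (pact h p h)" by (rule spec_le_pact_self[OF h(1) t])
 also have "q (pact h p h) \<le> q (e \<ominus> pact h p h) + q e"
  using le_diff_add[of "pact h p h" e] diff_sym[of e "pact h p h"] cfc_rel_closed[OF rel] h by simp
 finally show "\<bar>f t\<bar> \<le> q e + eps" using p(2) by linarith
qed

lemma cfc_rel_id: "cfc_rel h (\<lambda>t. t) h" unfolding cfc_rel_def
proof (intro conjI ballI allI impI)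
 fix q eps assume q: "q \<in> \<S> A" and eps: "(0::real) < eps"
 interpret cstar_seminormed A q using q by (rule cont_seminormD)
 show "\<exists>p. (\<forall>t\<in>spectrum q h. cmod (of_real t - of_real t * poly p (of_real t)) \<le> eps) \<and> q (h \<ominus> pact h p h) \<le> eps"
  using h eps by (intro exI[of _ 1]) simp
qed (rule h)

lemma cfc_rel_diff:
 assumes f: "cfc_rel h f d" and g: "cfc_rel h g e"
 shows "cfc_rel h (\<lambda>t. f t - g t) (d \<ominus> e)" unfolding cfc_rel_def
proof (intro conjI ballI allI impI)
 show "d \<ominus> e \<in> carrier A" using f g by (simp add: cfc_rel_closed)
 fix q eps assume q: "q \<in> \<S> A" and "(0::real) < eps"
 then have eps2: "eps / 2 > 0" by simp
 interpret cstar_seminormed A q using q by (rule cont_seminormD)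
 obtain p where p: "!!t. t \<in> spec h ==> cmod (of_real (f t) - of_real t * poly p (of_real t)) \<le> eps / 2"
  "q (d \<ominus> pact h p h) \<le> eps / 2" using cfc_relE[OF f q eps2] by metis
 obtain r where r: "!!t. t \<in> spec h ==> cmod (of_real (g t) - of_real t * poly r (of_real t)) \<le> eps / 2"
  "q (e \<ominus> pact h r h) \<le> eps / 2" using cfc_relE[OF g q eps2] by metis
 have "cmod (of_real (f t - g t) - of_real t * poly (p - r) (of_real t)) \<le> eps" if t: "t \<in> spec h" for t
 proof -
  have eq: "of_real (f t - g t) - of_real t * poly (p - r) (of_real t) =
    (of_real (f t) - of_real t * poly p (of_real t)) - (of_real (g t) - of_real t * poly r (of_real t))"
   by (simp add: algebra_simps)
  show ?thesis unfolding eq using norm_triangle_ineq4[of "of_real (f t) - of_real t * poly p (of_real t)"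
     "of_real (g t) - of_real t * poly r (of_real t)"] p(1)[OF t] r(1)[OF t] by linarith
 qed
 moreover have "q ((d \<ominus> e) \<ominus> pact h (p - r) h) \<le> eps"
 proof -
  have "q ((d \<ominus> e) \<ominus> pact h (p - r) h) = q ((d \<oplus> (\<ominus> e)) \<ominus> (pact h p h \<oplus> (\<ominus> pact h r h)))"
   using h by (simp add: pact_diff M.minus_eq)
  also have "... \<le> q (d \<ominus> pact h p h) + q (\<ominus> e \<ominus> \<ominus> pact h r h)"
   by (rule add_diff_add_le) (use f g h in \<open>simp_all add: cfc_rel_closed\<close>)
  also have "\<ominus> e \<ominus> \<ominus> pact h r h = \<ominus> (e \<ominus> pact h r h)" using g h by (simp add: M.minus_eq M.minus_add cfc_rel_closed)
  also have "q ... = q (e \<ominus> pact h r h)" using g h by (intro minus) (simp add: cfc_rel_closed)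
  finally show ?thesis using p(2) r(2) by simp
 qed
 ultimately show "\<exists>p. (\<forall>t\<in>spectrum q h. cmod (of_real (f t - g t) - of_real t * poly p (of_real t)) \<le> eps) \<and>
   q ((d \<ominus> e) \<ominus> pact h p h) \<le> eps" by blast
qed

lemma cfc_rel_mult:
 assumes f: "cfc_rel h f d" and g: "cfc_rel h g e"
 shows "cfc_rel h (\<lambda>t. f t * g t) (d \<otimes> e)" unfolding cfc_rel_def
proof (intro conjI ballI allI impI)
 have d: "d \<in> carrier A" and e: "e \<in> carrier A" using f g by (simp_all add: cfc_rel_closed)
 then show "d \<otimes> e \<in> carrier A" by simp
 fix q eps assume q: "q \<in> \<S> A" and eps: "(0::real) < eps"
 interpret cstar_seminormed A q using q by (rule cont_seminormD)
 define del where "del = min 1 (eps / (q d + q e + 1))"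
 have pos: "q d + q e + 1 > 0" using nonneg[OF d] nonneg[OF e] by linarith
 then have del: "del > 0" "del \<le> 1" using eps by (simp_all add: del_def)
 have "del \<le> eps / (q d + q e + 1)" by (simp add: del_def)
 then have deleps: "del * (q d + q e + 1) \<le> eps" using pos by (simp add: pos_le_divide_eq)
 have bound: "x * del + (y + del) * del \<le> eps" if "x = q d \<and> y = q e \<or> x = q e \<and> y = q d" for x y
 proof -
  have "del * del \<le> 1 * del" using del by (intro mult_right_mono) simp_all
  then show ?thesis using deleps that by (auto simp: algebra_simps)
 qed
 obtain p where p: "!!t. t \<in> spec h ==> cmod (of_real (f t) - of_real t * poly p (of_real t)) \<le> del"
  "q (d \<ominus> pact h p h) \<le> del" using cfc_relE[OF f q del(1)] by metis
 obtain r where r: "!!t. t \<in> spec h ==> cmod (of_real (g t) - of_real t * poly r (of_real t)) \<le> del"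
  "q (e \<ominus> pact h r h) \<le> del" using cfc_relE[OF g q del(1)] by metis
 define s where "s = pCons 0 p * r"
 have "cmod (of_real (f t * g t) - of_real t * poly s (of_real t)) \<le> eps" if t: "t \<in> spec h" for t
 proof -
  let ?F = "complex_of_real (f t)" and ?G = "complex_of_real (g t)"
  let ?P = "of_real t * poly p (of_real t)" and ?R = "of_real t * poly r (of_real t)"
  have "?F * ?G - ?P * ?R = ?F * (?G - ?R) + ?R * (?F - ?P)" by (simp add: algebra_simps)
  then have "cmod (?F * ?G - ?P * ?R) \<le> cmod ?F * cmod (?G - ?R) + cmod ?R * cmod (?F - ?P)"
   by (metis norm_triangle_ineq norm_mult)
  also have "... \<le> q d * del + (q e + del) * del"
  proof (intro add_mono mult_mono)
   show "cmod ?F \<le> q d" using cfc_rel_le_norm[OF f q t] by simp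
   have "cmod ?R \<le> cmod ?G + cmod (?G - ?R)" by (metis norm_minus_commute norm_triangle_sub add.commute)
   then show "cmod ?R \<le> q e + del" using cfc_rel_le_norm[OF g q t] r(1)[OF t] by simp
  qed (use p(1)[OF t] r(1)[OF t] nonneg[OF d] nonneg[OF e] del in simp_all)
  also have "... \<le> eps" by (rule bound) simp
  finally show ?thesis by (simp add: s_def mult_ac)
 qed
 moreover have "q (d \<otimes> e \<ominus> pact h s h) \<le> eps"
 proof -
  let ?a = "pact h p h" and ?b = "pact h r h"
  have "pact h s h = ?a \<otimes> ?b" using h  by (simp only: s_def pact_mult[OF h(1) h(1)] pact_self_mult pact_closed)
  then have "q (d \<otimes> e \<ominus> pact h s h) \<le> q (d \<ominus> ?a) * q e + q ?a * q (e \<ominus> ?b)"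
   using mult_diff_mult_le[of d e ?a ?b] d e h by simp
  also have "... \<le> del * q e + (q d + del) * del"
  proof (intro add_mono mult_mono)
   show "q ?a \<le> q d + del" using le_diff_add[of ?a d] diff_sym[of ?a d] d h p(2) by simp
  qed (use p(2) r(2) nonneg d e del h in simp_all)
  also have "... \<le> eps" using bound[of "q e" "q d"] by (simp add: mult.commute)
  finally show ?thesis .
 qed
 ultimately show "\<exists>p. (\<forall>t\<in>spectrum q h. cmod (of_real (f t * g t) - of_real t * poly p (of_real t)) \<le> eps) \<and>
   q (d \<otimes> e \<ominus> pact h p h) \<le> eps" by blast
qed

lemma cfc_rel_cong:
 assumes "cfc_rel h f e" "!!q t. q \<in> \<S> A ==> t \<in> spectrum q h ==> f t = g t"
 shows "cfc_rel h g e" using assms unfolding cfc_rel_def by simp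

lemma cfc_rel_unique:
 assumes f: "cfc_rel h f d" "cfc_rel h f e"
 shows "d = e"
proof (rule eqI)
 fix q eps assume "q \<in> \<S> A" "(eps::real) > 0"
 then show "q (d \<ominus> e) \<le> eps" using cfc_rel_norm_le[OF cfc_rel_diff[OF f], of q eps] by simp
qed (use f cfc_rel_closed in auto)

lemma cfc_rel_star:
 assumes rel: "cfc_rel h f e"
 shows "cfc_rel h f (star A e)" unfolding cfc_rel_def
proof (intro conjI ballI allI impI)
 have e: "e \<in> carrier A" using rel by (rule cfc_rel_closed)
 then show "star A e \<in> carrier A" by simp
 fix q eps assume q: "q \<in> \<S> A" and eps: "(0::real) < eps"
 interpret cstar_seminormed A q using q by (rule cont_seminormD)
 obtain p where p: "!!t. t \<in> spec h ==> cmod (of_real (f t) - of_real t * poly p (of_real t)) \<le> eps"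
  "q (e \<ominus> pact h p h) \<le> eps" using cfc_relE[OF rel q eps] by metis
 have pc: "poly (conj p) (of_real t) = cnj (poly p (of_real t))" for t by (induction p) (simp_all add: map_poly_pCons)
 have "cmod (of_real (f t) - of_real t * poly (conj p) (of_real t)) \<le> eps" if t: "t \<in> spec h" for t
 proof -
  have "of_real (f t) - of_real t * poly (conj p) (of_real t) = cnj (of_real (f t) - of_real t * poly p (of_real t))"
   by (simp add: pc)
  then show ?thesis using p(1)[OF t] by (metis complex_mod_cnj)
 qed
 moreover have "q (star A e \<ominus> pact h (conj p) h) \<le> eps"
 proof -
  have "star A e \<ominus> pact h (conj p) h = star A (e \<ominus> pact h p h)" using e h by (simp add: star_diff star_pact_self)
  then show ?thesis using p(2) e h by simp
 qed
 ultimately show "\<exists>p. (\<forall>t\<in>spectrum q h. cmod (of_real (f t) - of_real t * poly p (of_real t)) \<le> eps) \<and>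
   q (star A e \<ominus> pact h p h) \<le> eps" by blast
qed

lemma cfc_rel_selfadjoint: "cfc_rel h f e ==> star A e = e" using cfc_rel_unique cfc_rel_star by blast

text \<open>
 Polynomials approximating \<open>f\<close> on $[-n,n]$ up to $1/n$ give a sequence of elements that is Cauchy for
 every seminorm, since each spectrum is bounded; completeness supplies the limit.
\<close>

lemma cfc_rel_exists:
 assumes f: "continuous_on UNIV f" "f 0 = 0"
 shows "\<exists>e. cfc_rel h f e"
proof -
 have "\<exists>p::complex poly. \<forall>t. \<bar>t\<bar> \<le> real n -->
   cmod (of_real (f t) - of_real t * poly p (of_real t)) \<le> 1 / Suc n" for n
  using polynomial_approximation_vanishing_at_0[OF f, of "1 / Suc n" "real n"] by simp
 then obtain p :: "nat => complex poly" where p: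
  "!!n t. \<bar>t\<bar> \<le> real n ==> cmod (of_real (f t) - of_real t * poly (p n) (of_real t)) \<le> 1 / Suc n" by metis
 have close: "q (pact h (p m) h \<ominus> pact h (p n) h) \<le> 1 / Suc m + 1 / Suc n"
  if q: "q \<in> \<S> A" and mn: "q h \<le> real m" "q h \<le> real n" for q m n
 proof -
  interpret cstar_seminormed A q using q by (rule cont_seminormD)
  have "q (pact h (p m - p n) h) \<le> 1 / Suc m + 1 / Suc n"
  proof (rule pact_self_le_if_spec[OF h])
   fix t assume "t \<in> spec h"
   then have t: "\<bar>t\<bar> \<le> real m" "\<bar>t\<bar> \<le> real n" using spec_le_norm[OF h(1)] mn by fastforce+
   have eq: "of_real t * poly (p m - p n) (of_real t) =
     (of_real (f t) - of_real t * poly (p n) (of_real t)) - (of_real (f t) - of_real t * poly (p m) (of_real t))"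
    by (simp add: algebra_simps)
   show "cmod (of_real t * poly (p m - p n) (of_real t)) \<le> 1 / Suc m + 1 / Suc n"
    unfolding eq using norm_triangle_ineq4[of "of_real (f t) - of_real t * poly (p n) (of_real t)"
      "of_real (f t) - of_real t * poly (p m) (of_real t)"] p[OF t(1)] p[OF t(2)] by linarith
  qed simp
  then show ?thesis using h by (simp add: pact_diff)
 qed
 have ev: "eventually (\<lambda>n. q h \<le> real n \<and> 1 / Suc n < eps) sequentially" if "eps > 0" for q and eps :: real
 proof (rule eventually_conj)
  show "eventually (\<lambda>n. q h \<le> real n) sequentially" using filterlim_real_sequentially unfolding filterlim_at_top by blast
  show "eventually (\<lambda>n. 1 / Suc n < eps) sequentially"
   using order_tendstoD(2)[OF LIMSEQ_inverse_real_of_nat that] by (simp add: inverse_eq_divide)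
 qed
 have "\<exists>e\<in>carrier A. \<forall>q\<in>\<S> A. \<forall>eps>0. eventually (\<lambda>n. q (pact h (p n) h \<ominus> e) < eps) sequentially"
 proof (rule complete_filter)
  fix q eps assume q: "q \<in> \<S> A" and "(eps::real) > 0"
  then have eps2: "eps / 2 > 0" by simp
  show "\<exists>Q. eventually Q sequentially \<and>
    (\<forall>i j. Q i --> Q j --> q (pact h (p i) h \<ominus> pact h (p j) h) < eps)"
  proof (intro exI conjI allI impI)
   show "eventually (\<lambda>n. q h \<le> real n \<and> 1 / Suc n < eps / 2) sequentially" by (rule ev[OF eps2])
   fix i j assume "q h \<le> real i \<and> 1 / Suc i < eps / 2" "q h \<le> real j \<and> 1 / Suc j < eps / 2"
   then show "q (pact h (p i) h \<ominus> pact h (p j) h) < eps" using close[OF q, of i j] by linarith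
  qed
 qed (use h in simp_all)
 then obtain e where e: "e \<in> carrier A" "!!q eps. q \<in> \<S> A ==> eps > 0 ==>
  eventually (\<lambda>n. q (pact h (p n) h \<ominus> e) < eps) sequentially" by blast
 have "cfc_rel h f e" unfolding cfc_rel_def
 proof (intro conjI ballI allI impI)
  fix q eps assume q: "q \<in> \<S> A" and eps: "(eps::real) > 0"
  interpret cstar_seminormed A q using q by (rule cont_seminormD)
  have "eventually (\<lambda>n. q (pact h (p n) h \<ominus> e) < eps \<and> q h \<le> real n \<and> 1 / Suc n < eps) sequentially"
   by (intro eventually_conj e(2)[OF q eps] ev[OF eps])
  from eventually_happens'[OF sequentially_bot this]
  obtain n where n: "q (pact h (p n) h \<ominus> e) < eps" "q h \<le> real n" "1 / Suc n < eps" by blast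
  have "cmod (of_real (f t) - of_real t * poly (p n) (of_real t)) \<le> eps" if "t \<in> spec h" for t
   using p[of t n] spec_le_norm[OF h(1) that] n by linarith
  moreover have "q (e \<ominus> pact h (p n) h) \<le> eps" using n(1) diff_sym[of e "pact h (p n) h"] e(1) h by simp
  ultimately show "\<exists>p. (\<forall>t\<in>spectrum q h. cmod (of_real (f t) - of_real t * poly p (of_real t)) \<le> eps) \<and>
   q (e \<ominus> pact h p h) \<le> eps" by blast
 qed (rule e(1))
 then show ?thesis by blast
qed

end

section \<open>Positive elements\<close>

text \<open>
 Closure under sums and limits is easy for the spectral condition and hard for the form $b^*b$.
\<close>

definition spectrally_positive :: "'a => bool"
 where "spectrally_positive h \<longleftrightarrow> h \<in> carrier A \<and> star A h = h \<and>
  (\<forall>q\<in>\<S> A. \<forall>t\<in>spectrum q h. 0 \<le> t)"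

lemma spectrally_positiveD:
 assumes "spectrally_positive h"
 shows "h \<in> carrier A" "star A h = h" "!!q t. q \<in> \<S> A ==> t \<in> spectrum q h ==> 0 \<le> t"
 using assms by (auto simp: spectrally_positive_def)

text \<open>
 For $r \ge \|h\|$, positivity of \<open>h\<close> is equivalent to $\|r - h\| \le r$, with the norm taken in the
 multipliers. This convex condition yields closure under sums.
\<close>

lemma spectrally_positive_norm_le:
 assumes pos: "spectrally_positive h" and q: "q \<in> \<S> A" and r: "q h \<le> r" and x: "x \<in> carrier A"
 shows "q (of_real r \<odot> x \<ominus> h \<otimes> x) \<le> r * q x"
proof -
 interpret cstar_seminormed A q using q by (rule cont_seminormD)
 note h = spectrally_positiveD[OF pos]
 have "q (pact h [:of_real r, - 1:] x) \<le> r * q x"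
 proof (rule pact_le_if_spec[OF h(1,2)])
  show "0 \<le> r" using r nonneg[OF h(1)] by simp
  fix t assume t: "t \<in> spec h"
  have "\<bar>r - t\<bar> \<le> r" using h(3)[OF q t] spec_le_norm[OF h(1) t] r by linarith
  moreover have "poly [:of_real r, - 1:] (of_real t) = complex_of_real (r - t)" by simp
  ultimately show "cmod (poly [:of_real r, - 1:] (of_real t)) \<le> r" by (metis norm_of_real)
 qed (rule x)
 moreover have "pact h [:of_real r, - 1:] x = of_real r \<odot> x \<ominus> h \<otimes> x"
  using h x by (simp add: pact_pCons smult_minus_1 mult_minus_right M.minus_eq)
 ultimately show ?thesis by simp
qed

lemma spectrally_positiveI:
 assumes h: "h \<in> carrier A" "star A h = h"
  and le: "!!q. q \<in> \<S> A ==> \<exists>r. \<forall>x\<in>carrier A. q (of_real r \<odot> x \<ominus> h \<otimes> x) \<le> r * q x"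
 shows "spectrally_positive h" unfolding spectrally_positive_def
proof (intro conjI h ballI)
 fix q t assume q: "q \<in> \<S> A" and t: "t \<in> spectrum q h"
 interpret cstar_seminormed A q using q by (rule cont_seminormD)
 obtain r where r: "!!x. x \<in> carrier A ==> q (of_real r \<odot> x \<ominus> h \<otimes> x) \<le> r * q x" using le[OF q] by blast
 have "cmod (poly [:of_real r, - 1:] (of_real t)) \<le> r" by (rule specD[OF t])
   (use r h in \<open>simp add: pact_pCons smult_minus_1 mult_minus_right M.minus_eq\<close>)
 moreover have "poly [:of_real r, - 1:] (of_real t) = complex_of_real (r - t)" by simp
 ultimately have "\<bar>r - t\<bar> \<le> r" by (metis norm_of_real)
 then show "0 \<le> t" by simp
qed

lemma spectrally_positive_add:
 assumes g: "spectrally_positive g" and h: "spectrally_positive h"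
 shows "spectrally_positive (g \<oplus> h)"
proof (rule spectrally_positiveI)
 note g' = spectrally_positiveD[OF g] and h' = spectrally_positiveD[OF h]
 show "g \<oplus> h \<in> carrier A" "star A (g \<oplus> h) = g \<oplus> h" using g' h' by (simp_all add: star_add)
 fix q assume q: "q \<in> \<S> A"
 interpret cstar_seminormed A q using q by (rule cont_seminormD)
 have "q (of_real (q g + q h) \<odot> x \<ominus> (g \<oplus> h) \<otimes> x) \<le> (q g + q h) * q x" if x: "x \<in> carrier A" for x
 proof -
  have "of_real (q g + q h) \<odot> x \<ominus> (g \<oplus> h) \<otimes> x =
    (of_real (q g) \<odot> x \<oplus> of_real (q h) \<odot> x) \<ominus> (g \<otimes> x \<oplus> h \<otimes> x)" using g' h' x by (simp add: mult_distr_left smult_add_left)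
  then have "q (of_real (q g + q h) \<odot> x \<ominus> (g \<oplus> h) \<otimes> x) \<le>
    q (of_real (q g) \<odot> x \<ominus> g \<otimes> x) + q (of_real (q h) \<odot> x \<ominus> h \<otimes> x)"
   using add_diff_add_le[of "of_real (q g) \<odot> x" "of_real (q h) \<odot> x" "g \<otimes> x" "h \<otimes> x"] g' h' x by simp
  also have "... \<le> q g * q x + q h * q x" by (intro add_mono spectrally_positive_norm_le g h q x order_refl)
  finally show ?thesis by (simp add: algebra_simps)
 qed
 then show "\<exists>r. \<forall>x\<in>carrier A. q (of_real r \<odot> x \<ominus> (g \<oplus> h) \<otimes> x) \<le> r * q x" by blast
qed

lemma spectrally_positive_square:
 assumes h: "h \<in> carrier A" "star A h = h"
 shows "spectrally_positive (h \<otimes> h)"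
proof (rule spectrally_positiveI)
 show "h \<otimes> h \<in> carrier A" "star A (h \<otimes> h) = h \<otimes> h" using h by (simp_all add: star_mult)
 fix q assume q: "q \<in> \<S> A"
 interpret cstar_seminormed A q using q by (rule cont_seminormD)
 let ?r = "(q h)\<^sup>2"
 have "q (of_real ?r \<odot> x \<ominus> (h \<otimes> h) \<otimes> x) \<le> ?r * q x" if x: "x \<in> carrier A" for x
 proof -
  have "q (pact h [:of_real ?r, 0, - 1:] x) \<le> ?r * q x"
  proof (rule pact_le_if_spec[OF h])
   fix t assume t: "t \<in> spec h"
   have "t\<^sup>2 \<le> ?r" using spec_le_norm[OF h(1) t] by (simp add: abs_le_square_iff[symmetric])
   moreover have "poly [:of_real ?r, 0, - 1:] (of_real t) = complex_of_real (?r - t\<^sup>2)" by (simp add: power2_eq_square)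
   moreover have "\<bar>?r - t\<^sup>2\<bar> \<le> ?r" using \<open>t\<^sup>2 \<le> ?r\<close> zero_le_power2[of t] by linarith
   ultimately show "cmod (poly [:of_real ?r, 0, - 1:] (of_real t)) \<le> ?r" by (metis norm_of_real)
  qed (use x in simp_all)
  moreover have "pact h [:of_real ?r, 0, - 1:] x = of_real ?r \<odot> x \<ominus> (h \<otimes> h) \<otimes> x"
   using h x by (simp add: pact_pCons smult_minus_1 mult_minus_right M.minus_eq mult_assoc)
  ultimately show ?thesis by simp
 qed
 then show "\<exists>r. \<forall>x\<in>carrier A. q (of_real r \<odot> x \<ominus> (h \<otimes> h) \<otimes> x) \<le> r * q x" by blast
qed

lemma spectrally_positive_limit:
 assumes h: "h \<in> carrier A"
  and lim: "!!q eps. q \<in> \<S> A ==> eps > 0 ==> \<exists>k. spectrally_positive k \<and> q (h \<ominus> k) \<le> eps"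
 shows "spectrally_positive h"
proof (rule spectrally_positiveI[OF h])
 show "star A h = h"
 proof (rule eqI)
  fix q eps assume q: "q \<in> \<S> A" and "(eps::real) > 0"
  interpret cstar_seminormed A q using q by (rule cont_seminormD)
  from \<open>eps > 0\<close> have "eps / 2 > 0" by simp
  then obtain k where k: "spectrally_positive k" "q (h \<ominus> k) \<le> eps / 2" using lim[OF q] by blast
  note k' = spectrally_positiveD[OF k(1)]
  have "q (star A h \<ominus> h) \<le> q (star A h \<ominus> k) + q (k \<ominus> h)" by (rule diff_triangle) (use h k' in simp_all)
  also have "star A h \<ominus> k = star A (h \<ominus> k)" using h k' by (simp add: star_diff)
  also have "q (star A (h \<ominus> k)) = q (h \<ominus> k)" using h k' by (intro star_isometric) simp
  also have "q (k \<ominus> h) = q (h \<ominus> k)" using h k' by (intro diff_sym) simp_all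
  finally show "q (star A h \<ominus> h) \<le> eps" using k(2) by simp
 qed (use h in simp_all)
 fix q assume q: "q \<in> \<S> A"
 interpret cstar_seminormed A q using q by (rule cont_seminormD)
 let ?r = "q h + 1"
 have "q (of_real ?r \<odot> x \<ominus> h \<otimes> x) \<le> ?r * q x" if x: "x \<in> carrier A" for x
 proof (rule field_le_epsilon)
  fix eps :: real assume eps: "eps > 0"
  define del where "del = min 1 (eps / (q x + 1))"
  have qx: "q x + 1 > 0" using nonneg[OF x] by linarith
  then have del: "del > 0" "del \<le> 1" using eps by (simp_all add: del_def)
  have "del \<le> eps / (q x + 1)" by (simp add: del_def)
  then have "del * (q x + 1) \<le> eps" using qx by (simp add: pos_le_divide_eq)
  then have deleps: "del * q x \<le> eps" using del by (simp add: distrib_left)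
  obtain k where k: "spectrally_positive k" "q (h \<ominus> k) \<le> del" using lim[OF q del(1)] by blast
  note k' = spectrally_positiveD[OF k(1)]
  have "q k \<le> ?r" using le_diff_add[of k h] diff_sym[of k h] h k' k(2) del by simp
  have "q (of_real ?r \<odot> x \<ominus> h \<otimes> x) \<le> q (of_real ?r \<odot> x \<ominus> k \<otimes> x) + q (k \<otimes> x \<ominus> h \<otimes> x)"
   by (rule diff_triangle) (use h k' x in simp_all)
  also have "... \<le> ?r * q x + del * q x"
  proof (rule add_mono)
   show "q (of_real ?r \<odot> x \<ominus> k \<otimes> x) \<le> ?r * q x" by (rule spectrally_positive_norm_le[OF k(1) q \<open>q k \<le> ?r\<close> x])
   have "q (k \<otimes> x \<ominus> h \<otimes> x) \<le> q (k \<ominus> h) * q x" using submultiplicative[of "k \<ominus> h" x] h k' x by (simp add: mult_diff_left)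
   also have "q (k \<ominus> h) \<le> del" using k(2) diff_sym[of k h] h k' by simp
   finally show "q (k \<otimes> x \<ominus> h \<otimes> x) \<le> del * q x" using nonneg[OF x] by (simp add: mult_right_mono)
  qed
  finally show "q (of_real ?r \<odot> x \<ominus> h \<otimes> x) \<le> ?r * q x + eps" using deleps by simp
 qed
 then show "\<exists>r. \<forall>x\<in>carrier A. q (of_real r \<odot> x \<ominus> h \<otimes> x) \<le> r * q x" by blast
qed

lemma spectrally_positive_norm_mono:
 assumes h: "spectrally_positive h" and k: "spectrally_positive k" and q: "q \<in> \<S> A"
 shows "q h \<le> q (h \<oplus> k)"
proof -
 interpret cstar_seminormed A q using q by (rule cont_seminormD)
 note h' = spectrally_positiveD[OF h] and k' = spectrally_positiveD[OF k]
 show ?thesis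
 proof (cases "q h > 0")
  case True
  obtain t where t: "t \<in> spec h" "\<bar>t\<bar> = q h" using norm_attained_on_spec[OF h'(1,2) True] by blast
  then have tq: "t = q h" using h'(3)[OF q t(1)] by simp
  have "cmod (poly [:of_real (q k), 1:] (of_real t)) \<le> q (h \<oplus> k) + q k"
  proof (rule specD[OF t(1)])
   fix x assume x: "x \<in> carrier A"
   have "(h \<oplus> k) \<otimes> x \<oplus> (of_real (q k) \<odot> x \<ominus> k \<otimes> x) = of_real (q k) \<odot> x \<oplus> h \<otimes> x"
   proof -
    have "k \<otimes> x \<oplus> (of_real (q k) \<odot> x \<ominus> k \<otimes> x) = of_real (q k) \<odot> x"
     using k' x M.diff_add_cancel[of "of_real (q k) \<odot> x" "k \<otimes> x"] by (simp add: M.a_comm)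
    then show ?thesis using h' k' x by (simp add: mult_distr_left M.a_assoc) (simp add: M.a_comm)
   qed
   then have "pact h [:of_real (q k), 1:] x = (h \<oplus> k) \<otimes> x \<oplus> (of_real (q k) \<odot> x \<ominus> k \<otimes> x)" using h' x by (simp add: pact_pCons)
   then have "q (pact h [:of_real (q k), 1:] x) \<le> q ((h \<oplus> k) \<otimes> x) + q (of_real (q k) \<odot> x \<ominus> k \<otimes> x)"
    using triangle[of "(h \<oplus> k) \<otimes> x" "of_real (q k) \<odot> x \<ominus> k \<otimes> x"] h' k' x by simp
   also have "... \<le> q (h \<oplus> k) * q x + q k * q x"
    by (intro add_mono submultiplicative spectrally_positive_norm_le k q x) (use h' k' in simp_all)
   finally show "q (pact h [:of_real (q k), 1:] x) \<le> (q (h \<oplus> k) + q k) * q x" by (simp add: distrib_right)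
  qed
  moreover have "poly [:of_real (q k), 1:] (of_real t) = complex_of_real (q k + t)" by simp
  ultimately have "\<bar>q k + t\<bar> \<le> q (h \<oplus> k) + q k" by (metis norm_of_real)
  then show ?thesis using tq by linarith
 next
  case False
  moreover have "0 \<le> q (h \<oplus> k)" using h' k' by (intro nonneg) simp
  ultimately show ?thesis by linarith
 qed
qed

lemma spectrally_positive_sqrt:
 assumes h: "spectrally_positive h"
 shows "\<exists>d\<in>carrier A. star A d = d \<and> d \<otimes> d = h"
proof -
 note h' = spectrally_positiveD[OF h]
 have "continuous_on UNIV (\<lambda>t::real. sqrt \<bar>t\<bar>)" by (intro continuous_intros)
 then obtain d where d: "cfc_rel h (\<lambda>t. sqrt \<bar>t\<bar>) d" using cfc_rel_exists[OF h'(1,2), of "\<lambda>t. sqrt \<bar>t\<bar>"] by auto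
 have "cfc_rel h (\<lambda>t. sqrt \<bar>t\<bar> * sqrt \<bar>t\<bar>) (d \<otimes> d)" by (rule cfc_rel_mult[OF h'(1,2) d d])
 then have "cfc_rel h (\<lambda>t. t) (d \<otimes> d)" by (rule cfc_rel_cong[OF h'(1,2)]) (use h'(3) in simp)
 then have "d \<otimes> d = h" using cfc_rel_unique[OF h'(1,2)] cfc_rel_id[OF h'(1,2)] by blast
 then show ?thesis using cfc_rel_closed[OF h'(1,2) d] cfc_rel_selfadjoint[OF h'(1,2) d] by blast
qed

text \<open>
 With $c = x + iy$, the sum $c^*c + cc^*$ is $2(x^2 + y^2)$; here \<open>u\<close> and \<open>v\<close> are $2x$ and $-2y$.
\<close>

lemma sum_of_products_star:
 assumes c: "c \<in> carrier A"
 defines "u \<equiv> c \<oplus> star A c" and "v \<equiv> \<i> \<odot> (c \<ominus> star A c)"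
 shows "star A u = u" "star A v = v"
  "u \<otimes> u \<oplus> v \<otimes> v = (c \<otimes> star A c \<oplus> star A c \<otimes> c) \<oplus> (c \<otimes> star A c \<oplus> star A c \<otimes> c)"
proof -
 show "star A u = u" using c by (simp add: u_def star_add M.a_comm)
 have "star A v = (- \<i>) \<odot> (star A c \<ominus> c)" using c by (simp add: v_def star_smult star_diff)
 also have "... = \<i> \<odot> (\<ominus> (star A c \<ominus> c))" using c by (simp add: smult_minus_left smult_minus_right)
 also have "\<ominus> (star A c \<ominus> c) = c \<ominus> star A c" using c by (simp add: M.minus_diff)
 finally show "star A v = v" by (simp add: v_def)
 let ?P = "c \<otimes> c \<oplus> star A c \<otimes> star A c" and ?Q = "c \<otimes> star A c \<oplus> star A c \<otimes> c"
 have uu: "u \<otimes> u = ?P \<oplus> ?Q" using c by (simp add: u_def mult_distr_left mult_distr_right M.a_ac)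
 have "(c \<ominus> star A c) \<otimes> (c \<ominus> star A c) = ?P \<oplus> \<ominus> ?Q"
  using c by (simp add: M.minus_eq mult_distr_left mult_distr_right mult_minus_left mult_minus_right M.minus_add M.a_ac)
 then have "v \<otimes> v = (- 1) \<odot> (?P \<oplus> \<ominus> ?Q)" using c by (simp add: v_def smult_mult_left smult_mult_right smult_smult)
 also have "... = \<ominus> ?P \<oplus> ?Q" using c by (simp add: smult_minus_1 M.minus_add)
 finally have vv: "v \<otimes> v = \<ominus> ?P \<oplus> ?Q" .
 have "(?P \<oplus> ?Q) \<oplus> (\<ominus> ?P \<oplus> ?Q) = (?P \<oplus> \<ominus> ?P) \<oplus> (?Q \<oplus> ?Q)" using c by (simp add: M.a_ac)
 also have "?P \<oplus> \<ominus> ?P = \<zero>" using c by (intro M.r_neg) simp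
 finally show "u \<otimes> u \<oplus> v \<otimes> v = ?Q \<oplus> ?Q" using c by (simp add: uu vv)
qed

lemma spectrally_positive_double_norm_le:
 assumes c: "c \<in> carrier A" and k: "k \<in> carrier A" "star A k = k" and ck: "star A c \<otimes> c = \<ominus> (k \<otimes> k)"
 shows "spectrally_positive (c \<otimes> star A c \<oplus> c \<otimes> star A c)"
proof -
 define u where "u = c \<oplus> star A c"
 define v where "v = \<i> \<odot> (c \<ominus> star A c)"
 note uv = sum_of_products_star[OF c, folded u_def v_def]
 have uvc: "u \<in> carrier A" "v \<in> carrier A" using c by (simp_all add: u_def v_def)
 let ?W = "c \<otimes> star A c" and ?K = "k \<otimes> k"
 have W: "?W \<in> carrier A" "?K \<in> carrier A" using c k by simp_all
 have "spectrally_positive ((u \<otimes> u \<oplus> v \<otimes> v) \<oplus> (?K \<oplus> ?K))"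
  by (intro spectrally_positive_add spectrally_positive_square uv uvc k)
 also have "(u \<otimes> u \<oplus> v \<otimes> v) \<oplus> (?K \<oplus> ?K) = ((?W \<ominus> ?K) \<oplus> ?K) \<oplus> ((?W \<ominus> ?K) \<oplus> ?K)"
  unfolding uv(3) ck using W by (simp add: M.minus_eq M.a_ac)
 also have "(?W \<ominus> ?K) \<oplus> ?K = ?W" using W by (rule M.diff_add_cancel)
 finally show ?thesis .
qed

text \<open>
 If $c^*c = -k^2$, then $w = 2cc^*$ is positive by the previous lemmas. Hence
 $\|c^*(r - w)c\| \le r\|k\|^2$ for $r = \|w\|$, but $c^*(r - w)c = -(rk^2 + 2k^4)$ has norm
 $r\|k\|^2 + 2\|k\|^4$. This form of the classical argument avoids comparing the spectra of $c^*c$ and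
 $cc^*$.
\<close>

lemma star_mult_self_neg_square:
 assumes c: "c \<in> carrier A" and k: "k \<in> carrier A" "star A k = k" and ck: "star A c \<otimes> c = \<ominus> (k \<otimes> k)"
 shows "k = \<zero>"
proof (rule separated[OF k(1)])
 fix q assume q: "q \<in> \<S> A"
 interpret cstar_seminormed A q using q by (rule cont_seminormD)
 let ?W = "c \<otimes> star A c" and ?K = "k \<otimes> k"
 define w where "w = ?W \<oplus> ?W"
 have W: "?W \<in> carrier A" "?K \<in> carrier A" "w \<in> carrier A" using c k by (simp_all add: w_def)
 have pos: "spectrally_positive w" unfolding w_def by (rule spectrally_positive_double_norm_le[OF c k ck])
 have qck: "q c = q k"
 proof -
  have "(q c)\<^sup>2 = q (\<ominus> ?K)" using cstar[OF c] ck by simp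
  also have "... = (q k)\<^sup>2" using W square_selfadjoint[OF k] by simp
  finally show ?thesis using nonneg[OF c] nonneg[OF k(1)] by (simp add: power2_eq_iff_nonneg)
 qed
 define r where "r = q w"
 have r: "r \<ge> 0" using W by (simp add: r_def nonneg)
 have "q (of_real r \<odot> c \<ominus> w \<otimes> c) \<le> r * q c" by (rule spectrally_positive_norm_le[OF pos q _ c]) (simp add: r_def)
 then have "q (star A c) * q (of_real r \<odot> c \<ominus> w \<otimes> c) \<le> q c * (r * q c)" using c nonneg[OF c] by (simp add: mult_left_mono)
 moreover have "q (star A c \<otimes> (of_real r \<odot> c \<ominus> w \<otimes> c)) \<le> q (star A c) * q (of_real r \<odot> c \<ominus> w \<otimes> c)"
  by (rule submultiplicative) (use c W in simp_all)
 moreover have "star A c \<otimes> (of_real r \<odot> c \<ominus> w \<otimes> c) = \<ominus> pact k [:0, of_real r, 0, 2:] k"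
 proof -
  have "star A c \<otimes> (?W \<otimes> c) = (star A c \<otimes> c) \<otimes> (star A c \<otimes> c)" using c by (simp add: mult_assoc)
  also have "... = ?K \<otimes> ?K" unfolding ck using W by (simp add: mult_minus_left mult_minus_right)
  finally have "star A c \<otimes> (w \<otimes> c) = 2 \<odot> (?K \<otimes> ?K)"
   using c W smult_add_left[of "?K \<otimes> ?K" 1 1] by (simp add: w_def mult_distr_left mult_distr_right)
  moreover have "star A c \<otimes> (of_real r \<odot> c) = \<ominus> (of_real r \<odot> ?K)"
   using c W ck by (simp add: smult_mult_right smult_minus_right)
  ultimately have "star A c \<otimes> (of_real r \<odot> c \<ominus> w \<otimes> c) = \<ominus> (of_real r \<odot> ?K) \<ominus> 2 \<odot> (?K \<otimes> ?K)"
   using c W by (simp add: mult_diff_right)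
  also have "... = \<ominus> (of_real r \<odot> ?K \<oplus> 2 \<odot> (?K \<otimes> ?K))" using W by (simp add: M.minus_eq M.minus_add)
  also have "of_real r \<odot> ?K \<oplus> 2 \<odot> (?K \<otimes> ?K) = pact k [:0, of_real r, 0, 2:] k"
   using k by (simp add: pact_pCons mult_distr_right smult_mult_right mult_assoc)
  finally show ?thesis .
 qed
 ultimately have upper: "q (pact k [:0, of_real r, 0, 2:] k) \<le> r * (q k)\<^sup>2"
  using k qck by (simp add: power2_eq_square mult_ac)
 show "q k = 0"
 proof (rule ccontr)
  assume "q k \<noteq> 0"
  then have "q k > 0" using nonneg[OF k(1)] by simp
  then obtain t where t: "t \<in> spec k" "\<bar>t\<bar> = q k" using norm_attained_on_spec[OF k] by blast
  have "cmod (of_real t * poly [:0, of_real r, 0, 2:] (of_real t)) \<le> r * (q k)\<^sup>2"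
   using spec_le_pact_self[OF k(1) t(1), of "[:0, of_real r, 0, 2:]"] upper by linarith
  moreover have "of_real t * poly [:0, of_real r, 0, 2:] (of_real t) = complex_of_real (r * t\<^sup>2 + 2 * (t\<^sup>2)\<^sup>2)"
   by (simp add: power2_eq_square algebra_simps)
  ultimately have "\<bar>r * t\<^sup>2 + 2 * (t\<^sup>2)\<^sup>2\<bar> \<le> r * (q k)\<^sup>2" by (metis norm_of_real)
  moreover have "t\<^sup>2 = (q k)\<^sup>2" using t(2) by (metis power2_abs)
  ultimately have "\<bar>r * (q k)\<^sup>2 + 2 * ((q k)\<^sup>2)\<^sup>2\<bar> \<le> r * (q k)\<^sup>2" by metis
  then have "((q k)\<^sup>2)\<^sup>2 \<le> 0" by linarith
  then show False using \<open>q k > 0\<close> by simp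
 qed
qed

text \<open>
 For $h = b^*b$ with negative part \<open>e\<close>, the element $c = be$ satisfies $c^*c = ehe = -e^3$, so $e = 0$.
\<close>

theorem star_mult_self_spectrally_positive:
 assumes b: "b \<in> carrier A"
 shows "spectrally_positive (star A b \<otimes> b)"
proof -
 define h where "h = star A b \<otimes> b"
 have h: "h \<in> carrier A" "star A h = h" using b by (simp_all add: h_def star_mult)
 let ?f = "\<lambda>t::real. max (- t) 0" and ?g = "\<lambda>t::real. max (- t) 0 * sqrt (max (- t) 0)"
 have cont: "continuous_on UNIV ?f" "continuous_on UNIV ?g" by (intro continuous_intros)+
 obtain e where e: "cfc_rel h ?f e" using cfc_rel_exists[OF h cont(1)] by auto
 obtain k where k: "cfc_rel h ?g k" using cfc_rel_exists[OF h cont(2)] by auto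
 note e' = cfc_rel_closed[OF h e] cfc_rel_selfadjoint[OF h e]
 note k' = cfc_rel_closed[OF h k] cfc_rel_selfadjoint[OF h k]
 define c where "c = b \<otimes> e"
 have c: "c \<in> carrier A" using b e' by (simp add: c_def)
 have "star A c \<otimes> c = e \<otimes> h \<otimes> e" using b e' by (simp add: c_def h_def star_mult mult_assoc)
 also have "... = \<ominus> (k \<otimes> k)"
 proof -
  have "cfc_rel h (\<lambda>t. (?g t * ?g t - ?g t * ?g t) - ?g t * ?g t) ((k \<otimes> k \<ominus> k \<otimes> k) \<ominus> k \<otimes> k)"
   by (intro cfc_rel_diff[OF h] cfc_rel_mult[OF h] k)
  then have "cfc_rel h (\<lambda>t. (?g t * ?g t - ?g t * ?g t) - ?g t * ?g t) (\<ominus> (k \<otimes> k))" using k' by (simp add: M.minus_eq M.r_neg)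
  moreover have "cfc_rel h (\<lambda>t. ?f t * t * ?f t) (e \<otimes> h \<otimes> e)" by (intro cfc_rel_mult[OF h] e cfc_rel_id[OF h])
  moreover have "?f t * t * ?f t = (?g t * ?g t - ?g t * ?g t) - ?g t * ?g t" for t :: real
  proof (cases "t \<le> 0")
   case True
   then have "sqrt (- t) * sqrt (- t) = - t" by simp
   then have "(- t * sqrt (- t)) * (- t * sqrt (- t)) = (- t) * (- t) * (- t)" by (simp add: mult_ac)
   then show ?thesis using True by (simp add: max_def)
  qed (simp add: max_def)
  ultimately show ?thesis using cfc_rel_unique[OF h] by simp
 qed
 finally have "k = \<zero>" by (rule star_mult_self_neg_square[OF c k'])
 have "0 \<le> t" if q: "q \<in> \<S> A" and t: "t \<in> spectrum q h" for q t
 proof (rule ccontr)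
  assume t0: "\<not> 0 \<le> t"
  interpret cstar_seminormed A q using q by (rule cont_seminormD)
  have "\<bar>?g t\<bar> \<le> q k" by (rule cfc_rel_le_norm[OF h k q t])
  moreover have "q k = 0" using \<open>k = \<zero>\<close> by simp
  moreover have "?g t > 0" using t0 by (simp add: max_def mult_neg_pos)
  ultimately show False by linarith
 qed
 then show ?thesis using h unfolding spectrally_positive_def h_def by simp
qed

theorem positive_iff_spectrally_positive: "positive A h \<longleftrightarrow> spectrally_positive h"
proof
 assume "positive A h"
 then show "spectrally_positive h" unfolding positive_def using star_mult_self_spectrally_positive by blast
next
 assume "spectrally_positive h"
 then obtain d where "d \<in> carrier A" "star A d = d" "d \<otimes> d = h" using spectrally_positive_sqrt by blast
 then show "positive A h" unfolding positive_def by (metis (no_types))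
qed

lemma positive_zero: "positive A \<zero>" unfolding positive_def by (intro bexI[of _ \<zero>]) simp_all

end

section \<open>Hilbert modules\<close>

text \<open>
 The positive element is $\langle \xi c - s\eta, \xi c - s\eta\rangle$ for
 $h = \langle\xi,\xi\rangle$, $c = \langle\xi,\eta\rangle$, $k = \langle\eta,\eta\rangle$. It gives
 $2s\,c^*c \le c^*hc + s^2k$; the inequality follows by taking norms and $s = q(h)$, or $s \to 0$ if
 $q(h) = 0$. Stated for elements of the algebra, it serves Hilbert modules and
 kernels alike.
\<close>

lemma (in locally_cstar_algebra) Cauchy_Schwarz_algebraic:
 assumes h: "h \<in> carrier A" and k: "k \<in> carrier A" and c: "c \<in> carrier A"
  and pos: "!!s::real. positive A
   ((star A c \<otimes> (h \<otimes> c) \<ominus> of_real s \<odot> (star A c \<otimes> c)) \<ominus>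
    (of_real s \<odot> (star A c \<otimes> c) \<ominus> of_real (s\<^sup>2) \<odot> k))"
  and q: "q \<in> \<S> A"
 shows "(q c)\<^sup>2 \<le> q h * q k"
proof -
 interpret cstar_seminormed A q using q by (rule cont_seminormD)
 have main: "2 * s * (q c)\<^sup>2 \<le> q h * (q c)\<^sup>2 + s\<^sup>2 * q k" if s: "s \<ge> 0" for s
 proof -
  let ?w = "star A c \<otimes> c" and ?H = "star A c \<otimes> (h \<otimes> c)" and ?K = "of_real (s\<^sup>2) \<odot> k"
  have cl: "?w \<in> carrier A" "?H \<in> carrier A" "?K \<in> carrier A" using h k c by simp_all
  let ?Z = "(?H \<ominus> of_real s \<odot> ?w) \<ominus> (of_real s \<odot> ?w \<ominus> ?K)"
  let ?d = "of_real (sqrt (2 * s)) \<odot> c"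
  have dd: "star A ?d \<otimes> ?d = of_real s \<odot> ?w \<oplus> of_real s \<odot> ?w"
  proof -
   have "star A ?d \<otimes> ?d = of_real (sqrt (2 * s) * sqrt (2 * s)) \<odot> ?w"
    using c by (simp only: star_smult smult_mult_left smult_mult_right smult_smult star_closed
      smult_in mult_closed complex_cnj_complex_of_real of_real_mult)
   also have "sqrt (2 * s) * sqrt (2 * s) = s + s" using s by simp
   finally show ?thesis using c by (simp add: smult_add_left[symmetric])
  qed
  have "positive A (star A ?d \<otimes> ?d)" unfolding positive_def using c by (intro bexI[of _ ?d]) simp_all
  then have "spectrally_positive (star A ?d \<otimes> ?d)" "spectrally_positive ?Z"
   using pos[of s] by (simp_all add: positive_iff_spectrally_positive)
  then have "q (star A ?d \<otimes> ?d) \<le> q (star A ?d \<otimes> ?d \<oplus> ?Z)" using q by (rule spectrally_positive_norm_mono)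
  also have "star A ?d \<otimes> ?d \<oplus> ?Z = ((?H \<ominus> of_real s \<odot> ?w) \<oplus> of_real s \<odot> ?w) \<oplus> ((?K \<ominus> of_real s \<odot> ?w) \<oplus> of_real s \<odot> ?w)"
  proof -
   let ?v = "of_real s \<odot> ?w"
   have v: "?v \<in> carrier A" using c by simp
   have "?Z = (?H \<ominus> ?v) \<oplus> (?K \<ominus> ?v)" using cl v M.minus_diff[of ?v ?K] by (simp only: M.minus_eq[of "?H \<ominus> ?v" "?v \<ominus> ?K"])
   then show ?thesis unfolding dd using cl v by (simp add: M.a_ac)
  qed
  also have "... = ?H \<oplus> ?K" using cl c by (simp only: M.diff_add_cancel smult_in)
  also have "q (?H \<oplus> ?K) \<le> q ?H + q ?K" by (rule triangle) (use cl in simp_all)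
  also have "q ?H \<le> q c * (q h * q c)"
  proof -
   have "q ?H \<le> q c * q (h \<otimes> c)" using submultiplicative[of "star A c" "h \<otimes> c"] h c by simp
   also have "... \<le> q c * (q h * q c)" using submultiplicative[OF h c] nonneg[OF c] by (rule mult_left_mono)
   finally show ?thesis .
  qed
  also have "q ?K = s\<^sup>2 * q k" using homogeneous[OF k] by (simp add: norm_power)
  also have "q (star A ?d \<otimes> ?d) = 2 * s * (q c)\<^sup>2"
  proof -
   have "q (star A ?d \<otimes> ?d) = (q ?d)\<^sup>2" using c by (intro cstar) simp
   also have "q ?d = sqrt (2 * s) * q c" using homogeneous[OF c] s by simp
   finally show ?thesis using s by (simp add: power_mult_distrib)
  qed
  finally show ?thesis by (simp add: power2_eq_square mult_ac)
 qed
 show ?thesis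
 proof (cases "q h = 0")
  case True
  have "(q c)\<^sup>2 \<le> 0"
  proof (rule field_le_epsilon)
   fix eps :: real assume eps: "eps > 0"
   define s where "s = 2 * eps / (q k + 1)"
   have k1: "q k + 1 > 0" using nonneg[OF k] by linarith
   then have s: "s > 0" using eps by (simp add: s_def)
   have "s * (2 * (q c)\<^sup>2) \<le> s * (s * q k)" using main[of s] True s by (simp add: power2_eq_square mult_ac)
   then have "2 * (q c)\<^sup>2 \<le> s * q k" using s by simp
   also have "... \<le> s * (q k + 1)" using s by simp
   also have "... = 2 * eps" using k1 by (simp add: s_def)
   finally show "(q c)\<^sup>2 \<le> 0 + eps" by simp
  qed
  then show ?thesis using True by simp
 next
  case False
  then have "q h > 0" using nonneg[OF h] by simp
  have "q h * (q c)\<^sup>2 \<le> q h * (q h * q k)" using main[of "q h"] \<open>q h > 0\<close> by (simp add: power2_eq_square algebra_simps)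
  then show ?thesis using \<open>q h > 0\<close> by simp
 qed
qed

locale lc_pre_hilbert = B?: locally_cstar_algebra B + E?: pre_hilbert_module B E
 for B :: "'b star_algebra" and E :: "('b, 'e) hilbert_module" (structure)

sublocale lc_pre_hilbert \<subseteq> V: complex_module E ..

context lc_pre_hilbert
begin

declare E.ract_closed [simp, intro] E.ip_closed [simp, intro]

lemma ip_add_left:
 assumes "\<xi> \<in> carrier E" "\<eta> \<in> carrier E" "\<zeta> \<in> carrier E"
 shows "ip E (\<xi> \<oplus> \<eta>) \<zeta> = ip E \<xi> \<zeta> \<oplus>\<^bsub>B\<^esub> ip E \<eta> \<zeta>"
proof -
 have "ip E (\<xi> \<oplus> \<eta>) \<zeta> = star B (ip E \<zeta> (\<xi> \<oplus> \<eta>))" using assms by (simp add: E.ip_star)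
 also have "... = star B (ip E \<zeta> \<xi>) \<oplus>\<^bsub>B\<^esub> star B (ip E \<zeta> \<eta>)" using assms by (simp add: E.ip_add B.star_add)
 finally show ?thesis using assms by (simp add: E.ip_star)
qed

lemma ip_smult_left:
 assumes "\<xi> \<in> carrier E" "\<zeta> \<in> carrier E"
 shows "ip E (z \<odot> \<xi>) \<zeta> = cnj z \<odot>\<^bsub>B\<^esub> ip E \<xi> \<zeta>"
proof -
 have "ip E (z \<odot> \<xi>) \<zeta> = star B (ip E \<zeta> (z \<odot> \<xi>))" using assms by (simp add: E.ip_star)
 also have "... = cnj z \<odot>\<^bsub>B\<^esub> star B (ip E \<zeta> \<xi>)" using assms by (simp add: E.ip_smult B.star_smult)
 finally show ?thesis using assms by (simp add: E.ip_star)
qed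

lemma ip_ract_left:
 assumes "\<xi> \<in> carrier E" "\<zeta> \<in> carrier E" "b \<in> carrier B"
 shows "ip E (ract E \<xi> b) \<zeta> = star B b \<otimes>\<^bsub>B\<^esub> ip E \<xi> \<zeta>"
proof -
 have "ip E (ract E \<xi> b) \<zeta> = star B (ip E \<zeta> (ract E \<xi> b))" using assms by (simp add: E.ip_star)
 also have "... = star B b \<otimes>\<^bsub>B\<^esub> star B (ip E \<zeta> \<xi>)" using assms by (simp add: E.ip_ract B.star_mult)
 finally show ?thesis using assms by (simp add: E.ip_star)
qed

lemma ip_zero_right [simp]: "\<xi> \<in> carrier E ==> ip E \<xi> \<zero> = \<zero>\<^bsub>B\<^esub>" using E.ip_smult[of \<xi> \<zero> 0] by simp

lemma ip_zero_left [simp]: "\<xi> \<in> carrier E ==> ip E \<zero> \<xi> = \<zero>\<^bsub>B\<^esub>" using ip_smult_left[of \<zero> \<xi> 0] by simp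

lemma ip_minus_right: "[|\<xi> \<in> carrier E; \<eta> \<in> carrier E|] ==> ip E \<xi> (\<ominus> \<eta>) = \<ominus>\<^bsub>B\<^esub> ip E \<xi> \<eta>"
 using E.ip_smult[of \<xi> \<eta> "-1"] by (simp add: V.smult_minus_1 B.smult_minus_1)

lemma ip_minus_left: "[|\<xi> \<in> carrier E; \<eta> \<in> carrier E|] ==> ip E (\<ominus> \<xi>) \<eta> = \<ominus>\<^bsub>B\<^esub> ip E \<xi> \<eta>"
 using ip_smult_left[of \<xi> \<eta> "-1"] by (simp add: V.smult_minus_1 B.smult_minus_1)

lemma ip_diff_right:
 "[|\<xi> \<in> carrier E; \<eta> \<in> carrier E; \<zeta> \<in> carrier E|] ==> ip E \<xi> (\<eta> \<ominus> \<zeta>) = ip E \<xi> \<eta> \<ominus>\<^bsub>B\<^esub> ip E \<xi> \<zeta>"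
 by (simp add: E.M.minus_eq B.M.minus_eq E.ip_add ip_minus_right)

lemma ip_diff_left:
 "[|\<xi> \<in> carrier E; \<eta> \<in> carrier E; \<zeta> \<in> carrier E|] ==> ip E (\<xi> \<ominus> \<eta>) \<zeta> = ip E \<xi> \<zeta> \<ominus>\<^bsub>B\<^esub> ip E \<eta> \<zeta>"
 by (simp add: E.M.minus_eq B.M.minus_eq ip_add_left ip_minus_left)

lemma ip_nonneg: "q \<in> \<S> B ==> \<xi> \<in> carrier E ==> 0 \<le> q (ip E \<xi> \<xi>)"
 by (intro seminormed_module.nonneg[OF B.cont_seminorm_seminormed]) simp_all

lemma hm_norm_nonneg: "q \<in> \<S> B ==> \<xi> \<in> carrier E ==> 0 \<le> hm_norm E q \<xi>" by (simp add: hm_norm_def ip_nonneg)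

lemma hm_norm_square: "q \<in> \<S> B ==> \<xi> \<in> carrier E ==> (hm_norm E q \<xi>)\<^sup>2 = q (ip E \<xi> \<xi>)" by (simp add: hm_norm_def ip_nonneg)

theorem Cauchy_Schwarz:
 assumes q: "q \<in> \<S> B" and \<xi>: "\<xi> \<in> carrier E" and \<eta>: "\<eta> \<in> carrier E"
 shows "q (ip E \<xi> \<eta>) \<le> hm_norm E q \<xi> * hm_norm E q \<eta>"
proof -
 let ?c = "ip E \<xi> \<eta>" and ?h = "ip E \<xi> \<xi>" and ?k = "ip E \<eta> \<eta>"
 have "(q ?c)\<^sup>2 \<le> q ?h * q ?k"
 proof (rule B.Cauchy_Schwarz_algebraic[OF _ _ _ _ q])
  fix s :: real
  have c: "?c \<in> carrier B" "ip E \<eta> \<xi> = star B ?c" using \<xi> \<eta> by (simp_all add: E.ip_star)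
  define \<zeta> where "\<zeta> = ract E \<xi> ?c \<ominus> of_real s \<odot> \<eta>"
  have \<zeta>: "\<zeta> \<in> carrier E" using \<xi> \<eta> by (simp add: \<zeta>_def)
  have "ip E \<zeta> \<zeta> = ((star B ?c \<otimes>\<^bsub>B\<^esub> (?h \<otimes>\<^bsub>B\<^esub> ?c) \<ominus>\<^bsub>B\<^esub> of_real s \<odot>\<^bsub>B\<^esub> (star B ?c \<otimes>\<^bsub>B\<^esub> ?c)) \<ominus>\<^bsub>B\<^esub>
    (of_real s \<odot>\<^bsub>B\<^esub> (star B ?c \<otimes>\<^bsub>B\<^esub> ?c) \<ominus>\<^bsub>B\<^esub> of_real (s\<^sup>2) \<odot>\<^bsub>B\<^esub> ?k))" unfolding \<zeta>_def using \<xi> \<eta> c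
   by (simp add: ip_diff_left ip_diff_right ip_ract_left ip_smult_left E.ip_ract E.ip_smult
     B.smult_mult_left B.smult_mult_right B.smult_smult B.smult_diff_right B.mult_diff_left
     B.mult_assoc power2_eq_square)
  with E.ip_positive[OF \<zeta>]
  show "positive B ((star B ?c \<otimes>\<^bsub>B\<^esub> (?h \<otimes>\<^bsub>B\<^esub> ?c) \<ominus>\<^bsub>B\<^esub> of_real s \<odot>\<^bsub>B\<^esub> (star B ?c \<otimes>\<^bsub>B\<^esub> ?c)) \<ominus>\<^bsub>B\<^esub>
    (of_real s \<odot>\<^bsub>B\<^esub> (star B ?c \<otimes>\<^bsub>B\<^esub> ?c) \<ominus>\<^bsub>B\<^esub> of_real (s\<^sup>2) \<odot>\<^bsub>B\<^esub> ?k))" by simp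
 qed (use \<xi> \<eta> in simp_all)
 then have "(q ?c)\<^sup>2 \<le> (hm_norm E q \<xi> * hm_norm E q \<eta>)\<^sup>2" using q \<xi> \<eta> by (simp add: power_mult_distrib hm_norm_square)
 then show ?thesis by (rule power2_le_imp_le) (simp add: hm_norm_nonneg[OF q] \<xi> \<eta>)
qed

lemma hm_norm_seminormed:
 assumes q: "q \<in> \<S> B"
 shows "seminormed_module E (hm_norm E q)"
proof -
 interpret q: cstar_seminormed B q using q by (rule B.cont_seminormD)
 have "hm_norm E q (\<xi> \<oplus> \<eta>) \<le> hm_norm E q \<xi> + hm_norm E q \<eta>" if \<xi>: "\<xi> \<in> carrier E" and \<eta>: "\<eta> \<in> carrier E" for \<xi> \<eta>
 proof (rule power2_le_imp_le)
  have "(hm_norm E q (\<xi> \<oplus> \<eta>))\<^sup>2 = q ((ip E \<xi> \<xi> \<oplus>\<^bsub>B\<^esub> ip E \<eta> \<xi>) \<oplus>\<^bsub>B\<^esub> (ip E \<xi> \<eta> \<oplus>\<^bsub>B\<^esub> ip E \<eta> \<eta>))"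
   using \<xi> \<eta> q by (simp add: hm_norm_square E.ip_add ip_add_left)
  also have "... \<le> q (ip E \<xi> \<xi> \<oplus>\<^bsub>B\<^esub> ip E \<eta> \<xi>) + q (ip E \<xi> \<eta> \<oplus>\<^bsub>B\<^esub> ip E \<eta> \<eta>)" using \<xi> \<eta> by (intro q.triangle) simp_all
  also have "... \<le> (q (ip E \<xi> \<xi>) + q (ip E \<eta> \<xi>)) + (q (ip E \<xi> \<eta>) + q (ip E \<eta> \<eta>))"
   using \<xi> \<eta> by (intro add_mono q.triangle) simp_all
  also have "... \<le> ((hm_norm E q \<xi>)\<^sup>2 + hm_norm E q \<eta> * hm_norm E q \<xi>) + (hm_norm E q \<xi> * hm_norm E q \<eta> + (hm_norm E q \<eta>)\<^sup>2)"
   using \<xi> \<eta> q by (intro add_mono Cauchy_Schwarz) (simp_all add: hm_norm_square)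
  also have "... = (hm_norm E q \<xi> + hm_norm E q \<eta>)\<^sup>2" by (simp add: power2_eq_square algebra_simps)
  finally show "(hm_norm E q (\<xi> \<oplus> \<eta>))\<^sup>2 \<le> (hm_norm E q \<xi> + hm_norm E q \<eta>)\<^sup>2" .
 qed (use q \<xi> \<eta> in \<open>simp add: hm_norm_nonneg\<close>)
 moreover have "hm_norm E q (z \<odot> \<xi>) = cmod z * hm_norm E q \<xi>" if \<xi>: "\<xi> \<in> carrier E" for z \<xi>
 proof -
  have "q (ip E (z \<odot> \<xi>) (z \<odot> \<xi>)) = cmod z * (cmod z * q (ip E \<xi> \<xi>))"
   using \<xi> by (simp add: E.ip_smult ip_smult_left q.homogeneous)
  then show ?thesis unfolding hm_norm_def by (simp add: real_sqrt_mult)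
 qed
 ultimately show ?thesis using hm_norm_nonneg[OF q]
  by (intro seminormed_module.intro V.complex_module_axioms seminormed_module_axioms.intro)
qed

lemma hm_separated:
 assumes \<xi>: "\<xi> \<in> carrier E" and null: "!!q. q \<in> \<S> B ==> hm_norm E q \<xi> = 0"
 shows "\<xi> = \<zero>"
proof -
 have "ip E \<xi> \<xi> = \<zero>\<^bsub>B\<^esub>"
 proof (rule B.separated)
  fix q assume q: "q \<in> \<S> B"
  show "q (ip E \<xi> \<xi>) = 0" using hm_norm_square[OF q \<xi>] null[OF q] by simp
 qed (use \<xi> in simp)
 then show ?thesis using E.ip_definite[OF \<xi>] by simp
qed

lemma hm_eqI:
 assumes "\<xi> \<in> carrier E" "\<eta> \<in> carrier E" "!!\<zeta>. \<zeta> \<in> carrier E ==> ip E \<xi> \<zeta> = ip E \<eta> \<zeta>"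
 shows "\<xi> = \<eta>"
proof -
 have "ip E (\<xi> \<ominus> \<eta>) (\<xi> \<ominus> \<eta>) = \<zero>\<^bsub>B\<^esub>" using assms(1,2) assms(3)[of "\<xi> \<ominus> \<eta>"] by (simp add: ip_diff_left B.M.minus_eq B.M.r_neg)
 then have "\<xi> \<ominus> \<eta> = \<zero>" using E.ip_definite[of "\<xi> \<ominus> \<eta>"] assms(1,2) by simp
 then show ?thesis using assms(1,2) by (simp add: E.M.diff_eq_zero_iff)
qed

lemma hm_seminorm_family: "seminorm_family E (hm_norm E ` \<S> B)"
 by (intro seminorm_family.intro V.complex_module_axioms seminorm_family_axioms.intro) (use hm_norm_seminormed in blast)

lemma hm_norm_mono:
 "[|\<xi> \<in> carrier E; !!b. b \<in> carrier B ==> q b \<le> r b|] ==> hm_norm E q \<xi> \<le> hm_norm E r \<xi>" by (simp add: hm_norm_def)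

lemma topspace_hm_topology [simp]: "topspace (hm_topology B E) = carrier E"
 by (simp add: hm_topology_def topspace_seminorm_topology)

lemma dense_in_hm_topology:
 "dense_in (hm_topology B E) D \<longleftrightarrow> D \<subseteq> carrier E \<and>
  (\<forall>\<xi>\<in>carrier E. \<forall>q\<in>\<S> B. \<forall>eps>0. \<exists>d\<in>D. hm_norm E q (d \<ominus> \<xi>) < eps)"
 (is "_ \<longleftrightarrow> _ \<and> ?R")
proof -
 interpret F: seminorm_family E "hm_norm E ` \<S> B" by (rule hm_seminorm_family)
 show ?thesis unfolding hm_topology_def F.dense_in_seminorm_topology
 proof (intro conj_cong refl iffI ballI allI impI)
  fix \<xi> q and eps :: real
  assume L: "\<forall>x\<in>carrier E. \<forall>F eps. finite F --> F \<subseteq> hm_norm E ` \<S> B --> 0 < eps -->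
    (\<exists>d\<in>D. \<forall>p\<in>F. p (d \<ominus> x) < eps)"
   and "\<xi> \<in> carrier E" "q \<in> \<S> B" "eps > 0"
  then have "\<exists>d\<in>D. \<forall>p\<in>{hm_norm E q}. p (d \<ominus> \<xi>) < eps" by blast
  then show "\<exists>d\<in>D. hm_norm E q (d \<ominus> \<xi>) < eps" by simp
 next
  fix \<xi> F and eps :: real
  assume D: "D \<subseteq> carrier E" and R: ?R and \<xi>: "\<xi> \<in> carrier E"
   and F: "finite F" "F \<subseteq> hm_norm E ` \<S> B" and eps: "eps > 0"
  obtain Q where Q: "finite Q" "Q \<subseteq> \<S> B" "F = hm_norm E ` Q" using finite_subset_image[OF F] by blast
  obtain r where r: "r \<in> \<S> B" "!!p a. p \<in> Q ==> a \<in> carrier B ==> p a \<le> r a"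
   using B.cont_seminorms_directed[OF Q(1,2)] by blast
  obtain d where d: "d \<in> D" "hm_norm E r (d \<ominus> \<xi>) < eps" using R \<xi> r(1) eps by blast
  have dE: "d \<in> carrier E" using d(1) D by blast
  have "p (d \<ominus> \<xi>) < eps" if p: "p \<in> F" for p
  proof -
   obtain q where q: "q \<in> Q" "p = hm_norm E q" using p Q(3) by blast
   have "hm_norm E q (d \<ominus> \<xi>) \<le> hm_norm E r (d \<ominus> \<xi>)" by (rule hm_norm_mono) (use r(2)[OF q(1)] dE \<xi> in simp_all)
   then show ?thesis using d(2) q(2) by simp
  qed
  then show "\<exists>d\<in>D. \<forall>p\<in>F. p (d \<ominus> \<xi>) < eps" using d(1) by blast
 qed
qed

text \<open>
 A vector that is small for one seminorm can be large for the others. Multiplication by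
 $\delta/\max(\delta, |\xi|)$ with $|\xi| = \langle\xi,\xi\rangle^{1/2}$ makes it small for all of them
 and does not change its class for the given one.
\<close>

lemma truncation:
 assumes \<xi>: "\<xi> \<in> carrier E" and q: "q \<in> \<S> B" and del: "del > 0" "hm_norm E q \<xi> \<le> del"
 shows "\<exists>\<eta>\<in>carrier E. (\<forall>r\<in>\<S> B. hm_norm E r \<eta> \<le> del) \<and> hm_norm E q (\<eta> \<ominus> \<xi>) = 0"
proof -
 define h where "h = ip E \<xi> \<xi>"
 have pos: "B.spectrally_positive h" using E.ip_positive[OF \<xi>] by (simp add: h_def B.positive_iff_spectrally_positive)
 note h = B.spectrally_positiveD[OF pos]
 let ?f = "\<lambda>t::real. 1 - del / max del (sqrt \<bar>t\<bar>)"
 have m: "max del (sqrt \<bar>t\<bar>) > 0" for t using del(1) by (simp add: less_max_iff_disj)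
 have "continuous_on UNIV ?f" by (intro continuous_intros) (use m in \<open>auto simp: less_le\<close>)
 moreover have "?f 0 = 0" using del(1) by (simp add: max_def)
 ultimately obtain e where e: "B.cfc_rel h ?f e" using B.cfc_rel_exists[OF h(1,2), of ?f] by blast
 note e' = B.cfc_rel_closed[OF h(1,2) e] B.cfc_rel_selfadjoint[OF h(1,2) e]
 note rels = B.cfc_rel_diff[OF h(1,2)] B.cfc_rel_mult[OF h(1,2)] B.cfc_rel_id[OF h(1,2)] e
 define \<eta> where "\<eta> = \<xi> \<ominus> ract E \<xi> e"
 have \<eta>: "\<eta> \<in> carrier E" using \<xi> e' by (simp add: \<eta>_def)
 have hm_norm_leI: "hm_norm E r \<zeta> \<le> c" if "r (ip E \<zeta> \<zeta>) \<le> c\<^sup>2" "c \<ge> 0" for r \<zeta> c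
  using that real_sqrt_le_mono[OF that(1)] by (simp add: hm_norm_def)
 have "hm_norm E r \<eta> \<le> del" if r: "r \<in> \<S> B" for r
 proof (rule hm_norm_leI)
  have "ip E \<eta> \<eta> = (h \<ominus>\<^bsub>B\<^esub> e \<otimes>\<^bsub>B\<^esub> h) \<ominus>\<^bsub>B\<^esub> (h \<otimes>\<^bsub>B\<^esub> e \<ominus>\<^bsub>B\<^esub> e \<otimes>\<^bsub>B\<^esub> (h \<otimes>\<^bsub>B\<^esub> e))" unfolding \<eta>_def h_def using \<xi> e'
   by (simp add: ip_diff_left ip_diff_right ip_ract_left E.ip_ract B.mult_diff_left B.mult_diff_right B.mult_assoc)
  moreover have "B.cfc_rel h (\<lambda>t. (t - ?f t * t) - (t * ?f t - ?f t * (t * ?f t)))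
    ((h \<ominus>\<^bsub>B\<^esub> e \<otimes>\<^bsub>B\<^esub> h) \<ominus>\<^bsub>B\<^esub> (h \<otimes>\<^bsub>B\<^esub> e \<ominus>\<^bsub>B\<^esub> e \<otimes>\<^bsub>B\<^esub> (h \<otimes>\<^bsub>B\<^esub> e)))" by (intro rels)
  ultimately have rel: "B.cfc_rel h (\<lambda>t. (t - ?f t * t) - (t * ?f t - ?f t * (t * ?f t))) (ip E \<eta> \<eta>)" by simp
  show "r (ip E \<eta> \<eta>) \<le> del\<^sup>2"
  proof (rule B.cfc_rel_norm_le[OF h(1,2) rel r])
   fix t assume "t \<in> B.spectrum r h"
   then have t: "t \<ge> 0" by (rule h(3)[OF r])
   let ?m = "max del (sqrt \<bar>t\<bar>)"
   have eq: "(t - ?f t * t) - (t * ?f t - ?f t * (t * ?f t)) = del\<^sup>2 * (t / ?m\<^sup>2)"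
   proof -
    have "(t - (1 - a) * t) - (t * (1 - a) - (1 - a) * (t * (1 - a))) = a\<^sup>2 * t" for a :: real
     by (simp add: algebra_simps power2_eq_square)
    from this[of "del / ?m"] show ?thesis by (simp add: power_divide)
   qed
   have "(sqrt \<bar>t\<bar>)\<^sup>2 \<le> ?m\<^sup>2" by (rule power_mono) simp_all
   then have "t \<le> ?m\<^sup>2" using t by simp
   moreover have "?m\<^sup>2 > 0" using m[of t] by (rule zero_less_power)
   ultimately have "t / ?m\<^sup>2 \<le> 1" "0 \<le> t / ?m\<^sup>2" using t by (simp_all add: pos_divide_le_eq)
   then have "del\<^sup>2 * (t / ?m\<^sup>2) \<le> del\<^sup>2 * 1" "0 \<le> del\<^sup>2 * (t / ?m\<^sup>2)" by (intro mult_left_mono mult_nonneg_nonneg; simp)+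
   then show "\<bar>(t - ?f t * t) - (t * ?f t - ?f t * (t * ?f t))\<bar> \<le> del\<^sup>2" unfolding eq by linarith
  qed simp
 qed (use del in simp)
 moreover have "hm_norm E q (\<eta> \<ominus> \<xi>) = 0"
 proof -
  have "hm_norm E q (ract E \<xi> e) \<le> 0"
  proof (rule hm_norm_leI)
   have "ip E (ract E \<xi> e) (ract E \<xi> e) = e \<otimes>\<^bsub>B\<^esub> (h \<otimes>\<^bsub>B\<^esub> e)"
    unfolding h_def using \<xi> e' by (simp add: ip_ract_left E.ip_ract B.mult_assoc)
   moreover have "B.cfc_rel h (\<lambda>t. ?f t * (t * ?f t)) (e \<otimes>\<^bsub>B\<^esub> (h \<otimes>\<^bsub>B\<^esub> e))" by (intro rels)
   ultimately have rel: "B.cfc_rel h (\<lambda>t. ?f t * (t * ?f t)) (ip E (ract E \<xi> e) (ract E \<xi> e))" by simp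
   have "q (ip E (ract E \<xi> e) (ract E \<xi> e)) \<le> 0"
   proof (rule B.cfc_rel_norm_le[OF h(1,2) rel q])
    interpret q: cstar_seminormed B q using q by (rule B.cont_seminormD)
    fix t assume t: "t \<in> q.spec h"
    have "\<bar>t\<bar> \<le> q h" by (rule q.spec_le_norm[OF h(1) t])
    also have "q h = (hm_norm E q \<xi>)\<^sup>2" using hm_norm_square[OF q \<xi>] by (simp add: h_def)
    also have "... \<le> del\<^sup>2" using del(2) hm_norm_nonneg[OF q \<xi>] by (rule power_mono)
    finally have "sqrt \<bar>t\<bar> \<le> del" using del(1) real_sqrt_le_mono[of "\<bar>t\<bar>" "del\<^sup>2"] by simp
    then have "?f t = 0" using del(1) by (simp add: max_def)
    then show "\<bar>?f t * (t * ?f t)\<bar> \<le> 0" by simp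
   qed simp
   then show "q (ip E (ract E \<xi> e) (ract E \<xi> e)) \<le> 0\<^sup>2" by simp
  qed simp
  moreover have "\<eta> \<ominus> \<xi> = \<ominus> (ract E \<xi> e)"
   unfolding \<eta>_def using \<xi> e' by (simp add: E.M.minus_eq E.M.a_ac E.M.r_neg1 E.M.r_neg2 E.M.r_neg)
  moreover have "hm_norm E q (\<ominus> (ract E \<xi> e)) = hm_norm E q (ract E \<xi> e)"
   using \<xi> e' by (intro seminormed_module.minus[OF hm_norm_seminormed[OF q]]) simp
  moreover have "0 \<le> hm_norm E q (ract E \<xi> e)" using hm_norm_nonneg[OF q] \<xi> e' by simp
  ultimately show ?thesis by simp
 qed
 ultimately show ?thesis using \<eta> by blast
qed

end

locale lc_hilbert = B?: locally_cstar_algebra B + E?: hilbert_module B E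
 for B :: "'b star_algebra" and E :: "('b, 'e) hilbert_module" (structure)

sublocale lc_hilbert \<subseteq> lc_pre_hilbert ..

lemma (in abelian_group) add_diff_cancel_left:
 "[|x \<in> carrier G; y \<in> carrier G|] ==> (x \<oplus> y) \<ominus> x = y" by (simp add: a_comm[of x y] minus_eq a_assoc r_neg)

lemma (in abelian_group) add_diff_diff:
 "[|x \<in> carrier G; y \<in> carrier G|] ==> (x \<oplus> y) \<ominus> (x \<ominus> y) = y \<oplus> y"
 using diff_add_diff[of x y x "\<ominus> y"] by (simp add: minus_eq r_neg)

context lc_hilbert
begin

lemma hm_complete_filter:
 assumes F: "F \<noteq> bot" and carrier: "eventually (\<lambda>i. f i \<in> carrier E) F"
  and cauchy: "!!q eps. q \<in> \<S> B ==> eps > 0 ==>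
   \<exists>Q. eventually Q F \<and> (\<forall>i j. Q i --> Q j --> hm_norm E q (f i \<ominus> f j) < eps)"
 shows "\<exists>x\<in>carrier E. \<forall>q\<in>\<S> B. \<forall>eps>0. eventually (\<lambda>i. hm_norm E q (f i \<ominus> x) < eps) F"
proof -
 have "\<exists>x\<in>carrier E. \<forall>p\<in>hm_norm E ` \<S> B. \<forall>eps>0. eventually (\<lambda>i. p (f i \<ominus> x) < eps) F"
  by (rule seminorm_complete_filter[OF E.complete F carrier]) (use cauchy hm_norm_nonneg in \<open>auto simp del: One_nat_def\<close>)
 then show ?thesis by blast
qed

lemma hm_complete_fast_sequence:
 assumes x: "!!n. x n \<in> carrier E"
  and step: "!!n q. q \<in> \<S> B ==> hm_norm E q (x (Suc n) \<ominus> x n) \<le> 1 / 3 ^ n"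
 shows "\<exists>y\<in>carrier E. \<forall>q\<in>\<S> B. \<forall>n. hm_norm E q (x n \<ominus> y) \<le> 3 / 2 / 3 ^ n"
proof -
 have close: "hm_norm E q (x (n + j) \<ominus> x n) \<le> 3 / 2 / 3 ^ n" if q: "q \<in> \<S> B" for q n j
 proof -
  interpret q: seminormed_module E "hm_norm E q" by (rule hm_norm_seminormed[OF q])
  have "hm_norm E q (x (n + j) \<ominus> x n) \<le> 3 / 2 / 3 ^ n - 3 / 2 / 3 ^ (n + j)"
  proof (induction j)
   case 0
   show ?case using x by simp
  next
   case (Suc j)
   have "hm_norm E q (x (n + Suc j) \<ominus> x n) \<le> hm_norm E q (x (Suc (n + j)) \<ominus> x (n + j)) + hm_norm E q (x (n + j) \<ominus> x n)"
    using q.diff_triangle[of "x (Suc (n + j))" "x (n + j)" "x n"] x by simp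
   also have "... \<le> 1 / 3 ^ (n + j) + (3 / 2 / 3 ^ n - 3 / 2 / 3 ^ (n + j))" by (intro add_mono step q Suc)
   also have "... = 3 / 2 / 3 ^ n - 3 / 2 / 3 ^ (n + Suc j)" by simp
   finally show ?case .
  qed
  also have "... \<le> 3 / 2 / 3 ^ n" by simp
  finally show ?thesis .
 qed
 have "\<exists>y\<in>carrier E. \<forall>q\<in>\<S> B. \<forall>eps>0. eventually (\<lambda>i. hm_norm E q (x i \<ominus> y) < eps) sequentially"
 proof (rule hm_complete_filter)
  fix q and eps :: real assume q: "q \<in> \<S> B" and eps: "eps > 0"
  interpret q: seminormed_module E "hm_norm E q" by (rule hm_norm_seminormed[OF q])
  obtain N where N: "(1 / 3) ^ N < eps / 3" using real_arch_pow_inv[of "eps / 3" "1 / 3"] eps by auto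
  show "\<exists>Q. eventually Q sequentially \<and> (\<forall>i j. Q i --> Q j --> hm_norm E q (x i \<ominus> x j) < eps)"
  proof (intro exI conjI allI impI)
   show "eventually (\<lambda>n. N \<le> n) sequentially" by (rule eventually_ge_at_top)
   fix i j assume ij: "N \<le> i" "N \<le> j"
   have "hm_norm E q (x i \<ominus> x N) \<le> 3 / 2 / 3 ^ N" "hm_norm E q (x j \<ominus> x N) \<le> 3 / 2 / 3 ^ N"
    using close[OF q, of N "i - N"] close[OF q, of N "j - N"] ij by simp_all
   moreover have "hm_norm E q (x i \<ominus> x j) \<le> hm_norm E q (x i \<ominus> x N) + hm_norm E q (x N \<ominus> x j)"
    by (rule q.diff_triangle) (rule x)+
   moreover have "hm_norm E q (x N \<ominus> x j) = hm_norm E q (x j \<ominus> x N)" by (rule q.diff_sym) (rule x)+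
   moreover have "3 / 2 / 3 ^ N < eps / 2" using N by (simp add: power_one_over)
   ultimately show "hm_norm E q (x i \<ominus> x j) < eps" by linarith
  qed
 qed (use x in simp_all)
 then obtain y where y: "y \<in> carrier E" "!!q eps. q \<in> \<S> B ==> eps > 0 ==>
   eventually (\<lambda>i. hm_norm E q (x i \<ominus> y) < eps) sequentially" by blast
 have "hm_norm E q (x n \<ominus> y) \<le> 3 / 2 / 3 ^ n" if q: "q \<in> \<S> B" for q n
 proof (rule field_le_epsilon)
  interpret q: seminormed_module E "hm_norm E q" by (rule hm_norm_seminormed[OF q])
  fix eps :: real assume "eps > 0"
  then obtain N where N: "!!i. i \<ge> N ==> hm_norm E q (x i \<ominus> y) < eps"
   using y(2)[OF q] unfolding eventually_sequentially by blast
  have "hm_norm E q (x n \<ominus> y) \<le> hm_norm E q (x n \<ominus> x (n + N)) + hm_norm E q (x (n + N) \<ominus> y)"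
   by (rule q.diff_triangle) (use x y in simp_all)
  moreover have "hm_norm E q (x n \<ominus> x (n + N)) = hm_norm E q (x (n + N) \<ominus> x n)" by (rule q.diff_sym) (rule x)+
  ultimately show "hm_norm E q (x n \<ominus> y) \<le> 3 / 2 / 3 ^ n + eps" using close[OF q, of n N] N[of "n + N"] by simp
 qed
 then show ?thesis using y(1) by blast
qed

text \<open>
 Adjointable operators are bounded for each seminorm \<open>q\<close>, so that the supremum in
 \<^const>\<open>op_seminorm\<close> is never a default value. Otherwise, by a gliding hump, there is a vector
 $\xi = \sum_n \pm d_n$ for which $\langle T\xi, y_n\rangle = \langle\xi, Sy_n\rangle$ is too large
 compared with $\|y_n\|_q$. Completeness is available only for all seminorms together, which is why the summands
 are truncated first.
\<close>

theorem adjointable_bounded: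
 fixes F :: "('b, 'f) hilbert_module"
 assumes F: "lc_pre_hilbert B F"
  and T: "!!\<xi>. \<xi> \<in> carrier E ==> T \<xi> \<in> carrier F" and S: "!!\<eta>. \<eta> \<in> carrier F ==> S \<eta> \<in> carrier E"
  and adj: "!!\<xi> \<eta>. \<xi> \<in> carrier E ==> \<eta> \<in> carrier F ==> ip F (T \<xi>) \<eta> = ip E \<xi> (S \<eta>)"
  and q: "q \<in> \<S> B"
 shows "\<exists>C\<ge>0. \<forall>\<xi>\<in>carrier E. hm_norm F q (T \<xi>) \<le> C * hm_norm E q \<xi>"
proof (rule ccontr)
 interpret F: lc_pre_hilbert B F by (rule F)
 interpret q: seminormed_module E "hm_norm E q" by (rule hm_norm_seminormed[OF q])
 interpret qB: cstar_seminormed B q by (rule B.cont_seminormD[OF q])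
 assume "\<not> ?thesis"
 then have unbounded: "\<exists>\<xi>\<in>carrier E. C * hm_norm E q \<xi> < hm_norm F q (T \<xi>)" if "C \<ge> 0" for C using that by (meson not_le)
 have "\<exists>\<eta>\<in>carrier F. hm_norm F q \<eta> > 0 \<and> 4 ^ n * hm_norm F q \<eta> \<le> hm_norm E q (S \<eta>)" for n :: nat
 proof -
  obtain \<xi> where \<xi>: "\<xi> \<in> carrier E" "4 ^ n * hm_norm E q \<xi> < hm_norm F q (T \<xi>)" using unbounded[of "4 ^ n"] by auto
  let ?x = "hm_norm E q \<xi>" and ?y = "hm_norm F q (T \<xi>)"
  have x0: "?x \<ge> 0" by (rule hm_norm_nonneg[OF q \<xi>(1)])
  then have y0: "?y > 0" using \<xi>(2) by (smt (verit) mult_nonneg_nonneg zero_le_power)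
  have "?y\<^sup>2 = q (ip E \<xi> (S (T \<xi>)))" using F.hm_norm_square[OF q T[OF \<xi>(1)]] adj \<xi>(1) T by simp
  also have "... \<le> ?x * hm_norm E q (S (T \<xi>))" by (rule Cauchy_Schwarz[OF q \<xi>(1)]) (use S T \<xi> in simp)
  finally have le: "?y * ?y \<le> ?x * hm_norm E q (S (T \<xi>))" by (simp add: power2_eq_square)
  have "?x \<noteq> 0" using le mult_pos_pos[OF y0 y0] by auto
  then have xpos: "?x > 0" using x0 by simp
  have "?x * (4 ^ n * ?y) \<le> ?y * ?y" using \<xi>(2) y0 by (simp add: mult_ac)
  with le have "?x * (4 ^ n * ?y) \<le> ?x * hm_norm E q (S (T \<xi>))" by linarith
  then have "4 ^ n * ?y \<le> hm_norm E q (S (T \<xi>))" using xpos by simp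
  then show ?thesis using y0 T[OF \<xi>(1)] by blast
 qed
 then obtain y where y: "!!n. y n \<in> carrier F" "!!n. hm_norm F q (y n) > 0"
  "!!n::nat. 4 ^ n * hm_norm F q (y n) \<le> hm_norm E q (S (y n))" by metis
 define w where "w n = S (y n)" for n
 have w: "w n \<in> carrier E" for n by (simp add: w_def S y)
 have wpos: "hm_norm E q (w n) > 0" for n
 proof -
  have "0 < 4 ^ n * hm_norm F q (y n)" using y(2) by simp
  with y(3)[of n] show ?thesis unfolding w_def by linarith
 qed
 have "\<exists>d\<in>carrier E. (\<forall>r\<in>\<S> B. hm_norm E r d \<le> 1 / 3 ^ n) \<and>
   hm_norm E q (w n) / 3 ^ n \<le> q (ip E (w n) d)" for n
 proof -
  define c where "c = 1 / (3 ^ n * hm_norm E q (w n))"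
  have c: "c > 0" using wpos[of n] by (simp add: c_def)
  define v where "v = of_real c \<odot> w n"
  have v: "v \<in> carrier E" using w by (simp add: v_def)
  have "hm_norm E q v = c * hm_norm E q (w n)" using q.homogeneous[OF w[of n], of "of_real c"] c by (simp add: v_def)
  also have "... = 1 / 3 ^ n" using wpos[of n] by (simp add: c_def)
  finally have "hm_norm E q v \<le> 1 / 3 ^ n" by simp
  then obtain d where d: "d \<in> carrier E" "\<forall>r\<in>\<S> B. hm_norm E r d \<le> 1 / 3 ^ n"
   "hm_norm E q (d \<ominus> v) = 0" using truncation[OF v q, of "1 / 3 ^ n"] by auto
  have "q (ip E (w n) v) = c * q (ip E (w n) (w n))"
   using E.ip_smult[OF w[of n] w[of n], of "of_real c"] qB.homogeneous[of "ip E (w n) (w n)" "of_real c"] w c by (simp add: v_def)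
  also have "... = c * (hm_norm E q (w n) * hm_norm E q (w n))" using hm_norm_square[OF q w] by (simp add: power2_eq_square)
  also have "... = hm_norm E q (w n) / 3 ^ n" using wpos[of n] by (simp add: c_def)
  finally have eq: "q (ip E (w n) v) = hm_norm E q (w n) / 3 ^ n" .
  have "q (ip E (w n) v) \<le> q (ip E (w n) v \<ominus>\<^bsub>B\<^esub> ip E (w n) d) + q (ip E (w n) d)"
   by (rule qB.le_diff_add) (use w v d in simp_all)
  also have "q (ip E (w n) v \<ominus>\<^bsub>B\<^esub> ip E (w n) d) = q (ip E (w n) (v \<ominus> d))" using w v d by (simp add: ip_diff_right)
  also have "... \<le> hm_norm E q (w n) * hm_norm E q (v \<ominus> d)" by (rule Cauchy_Schwarz[OF q w]) (use v d in simp)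
  also have "hm_norm E q (v \<ominus> d) = 0" using d(3) q.diff_sym[OF v d(1)] by simp
  finally show ?thesis using d(1,2) eq by auto
 qed
 then obtain d where d: "!!n. d n \<in> carrier E" "!!n r. r \<in> \<S> B ==> hm_norm E r (d n) \<le> 1 / 3 ^ n"
  "!!n. hm_norm E q (w n) / 3 ^ n \<le> q (ip E (w n) (d n))" by metis
 \<comment> \<open>One of \<open>x + d\<close>, \<open>x - d\<close> pairs with \<open>w\<close> at least as strongly as \<open>d\<close> does.\<close>
 define next_x where "next_x n x = (if q (ip E (w n) (x \<oplus> d n)) \<ge> q (ip E (w n) (d n)) then x \<oplus> d n else x \<ominus> d n)" for n x
 define x where "x = rec_nat \<zero> next_x"
 have x_Suc: "x (Suc n) = next_x n (x n)" for n by (simp add: x_def)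
 have x: "x n \<in> carrier E" for n
 proof (induction n)
  case (Suc n)
  then show ?case using d(1) by (simp add: x_Suc next_x_def)
 qed (simp add: x_def)
 have step: "hm_norm E r (x (Suc n) \<ominus> x n) \<le> 1 / 3 ^ n" if r: "r \<in> \<S> B" for r n
 proof -
  interpret r: seminormed_module E "hm_norm E r" by (rule hm_norm_seminormed[OF r])
  have "(x n \<oplus> d n) \<ominus> x n = d n" using x d(1) by (intro E.M.add_diff_cancel_left)
  moreover have "(x n \<ominus> d n) \<ominus> x n = \<ominus> d n"
   using E.M.add_diff_cancel_left[of "x n" "\<ominus> d n"] x d(1) by (simp add: E.M.minus_eq)
  ultimately show ?thesis using d(1) d(2)[OF r, of n] by (simp add: x_Suc next_x_def)
 qed
 have large: "hm_norm E q (w n) / 3 ^ n \<le> q (ip E (w n) (x (Suc n)))" for n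
 proof (cases "q (ip E (w n) (x n \<oplus> d n)) \<ge> q (ip E (w n) (d n))")
  case True
  then show ?thesis using d(3)[of n] by (simp add: x_Suc next_x_def)
 next
  case False
  let ?a = "ip E (w n) (x n)" and ?b = "ip E (w n) (d n)"
  have ab: "?a \<in> carrier B" "?b \<in> carrier B" using w x d by simp_all
  have "?b \<oplus>\<^bsub>B\<^esub> ?b = (?a \<oplus>\<^bsub>B\<^esub> ?b) \<ominus>\<^bsub>B\<^esub> (?a \<ominus>\<^bsub>B\<^esub> ?b)" using ab by (simp add: B.M.add_diff_diff)
  then have "q (?b \<oplus>\<^bsub>B\<^esub> ?b) \<le> q (?a \<oplus>\<^bsub>B\<^esub> ?b) + q (?a \<ominus>\<^bsub>B\<^esub> ?b)" using qB.diff_le[of "?a \<oplus>\<^bsub>B\<^esub> ?b" "?a \<ominus>\<^bsub>B\<^esub> ?b"] ab by simp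
  moreover have "?b \<oplus>\<^bsub>B\<^esub> ?b = 2 \<odot>\<^bsub>B\<^esub> ?b" using B.smult_add_left[OF ab(2), of 1 1] ab by simp
  ultimately have "2 * q ?b \<le> q (?a \<oplus>\<^bsub>B\<^esub> ?b) + q (?a \<ominus>\<^bsub>B\<^esub> ?b)" using qB.homogeneous[OF ab(2), of 2] by simp
  then have "q ?b \<le> q (?a \<ominus>\<^bsub>B\<^esub> ?b)" using False w x d(1) by (simp add: E.ip_add)
  then show ?thesis using False d(3)[of n] w x d(1) by (simp add: x_Suc next_x_def ip_diff_right)
 qed
 obtain z where z: "z \<in> carrier E" "!!n. hm_norm E q (x n \<ominus> z) \<le> 3 / 2 / 3 ^ n"
  using hm_complete_fast_sequence[OF x step] q by blast
 have "(4 / 3) ^ n \<le> 2 * hm_norm F q (T z)" for n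
 proof -
  let ?W = "hm_norm E q (w n)"
  have "?W / 3 ^ n \<le> q (ip E (w n) (x (Suc n)))" by (rule large)
  also have "... \<le> q (ip E (w n) (x (Suc n)) \<ominus>\<^bsub>B\<^esub> ip E (w n) z) + q (ip E (w n) z)"
   by (rule qB.le_diff_add) (use w x z in simp_all)
  also have "q (ip E (w n) (x (Suc n)) \<ominus>\<^bsub>B\<^esub> ip E (w n) z) = q (ip E (w n) (x (Suc n) \<ominus> z))"
   using w x z by (simp add: ip_diff_right)
  also have "... \<le> ?W * hm_norm E q (x (Suc n) \<ominus> z)" by (rule Cauchy_Schwarz[OF q w]) (use x z in simp)
  also have "... \<le> ?W * (3 / 2 / 3 ^ Suc n)" using z(2)[of "Suc n"] wpos[of n] by (intro mult_left_mono) simp_all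
  also have "?W * (3 / 2 / 3 ^ Suc n) = ?W / 3 ^ n / 2" by simp
  finally have "?W / 3 ^ n / 2 \<le> q (ip E (w n) z)" by simp
  also have "q (ip E (w n) z) = q (ip F (y n) (T z))"
  proof -
   have "ip E (w n) z = star B (ip E z (S (y n)))" using z(1) w by (simp add: w_def E.ip_star)
   also have "... = star B (ip F (T z) (y n))" using adj z(1) y(1) by simp
   also have "... = ip F (y n) (T z)" using T z(1) y(1) by (simp add: F.E.ip_star)
   finally show ?thesis by simp
  qed
  also have "... \<le> hm_norm F q (y n) * hm_norm F q (T z)" by (rule F.Cauchy_Schwarz[OF q]) (use y T z in simp_all)
  finally have "?W / 3 ^ n / 2 \<le> hm_norm F q (y n) * hm_norm F q (T z)" .
  moreover have "4 ^ n * hm_norm F q (y n) / 3 ^ n / 2 \<le> ?W / 3 ^ n / 2"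
   using y(3)[of n] by (simp add: w_def divide_right_mono)
  ultimately have "hm_norm F q (y n) * ((4 / 3) ^ n / 2) \<le> hm_norm F q (y n) * hm_norm F q (T z)"
   by (simp add: power_divide mult_ac)
  then show ?thesis using y(2)[of n] by simp
 qed
 moreover obtain n :: nat where "2 * hm_norm F q (T z) < (4 / 3) ^ n"
  using real_arch_pow[of "4 / 3" "2 * hm_norm F q (T z)"] by auto
 ultimately show False by (metis not_le)
qed

end

section \<open>Sums over lists\<close>

text \<open>
 Finite linear combinations of vectors $\iota(x)$ are written as sums over lists of indices. Lists
 can be concatenated, so that no equality of indices has to be decided.
\<close>

definition lsum :: "('a, 'm) ring_scheme => ('x => 'a) => 'x list => 'a"
 where "lsum M f l = foldr (\<lambda>x s. f x \<oplus>\<^bsub>M\<^esub> s) l \<zero>\<^bsub>M\<^esub>"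

lemma lsum_Nil [simp]: "lsum M f [] = \<zero>\<^bsub>M\<^esub>" by (simp add: lsum_def)

lemma lsum_Cons [simp]: "lsum M f (x # l) = f x \<oplus>\<^bsub>M\<^esub> lsum M f l" by (simp add: lsum_def)

lemma lsum_map: "lsum M f (map g l) = lsum M (\<lambda>x. f (g x)) l" by (induction l) simp_all

lemma lsum_cong: "(!!x. x \<in> set l ==> f x = g x) ==> lsum M f l = lsum M g l" by (induction l) simp_all

lemma lsum_additive:
 assumes "h \<zero>\<^bsub>M\<^esub> = \<zero>\<^bsub>N\<^esub>" "!!x y. x \<in> C ==> y \<in> C ==> h (x \<oplus>\<^bsub>M\<^esub> y) = h x \<oplus>\<^bsub>N\<^esub> h y"
  and "\<zero>\<^bsub>M\<^esub> \<in> C" "!!x y. x \<in> C ==> y \<in> C ==> x \<oplus>\<^bsub>M\<^esub> y \<in> C" "!!x. x \<in> set l ==> f x \<in> C"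
 shows "h (lsum M f l) = lsum N (\<lambda>x. h (f x)) l"
proof -
 have "lsum M f l \<in> C \<and> h (lsum M f l) = lsum N (\<lambda>x. h (f x)) l" using assms(5) by (induction l) (simp_all add: assms(1-4))
 then show ?thesis by simp
qed

context complex_module
begin

lemma lsum_closed [simp, intro]: "(!!x. x \<in> set l ==> f x \<in> carrier M) ==> lsum M f l \<in> carrier M" by (induction l) simp_all

lemma lsum_append:
 "(!!x. x \<in> set l \<union> set l' ==> f x \<in> carrier M) ==> lsum M f (l @ l') = lsum M f l \<oplus> lsum M f l'"
 by (induction l) (simp_all add: M.a_assoc)

lemma lsum_add:
 "(!!x. x \<in> set l ==> f x \<in> carrier M) ==> (!!x. x \<in> set l ==> g x \<in> carrier M) ==>
  lsum M (\<lambda>x. f x \<oplus> g x) l = lsum M f l \<oplus> lsum M g l" by (induction l) (simp_all add: M.a_ac)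

lemma lsum_zero: "lsum M (\<lambda>x. \<zero>) l = \<zero>" by (induction l) simp_all

lemma lsum_smult:
 "(!!x. x \<in> set l ==> f x \<in> carrier M) ==> lsum M (\<lambda>x. z \<odot> f x) l = z \<odot> lsum M f l"
 by (induction l) (simp_all add: smult_add_right)

lemma lsum_diff:
 "(!!x. x \<in> set l ==> f x \<in> carrier M) ==> (!!x. x \<in> set l ==> g x \<in> carrier M) ==>
  lsum M (\<lambda>x. f x \<ominus> g x) l = lsum M f l \<ominus> lsum M g l"
 by (induction l) (simp_all add: M.diff_add_diff, simp add: M.minus_eq M.r_neg)

lemma lsum_swap:
 assumes "!!x y. x \<in> set l ==> y \<in> set l' ==> f x y \<in> carrier M"
 shows "lsum M (\<lambda>x. lsum M (f x) l') l = lsum M (\<lambda>y. lsum M (\<lambda>x. f x y) l) l'" using assms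
proof (induction l)
 case Nil
 then show ?case by (simp add: lsum_zero)
next
 case (Cons x l)
 have "lsum M (\<lambda>y. lsum M (\<lambda>x. f x y) (x # l)) l' = lsum M (\<lambda>y. f x y \<oplus> lsum M (\<lambda>x. f x y) l) l'" by simp
 also have "... = lsum M (f x) l' \<oplus> lsum M (\<lambda>y. lsum M (\<lambda>x. f x y) l) l'" by (rule lsum_add) (use Cons.prems in auto)
 finally show ?case using Cons by simp
qed

end

text \<open>
 Approximations to a vector, with a bound for one seminorm at a time, form the base of a filter,
 because two seminorms have a common majorant. Limits in Hilbert modules are taken along it.
\<close>

lemma (in locally_cstar_algebra) near_filter:
 assumes ne: "!!q eps. [|q \<in> \<S> A; eps > 0|] ==> near q eps \<noteq> {}"
  and mono: "!!q r eps del. [|!!a. a \<in> carrier A ==> q a \<le> r a; del \<le> eps|] ==> near r del \<subseteq> near q (eps::real)"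
 obtains F where "F \<noteq> bot" "!!q eps. [|q \<in> \<S> A; eps > 0|] ==> eventually (\<lambda>x. x \<in> near q eps) F"
proof -
 define I where "I = \<S> A \<times> {eps::real. eps > 0}"
 define F where "F = (INF i\<in>I. principal (near (fst i) (snd i)))"
 obtain q0 where "q0 \<in> \<S> A" using cont_seminorms_nonempty by blast
 then have "(q0, 1) \<in> I" by (simp add: I_def)
 then have I: "I \<noteq> {}" by blast
 have base: "\<exists>k\<in>I. principal (near (fst k) (snd k)) \<le> inf (principal (near (fst i) (snd i))) (principal (near (fst j) (snd j)))"
  if ij: "i \<in> I" "j \<in> I" for i j
 proof (rule bexI)
  let ?k = "(\<lambda>a. max (fst i a) (fst j a), min (snd i) (snd j))"
  show "?k \<in> I" using ij by (auto simp: I_def max_cont_seminorms)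
  have "near (fst ?k) (snd ?k) \<subseteq> near (fst i) (snd i)" "near (fst ?k) (snd ?k) \<subseteq> near (fst j) (snd j)" by (rule mono; simp)+
  then show "principal (near (fst ?k) (snd ?k)) \<le> inf (principal (near (fst i) (snd i))) (principal (near (fst j) (snd j)))"
   by simp
 qed
 have ev: "eventually P F \<longleftrightarrow> (\<exists>i\<in>I. \<forall>x\<in>near (fst i) (snd i). P x)" for P
  unfolding F_def by (subst eventually_INF_base[OF I base]) (simp_all add: eventually_principal)
 show thesis
 proof (rule that)
  have "near (fst i) (snd i) \<noteq> {}" if "i \<in> I" for i by (rule ne) (use that in \<open>auto simp: I_def\<close>)
  then show "F \<noteq> bot" unfolding trivial_limit_def ev by blast
  show "eventually (\<lambda>x. x \<in> near q eps) F" if "q \<in> \<S> A" "eps > 0" for q eps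
   unfolding ev using that by (intro bexI[of _ "(q, eps)"]) (simp_all add: I_def)
 qed
qed

section \<open>Hilbert modules with a reproducing kernel\<close>

text \<open>
 Every \<open>B\<close>-valued positive definite kernel on a set \<open>\<Omega>\<close> is of the form
 $\kappa(x,y) = \langle\iota(x),\iota(y)\rangle$. The completion of the span of the $\iota(x)$ is realised
 by functions on \<open>\<Omega>\<close>: a vector \<open>f\<close> becomes $x \mapsto \langle\iota(x), f\rangle$. No quotient is needed,
 and the elements have type \<open>'x => 'b\<close>. The operations \<open>scale\<close> and \<open>act\<close> on \<open>\<Omega>\<close> stand for the
 scalar multiples and the right action on the $\iota(x)$.
\<close>

locale positive_definite_kernel = B?: locally_cstar_algebra B for B :: "'b star_algebra" (structure) +
 fixes \<Omega> :: "'x set" and \<kappa> :: "'x => 'x => 'b"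
  and scale :: "complex => 'x => 'x" and act :: "'x => 'b => 'x"
 assumes kernel_closed [simp, intro]: "[|x \<in> \<Omega>; y \<in> \<Omega>|] ==> \<kappa> x y \<in> carrier B"
  and scale_closed [simp, intro]: "x \<in> \<Omega> ==> scale z x \<in> \<Omega>"
  and act_closed [simp, intro]: "[|x \<in> \<Omega>; b \<in> carrier B|] ==> act x b \<in> \<Omega>"
  and kernel_star: "[|x \<in> \<Omega>; y \<in> \<Omega>|] ==> star B (\<kappa> x y) = \<kappa> y x"
  and kernel_scale: "[|x \<in> \<Omega>; y \<in> \<Omega>|] ==> \<kappa> x (scale z y) = z \<odot> \<kappa> x y"
  and kernel_act: "[|x \<in> \<Omega>; y \<in> \<Omega>; b \<in> carrier B|] ==> \<kappa> x (act y b) = \<kappa> x y \<otimes> b"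
  and kernel_positive: "set l \<subseteq> \<Omega> ==> positive B (lsum B (\<lambda>x. lsum B (\<kappa> x) l) l)"
begin

abbreviation funs :: "('x => 'b) set"
 where "funs \<equiv> \<Omega> \<rightarrow>\<^sub>E (carrier B)"

definition gram :: "'x list => 'x list => 'b"
 where "gram l l' = lsum B (\<lambda>x. lsum B (\<kappa> x) l') l"

lemma gram_closed [simp, intro]: "[|set l \<subseteq> \<Omega>; set l' \<subseteq> \<Omega>|] ==> gram l l' \<in> carrier B"
 unfolding gram_def by (intro lsum_closed) auto

lemma gram_star:
 assumes "set l \<subseteq> \<Omega>" "set l' \<subseteq> \<Omega>"
 shows "star B (gram l l') = gram l' l"
proof -
 have "star B (gram l l') = lsum B (\<lambda>x. star B (lsum B (\<kappa> x) l')) l"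
  unfolding gram_def by (rule lsum_additive[where C = "carrier B"]) (use assms in \<open>auto simp: star_add\<close>)
 also have "... = lsum B (\<lambda>x. lsum B (\<lambda>y. \<kappa> y x) l') l"
 proof (rule lsum_cong)
  fix x assume x: "x \<in> set l"
  have "star B (lsum B (\<kappa> x) l') = lsum B (\<lambda>y. star B (\<kappa> x y)) l'"
   by (rule lsum_additive[where C = "carrier B"]) (use assms x in \<open>auto simp: star_add\<close>)
  also have "... = lsum B (\<lambda>y. \<kappa> y x) l'" by (rule lsum_cong) (use assms x kernel_star in auto)
  finally show "star B (lsum B (\<kappa> x) l') = lsum B (\<lambda>y. \<kappa> y x) l'" .
 qed
 also have "... = gram l' l" unfolding gram_def by (rule lsum_swap) (use assms in auto)
 finally show ?thesis .
qed

lemma gram_append_right: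
 assumes "set l \<subseteq> \<Omega>" "set l1 \<subseteq> \<Omega>" "set l2 \<subseteq> \<Omega>"
 shows "gram l (l1 @ l2) = gram l l1 \<oplus> gram l l2"
proof -
 have "gram l (l1 @ l2) = lsum B (\<lambda>x. lsum B (\<kappa> x) l1 \<oplus> lsum B (\<kappa> x) l2) l"
  unfolding gram_def by (intro lsum_cong lsum_append) (use assms in auto)
 also have "... = gram l l1 \<oplus> gram l l2"
  unfolding gram_def by (rule lsum_add; rule lsum_closed; rule kernel_closed) (use assms in auto)
 finally show ?thesis .
qed

lemma gram_scale_right:
 assumes "set l \<subseteq> \<Omega>" "set l' \<subseteq> \<Omega>"
 shows "gram l (map (scale z) l') = z \<odot> gram l l'"
proof -
 have "gram l (map (scale z) l') = lsum B (\<lambda>x. z \<odot> lsum B (\<kappa> x) l') l" unfolding gram_def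
 proof (rule lsum_cong)
  fix x assume x: "x \<in> set l"
  have "lsum B (\<kappa> x) (map (scale z) l') = lsum B (\<lambda>y. z \<odot> \<kappa> x y) l'"
   unfolding lsum_map by (rule lsum_cong, rule kernel_scale) (use assms x in auto)
  also have "... = z \<odot> lsum B (\<kappa> x) l'" by (rule lsum_smult) (use assms x in auto)
  finally show "lsum B (\<kappa> x) (map (scale z) l') = z \<odot> lsum B (\<kappa> x) l'" .
 qed
 also have "... = z \<odot> gram l l'" unfolding gram_def by (rule lsum_smult) (use assms in auto)
 finally show ?thesis .
qed

lemma lsum_mult_right:
 assumes "!!x. x \<in> set l ==> f x \<in> carrier B" "b \<in> carrier B"
 shows "lsum B (\<lambda>x. f x \<otimes> b) l = lsum B f l \<otimes> b" by (rule lsum_additive[where C = "carrier B" and h = "\<lambda>x. x \<otimes> b", symmetric])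
  (use assms in \<open>auto simp: mult_distr_left\<close>)

lemma gram_act_right:
 assumes "set l \<subseteq> \<Omega>" "set l' \<subseteq> \<Omega>" "b \<in> carrier B"
 shows "gram l (map (\<lambda>x. act x b) l') = gram l l' \<otimes> b"
proof -
 have "gram l (map (\<lambda>x. act x b) l') = lsum B (\<lambda>x. lsum B (\<kappa> x) l' \<otimes> b) l" unfolding gram_def
 proof (rule lsum_cong)
  fix x assume x: "x \<in> set l"
  have "lsum B (\<kappa> x) (map (\<lambda>x. act x b) l') = lsum B (\<lambda>y. \<kappa> x y \<otimes> b) l'"
   unfolding lsum_map by (rule lsum_cong, rule kernel_act) (use assms x in auto)
  also have "... = lsum B (\<kappa> x) l' \<otimes> b" by (rule lsum_mult_right) (use assms x in auto)
  finally show "lsum B (\<kappa> x) (map (\<lambda>x. act x b) l') = lsum B (\<kappa> x) l' \<otimes> b" .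
 qed
 also have "... = gram l l' \<otimes> b" unfolding gram_def by (rule lsum_mult_right) (use assms in auto)
 finally show ?thesis .
qed

lemma gram_append_left:
 assumes "set l \<subseteq> \<Omega>" "set l1 \<subseteq> \<Omega>" "set l2 \<subseteq> \<Omega>"
 shows "gram (l1 @ l2) l = gram l1 l \<oplus> gram l2 l"
proof -
 have "gram (l1 @ l2) l = star B (gram l (l1 @ l2))" using assms by (simp add: gram_star)
 also have "... = gram l1 l \<oplus> gram l2 l" using assms by (simp add: gram_append_right star_add gram_star)
 finally show ?thesis .
qed

lemma gram_scale_left:
 assumes "set l \<subseteq> \<Omega>" "set l' \<subseteq> \<Omega>"
 shows "gram (map (scale z) l') l = cnj z \<odot> gram l' l"
proof -
 have "gram (map (scale z) l') l = star B (gram l (map (scale z) l'))" using assms by (intro gram_star[symmetric]) auto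
 also have "... = cnj z \<odot> gram l' l" using assms by (simp add: gram_scale_right star_smult gram_star)
 finally show ?thesis .
qed

lemma gram_act_left:
 assumes "set l \<subseteq> \<Omega>" "set l' \<subseteq> \<Omega>" "b \<in> carrier B"
 shows "gram (map (\<lambda>x. act x b) l') l = star B b \<otimes> gram l' l"
proof -
 have "gram (map (\<lambda>x. act x b) l') l = star B (gram l (map (\<lambda>x. act x b) l'))"
  using assms by (intro gram_star[symmetric]) auto
 also have "... = star B b \<otimes> gram l' l" using assms by (simp add: gram_act_right star_mult gram_star)
 finally show ?thesis .
qed

definition gram_norm :: "('b => real) => 'x list => real"
 where "gram_norm q l = sqrt (q (gram l l))"

lemma gram_norm_nonneg:
 assumes "q \<in> \<S> B" "set l \<subseteq> \<Omega>"
 shows "0 \<le> gram_norm q l"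
 unfolding gram_norm_def using seminormed_module.nonneg[OF cont_seminorm_seminormed[OF assms(1)]] assms(2) by simp

lemma gram_norm_square:
 assumes "q \<in> \<S> B" "set l \<subseteq> \<Omega>"
 shows "(gram_norm q l)\<^sup>2 = q (gram l l)"
 unfolding gram_norm_def using seminormed_module.nonneg[OF cont_seminorm_seminormed[OF assms(1)]] assms(2) by simp

lemma gram_Cauchy_Schwarz:
 assumes q: "q \<in> \<S> B" and l: "set l \<subseteq> \<Omega>" "set l' \<subseteq> \<Omega>"
 shows "q (gram l l') \<le> gram_norm q l * gram_norm q l'"
proof -
 let ?c = "gram l l'" and ?h = "gram l l" and ?k = "gram l' l'"
 have "(q ?c)\<^sup>2 \<le> q ?h * q ?k"
 proof (rule Cauchy_Schwarz_algebraic[OF _ _ _ _ q])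
  fix s :: real
  have c: "?c \<in> carrier B" "gram l' l = star B ?c" using l by (simp_all add: gram_star)
  define m where "m = map (\<lambda>x. act x ?c) l @ map (scale (- of_real s)) l'"
  have m: "set (map (\<lambda>x. act x ?c) l) \<subseteq> \<Omega>" "set (map (scale (- of_real s)) l') \<subseteq> \<Omega>" using l c by auto
  have "gram m m = ((star B ?c \<otimes> (?h \<otimes> ?c) \<ominus> of_real s \<odot> (star B ?c \<otimes> ?c)) \<ominus>
    (of_real s \<odot> (star B ?c \<otimes> ?c) \<ominus> of_real (s\<^sup>2) \<odot> ?k))"
  proof -
   have "gram m m = (star B ?c \<otimes> (?h \<otimes> ?c) \<oplus> (- of_real s) \<odot> (star B ?c \<otimes> ?c)) \<oplus>
     ((- of_real s) \<odot> (star B ?c \<otimes> ?c) \<oplus> of_real (s\<^sup>2) \<odot> ?k)" unfolding m_def using m l c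
    by (simp add: gram_append_left gram_append_right gram_scale_left gram_scale_right gram_act_left
      gram_act_right smult_mult_left smult_mult_right smult_smult smult_add_right mult_distr_left
      power2_eq_square mult_assoc B.M.a_ac)
   then show ?thesis using l c by (simp add: smult_minus_left B.M.minus_eq B.M.minus_add)
  qed
  moreover have "positive B (gram m m)" unfolding gram_def by (rule kernel_positive) (use m in \<open>auto simp: m_def\<close>)
  ultimately show "positive B ((star B ?c \<otimes> (?h \<otimes> ?c) \<ominus> of_real s \<odot> (star B ?c \<otimes> ?c)) \<ominus>
    (of_real s \<odot> (star B ?c \<otimes> ?c) \<ominus> of_real (s\<^sup>2) \<odot> ?k))" by simp
 qed (use l in simp_all)
 then have "(q ?c)\<^sup>2 \<le> (gram_norm q l * gram_norm q l')\<^sup>2" using q l by (simp add: power_mult_distrib gram_norm_square)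
 then show ?thesis by (rule power2_le_imp_le) (simp add: gram_norm_nonneg[OF q] l)
qed

definition kernel_fun :: "'x list => 'x => 'b"
 where "kernel_fun l = (\<lambda>x\<in>\<Omega>. lsum B (\<kappa> x) l)"

definition fun_diff :: "('x => 'b) => ('x => 'b) => 'x => 'b"
 where "fun_diff f g = (\<lambda>x\<in>\<Omega>. f x \<ominus> g x)"

text \<open>
 \<open>f\<close> acts on a combination $\sum\iota(x)$ as the functional $\sum f(x)$, and \<open>C\<close> bounds its norm. All
 seminorms below \<open>q\<close> are included to make the bound monotone in \<open>q\<close>.
\<close>

definition bounded_by :: "('x => 'b) => ('b => real) => real => bool"
 where "bounded_by f q C \<longleftrightarrow> (\<forall>r\<in>\<S> B. (\<forall>b\<in>carrier B. r b \<le> q b) -->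
  (\<forall>l. set l \<subseteq> \<Omega> --> r (lsum B f l) \<le> C * gram_norm r l))"

abbreviation approx :: "('x => 'b) => 'x list => ('b => real) => real => bool"
 where "approx f l \<equiv> bounded_by (fun_diff f (kernel_fun l) )"

lemma bounded_byI:
 assumes "!!r l. [|r \<in> \<S> B; !!b. b \<in> carrier B ==> r b \<le> q b; set l \<subseteq> \<Omega>|] ==>
  r (lsum B f l) \<le> C * gram_norm r l"
 shows "bounded_by f q C" using assms unfolding bounded_by_def by blast

lemma bounded_byD:
 "[|bounded_by f q C; r \<in> \<S> B; !!b. b \<in> carrier B ==> r b \<le> q b; set l \<subseteq> \<Omega>|] ==>
  r (lsum B f l) \<le> C * gram_norm r l" unfolding bounded_by_def by blast

lemma bounded_byD_self:
 "[|bounded_by f q C; q \<in> \<S> B; set l \<subseteq> \<Omega>|] ==> q (lsum B f l) \<le> C * gram_norm q l" using bounded_byD[of f q C q l] by simp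

lemma bounded_by_seminorm_mono:
 "[|bounded_by f q C; !!b. b \<in> carrier B ==> p b \<le> q b|] ==> bounded_by f p C" unfolding bounded_by_def by (meson order_trans)

lemma gram_norm_mono:
 "[|!!b. b \<in> carrier B ==> r b \<le> q b; set l \<subseteq> \<Omega>|] ==> gram_norm r l \<le> gram_norm q l" by (simp add: gram_norm_def)

definition RKH :: "('x => 'b) set"
 where "RKH = {f \<in> \<Omega> \<rightarrow>\<^sub>E carrier B. \<forall>q\<in>\<S> B. \<forall>eps>0.
  \<exists>l. set l \<subseteq> \<Omega> \<and> approx f l q eps}"

lemma kernel_fun_in: "set l \<subseteq> \<Omega> ==> kernel_fun l \<in> funs" unfolding kernel_fun_def by auto

lemma lsum_kernel_fun: "set l' \<subseteq> \<Omega> ==> lsum B (kernel_fun l) l' = gram l' l"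
 unfolding gram_def by (rule lsum_cong) (auto simp: kernel_fun_def)

lemma lsum_fun_diff:
 assumes "f \<in> funs" "g \<in> funs" "set l \<subseteq> \<Omega>"
 shows "lsum B (fun_diff f g) l = lsum B f l \<ominus> lsum B g l"
proof -
 have "lsum B (fun_diff f g) l = lsum B (\<lambda>x. f x \<ominus> g x) l" by (rule lsum_cong) (use assms in \<open>auto simp: fun_diff_def\<close>)
 also have "... = lsum B f l \<ominus> lsum B g l" by (rule lsum_diff) (use assms in auto)
 finally show ?thesis .
qed

lemma fun_diff_in:
 "[|f \<in> funs; g \<in> funs|] ==> fun_diff f g \<in> funs" unfolding fun_diff_def by (auto simp: PiE_iff)

lemma lsum_in: "[|f \<in> funs; set l \<subseteq> \<Omega>|] ==> lsum B f l \<in> carrier B" by (rule lsum_closed) auto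

lemma bounded_by_kernel_fun:
 assumes "set l \<subseteq> \<Omega>"
 shows "bounded_by (kernel_fun l) q (gram_norm q l)"
proof (rule bounded_byI)
 fix r l' assume r: "r \<in> \<S> B" and rq: "!!b. b \<in> carrier B ==> r b \<le> q b" and l': "set l' \<subseteq> \<Omega>"
 have "r (lsum B (kernel_fun l) l') \<le> gram_norm r l * gram_norm r l'"
  using gram_Cauchy_Schwarz[OF r l' assms] by (simp add: lsum_kernel_fun[OF l'] mult.commute)
 also have "... \<le> gram_norm q l * gram_norm r l'"
  using gram_norm_mono[OF rq assms] gram_norm_nonneg[OF r l'] by (rule mult_right_mono)
 finally show "r (lsum B (kernel_fun l) l') \<le> gram_norm q l * gram_norm r l'" .
qed

lemma gram_norm_le_if_bounded_by:
 assumes q: "q \<in> \<S> B" and l: "set l \<subseteq> \<Omega>" and b: "bounded_by (kernel_fun l) q C" and C: "0 \<le> C"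
 shows "gram_norm q l \<le> C"
proof (cases "gram_norm q l = 0")
 case False
 with gram_norm_nonneg[OF q l] have pos: "gram_norm q l > 0" by simp
 have "gram_norm q l * gram_norm q l = q (gram l l)" using gram_norm_square[OF q l] by (simp add: power2_eq_square)
 also have "... \<le> C * gram_norm q l" using bounded_byD_self[OF b q l] by (simp add: lsum_kernel_fun[OF l])
 finally show ?thesis using pos by simp
qed (use C in simp)

lemma bounded_by_diff_trans:
 assumes q: "q \<in> \<S> B"
  and f: "f \<in> funs" and g: "g \<in> funs" and h: "h \<in> funs"
  and b: "bounded_by (fun_diff f g) q C" "bounded_by (fun_diff g h) q D"
 shows "bounded_by (fun_diff f h) q (C + D)"
proof (rule bounded_byI)
 fix r l assume r: "r \<in> \<S> B" and rq: "!!b. b \<in> carrier B ==> r b \<le> q b" and l: "set l \<subseteq> \<Omega>"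
 interpret r: seminormed_module B r by (rule cont_seminorm_seminormed[OF r])
 have "r (lsum B f l \<ominus> lsum B h l) \<le> r (lsum B f l \<ominus> lsum B g l) + r (lsum B g l \<ominus> lsum B h l)"
  by (intro r.diff_triangle lsum_in f g h l)
 also have "... \<le> C * gram_norm r l + D * gram_norm r l"
  using bounded_byD[OF b(1) r rq l] bounded_byD[OF b(2) r rq l] unfolding lsum_fun_diff[OF f g l] lsum_fun_diff[OF g h l] by (rule add_mono)
 finally show "r (lsum B (fun_diff f h) l) \<le> (C + D) * gram_norm r l" by (simp add: lsum_fun_diff[OF f h l] distrib_right)
qed

lemma bounded_by_diff_sym:
 assumes q: "q \<in> \<S> B" and f: "f \<in> funs" and g: "g \<in> funs"
  and b: "bounded_by (fun_diff f g) q C"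
 shows "bounded_by (fun_diff g f) q C"
proof (rule bounded_byI)
 fix r l assume r: "r \<in> \<S> B" and rq: "!!b. b \<in> carrier B ==> r b \<le> q b" and l: "set l \<subseteq> \<Omega>"
 interpret r: seminormed_module B r by (rule cont_seminorm_seminormed[OF r])
 show "r (lsum B (fun_diff g f) l) \<le> C * gram_norm r l"
  using bounded_byD[OF b r rq l] r.diff_sym[OF lsum_in[OF f l] lsum_in[OF g l]]
  by (simp add: lsum_fun_diff[OF f g l] lsum_fun_diff[OF g f l])
qed

lemma bounded_by_of_diff:
 assumes q: "q \<in> \<S> B" and f: "f \<in> funs" and g: "g \<in> funs"
  and b: "bounded_by (fun_diff f g) q C" "bounded_by g q D"
 shows "bounded_by f q (C + D)"
proof (rule bounded_byI)
 fix r l assume r: "r \<in> \<S> B" and rq: "!!b. b \<in> carrier B ==> r b \<le> q b" and l: "set l \<subseteq> \<Omega>"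
 interpret r: seminormed_module B r by (rule cont_seminorm_seminormed[OF r])
 have "r (lsum B f l) \<le> r (lsum B f l \<ominus> lsum B g l) + r (lsum B g l)" by (intro r.le_diff_add lsum_in f g l)
 also have "... \<le> C * gram_norm r l + D * gram_norm r l"
  using bounded_byD[OF b(1) r rq l] bounded_byD[OF b(2) r rq l] unfolding lsum_fun_diff[OF f g l] by (rule add_mono)
 finally show "r (lsum B f l) \<le> (C + D) * gram_norm r l" by (simp add: distrib_right)
qed

lemma RKHD: "f \<in> RKH ==> f \<in> funs" by (simp add: RKH_def)

lemma rkhm_approx:
 assumes "f \<in> RKH" "q \<in> \<S> B" "eps > 0"
 obtains l where "set l \<subseteq> \<Omega>" "approx f l q eps" using assms unfolding RKH_def by blast

lemma rkhm_bounded: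
 assumes f: "f \<in> RKH" and q: "q \<in> \<S> B"
 obtains C where "C \<ge> 0" "bounded_by f q C"
proof -
 obtain l where l: "set l \<subseteq> \<Omega>" "approx f l q 1" using rkhm_approx[OF f q, of 1] by auto
 have "bounded_by f q (1 + gram_norm q l)"
  by (rule bounded_by_of_diff[OF q RKHD[OF f] kernel_fun_in[OF l(1)] l(2) bounded_by_kernel_fun[OF l(1)]])
 then show thesis using gram_norm_nonneg[OF q l(1)] by (intro that[of "1 + gram_norm q l"]) simp_all
qed

lemma gram_norm_approx_le:
 assumes q: "q \<in> \<S> B" and f: "f \<in> funs" and l: "set l \<subseteq> \<Omega>"
  and b: "approx f l q eps" "bounded_by f q C" and nn: "0 \<le> eps" "0 \<le> C"
 shows "gram_norm q l \<le> eps + C" by (rule gram_norm_le_if_bounded_by[OF q l bounded_by_of_diff[OF q kernel_fun_in[OF l] f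
    bounded_by_diff_sym[OF q f kernel_fun_in[OF l] b(1)] b(2)]]) (use nn in simp)

lemma kernel_fun_in_rkhm: "set l \<subseteq> \<Omega> ==> kernel_fun l \<in> RKH" unfolding RKH_def
proof (intro CollectI conjI ballI allI impI)
 assume l: "set l \<subseteq> \<Omega>"
 then show k: "kernel_fun l \<in> funs" by (rule kernel_fun_in)
 fix q eps assume q: "q \<in> \<S> B" and eps: "(eps::real) > 0"
 have "approx (kernel_fun l) l q eps"
 proof (rule bounded_byI)
  fix r m assume r: "r \<in> \<S> B" and m: "set m \<subseteq> \<Omega>"
  interpret r: seminormed_module B r by (rule cont_seminorm_seminormed[OF r])
  show "r (lsum B (fun_diff (kernel_fun l) (kernel_fun l)) m) \<le> eps * gram_norm r m"
   using eps gram_norm_nonneg[OF r m] lsum_in[OF k m] by (simp add: lsum_fun_diff[OF k k m])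
 qed
 with l show "\<exists>l'. set l' \<subseteq> \<Omega> \<and> approx (kernel_fun l) l' q eps" by blast
qed

lemma kernel_fun_eq_gram: "[|x \<in> \<Omega>; set l \<subseteq> \<Omega>|] ==> kernel_fun l x = gram [x] l"
proof -
 assume x: "x \<in> \<Omega>" and l: "set l \<subseteq> \<Omega>"
 then have "lsum B (\<kappa> x) l \<in> carrier B" by (intro lsum_closed kernel_closed) auto
 then show ?thesis using x by (simp add: kernel_fun_def gram_def)
qed

lemma kernel_fun_append:
 assumes "set l1 \<subseteq> \<Omega>" "set l2 \<subseteq> \<Omega>" "x \<in> \<Omega>"
 shows "kernel_fun (l1 @ l2) x = kernel_fun l1 x \<oplus> kernel_fun l2 x"
 using gram_append_right[of "[x]" l1 l2] assms by (subst (1 2 3) kernel_fun_eq_gram) auto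

lemma kernel_fun_scale:
 assumes "set l \<subseteq> \<Omega>" "x \<in> \<Omega>"
 shows "kernel_fun (map (scale z) l) x = z \<odot> kernel_fun l x"
 using gram_scale_right[of "[x]" l z] assms by (subst (1 2) kernel_fun_eq_gram) auto

lemma kernel_fun_act:
 assumes "set l \<subseteq> \<Omega>" "x \<in> \<Omega>" "b \<in> carrier B"
 shows "kernel_fun (map (\<lambda>x. act x b) l) x = kernel_fun l x \<otimes> b"
 using gram_act_right[of "[x]" l b] assms by (subst (1 2) kernel_fun_eq_gram) auto

definition fun_add :: "('x => 'b) => ('x => 'b) => 'x => 'b"
 where "fun_add f g = (\<lambda>x\<in>\<Omega>. f x \<oplus> g x)"

definition fun_smult :: "complex => ('x => 'b) => 'x => 'b"
 where "fun_smult z f = (\<lambda>x\<in>\<Omega>. z \<odot> f x)"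

definition fun_ract :: "('x => 'b) => 'b => 'x => 'b"
 where "fun_ract f b = (\<lambda>x\<in>\<Omega>. f x \<otimes> b)"

lemma lsum_fun_add:
 assumes "f \<in> funs" "g \<in> funs" "set l \<subseteq> \<Omega>"
 shows "lsum B (fun_add f g) l = lsum B f l \<oplus> lsum B g l"
proof -
 have "lsum B (fun_add f g) l = lsum B (\<lambda>x. f x \<oplus> g x) l" by (rule lsum_cong) (use assms in \<open>auto simp: fun_add_def\<close>)
 also have "... = lsum B f l \<oplus> lsum B g l" by (rule lsum_add) (use assms in auto)
 finally show ?thesis .
qed

lemma lsum_fun_smult:
 assumes "f \<in> funs" "set l \<subseteq> \<Omega>"
 shows "lsum B (fun_smult z f) l = z \<odot> lsum B f l"
proof -
 have "lsum B (fun_smult z f) l = lsum B (\<lambda>x. z \<odot> f x) l" by (rule lsum_cong) (use assms in \<open>auto simp: fun_smult_def\<close>)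
 also have "... = z \<odot> lsum B f l" by (rule lsum_smult) (use assms in auto)
 finally show ?thesis .
qed

lemma lsum_fun_ract:
 assumes "f \<in> funs" "set l \<subseteq> \<Omega>" "b \<in> carrier B"
 shows "lsum B (fun_ract f b) l = lsum B f l \<otimes> b"
proof -
 have "lsum B (fun_ract f b) l = lsum B (\<lambda>x. f x \<otimes> b) l" by (rule lsum_cong) (use assms in \<open>auto simp: fun_ract_def\<close>)
 also have "... = lsum B f l \<otimes> b" by (rule lsum_mult_right) (use assms in auto)
 finally show ?thesis .
qed

lemma fun_ops_in:
 "[|f \<in> funs; g \<in> funs|] ==> fun_add f g \<in> funs"
 "f \<in> funs ==> fun_smult z f \<in> funs"
 "[|f \<in> funs; b \<in> carrier B|] ==> fun_ract f b \<in> funs"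
 unfolding fun_add_def fun_smult_def fun_ract_def by (auto simp: PiE_iff)

lemma bounded_by_fun_add:
 assumes q: "q \<in> \<S> B" and f: "f \<in> funs" and g: "g \<in> funs"
  and b: "bounded_by f q C" "bounded_by g q D"
 shows "bounded_by (fun_add f g) q (C + D)"
proof (rule bounded_byI)
 fix r l assume r: "r \<in> \<S> B" and rq: "!!b. b \<in> carrier B ==> r b \<le> q b" and l: "set l \<subseteq> \<Omega>"
 interpret r: seminormed_module B r by (rule cont_seminorm_seminormed[OF r])
 have "r (lsum B f l \<oplus> lsum B g l) \<le> r (lsum B f l) + r (lsum B g l)" by (intro r.triangle lsum_in f g l)
 also have "... \<le> C * gram_norm r l + D * gram_norm r l"
  using bounded_byD[OF b(1) r rq l] bounded_byD[OF b(2) r rq l] by (rule add_mono)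
 finally show "r (lsum B (fun_add f g) l) \<le> (C + D) * gram_norm r l" by (simp add: lsum_fun_add[OF f g l] distrib_right)
qed

lemma bounded_by_fun_smult:
 assumes q: "q \<in> \<S> B" and f: "f \<in> funs" and b: "bounded_by f q C"
 shows "bounded_by (fun_smult z f) q (cmod z * C)"
proof (rule bounded_byI)
 fix r l assume r: "r \<in> \<S> B" and rq: "!!b. b \<in> carrier B ==> r b \<le> q b" and l: "set l \<subseteq> \<Omega>"
 interpret r: seminormed_module B r by (rule cont_seminorm_seminormed[OF r])
 have "r (lsum B f l) \<le> C * gram_norm r l" by (rule bounded_byD[OF b r rq l])
 then show "r (lsum B (fun_smult z f) l) \<le> cmod z * C * gram_norm r l" using r.homogeneous[OF lsum_in[OF f l], of z]
  by (simp add: lsum_fun_smult[OF f l] mult_left_mono mult.assoc)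
qed

lemma bounded_by_fun_ract:
 assumes q: "q \<in> \<S> B" and f: "f \<in> funs" and c: "c \<in> carrier B"
  and b: "bounded_by f q C" and C: "0 \<le> C"
 shows "bounded_by (fun_ract f c) q (q c * C)"
proof (rule bounded_byI)
 fix r l assume r: "r \<in> \<S> B" and rq: "!!b. b \<in> carrier B ==> r b \<le> q b" and l: "set l \<subseteq> \<Omega>"
 interpret r: cstar_seminormed B r by (rule cont_seminormD[OF r])
 have "r (lsum B (fun_ract f c) l) \<le> r (lsum B f l) * r c"
  using r.submultiplicative[OF lsum_in[OF f l] c] by (simp add: lsum_fun_ract[OF f l c])
 also have "... \<le> (C * gram_norm r l) * q c"
  by (intro mult_mono bounded_byD[OF b r rq l] rq c mult_nonneg_nonneg C gram_norm_nonneg[OF r l] r.nonneg)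
 finally show "r (lsum B (fun_ract f c) l) \<le> q c * C * gram_norm r l" by (simp add: mult_ac)
qed

lemma fun_ops_diff:
 assumes f: "f \<in> funs" and g: "g \<in> funs"
  and f': "f' \<in> funs" and g': "g' \<in> funs"
 shows "fun_diff (fun_add f g) (fun_add f' g') = fun_add (fun_diff f f') (fun_diff g g')"
  "fun_diff (fun_smult z f) (fun_smult z f') = fun_smult z (fun_diff f f')"
  "b \<in> carrier B ==> fun_diff (fun_ract f b) (fun_ract f' b) = fun_ract (fun_diff f f') b"
proof -
 have in1: "f x \<in> carrier B" "g x \<in> carrier B" "f' x \<in> carrier B" "g' x \<in> carrier B" if "x \<in> \<Omega>" for x
  using f g f' g' that by auto
 show "fun_diff (fun_add f g) (fun_add f' g') = fun_add (fun_diff f f') (fun_diff g g')"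
  unfolding fun_diff_def fun_add_def using in1 by (auto simp: B.M.diff_add_diff intro!: restrict_ext)
 show "fun_diff (fun_smult z f) (fun_smult z f') = fun_smult z (fun_diff f f')"
  unfolding fun_diff_def fun_smult_def using in1 by (auto simp: smult_diff_right intro!: restrict_ext)
 show "fun_diff (fun_ract f b) (fun_ract f' b) = fun_ract (fun_diff f f') b" if "b \<in> carrier B"
  unfolding fun_diff_def fun_ract_def using in1 that by (auto simp: mult_diff_left intro!: restrict_ext)
qed

lemma kernel_fun_ops:
 assumes l: "set l \<subseteq> \<Omega>" "set l' \<subseteq> \<Omega>"
 shows "kernel_fun (l @ l') = fun_add (kernel_fun l) (kernel_fun l')"
  "kernel_fun (map (scale z) l) = fun_smult z (kernel_fun l)"
  "b \<in> carrier B ==> kernel_fun (map (\<lambda>x. act x b) l) = fun_ract (kernel_fun l) b"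
proof -
 have ext: "f = g" if "f \<in> extensional \<Omega>" "g \<in> extensional \<Omega>" "!!x. x \<in> \<Omega> ==> f x = g x" for f g :: "'x => 'b"
  using that by (rule extensionalityI)
 have kext: "kernel_fun m \<in> extensional \<Omega>" for m by (simp add: kernel_fun_def)
 show "kernel_fun (l @ l') = fun_add (kernel_fun l) (kernel_fun l')"
  by (rule ext) (use l kext kernel_fun_append in \<open>simp_all add: fun_add_def\<close>)
 show "kernel_fun (map (scale z) l) = fun_smult z (kernel_fun l)"
  by (rule ext) (use l kext kernel_fun_scale in \<open>simp_all add: fun_smult_def\<close>)
 show "kernel_fun (map (\<lambda>x. act x b) l) = fun_ract (kernel_fun l) b" if "b \<in> carrier B"
  by (rule ext) (use l kext kernel_fun_act that in \<open>simp_all add: fun_ract_def\<close>)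
qed

lemma bounded_by_mono:
 assumes b: "bounded_by f q C" and CD: "C \<le> D"
 shows "bounded_by f q D"
proof (rule bounded_byI)
 fix r l assume r: "r \<in> \<S> B" and rq: "!!b. b \<in> carrier B ==> r b \<le> q b" and l: "set l \<subseteq> \<Omega>"
 have "r (lsum B f l) \<le> C * gram_norm r l" by (rule bounded_byD[OF b r rq l])
 also have "... \<le> D * gram_norm r l" using CD gram_norm_nonneg[OF r l] by (rule mult_right_mono)
 finally show "r (lsum B f l) \<le> D * gram_norm r l" .
qed

lemma RKHI:
 assumes "f \<in> funs"
  "!!q eps. q \<in> \<S> B ==> eps > 0 ==> \<exists>l. set l \<subseteq> \<Omega> \<and> approx f l q eps"
 shows "f \<in> RKH" using assms unfolding RKH_def by blast

lemma rkhm_add: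
 assumes f: "f \<in> RKH" and g: "g \<in> RKH"
 shows "fun_add f g \<in> RKH"
proof (rule RKHI)
 note f' = RKHD[OF f] and g' = RKHD[OF g]
 show "fun_add f g \<in> funs" by (rule fun_ops_in(1)[OF f' g'])
 fix q and eps :: real assume q: "q \<in> \<S> B" and "eps > 0"
 then have eps2: "eps / 2 > 0" by simp
 obtain l where l: "set l \<subseteq> \<Omega>" "approx f l q (eps / 2)" by (rule rkhm_approx[OF f q eps2])
 obtain l' where l': "set l' \<subseteq> \<Omega>" "approx g l' q (eps / 2)" by (rule rkhm_approx[OF g q eps2])
 note k = kernel_fun_in[OF l(1)] kernel_fun_in[OF l'(1)]
 have "approx (fun_add f g) (l @ l') q (eps / 2 + eps / 2)"
  unfolding kernel_fun_ops(1)[OF l(1) l'(1)] fun_ops_diff(1)[OF f' g' k]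
  by (rule bounded_by_fun_add[OF q fun_diff_in[OF f' k(1)] fun_diff_in[OF g' k(2)] l(2) l'(2)])
 then show "\<exists>l. set l \<subseteq> \<Omega> \<and> approx (fun_add f g) l q eps" using l l' by (intro exI[of _ "l @ l'"]) simp
qed

lemma rkhm_smult:
 assumes f: "f \<in> RKH"
 shows "fun_smult z f \<in> RKH"
proof (rule RKHI)
 note f' = RKHD[OF f]
 show "fun_smult z f \<in> funs" by (rule fun_ops_in(2)[OF f'])
 fix q and eps :: real assume q: "q \<in> \<S> B" and eps: "eps > 0"
 define del where "del = eps / (cmod z + 1)"
 have z1: "cmod z + 1 > 0" using norm_ge_zero[of z] by linarith
 then have del: "del > 0" "(cmod z + 1) * del = eps" using eps by (simp_all add: del_def)
 obtain l where l: "set l \<subseteq> \<Omega>" "approx f l q del" by (rule rkhm_approx[OF f q del(1)])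
 note k = kernel_fun_in[OF l(1)]
 have "approx (fun_smult z f) (map (scale z) l) q (cmod z * del)"
  unfolding kernel_fun_ops(2)[OF l(1) l(1)] fun_ops_diff(2)[OF f' f' k k]
  by (rule bounded_by_fun_smult[OF q fun_diff_in[OF f' k] l(2)])
 then have "approx (fun_smult z f) (map (scale z) l) q eps" by (rule bounded_by_mono) (use del in \<open>simp add: distrib_right\<close>)
 then show "\<exists>l. set l \<subseteq> \<Omega> \<and> approx (fun_smult z f) l q eps" using l by (intro exI[of _ "map (scale z) l"]) auto
qed

lemma rkhm_ract:
 assumes f: "f \<in> RKH" and b: "b \<in> carrier B"
 shows "fun_ract f b \<in> RKH"
proof (rule RKHI)
 note f' = RKHD[OF f]
 show "fun_ract f b \<in> funs" by (rule fun_ops_in(3)[OF f' b])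
 fix q and eps :: real assume q: "q \<in> \<S> B" and eps: "eps > 0"
 interpret q: seminormed_module B q by (rule cont_seminorm_seminormed[OF q])
 define del where "del = eps / (q b + 1)"
 have z1: "q b + 1 > 0" using q.nonneg[OF b] by linarith
 then have del: "del > 0" "(q b + 1) * del = eps" using eps by (simp_all add: del_def)
 obtain l where l: "set l \<subseteq> \<Omega>" "approx f l q del" by (rule rkhm_approx[OF f q del(1)])
 note k = kernel_fun_in[OF l(1)]
 have "approx (fun_ract f b) (map (\<lambda>x. act x b) l) q (q b * del)"
  unfolding kernel_fun_ops(3)[OF l(1) l(1) b] fun_ops_diff(3)[OF f' f' k k b]
  by (rule bounded_by_fun_ract[OF q fun_diff_in[OF f' k] b l(2) less_imp_le[OF del(1)]])
 then have "approx (fun_ract f b) (map (\<lambda>x. act x b) l) q eps"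
  by (rule bounded_by_mono) (use del in \<open>simp add: distrib_right\<close>)
 then show "\<exists>l. set l \<subseteq> \<Omega> \<and> approx (fun_ract f b) l q eps" using l b by (intro exI[of _ "map (\<lambda>x. act x b) l"]) auto
qed

lemma lsum_append_neg:
 assumes g: "g \<in> RKH" and l: "set l \<subseteq> \<Omega>" "set l' \<subseteq> \<Omega>"
 shows "lsum B g (l @ map (scale (- 1)) l') = lsum B g l \<ominus> lsum B g l'"
proof (rule eqI)
 note g' = RKHD[OF g]
 have m: "set (map (scale (- 1)) l') \<subseteq> \<Omega>" using l by auto
 then have m': "set (l @ map (scale (- 1)) l') \<subseteq> \<Omega>" using l by simp
 note cl = lsum_in[OF g' m'] lsum_in[OF g' l(1)] lsum_in[OF g' l(2)]
 show "lsum B g (l @ map (scale (- 1)) l') \<in> carrier B" "lsum B g l \<ominus> lsum B g l' \<in> carrier B" using cl by simp_all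
 fix q and eps :: real assume q: "q \<in> \<S> B" and eps: "eps > 0"
 interpret q: seminormed_module B q by (rule cont_seminorm_seminormed[OF q])
 let ?m = "l @ map (scale (- 1)) l'"
 define N where "N = gram_norm q ?m + gram_norm q l + gram_norm q l'"
 have N: "N \<ge> 0" using gram_norm_nonneg[OF q] m' l by (simp add: N_def)
 define del where "del = eps / (N + 1)"
 have del: "del > 0" "del * N \<le> eps" using N eps by (simp_all add: del_def field_simps)
 obtain l0 where l0: "set l0 \<subseteq> \<Omega>" "approx g l0 q del" by (rule rkhm_approx[OF g q del(1)])
 have near: "q (lsum B g k \<ominus> gram k l0) \<le> del * gram_norm q k" if k: "set k \<subseteq> \<Omega>" for k
  using bounded_byD_self[OF l0(2) q k] unfolding lsum_fun_diff[OF g' kernel_fun_in[OF l0(1)] k] lsum_kernel_fun[OF k] .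
 have "gram ?m l0 = gram l l0 \<ominus> gram l' l0"
  using l l0 m by (simp add: gram_append_left gram_scale_left smult_minus_left B.M.minus_eq)
 then have "q (lsum B g ?m \<ominus> (lsum B g l \<ominus> lsum B g l'))
   \<le> q (lsum B g ?m \<ominus> gram ?m l0) + q ((gram l l0 \<ominus> gram l' l0) \<ominus> (lsum B g l \<ominus> lsum B g l'))"
  using q.diff_triangle[of "lsum B g ?m" "gram ?m l0" "lsum B g l \<ominus> lsum B g l'"] cl m' l l0 by simp
 also have "(gram l l0 \<ominus> gram l' l0) \<ominus> (lsum B g l \<ominus> lsum B g l') = (gram l l0 \<ominus> lsum B g l) \<ominus> (gram l' l0 \<ominus> lsum B g l')"
  using cl l l0 by (simp add: B.M.minus_eq B.M.minus_add B.M.a_ac)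
 also have "q ... \<le> q (gram l l0 \<ominus> lsum B g l) + q (gram l' l0 \<ominus> lsum B g l')" by (rule q.diff_le) (use cl l l0 in simp_all)
 also have "q (gram l l0 \<ominus> lsum B g l) = q (lsum B g l \<ominus> gram l l0)" by (rule q.diff_sym) (use cl l l0 in simp_all)
 also have "q (gram l' l0 \<ominus> lsum B g l') = q (lsum B g l' \<ominus> gram l' l0)" by (rule q.diff_sym) (use cl l l0 in simp_all)
 finally have "q (lsum B g ?m \<ominus> (lsum B g l \<ominus> lsum B g l')) \<le> del * N"
  using near[OF m'] near[OF l(1)] near[OF l(2)] by (simp add: N_def distrib_left)
 then show "q (lsum B g ?m \<ominus> (lsum B g l \<ominus> lsum B g l')) \<le> eps" using del(2) by linarith
qed

lemma lsum_diff_le: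
 assumes q: "q \<in> \<S> B" and f: "f \<in> funs" and g: "g \<in> RKH"
  and l: "set l \<subseteq> \<Omega>" "approx f l q eps"
  and l': "set l' \<subseteq> \<Omega>" "approx f l' q eps'"
  and C: "bounded_by g q C" "0 \<le> C" and nn: "0 \<le> eps" "0 \<le> eps'"
 shows "q (lsum B g l \<ominus> lsum B g l') \<le> C * (eps + eps')"
proof -
 let ?m = "l @ map (scale (- 1)) l'"
 note k = kernel_fun_in[OF l(1)] and k' = kernel_fun_in[OF l'(1)]
 have m: "set ?m \<subseteq> \<Omega>" using l l' by auto
 have "kernel_fun ?m = fun_diff (kernel_fun l) (kernel_fun l')"
 proof (rule extensionalityI)
  fix x assume x: "x \<in> \<Omega>"
  have "kernel_fun ?m x = kernel_fun l x \<oplus> kernel_fun (map (scale (- 1)) l') x"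
   by (rule kernel_fun_append) (use l l' x in auto)
  moreover have "kernel_fun l' x \<in> carrier B" using k' x by auto
  ultimately show "kernel_fun ?m x = fun_diff (kernel_fun l) (kernel_fun l') x"
   using l'(1) x by (simp add: kernel_fun_scale fun_diff_def smult_minus_1 B.M.minus_eq)
 qed (auto simp: kernel_fun_def fun_diff_def)
 then have "bounded_by (kernel_fun ?m) q (eps + eps')"
  using bounded_by_diff_trans[OF q k f k' bounded_by_diff_sym[OF q f k l(2)] l'(2)] by simp
 then have "gram_norm q ?m \<le> eps + eps'" using nn by (intro gram_norm_le_if_bounded_by[OF q m]) simp_all
 then have "C * gram_norm q ?m \<le> C * (eps + eps')" using C(2) by (rule mult_left_mono)
 moreover have "q (lsum B g ?m) \<le> C * gram_norm q ?m" by (rule bounded_byD_self[OF C(1) q m])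
 ultimately show ?thesis using lsum_append_neg[OF g l(1) l'(1)] by simp
qed

text \<open>
 If the combinations $\sum_l \iota(x)$ tend to \<open>f\<close>, then $\langle f,g\rangle$ is the limit of
 $\sum_l g(x)$. A linear rate of convergence is part of the definition: it makes the algebraic laws
 of the inner product pass to the limit without further choices.
\<close>

definition rkhm_ip_rel :: "('x => 'b) => ('x => 'b) => 'b => bool"
 where "rkhm_ip_rel f g b \<longleftrightarrow> b \<in> carrier B \<and> (\<forall>q\<in>\<S> B. \<exists>C\<ge>0. \<forall>l eps. set l \<subseteq> \<Omega> --> eps > 0 -->
  approx f l q eps --> q (b \<ominus> lsum B g l) \<le> C * eps)"

definition rkhm_ip :: "('x => 'b) => ('x => 'b) => 'b"
 where "rkhm_ip f g = (THE b. rkhm_ip_rel f g b)"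

lemma rkhm_ip_relE:
 assumes "rkhm_ip_rel f g b" "q \<in> \<S> B"
 obtains C where "C \<ge> 0" "!!l eps. [|set l \<subseteq> \<Omega>; eps > 0; approx f l q eps|] ==>
  q (b \<ominus> lsum B g l) \<le> C * eps"
proof -
 have "\<exists>C\<ge>0. \<forall>l eps. set l \<subseteq> \<Omega> --> eps > 0 -->
  approx f l q eps --> q (b \<ominus> lsum B g l) \<le> C * eps" using assms unfolding rkhm_ip_rel_def by blast
 then show thesis using that by blast
qed

lemma rkhm_ip_rel_unique:
 assumes f: "f \<in> RKH" and g: "g \<in> RKH" and b: "rkhm_ip_rel f g b" "rkhm_ip_rel f g b'"
 shows "b = b'"
proof (rule eqI)
 show cl: "b \<in> carrier B" "b' \<in> carrier B" using b by (simp_all add: rkhm_ip_rel_def)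
 fix q and eps :: real assume q: "q \<in> \<S> B" and eps: "eps > 0"
 interpret q: seminormed_module B q by (rule cont_seminorm_seminormed[OF q])
 obtain C where C: "C \<ge> 0" "!!l eps. [|set l \<subseteq> \<Omega>; eps > 0; approx f l q eps|] ==>
  q (b \<ominus> lsum B g l) \<le> C * eps" using rkhm_ip_relE[OF b(1) q] by blast
 obtain D where D: "D \<ge> 0" "!!l eps. [|set l \<subseteq> \<Omega>; eps > 0; approx f l q eps|] ==>
  q (b' \<ominus> lsum B g l) \<le> D * eps" using rkhm_ip_relE[OF b(2) q] by blast
 define del where "del = eps / (C + D + 1)"
 have del0: "del > 0" "(C + D + 1) * del = eps" using C(1) D(1) eps by (simp_all add: del_def)
 then have del: "del > 0" "C * del + D * del \<le> eps" by (simp_all add: distrib_right)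
 obtain l where l: "set l \<subseteq> \<Omega>" "approx f l q del" by (rule rkhm_approx[OF f q del(1)])
 have s: "lsum B g l \<in> carrier B" by (rule lsum_in[OF RKHD[OF g] l(1)])
 have "q (b \<ominus> b') \<le> q (b \<ominus> lsum B g l) + q (lsum B g l \<ominus> b')" by (rule q.diff_triangle[OF cl(1) s cl(2)])
 moreover have "q (lsum B g l \<ominus> b') = q (b' \<ominus> lsum B g l)" by (rule q.diff_sym[OF s cl(2)])
 ultimately show "q (b \<ominus> b') \<le> eps" using C(2)[OF l(1) del(1) l(2)] D(2)[OF l(1) del(1) l(2)] del(2) by linarith
qed

lemma rkhm_ip_rel_exists:
 assumes f: "f \<in> RKH" and g: "g \<in> RKH"
 shows "\<exists>b. rkhm_ip_rel f g b"
proof -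
 note f' = RKHD[OF f] and g' = RKHD[OF g]
 define near where "near q eps = {l. set l \<subseteq> \<Omega> \<and> approx f l q eps}" for q eps
 have ne: "near q eps \<noteq> {}" if "q \<in> \<S> B" "eps > 0" for q eps using that f unfolding near_def RKH_def by auto
 have mono: "near r del \<subseteq> near q eps" if "!!b. b \<in> carrier B ==> q b \<le> r b" "del \<le> eps" for q r del eps
 proof -
  have "bounded_by g q eps" if "bounded_by g r del" for g
   by (rule bounded_by_mono[OF bounded_by_seminorm_mono[OF that] \<open>del \<le> eps\<close>]) fact
  then show ?thesis unfolding near_def by blast
 qed
 obtain F where F: "F \<noteq> bot" and near: "!!q eps. [|q \<in> \<S> B; eps > 0|] ==> eventually (\<lambda>l. l \<in> near q eps) F"
  by (rule near_filter[of near, OF ne mono]) blast+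
 have "\<exists>b\<in>carrier B. \<forall>q\<in>\<S> B. \<forall>eps>0. eventually (\<lambda>l. q (lsum B g l \<ominus> b) < eps) F"
 proof (rule complete_filter[OF F])
  obtain q0 where "q0 \<in> \<S> B" using cont_seminorms_nonempty by blast
  from near[OF this zero_less_one] show "eventually (\<lambda>l. lsum B g l \<in> carrier B) F"
   by (rule eventually_mono) (use lsum_in[OF g'] in \<open>simp add: near_def\<close>)
  fix q and eps :: real assume q: "q \<in> \<S> B" and eps: "eps > 0"
  obtain C where C: "C \<ge> 0" "bounded_by g q C" by (rule rkhm_bounded[OF g q])
  define del where "del = eps / (2 * (C + 1))"
  have del: "del > 0" "2 * (C + 1) * del = eps" using C(1) eps by (simp_all add: del_def)
  show "\<exists>Q. eventually Q F \<and> (\<forall>l l'. Q l --> Q l' --> q (lsum B g l \<ominus> lsum B g l') < eps)"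
  proof (intro exI conjI allI impI)
   show "eventually (\<lambda>l. l \<in> near q del) F" by (rule near[OF q del(1)])
   fix l l' assume "l \<in> near q del" "l' \<in> near q del"
   then have "q (lsum B g l \<ominus> lsum B g l') \<le> C * (del + del)"
    using del(1) by (intro lsum_diff_le[OF q f' g _ _ _ _ C(2) C(1)]) (simp_all add: near_def)
   also have "... < 2 * (C + 1) * del" using del(1) by (simp add: algebra_simps)
   finally show "q (lsum B g l \<ominus> lsum B g l') < eps" using del(2) by simp
  qed
 qed
 then obtain b where b: "b \<in> carrier B" "!!q eps. q \<in> \<S> B ==> eps > 0 ==> eventually (\<lambda>l. q (lsum B g l \<ominus> b) < eps) F"
  by blast
 have "rkhm_ip_rel f g b" unfolding rkhm_ip_rel_def
 proof (intro conjI ballI b(1))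
  fix q assume q: "q \<in> \<S> B"
  interpret q: seminormed_module B q by (rule cont_seminorm_seminormed[OF q])
  obtain C where C: "C \<ge> 0" "bounded_by g q C" by (rule rkhm_bounded[OF g q])
  have "q (b \<ominus> lsum B g l) \<le> C * eps"
   if l: "set l \<subseteq> \<Omega>" and eps: "eps > 0" and bl: "approx f l q eps" for l eps
  proof (rule field_le_epsilon)
   fix del :: real assume del: "del > 0"
   define \<gamma> where "\<gamma> = del / (C + 1)"
   have \<gamma>: "\<gamma> > 0" "(C + 1) * \<gamma> = del" using C(1) del by (simp_all add: \<gamma>_def)
   have "eventually (\<lambda>l'. q (lsum B g l' \<ominus> b) < \<gamma> \<and> l' \<in> near q \<gamma>) F" by (intro eventually_conj b(2) near q \<gamma>)
   from eventually_happens'[OF F this]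
   obtain l' where l': "q (lsum B g l' \<ominus> b) < \<gamma>" "l' \<in> near q \<gamma>" by blast
   have l'\<Omega>: "set l' \<subseteq> \<Omega>" "approx f l' q \<gamma>" using l'(2) by (simp_all add: near_def)
   note cl = lsum_in[OF g' l] lsum_in[OF g' l'\<Omega>(1)]
   have "q (b \<ominus> lsum B g l) \<le> q (b \<ominus> lsum B g l') + q (lsum B g l' \<ominus> lsum B g l)"
    by (rule q.diff_triangle[OF b(1) cl(2) cl(1)])
   also have "q (b \<ominus> lsum B g l') = q (lsum B g l' \<ominus> b)" by (rule q.diff_sym[OF b(1) cl(2)])
   also have "q (lsum B g l' \<ominus> lsum B g l) \<le> C * (\<gamma> + eps)"
    by (rule lsum_diff_le[OF q f' g l'\<Omega> l bl C(2) C(1)]) (use \<gamma> eps in simp_all)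
   finally show "q (b \<ominus> lsum B g l) \<le> C * eps + del" using l'(1) \<gamma>(2) by (simp add: algebra_simps)
  qed
  with C(1) show "\<exists>C\<ge>0. \<forall>l eps. set l \<subseteq> \<Omega> --> eps > 0 -->
    approx f l q eps --> q (b \<ominus> lsum B g l) \<le> C * eps" by blast
 qed
 then show ?thesis by blast
qed

lemma rkhm_ip:
 assumes "f \<in> RKH" "g \<in> RKH"
 shows "rkhm_ip_rel f g (rkhm_ip f g)"
 unfolding rkhm_ip_def using rkhm_ip_rel_exists[OF assms] rkhm_ip_rel_unique[OF assms] by (metis theI)

lemma rkhm_ip_eqI:
 assumes "f \<in> RKH" "g \<in> RKH" "rkhm_ip_rel f g b"
 shows "rkhm_ip f g = b" using rkhm_ip_rel_unique[OF assms(1,2) rkhm_ip[OF assms(1,2)] assms(3)] .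

end

lemma nonpos_if_le_sqrt:
 fixes s D :: real
 assumes D: "0 \<le> D" and le: "!!eps. 0 < eps ==> eps \<le> 1 ==> s \<le> D * sqrt eps"
 shows "s \<le> 0"
proof (rule ccontr)
 assume "\<not> s \<le> 0"
 then have s: "s > 0" by simp
 define r where "r = min 1 (s / (D + 1))"
 have r: "r > 0" "r \<le> 1" using s D by (simp_all add: r_def)
 have "s \<le> D * sqrt (r\<^sup>2)" by (rule le) (use r in \<open>simp_all add: power_le_one\<close>)
 also have "... = D * r" using r by simp
 also have "... \<le> D * (s / (D + 1))" using D by (intro mult_left_mono) (simp_all add: r_def)
 also have "... < (D + 1) * (s / (D + 1))" using s D by (intro mult_strict_right_mono) simp_all
 also have "... = s" using D by simp
 finally show False by simp
qed

context positive_definite_kernel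
begin

lemma rkhm_ip_relI:
 assumes "b \<in> carrier B" "!!q. q \<in> \<S> B ==> \<exists>C\<ge>0. \<forall>l eps. set l \<subseteq> \<Omega> --> eps > 0 -->
  approx f l q eps --> q (b \<ominus> lsum B g l) \<le> C * eps"
 shows "rkhm_ip_rel f g b" using assms unfolding rkhm_ip_rel_def by blast

lemma rkhm_ip_closed: "[|f \<in> RKH; g \<in> RKH|] ==> rkhm_ip f g \<in> carrier B" using rkhm_ip[of f g] by (simp add: rkhm_ip_rel_def)

lemma rkhm_ip_add:
 assumes f: "f \<in> RKH" and g: "g \<in> RKH" and h: "h \<in> RKH"
 shows "rkhm_ip f (fun_add g h) = rkhm_ip f g \<oplus> rkhm_ip f h"
proof (rule rkhm_ip_eqI[OF f rkhm_add[OF g h]], rule rkhm_ip_relI)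
 note cl = rkhm_ip_closed[OF f g] rkhm_ip_closed[OF f h]
 then show "rkhm_ip f g \<oplus> rkhm_ip f h \<in> carrier B" by simp
 fix q assume q: "q \<in> \<S> B"
 interpret q: seminormed_module B q by (rule cont_seminorm_seminormed[OF q])
 obtain C where C: "C \<ge> 0" "!!l eps. [|set l \<subseteq> \<Omega>; eps > 0; approx f l q eps|] ==>
  q (rkhm_ip f g \<ominus> lsum B g l) \<le> C * eps" using rkhm_ip_relE[OF rkhm_ip[OF f g] q] by blast
 obtain D where D: "D \<ge> 0" "!!l eps. [|set l \<subseteq> \<Omega>; eps > 0; approx f l q eps|] ==>
  q (rkhm_ip f h \<ominus> lsum B h l) \<le> D * eps" using rkhm_ip_relE[OF rkhm_ip[OF f h] q] by blast
 have "q ((rkhm_ip f g \<oplus> rkhm_ip f h) \<ominus> lsum B (fun_add g h) l) \<le> (C + D) * eps"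
  if l: "set l \<subseteq> \<Omega>" and eps: "eps > 0" and b: "approx f l q eps" for l eps
 proof -
  note s = lsum_in[OF RKHD[OF g] l] lsum_in[OF RKHD[OF h] l]
  show ?thesis using q.add_diff_add_le[OF cl s] C(2)[OF l eps b] D(2)[OF l eps b]
   by (simp add: lsum_fun_add[OF RKHD[OF g] RKHD[OF h] l] distrib_right)
 qed
 with C(1) D(1) show "\<exists>C\<ge>0. \<forall>l eps. set l \<subseteq> \<Omega> --> eps > 0 --> approx f l q eps -->
   q ((rkhm_ip f g \<oplus> rkhm_ip f h) \<ominus> lsum B (fun_add g h) l) \<le> C * eps" by (intro exI[of _ "C + D"]) simp
qed

lemma rkhm_ip_smult:
 assumes f: "f \<in> RKH" and g: "g \<in> RKH"
 shows "rkhm_ip f (fun_smult z g) = z \<odot> rkhm_ip f g"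
proof (rule rkhm_ip_eqI[OF f rkhm_smult[OF g]], rule rkhm_ip_relI)
 note cl = rkhm_ip_closed[OF f g]
 then show "z \<odot> rkhm_ip f g \<in> carrier B" by simp
 fix q assume q: "q \<in> \<S> B"
 interpret q: seminormed_module B q by (rule cont_seminorm_seminormed[OF q])
 obtain C where C: "C \<ge> 0" "!!l eps. [|set l \<subseteq> \<Omega>; eps > 0; approx f l q eps|] ==>
  q (rkhm_ip f g \<ominus> lsum B g l) \<le> C * eps" using rkhm_ip_relE[OF rkhm_ip[OF f g] q] by blast
 have "q (z \<odot> rkhm_ip f g \<ominus> lsum B (fun_smult z g) l) \<le> (cmod z * C) * eps"
  if l: "set l \<subseteq> \<Omega>" and eps: "eps > 0" and b: "approx f l q eps" for l eps
 proof -
  note s = lsum_in[OF RKHD[OF g] l]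
  have "z \<odot> rkhm_ip f g \<ominus> lsum B (fun_smult z g) l = z \<odot> (rkhm_ip f g \<ominus> lsum B g l)"
   using cl s by (simp add: lsum_fun_smult[OF RKHD[OF g] l] smult_diff_right)
  then show ?thesis using q.homogeneous[of "rkhm_ip f g \<ominus> lsum B g l" z] cl s C(2)[OF l eps b]
   by (simp add: mult_left_mono mult.assoc)
 qed
 with C(1) show "\<exists>C\<ge>0. \<forall>l eps. set l \<subseteq> \<Omega> --> eps > 0 --> approx f l q eps -->
   q (z \<odot> rkhm_ip f g \<ominus> lsum B (fun_smult z g) l) \<le> C * eps" by (intro exI[of _ "cmod z * C"]) simp
qed

lemma rkhm_ip_ract:
 assumes f: "f \<in> RKH" and g: "g \<in> RKH" and b: "b \<in> carrier B"
 shows "rkhm_ip f (fun_ract g b) = rkhm_ip f g \<otimes> b"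
proof (rule rkhm_ip_eqI[OF f rkhm_ract[OF g b]], rule rkhm_ip_relI)
 note cl = rkhm_ip_closed[OF f g]
 then show "rkhm_ip f g \<otimes> b \<in> carrier B" using b by simp
 fix q assume q: "q \<in> \<S> B"
 interpret q: cstar_seminormed B q by (rule cont_seminormD[OF q])
 obtain C where C: "C \<ge> 0" "!!l eps. [|set l \<subseteq> \<Omega>; eps > 0; approx f l q eps|] ==>
  q (rkhm_ip f g \<ominus> lsum B g l) \<le> C * eps" using rkhm_ip_relE[OF rkhm_ip[OF f g] q] by blast
 have "q (rkhm_ip f g \<otimes> b \<ominus> lsum B (fun_ract g b) l) \<le> (C * q b) * eps"
  if l: "set l \<subseteq> \<Omega>" and eps: "eps > 0" and bd: "approx f l q eps" for l eps
 proof -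
  note s = lsum_in[OF RKHD[OF g] l]
  have "rkhm_ip f g \<otimes> b \<ominus> lsum B (fun_ract g b) l = (rkhm_ip f g \<ominus> lsum B g l) \<otimes> b"
   using cl s b by (simp add: lsum_fun_ract[OF RKHD[OF g] l b] mult_diff_left)
  then have "q (rkhm_ip f g \<otimes> b \<ominus> lsum B (fun_ract g b) l) \<le> q (rkhm_ip f g \<ominus> lsum B g l) * q b"
   using q.submultiplicative[of "rkhm_ip f g \<ominus> lsum B g l" b] cl s b by simp
  also have "... \<le> (C * eps) * q b" using C(2)[OF l eps bd] q.nonneg[OF b] by (rule mult_right_mono)
  finally show ?thesis by (simp add: mult_ac)
 qed
 moreover have "0 \<le> C * q b" using C(1) q.nonneg[OF b] by simp
 ultimately show "\<exists>C\<ge>0. \<forall>l eps. set l \<subseteq> \<Omega> --> eps > 0 --> approx f l q eps -->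
   q (rkhm_ip f g \<otimes> b \<ominus> lsum B (fun_ract g b) l) \<le> C * eps" by blast
qed

lemma lsum_near_gram:
 assumes q: "q \<in> \<S> B" and f: "f \<in> RKH" and l: "set l \<subseteq> \<Omega>"
  and b: "approx f l q eps" and m: "set m \<subseteq> \<Omega>"
 shows "q (lsum B f m \<ominus> gram m l) \<le> eps * gram_norm q m" using bounded_byD_self[OF b q m]
 by (simp add: lsum_fun_diff[OF RKHD[OF f] kernel_fun_in[OF l] m] lsum_kernel_fun[OF m])

lemma rkhm_ip_star:
 assumes f: "f \<in> RKH" and g: "g \<in> RKH"
 shows "star B (rkhm_ip f g) = rkhm_ip g f"
proof (rule rkhm_ip_eqI[OF g f, symmetric], rule rkhm_ip_relI)
 note cl = rkhm_ip_closed[OF f g]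
 then show "star B (rkhm_ip f g) \<in> carrier B" by simp
 fix q assume q: "q \<in> \<S> B"
 interpret q: cstar_seminormed B q by (rule cont_seminormD[OF q])
 obtain C where C: "C \<ge> 0" "!!l eps. [|set l \<subseteq> \<Omega>; eps > 0; approx f l q eps|] ==>
  q (rkhm_ip f g \<ominus> lsum B g l) \<le> C * eps" using rkhm_ip_relE[OF rkhm_ip[OF f g] q] by blast
 obtain D where D: "D \<ge> 0" "bounded_by f q D" by (rule rkhm_bounded[OF f q])
 have "q (star B (rkhm_ip f g) \<ominus> lsum B f l) \<le> D * eps"
  if l: "set l \<subseteq> \<Omega>" and eps: "eps > 0" and b: "approx g l q eps" for l eps
 proof (rule field_le_epsilon)
  fix \<gamma> :: real assume \<gamma>: "\<gamma> > 0"
  define N where "N = C + eps + gram_norm q l"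
  have N: "N \<ge> 0" using C(1) eps gram_norm_nonneg[OF q l] by (simp add: N_def)
  define del where "del = \<gamma> / (N + 1)"
  have del: "del > 0" "(N + 1) * del = \<gamma>" using \<gamma> N by (simp_all add: del_def)
  obtain m where m: "set m \<subseteq> \<Omega>" "approx f m q del" by (rule rkhm_approx[OF f q del(1)])
  note s = lsum_in[OF RKHD[OF g] m(1)] lsum_in[OF RKHD[OF f] l]
  have "q (star B (rkhm_ip f g) \<ominus> lsum B f l) = q (star B (rkhm_ip f g \<ominus> star B (lsum B f l)))"
   using cl s by (simp add: star_diff)
  also have "... = q (rkhm_ip f g \<ominus> star B (lsum B f l))" using cl s by (intro q.star_isometric) simp
  also have "... \<le> q (rkhm_ip f g \<ominus> lsum B g m) + q (lsum B g m \<ominus> star B (lsum B f l))"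
   by (rule q.diff_triangle) (use cl s in simp_all)
  also have "q (lsum B g m \<ominus> star B (lsum B f l)) \<le> q (lsum B g m \<ominus> gram m l) + q (gram m l \<ominus> star B (lsum B f l))"
   by (rule q.diff_triangle) (use s m l in simp_all)
  also have "gram m l \<ominus> star B (lsum B f l) = star B (gram l m \<ominus> lsum B f l)" using s m l by (simp add: star_diff gram_star)
  also have "q ... = q (gram l m \<ominus> lsum B f l)" using s m l by (intro q.star_isometric) simp
  also have "... = q (lsum B f l \<ominus> gram l m)" using s m l by (intro q.diff_sym) simp_all
  finally have "q (star B (rkhm_ip f g) \<ominus> lsum B f l) \<le>
    q (rkhm_ip f g \<ominus> lsum B g m) + (q (lsum B g m \<ominus> gram m l) + q (lsum B f l \<ominus> gram l m))" by simp
  also have "... \<le> C * del + (eps * gram_norm q m + del * gram_norm q l)"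
   by (intro add_mono C(2) m del lsum_near_gram q f g l b)
  also have "eps * gram_norm q m \<le> eps * (del + D)"
   using gram_norm_approx_le[OF q RKHD[OF f] m D(2)] del D eps by (intro mult_left_mono) simp_all
  finally have "q (star B (rkhm_ip f g) \<ominus> lsum B f l) \<le> D * eps + N * del" by (simp add: N_def algebra_simps)
  then show "q (star B (rkhm_ip f g) \<ominus> lsum B f l) \<le> D * eps + \<gamma>" using del by (simp add: distrib_right)
 qed
 with D(1) show "\<exists>C\<ge>0. \<forall>l eps. set l \<subseteq> \<Omega> --> eps > 0 --> approx g l q eps -->
   q (star B (rkhm_ip f g) \<ominus> lsum B f l) \<le> C * eps" by blast
qed

lemma rkhm_ip_self_near_gram:
 assumes f: "f \<in> RKH" and q: "q \<in> \<S> B"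
 shows "\<exists>C\<ge>0. \<forall>l eps. set l \<subseteq> \<Omega> --> 0 < eps --> eps \<le> 1 --> approx f l q eps -->
  q (rkhm_ip f f \<ominus> gram l l) \<le> C * eps"
proof -
 interpret q: cstar_seminormed B q by (rule cont_seminormD[OF q])
 obtain C where C: "C \<ge> 0" "!!l eps. [|set l \<subseteq> \<Omega>; eps > 0; approx f l q eps|] ==>
  q (rkhm_ip f f \<ominus> lsum B f l) \<le> C * eps" using rkhm_ip_relE[OF rkhm_ip[OF f f] q] by blast
 obtain D where D: "D \<ge> 0" "bounded_by f q D" by (rule rkhm_bounded[OF f q])
 have "q (rkhm_ip f f \<ominus> gram l l) \<le> (C + 1 + D) * eps"
  if l: "set l \<subseteq> \<Omega>" and eps: "0 < eps" "eps \<le> 1" and b: "approx f l q eps" for l eps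
 proof -
  have "q (rkhm_ip f f \<ominus> gram l l) \<le> q (rkhm_ip f f \<ominus> lsum B f l) + q (lsum B f l \<ominus> gram l l)"
   by (rule q.diff_triangle) (use rkhm_ip_closed[OF f f] lsum_in[OF RKHD[OF f] l] l in simp_all)
  also have "... \<le> C * eps + eps * gram_norm q l" by (intro add_mono C(2) lsum_near_gram q f l eps b)
  also have "eps * gram_norm q l \<le> eps * (1 + D)"
   using gram_norm_approx_le[OF q RKHD[OF f] l b D(2)] D eps by (intro mult_left_mono) simp_all
  finally show ?thesis by (simp add: algebra_simps)
 qed
 with C(1) D(1) show ?thesis by (intro exI[of _ "C + 1 + D"]) simp
qed

lemma rkhm_ip_positive:
 assumes f: "f \<in> RKH"
 shows "positive B (rkhm_ip f f)" unfolding positive_iff_spectrally_positive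
proof (rule spectrally_positive_limit[OF rkhm_ip_closed[OF f f]])
 fix q and eps :: real assume q: "q \<in> \<S> B" and eps: "eps > 0"
 obtain C where C: "C \<ge> 0" "\<forall>l eps. set l \<subseteq> \<Omega> --> 0 < eps --> eps \<le> 1 -->
  approx f l q eps --> q (rkhm_ip f f \<ominus> gram l l) \<le> C * eps" using rkhm_ip_self_near_gram[OF f q] by blast
 define del where "del = min 1 (eps / (C + 1))"
 have del: "del > 0" "del \<le> 1" using C(1) eps by (simp_all add: del_def)
 have "del \<le> eps / (C + 1)" by (simp add: del_def)
 then have "del * (C + 1) \<le> eps" using C(1) by (simp add: pos_le_divide_eq)
 then have Cdel: "C * del \<le> eps" using del by (simp add: algebra_simps)
 obtain l where l: "set l \<subseteq> \<Omega>" "approx f l q del" by (rule rkhm_approx[OF f q del(1)])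
 have "q (rkhm_ip f f \<ominus> gram l l) \<le> C * del" using C(2) l del by blast
 moreover have "spectrally_positive (gram l l)"
  using kernel_positive[OF l(1)] by (simp add: gram_def positive_iff_spectrally_positive)
 ultimately show "\<exists>k. spectrally_positive k \<and> q (rkhm_ip f f \<ominus> k) \<le> eps" using Cdel by force
qed

lemma rkhm_ip_definite:
 assumes f: "f \<in> RKH" and null: "rkhm_ip f f = \<zero>" and x: "x \<in> \<Omega>"
 shows "f x = \<zero>"
proof (rule separated)
 have f': "f \<in> funs" by (rule RKHD[OF f])
 then show fx: "f x \<in> carrier B" using x by auto
 fix q assume q: "q \<in> \<S> B"
 interpret q: cstar_seminormed B q by (rule cont_seminormD[OF q])
 have x1: "set [x] \<subseteq> \<Omega>" using x by simp
 have sx: "lsum B f [x] = f x" using fx by simp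
 obtain C where C: "C \<ge> 0" "\<forall>l eps. set l \<subseteq> \<Omega> --> 0 < eps --> eps \<le> 1 -->
  approx f l q eps --> q (rkhm_ip f f \<ominus> gram l l) \<le> C * eps" using rkhm_ip_self_near_gram[OF f q] by blast
 let ?N = "gram_norm q [x]"
 have N: "?N \<ge> 0" by (rule gram_norm_nonneg[OF q x1])
 have "q (f x) \<le> 0"
 proof (rule nonpos_if_le_sqrt)
  show "0 \<le> ?N * (1 + sqrt C)" using N C(1) by simp
  fix eps :: real assume eps: "0 < eps" "eps \<le> 1"
  obtain l where l: "set l \<subseteq> \<Omega>" "approx f l q eps" by (rule rkhm_approx[OF f q eps(1)])
  have g: "gram l l \<in> carrier B" using l by simp
  have "q (gram l l) = q (rkhm_ip f f \<ominus> gram l l)" using g q.minus[OF g] by (simp add: null B.M.minus_eq)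
  also have "... \<le> C * eps" using C(2) l eps by blast
  finally have "gram_norm q l \<le> sqrt (C * eps)" by (simp add: gram_norm_def)
  then have nl: "gram_norm q l \<le> sqrt C * sqrt eps" by (simp add: real_sqrt_mult)
  have e: "eps \<le> sqrt eps" using eps by (intro real_le_rsqrt) (simp add: power2_eq_square mult_left_le_one_le)
  have "q (lsum B f [x]) \<le> q (lsum B f [x] \<ominus> gram [x] l) + q (gram [x] l)"
   by (rule q.le_diff_add[OF lsum_in[OF f' x1] gram_closed[OF x1 l(1)]])
  also have "... \<le> eps * ?N + ?N * gram_norm q l" by (intro add_mono lsum_near_gram gram_Cauchy_Schwarz q f l x1)
  also have "... \<le> sqrt eps * ?N + ?N * (sqrt C * sqrt eps)" by (intro add_mono mult_right_mono mult_left_mono e nl N)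
  finally show "q (f x) \<le> ?N * (1 + sqrt C) * sqrt eps" using sx by (simp add: algebra_simps)
 qed
 then show "q (f x) = 0" using q.nonneg[OF fx] by linarith
qed

lemma rkhm_reproducing:
 assumes l: "set l \<subseteq> \<Omega>" and g: "g \<in> RKH"
 shows "rkhm_ip (kernel_fun l) g = lsum B g l"
proof (rule rkhm_ip_eqI[OF kernel_fun_in_rkhm[OF l] g], rule rkhm_ip_relI)
 note k = kernel_fun_in[OF l]
 show "lsum B g l \<in> carrier B" by (rule lsum_in[OF RKHD[OF g] l])
 fix q assume q: "q \<in> \<S> B"
 obtain C where C: "C \<ge> 0" "bounded_by g q C" by (rule rkhm_bounded[OF g q])
 have "approx (kernel_fun l) l q 0"
 proof (rule bounded_byI)
  fix r m assume r: "r \<in> \<S> B" and m: "set m \<subseteq> \<Omega>"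
  interpret r: seminormed_module B r by (rule cont_seminorm_seminormed[OF r])
  show "r (lsum B (fun_diff (kernel_fun l) (kernel_fun l)) m) \<le> 0 * gram_norm r m"
   using lsum_in[OF k m] by (simp add: lsum_fun_diff[OF k k m])
 qed
 then have "q (lsum B g l \<ominus> lsum B g l') \<le> C * (0 + eps)"
  if "set l' \<subseteq> \<Omega>" "eps > 0" "approx (kernel_fun l) l' q eps" for l' eps
  by (rule lsum_diff_le[OF q k g l _ that(1,3) C(2,1)]) (use that in simp_all)
 with C(1) show "\<exists>C\<ge>0. \<forall>l' eps. set l' \<subseteq> \<Omega> --> eps > 0 -->
   approx (kernel_fun l) l' q eps --> q (lsum B g l \<ominus> lsum B g l') \<le> C * eps" by auto
qed

definition rkhm :: "('b, 'x => 'b) hilbert_module"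
 where "rkhm = \<lparr>carrier = RKH, mult = undefined, one = undefined, zero = (\<lambda>x\<in>\<Omega>. \<zero>),
  add = fun_add, smult = fun_smult, ract = fun_ract, ip = rkhm_ip\<rparr>"

lemma rkhm_simps [simp]:
 "carrier rkhm = RKH" "\<zero>\<^bsub>rkhm\<^esub> = (\<lambda>x\<in>\<Omega>. \<zero>)" "(\<oplus>\<^bsub>rkhm\<^esub>) = fun_add"
 "smult rkhm = fun_smult" "ract rkhm = fun_ract" "ip rkhm = rkhm_ip" by (simp_all add: rkhm_def)

lemma rkhm_value_closed: "[|f \<in> RKH; x \<in> \<Omega>|] ==> f x \<in> carrier B" by (auto dest: RKHD)

lemma rkhm_eqI:
 assumes "f \<in> RKH" "g \<in> RKH" "!!x. x \<in> \<Omega> ==> f x = g x"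
 shows "f = g"
proof (rule extensionalityI)
 show "f \<in> extensional \<Omega>" "g \<in> extensional \<Omega>" using RKHD[OF assms(1)] RKHD[OF assms(2)] by (simp_all add: PiE_def)
qed (rule assms(3))

lemma rkhm_zero: "(\<lambda>x\<in>\<Omega>. \<zero>) \<in> RKH"
proof -
 have "kernel_fun [] = (\<lambda>x\<in>\<Omega>. \<zero>)" by (simp add: kernel_fun_def)
 then show ?thesis using kernel_fun_in_rkhm[of "[]"] by simp
qed

lemma fun_ops_apply [simp]:
 "x \<in> \<Omega> ==> fun_add f g x = f x \<oplus> g x" "x \<in> \<Omega> ==> fun_smult z f x = z \<odot> f x"
 "x \<in> \<Omega> ==> fun_ract f b x = f x \<otimes> b" by (simp_all add: fun_add_def fun_smult_def fun_ract_def)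

lemma rkhm_abelian_group: "abelian_group rkhm"
proof (rule abelian_groupI; simp)
 fix f g h assume f: "f \<in> RKH" and g: "g \<in> RKH" and h: "h \<in> RKH"
 show "fun_add f g \<in> RKH" by (rule rkhm_add[OF f g])
 show "fun_add (fun_add f g) h = fun_add f (fun_add g h)"
  by (rule rkhm_eqI) (simp_all add: rkhm_add f g h B.M.a_assoc rkhm_value_closed)
 show "fun_add f g = fun_add g f" by (rule rkhm_eqI) (simp_all add: rkhm_add f g B.M.a_comm rkhm_value_closed)
 show "fun_add (\<lambda>x\<in>\<Omega>. \<zero>) f = f" by (rule rkhm_eqI) (simp_all add: rkhm_add rkhm_zero f rkhm_value_closed)
 show "\<exists>y\<in>RKH. fun_add y f = (\<lambda>x\<in>\<Omega>. \<zero>)"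
 proof (rule bexI[of _ "fun_smult (- 1) f"])
  show "fun_add (fun_smult (- 1) f) f = (\<lambda>x\<in>\<Omega>. \<zero>)" by (rule rkhm_eqI)
    (simp_all add: rkhm_add rkhm_smult rkhm_zero f rkhm_value_closed smult_minus_1 B.M.l_neg)
 qed (rule rkhm_smult[OF f])
qed (rule rkhm_zero)

lemma rkhm_pre_hilbert: "pre_hilbert_module B rkhm"
proof -
 have mod: "Module.module complex_ring rkhm"
 proof (rule moduleI[OF cring_from_type_algebra rkhm_abelian_group]; simp)
  fix f g z w assume f: "f \<in> RKH"
  show "fun_smult z f \<in> RKH" by (rule rkhm_smult[OF f])
  show "fun_smult (z + w) f = fun_add (fun_smult z f) (fun_smult w f)"
   by (rule rkhm_eqI) (simp_all add: rkhm_add rkhm_smult f rkhm_value_closed smult_add_left)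
  show "fun_smult (z * w) f = fun_smult z (fun_smult w f)"
   by (rule rkhm_eqI) (simp_all add: rkhm_smult f rkhm_value_closed smult_smult)
  show "fun_smult 1 f = f" by (rule rkhm_eqI) (simp_all add: rkhm_smult f rkhm_value_closed)
  assume g: "g \<in> RKH"
  show "fun_smult z (fun_add f g) = fun_add (fun_smult z f) (fun_smult z g)"
   by (rule rkhm_eqI) (simp_all add: rkhm_add rkhm_smult f g rkhm_value_closed smult_add_right)
 qed
 show ?thesis
 proof (intro pre_hilbert_module.intro[OF mod] pre_hilbert_module_axioms.intro; simp)
  fix f g h z b c
  assume f: "f \<in> RKH"
  show "positive B (rkhm_ip f f)" by (rule rkhm_ip_positive[OF f])
  show "(rkhm_ip f f = \<zero>) = (f = (\<lambda>x\<in>\<Omega>. \<zero>))"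
  proof
   assume "rkhm_ip f f = \<zero>"
   then show "f = (\<lambda>x\<in>\<Omega>. \<zero>)" by (intro rkhm_eqI f rkhm_zero) (simp add: rkhm_ip_definite[OF f])
  next
   assume f0: "f = (\<lambda>x\<in>\<Omega>. \<zero>)"
   have "kernel_fun [] = (\<lambda>x\<in>\<Omega>. \<zero>)" by (simp add: kernel_fun_def)
   then show "rkhm_ip f f = \<zero>" using rkhm_reproducing[of "[]" f] f f0 by simp
  qed
  {
   assume b: "b \<in> carrier B"
   show "fun_ract f b \<in> RKH" by (rule rkhm_ract[OF f b])
   show "fun_ract (fun_smult z f) b = fun_smult z (fun_ract f b)"
    by (rule rkhm_eqI) (simp_all add: rkhm_smult rkhm_ract f b rkhm_value_closed smult_mult_left)
   show "fun_ract f (z \<odot> b) = fun_smult z (fun_ract f b)"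
    by (rule rkhm_eqI) (simp_all add: rkhm_smult rkhm_ract f b rkhm_value_closed smult_mult_right)
   assume c: "c \<in> carrier B"
   show "fun_ract f (b \<oplus> c) = fun_add (fun_ract f b) (fun_ract f c)"
    by (rule rkhm_eqI) (simp_all add: rkhm_add rkhm_ract f b c rkhm_value_closed mult_distr_right)
   show "fun_ract f (b \<otimes> c) = fun_ract (fun_ract f b) c"
    by (rule rkhm_eqI) (simp_all add: rkhm_ract f b c rkhm_value_closed mult_assoc)
  }
  assume g: "g \<in> RKH"
  show "rkhm_ip f g \<in> carrier B" by (rule rkhm_ip_closed[OF f g])
  show "star B (rkhm_ip f g) = rkhm_ip g f" by (rule rkhm_ip_star[OF f g])
  show "rkhm_ip f (fun_smult z g) = z \<odot> rkhm_ip f g" by (rule rkhm_ip_smult[OF f g])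
  {
   assume b: "b \<in> carrier B"
   show "fun_ract (fun_add f g) b = fun_add (fun_ract f b) (fun_ract g b)"
    by (rule rkhm_eqI) (simp_all add: rkhm_add rkhm_ract f g b rkhm_value_closed mult_distr_left)
   show "rkhm_ip f (fun_ract g b) = rkhm_ip f g \<otimes> b" by (rule rkhm_ip_ract[OF f g b])
  }
  assume h: "h \<in> RKH"
  show "rkhm_ip f (fun_add g h) = rkhm_ip f g \<oplus> rkhm_ip f h" by (rule rkhm_ip_add[OF f g h])
 qed
qed

sublocale H: lc_pre_hilbert B rkhm by (intro lc_pre_hilbert.intro locally_cstar_algebra_axioms rkhm_pre_hilbert)

end

context positive_definite_kernel
begin

lemma rkhm_minus:
 assumes f: "f \<in> RKH" and g: "g \<in> RKH"
 shows "f \<ominus>\<^bsub>rkhm\<^esub> g = fun_diff f g"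
proof -
 have "\<ominus>\<^bsub>rkhm\<^esub> g = fun_smult (- 1) g" using H.V.smult_minus_1[of g] g by simp
 then have "f \<ominus>\<^bsub>rkhm\<^esub> g = fun_add f (fun_smult (- 1) g)" by (simp add: a_minus_def)
 also have "... = fun_diff f g"
 proof (rule extensionalityI)
  fix x assume "x \<in> \<Omega>"
  then show "fun_add f (fun_smult (- 1) g) x = fun_diff f g x" using rkhm_value_closed[OF f] rkhm_value_closed[OF g]
   by (simp add: fun_diff_def smult_minus_1 B.M.minus_eq)
 qed (simp_all add: fun_add_def fun_diff_def)
 finally show ?thesis .
qed

lemma rkhm_diff_closed: "[|f \<in> RKH; g \<in> RKH|] ==> fun_diff f g \<in> RKH"
 using H.E.M.minus_closed[of f g] rkhm_minus[of f g] by simp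

lemma hm_norm_kernel_fun: "set l \<subseteq> \<Omega> ==> hm_norm rkhm q (kernel_fun l) = gram_norm q l"
 by (simp add: hm_norm_def gram_norm_def rkhm_reproducing kernel_fun_in_rkhm lsum_kernel_fun)

lemma rkhm_lsum_le:
 assumes f: "f \<in> RKH" and q: "q \<in> \<S> B" and l: "set l \<subseteq> \<Omega>"
 shows "q (lsum B f l) \<le> hm_norm rkhm q f * gram_norm q l" using H.Cauchy_Schwarz[OF q, of "kernel_fun l" f] f l
 by (simp add: rkhm_reproducing kernel_fun_in_rkhm hm_norm_kernel_fun mult.commute)

lemma bounded_by_hm_norm:
 assumes f: "f \<in> RKH" and C: "hm_norm rkhm q f \<le> C"
 shows "bounded_by f q C"
proof (rule bounded_byI)
 fix r l assume r: "r \<in> \<S> B" and rq: "!!b. b \<in> carrier B ==> r b \<le> q b" and l: "set l \<subseteq> \<Omega>"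
 have "hm_norm rkhm r f \<le> C" using H.hm_norm_mono[of f r q] f rq C by force
 then have "hm_norm rkhm r f * gram_norm r l \<le> C * gram_norm r l" using gram_norm_nonneg[OF r l] by (rule mult_right_mono)
 with rkhm_lsum_le[OF f r l] show "r (lsum B f l) \<le> C * gram_norm r l" by linarith
qed

lemma hm_norm_le_if_bounded_by:
 assumes f: "f \<in> RKH" and q: "q \<in> \<S> B" and b: "bounded_by f q C" and C: "0 \<le> C"
 shows "hm_norm rkhm q f \<le> C"
proof -
 interpret q: seminormed_module B q by (rule cont_seminorm_seminormed[OF q])
 have "q (rkhm_ip f f) \<le> C\<^sup>2"
 proof (rule field_le_epsilon)
  fix eps :: real assume eps: "eps > 0"
  obtain K where K: "K \<ge> 0" "!!l eps. [|set l \<subseteq> \<Omega>; eps > 0; approx f l q eps|] ==>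
   q (rkhm_ip f f \<ominus> lsum B f l) \<le> K * eps" using rkhm_ip_relE[OF rkhm_ip[OF f f] q] by blast
  define del where "del = eps / (K + C + 1)"
  have del: "del > 0" "(K + C + 1) * del = eps" using K(1) C eps by (simp_all add: del_def)
  obtain l where l: "set l \<subseteq> \<Omega>" "approx f l q del" by (rule rkhm_approx[OF f q del(1)])
  have s: "lsum B f l \<in> carrier B" by (rule lsum_in[OF RKHD[OF f] l(1)])
  have "q (rkhm_ip f f) \<le> q (rkhm_ip f f \<ominus> lsum B f l) + q (lsum B f l)" by (rule q.le_diff_add[OF rkhm_ip_closed[OF f f] s])
  also have "... \<le> K * del + C * gram_norm q l" by (intro add_mono K(2) l del bounded_byD_self[OF b q])
  also have "C * gram_norm q l \<le> C * (del + C)"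
   using gram_norm_approx_le[OF q RKHD[OF f] l b] del(1) C by (intro mult_left_mono) simp_all
  finally have "q (rkhm_ip f f) \<le> C\<^sup>2 + (K + C) * del" by (simp add: power2_eq_square algebra_simps)
  also have "(K + C) * del \<le> eps" using del by (simp add: algebra_simps)
  finally show "q (rkhm_ip f f) \<le> C\<^sup>2 + eps" by simp
 qed
 then show ?thesis using C real_sqrt_le_mono[of "q (rkhm_ip f f)" "C\<^sup>2"] by (simp add: hm_norm_def)
qed

lemma eventually_lsum_close:
 assumes q: "q \<in> \<S> B" and eps: "eps > 0" and l: "set l \<subseteq> \<Omega>"
  and carrier: "eventually (\<lambda>\<phi>. \<phi> \<in> RKH) F" and h: "h \<in> funs"
  and lim: "!!x eps. x \<in> \<Omega> ==> eps > 0 ==> eventually (\<lambda>\<phi>. q (\<phi> x \<ominus> h x) < eps) F"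
 shows "eventually (\<lambda>\<phi>. q (lsum B \<phi> l \<ominus> lsum B h l) < eps) F" using l eps
proof (induction l arbitrary: eps)
 case Nil
 interpret q: seminormed_module B q by (rule cont_seminorm_seminormed[OF q])
 show ?case using Nil by simp
next
 case (Cons x l)
 interpret q: seminormed_module B q by (rule cont_seminorm_seminormed[OF q])
 have x: "x \<in> \<Omega>" and l: "set l \<subseteq> \<Omega>" and eps2: "eps / 2 > 0" using Cons.prems by simp_all
 have "eventually (\<lambda>\<phi>. \<phi> \<in> RKH \<and> q (\<phi> x \<ominus> h x) < eps / 2 \<and> q (lsum B \<phi> l \<ominus> lsum B h l) < eps / 2) F"
  by (intro eventually_conj carrier lim x eps2 Cons.IH l)
 then show ?case
 proof (rule eventually_mono)
  fix \<phi> assume \<phi>: "\<phi> \<in> RKH \<and> q (\<phi> x \<ominus> h x) < eps / 2 \<and> q (lsum B \<phi> l \<ominus> lsum B h l) < eps / 2"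
  have "h x \<in> carrier B" using h x by auto
  then have "q ((\<phi> x \<oplus> lsum B \<phi> l) \<ominus> (h x \<oplus> lsum B h l)) \<le> q (\<phi> x \<ominus> h x) + q (lsum B \<phi> l \<ominus> lsum B h l)"
   using \<phi> rkhm_value_closed[of \<phi> x] x lsum_in[OF RKHD l, of \<phi>] lsum_in[OF h l] by (intro q.add_diff_add_le) simp_all
  with \<phi> show "q (lsum B \<phi> (x # l) \<ominus> lsum B h (x # l)) < eps" by simp
 qed
qed

text \<open>
 Evaluation at a point is bounded, so a Cauchy filter converges pointwise. The Cauchy estimate
 bounds the functional of the difference on finite sums, and this bound survives the pointwise limit.
\<close>

lemma rkhm_complete: "seminorm_complete rkhm (hm_norm rkhm ` \<S> B)" unfolding seminorm_complete_def
proof (intro allI impI)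
 fix F :: "('x => 'b) filter"
 assume F: "F \<noteq> bot" and le: "F \<le> principal (carrier rkhm)"
  and cauchy: "\<forall>p\<in>hm_norm rkhm ` \<S> B. \<forall>eps>0. \<forall>\<^sub>F (\<phi>, \<psi>) in F \<times>\<^sub>F F. p (\<phi> \<ominus>\<^bsub>rkhm\<^esub> \<psi>) < eps"
 have carrier: "eventually (\<lambda>\<phi>. \<phi> \<in> RKH) F" using le by (simp add: le_principal)
 have Q: "\<exists>Q. eventually Q F \<and> (\<forall>\<phi> \<psi>. Q \<phi> --> Q \<psi> --> \<phi> \<in> RKH \<and> \<psi> \<in> RKH \<and> hm_norm rkhm q (fun_diff \<phi> \<psi>) < eps)"
  if q: "q \<in> \<S> B" and eps: "eps > 0" for q and eps :: real
 proof -
  have "\<forall>\<^sub>F (\<phi>, \<psi>) in F \<times>\<^sub>F F. hm_norm rkhm q (\<phi> \<ominus>\<^bsub>rkhm\<^esub> \<psi>) < eps" using cauchy q eps by blast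
  then obtain P1 P2 where P: "eventually P1 F" "eventually P2 F" "!!\<phi> \<psi>. P1 \<phi> ==> P2 \<psi> ==> hm_norm rkhm q (\<phi> \<ominus>\<^bsub>rkhm\<^esub> \<psi>) < eps"
   unfolding eventually_prod_filter by auto
  have "eventually (\<lambda>\<phi>. (P1 \<phi> \<and> P2 \<phi>) \<and> \<phi> \<in> RKH) F" by (intro eventually_conj P carrier)
  moreover have "hm_norm rkhm q (fun_diff \<phi> \<psi>) < eps" if "P1 \<phi>" "P2 \<psi>" "\<phi> \<in> RKH" "\<psi> \<in> RKH" for \<phi> \<psi>
   using P(3)[OF that(1,2)] rkhm_minus[OF that(3,4)] by simp
  ultimately show ?thesis by (intro exI[of _ "\<lambda>\<phi>. (P1 \<phi> \<and> P2 \<phi>) \<and> \<phi> \<in> RKH"]) blast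
 qed
 have "\<exists>b\<in>carrier B. \<forall>q\<in>\<S> B. \<forall>eps>0. eventually (\<lambda>\<phi>. q (\<phi> x \<ominus> b) < eps) F" if x: "x \<in> \<Omega>" for x
 proof (rule complete_filter[OF F])
  show "eventually (\<lambda>\<phi>. \<phi> x \<in> carrier B) F" by (rule eventually_mono[OF carrier]) (rule rkhm_value_closed[OF _ x])
  fix q and eps :: real assume q: "q \<in> \<S> B" and eps: "eps > 0"
  have x1: "set [x] \<subseteq> \<Omega>" using x by simp
  let ?N = "gram_norm q [x]"
  have N: "?N \<ge> 0" by (rule gram_norm_nonneg[OF q x1])
  define del where "del = eps / (?N + 1)"
  have del: "del > 0" "del * (?N + 1) = eps" using N eps by (simp_all add: del_def)
  obtain Q where Q: "eventually Q F"
   "!!\<phi> \<psi>. Q \<phi> ==> Q \<psi> ==> \<phi> \<in> RKH \<and> \<psi> \<in> RKH \<and> hm_norm rkhm q (fun_diff \<phi> \<psi>) < del" using Q[OF q del(1)] by blast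
  have "q (\<phi> x \<ominus> \<psi> x) < eps" if "Q \<phi>" "Q \<psi>" for \<phi> \<psi>
  proof -
   note pq = Q(2)[OF that]
   have c: "\<phi> x \<in> carrier B" "\<psi> x \<in> carrier B" using pq rkhm_value_closed x by blast+
   have "q (lsum B (fun_diff \<phi> \<psi>) [x]) \<le> hm_norm rkhm q (fun_diff \<phi> \<psi>) * ?N"
    by (rule rkhm_lsum_le[OF _ q x1]) (use pq rkhm_diff_closed in blast)
   also have "... \<le> del * ?N" using pq N by (intro mult_right_mono) simp_all
   also have "... < eps" using del by (simp add: distrib_left)
   finally show ?thesis using c x by (simp add: fun_diff_def)
  qed
  with Q(1) show "\<exists>Q. eventually Q F \<and> (\<forall>\<phi> \<psi>. Q \<phi> --> Q \<psi> --> q (\<phi> x \<ominus> \<psi> x) < eps)" by blast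
 qed
 then obtain h0 where h0: "!!x. x \<in> \<Omega> ==> h0 x \<in> carrier B"
  "!!x q eps. x \<in> \<Omega> ==> q \<in> \<S> B ==> eps > 0 ==> eventually (\<lambda>\<phi>. q (\<phi> x \<ominus> h0 x) < eps) F" by metis
 define h where "h = restrict h0 \<Omega>"
 have h: "h \<in> funs" using h0(1) by (simp add: h_def)
 have hlim: "eventually (\<lambda>\<phi>. q (\<phi> x \<ominus> h x) < eps) F" if "x \<in> \<Omega>" "q \<in> \<S> B" "eps > 0" for x q eps
  using h0(2)[OF that] that(1) by (simp add: h_def)
 have close: "\<exists>Q. eventually Q F \<and> (\<forall>\<phi>. Q \<phi> --> \<phi> \<in> RKH \<and> bounded_by (fun_diff \<phi> h) q eps)"
  if q: "q \<in> \<S> B" and eps: "eps > 0" for q eps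
 proof -
  obtain Q where Q: "eventually Q F"
   "!!\<phi> \<psi>. Q \<phi> ==> Q \<psi> ==> \<phi> \<in> RKH \<and> \<psi> \<in> RKH \<and> hm_norm rkhm q (fun_diff \<phi> \<psi>) < eps" using Q[OF q eps] by blast
  have "bounded_by (fun_diff \<phi> h) q eps" if \<phi>: "Q \<phi>" for \<phi>
  proof (rule bounded_byI)
   fix r l assume r: "r \<in> \<S> B" and rq: "!!b. b \<in> carrier B ==> r b \<le> q b" and l: "set l \<subseteq> \<Omega>"
   interpret r: seminormed_module B r by (rule cont_seminorm_seminormed[OF r])
   have \<phi>H: "\<phi> \<in> RKH" using Q(2)[OF \<phi> \<phi>] by blast
   note \<phi>' = RKHD[OF \<phi>H]
   have "r (lsum B \<phi> l \<ominus> lsum B h l) \<le> eps * gram_norm r l"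
   proof (rule field_le_epsilon)
    fix del :: real assume del: "del > 0"
    have "eventually (\<lambda>\<psi>. r (lsum B \<psi> l \<ominus> lsum B h l) < del) F"
     by (rule eventually_lsum_close[OF r del l carrier h]) (rule hlim[OF _ r])
    then have "eventually (\<lambda>\<psi>. r (lsum B \<psi> l \<ominus> lsum B h l) < del \<and> Q \<psi>) F" using Q(1) by (rule eventually_conj)
    from eventually_happens'[OF F this]
    obtain \<psi> where \<psi>: "r (lsum B \<psi> l \<ominus> lsum B h l) < del" "Q \<psi>" by blast
    note pq = Q(2)[OF \<phi> \<psi>(2)]
    have \<psi>': "\<psi> \<in> funs" using pq by (intro RKHD) simp
    have "bounded_by (fun_diff \<phi> \<psi>) q eps"
     by (rule bounded_by_hm_norm) (use pq rkhm_diff_closed in \<open>simp_all add: less_imp_le\<close>)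
    from bounded_byD[OF this r rq l]
    have "r (lsum B \<phi> l \<ominus> lsum B \<psi> l) \<le> eps * gram_norm r l" by (simp add: lsum_fun_diff[OF \<phi>' \<psi>' l])
    moreover have "r (lsum B \<phi> l \<ominus> lsum B h l) \<le> r (lsum B \<phi> l \<ominus> lsum B \<psi> l) + r (lsum B \<psi> l \<ominus> lsum B h l)"
     by (intro r.diff_triangle lsum_in \<phi>' \<psi>' h l)
    ultimately show "r (lsum B \<phi> l \<ominus> lsum B h l) \<le> eps * gram_norm r l + del" using \<psi>(1) by linarith
   qed
   then show "r (lsum B (fun_diff \<phi> h) l) \<le> eps * gram_norm r l" by (simp add: lsum_fun_diff[OF \<phi>' h l])
  qed
  with Q show ?thesis by blast
 qed
 have hH: "h \<in> RKH"
 proof (rule RKHI[OF h])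
  fix q and eps :: real assume q: "q \<in> \<S> B" and "eps > 0"
  then have eps2: "eps / 2 > 0" by simp
  obtain Q where Q: "eventually Q F" "!!\<phi>. Q \<phi> ==> \<phi> \<in> RKH \<and> bounded_by (fun_diff \<phi> h) q (eps / 2)"
   using close[OF q eps2] by blast
  obtain \<phi> where \<phi>: "\<phi> \<in> RKH" "bounded_by (fun_diff \<phi> h) q (eps / 2)" using eventually_happens'[OF F Q(1)] Q(2) by blast
  obtain l where l: "set l \<subseteq> \<Omega>" "approx \<phi> l q (eps / 2)" by (rule rkhm_approx[OF \<phi>(1) q eps2])
  note \<phi>' = RKHD[OF \<phi>(1)]
  have "approx h l q (eps / 2 + eps / 2)"
   by (rule bounded_by_diff_trans[OF q h \<phi>' kernel_fun_in[OF l(1)] bounded_by_diff_sym[OF q \<phi>' h \<phi>(2)] l(2)])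
  with l(1) show "\<exists>l. set l \<subseteq> \<Omega> \<and> approx h l q eps" by auto
 qed
 show "\<exists>h\<in>carrier rkhm. \<forall>p\<in>hm_norm rkhm ` \<S> B. ((\<lambda>\<phi>. p (\<phi> \<ominus>\<^bsub>rkhm\<^esub> h)) \<longlongrightarrow> 0) F"
 proof (rule bexI[of _ h], intro ballI)
  fix p assume "p \<in> hm_norm rkhm ` \<S> B"
  then obtain q where q: "q \<in> \<S> B" "p = hm_norm rkhm q" by blast
  show "((\<lambda>\<phi>. p (\<phi> \<ominus>\<^bsub>rkhm\<^esub> h)) \<longlongrightarrow> 0) F"
  proof (rule tendstoI)
   fix eps :: real assume eps: "eps > 0"
   then have eps2: "eps / 2 > 0" by simp
   obtain Q where Q: "eventually Q F" "!!\<phi>. Q \<phi> ==> \<phi> \<in> RKH \<and> bounded_by (fun_diff \<phi> h) q (eps / 2)"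
    using close[OF q(1) eps2] by blast
   show "eventually (\<lambda>\<phi>. dist (p (\<phi> \<ominus>\<^bsub>rkhm\<^esub> h)) 0 < eps) F"
   proof (rule eventually_mono[OF Q(1)])
    fix \<phi> assume "Q \<phi>"
    then have \<phi>: "\<phi> \<in> RKH" "bounded_by (fun_diff \<phi> h) q (eps / 2)" using Q(2) by blast+
    have d: "fun_diff \<phi> h \<in> RKH" by (rule rkhm_diff_closed[OF \<phi>(1) hH])
    have "hm_norm rkhm q (fun_diff \<phi> h) \<le> eps / 2" by (rule hm_norm_le_if_bounded_by[OF d q(1) \<phi>(2)]) (use eps in simp)
    moreover have "0 \<le> hm_norm rkhm q (fun_diff \<phi> h)" using H.hm_norm_nonneg[OF q(1)] d by simp
    ultimately show "dist (p (\<phi> \<ominus>\<^bsub>rkhm\<^esub> h)) 0 < eps" using eps by (simp add: dist_real_def q(2) rkhm_minus[OF \<phi>(1) hH])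
   qed
  qed
 qed (simp add: hH)
qed

lemma lsum_rkhm:
 assumes "set l \<subseteq> \<Omega>"
 shows "lsum rkhm (\<lambda>x. kernel_fun [x]) l = kernel_fun l" using assms
proof (induction l)
 case Nil
 show ?case by (simp add: kernel_fun_def)
next
 case (Cons x l)
 then show ?case using kernel_fun_ops(1)[of "[x]" l] by simp
qed

theorem kernel_realization:
 "\<exists>(H :: ('b, 'x => 'b) hilbert_module) \<iota>. hilbert_module B H \<and> (\<forall>x\<in>\<Omega>. \<iota> x \<in> carrier H) \<and>
  (\<forall>x\<in>\<Omega>. \<forall>y\<in>\<Omega>. ip H (\<iota> x) (\<iota> y) = \<kappa> x y) \<and>
  (\<forall>\<xi>\<in>carrier H. \<forall>q\<in>\<S> B. \<forall>eps>0. \<exists>l. set l \<subseteq> \<Omega> \<and> hm_norm H q (lsum H \<iota> l \<ominus>\<^bsub>H\<^esub> \<xi>) < eps)"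
proof -
 have "hilbert_module B rkhm" by (intro hilbert_module.intro rkhm_pre_hilbert hilbert_module_axioms.intro rkhm_complete)
 moreover have "kernel_fun [x] \<in> carrier rkhm" if "x \<in> \<Omega>" for x using that by (simp add: kernel_fun_in_rkhm)
 moreover have "ip rkhm (kernel_fun [x]) (kernel_fun [y]) = \<kappa> x y" if "x \<in> \<Omega>" "y \<in> \<Omega>" for x y
  using that by (simp add: rkhm_reproducing kernel_fun_in_rkhm kernel_fun_eq_gram gram_def)
 moreover have "\<exists>l. set l \<subseteq> \<Omega> \<and> hm_norm rkhm q (lsum rkhm (\<lambda>x. kernel_fun [x]) l \<ominus>\<^bsub>rkhm\<^esub> f) < eps"
  if "f \<in> carrier rkhm" and q: "q \<in> \<S> B" and eps: "eps > 0" for f q and eps :: real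
 proof -
  have f: "f \<in> RKH" and eps2: "eps / 2 > 0" using that by simp_all
  obtain l where l: "set l \<subseteq> \<Omega>" "approx f l q (eps / 2)" by (rule rkhm_approx[OF f q eps2])
  note k = kernel_fun_in_rkhm[OF l(1)]
  have "hm_norm rkhm q (fun_diff (kernel_fun l) f) \<le> eps / 2" by (rule hm_norm_le_if_bounded_by[OF rkhm_diff_closed[OF k f] q
      bounded_by_diff_sym[OF q RKHD[OF f] RKHD[OF k] l(2)]]) (use eps in simp)
  then show ?thesis using l(1) eps by (intro exI[of _ l]) (simp add: lsum_rkhm rkhm_minus[OF k f])
 qed
 ultimately show ?thesis by (intro exI[of _ rkhm] exI[of _ "\<lambda>x. kernel_fun [x]"]) blast
qed

end

section \<open>Adjointable operators\<close>

locale hilbert_pair = E: lc_hilbert B E + F: lc_hilbert B F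
 for B :: "'b star_algebra" and E :: "('b, 'e) hilbert_module" (structure) and F :: "('b, 'f) hilbert_module"
begin

text \<open>
 A pair of functions with $\langle T\xi,\eta\rangle = \langle\xi,S\eta\rangle$ is automatically linear and
 \<open>B\<close>-linear, because vectors are determined by their inner products.
\<close>

definition adjoint_pair :: "('e => 'f) => ('f => 'e) => bool"
 where "adjoint_pair T S \<longleftrightarrow> (\<forall>\<xi>\<in>carrier E. T \<xi> \<in> carrier F) \<and> (\<forall>\<eta>\<in>carrier F. S \<eta> \<in> carrier E) \<and>
  (\<forall>\<xi>\<in>carrier E. \<forall>\<eta>\<in>carrier F. ip F (T \<xi>) \<eta> = ip E \<xi> (S \<eta>))"

lemma adjoint_pair_morphism:
 assumes "adjoint_pair T S"
 shows "restrict T (carrier E) \<in> module_morphisms B E F"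
proof -
 have T: "!!\<xi>. \<xi> \<in> carrier E ==> T \<xi> \<in> carrier F" and S: "!!\<eta>. \<eta> \<in> carrier F ==> S \<eta> \<in> carrier E"
  and adj: "!!\<xi> \<eta>. [|\<xi> \<in> carrier E; \<eta> \<in> carrier F|] ==> ip F (T \<xi>) \<eta> = ip E \<xi> (S \<eta>)"
  using assms unfolding adjoint_pair_def by blast+
 have add: "T (\<xi> \<oplus> \<zeta>) = T \<xi> \<oplus>\<^bsub>F\<^esub> T \<zeta>" if "\<xi> \<in> carrier E" "\<zeta> \<in> carrier E" for \<xi> \<zeta>
  using that by (intro F.hm_eqI) (simp_all add: T S adj E.ip_add_left F.ip_add_left)
 have smult: "T (z \<odot> \<xi>) = z \<odot>\<^bsub>F\<^esub> T \<xi>" if "\<xi> \<in> carrier E" for z \<xi>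
  using that by (intro F.hm_eqI) (simp_all add: T S adj E.ip_smult_left F.ip_smult_left)
 have ract: "T (ract E \<xi> b) = ract F (T \<xi>) b" if "\<xi> \<in> carrier E" "b \<in> carrier B" for \<xi> b
  using that by (intro F.hm_eqI) (simp_all add: T S adj E.ip_ract_left F.ip_ract_left)
 show ?thesis unfolding module_morphisms_def linear_on_def by (auto simp: T add smult ract)
qed

lemma is_adjoint_unique:
 assumes "is_adjoint B E F T S" "is_adjoint B E F T S'"
 shows "S = S'"
proof (rule extensionalityI[of _ "carrier F"])
 show "S \<in> extensional (carrier F)" "S' \<in> extensional (carrier F)"
  using assms unfolding is_adjoint_def module_morphisms_def by (auto simp: PiE_def)
 fix \<eta> assume \<eta>: "\<eta> \<in> carrier F"
 have S: "S \<eta> \<in> carrier E" "S' \<eta> \<in> carrier E" using assms \<eta> unfolding is_adjoint_def module_morphisms_def by auto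
 show "S \<eta> = S' \<eta>"
 proof (rule E.hm_eqI[OF S])
  fix \<zeta> assume \<zeta>: "\<zeta> \<in> carrier E"
  have "ip E \<zeta> (S \<eta>) = ip E \<zeta> (S' \<eta>)" using assms \<eta> \<zeta> unfolding is_adjoint_def by metis
  then have "star B (ip E \<zeta> (S \<eta>)) = star B (ip E \<zeta> (S' \<eta>))" by simp
  then show "ip E (S \<eta>) \<zeta> = ip E (S' \<eta>) \<zeta>" using S \<zeta> by (simp add: E.E.ip_star)
 qed
qed

lemma adjoint_eqI: "is_adjoint B E F T S ==> adjoint B E F T = S" unfolding adjoint_def using is_adjoint_unique by blast

lemma adjointable_closed: "[|T \<in> adjointable B E F; \<xi> \<in> carrier E|] ==> T \<xi> \<in> carrier F"
 unfolding adjointable_def module_morphisms_def by auto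

lemma adjointable_extensional: "T \<in> adjointable B E F ==> T \<in> extensional (carrier E)"
 unfolding adjointable_def module_morphisms_def by (auto simp: PiE_def)

lemma adjointable_restrict: "T \<in> adjointable B E F ==> restrict T (carrier E) = T"
 by (rule extensional_restrict[OF adjointable_extensional])

lemma adjointable_is_adjoint: "T \<in> adjointable B E F ==> is_adjoint B E F T (adjoint B E F T)"
 unfolding adjointable_def using adjoint_eqI by auto

lemma adjoint_closed: "[|T \<in> adjointable B E F; \<eta> \<in> carrier F|] ==> adjoint B E F T \<eta> \<in> carrier E"
 using adjointable_is_adjoint[of T] unfolding is_adjoint_def module_morphisms_def by auto

lemma adjoint_extensional: "T \<in> adjointable B E F ==> adjoint B E F T \<in> extensional (carrier F)"
 using adjointable_is_adjoint[of T] unfolding is_adjoint_def module_morphisms_def by (auto simp: PiE_def)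

lemma ip_adjoint:
 "[|T \<in> adjointable B E F; \<xi> \<in> carrier E; \<eta> \<in> carrier F|] ==> ip F (T \<xi>) \<eta> = ip E \<xi> (adjoint B E F T \<eta>)"
 using adjointable_is_adjoint[of T] unfolding is_adjoint_def by blast

lemma ip_adjoint':
 assumes "T \<in> adjointable B E F" "\<xi> \<in> carrier E" "\<eta> \<in> carrier F"
 shows "ip E (adjoint B E F T \<eta>) \<xi> = ip F \<eta> (T \<xi>)"
proof -
 have "star B (ip F (T \<xi>) \<eta>) = star B (ip E \<xi> (adjoint B E F T \<eta>))" using ip_adjoint[OF assms] by simp
 then show ?thesis using assms adjoint_closed adjointable_closed by (simp add: E.E.ip_star F.E.ip_star)
qed

lemma adjointable_add:
 "[|T \<in> adjointable B E F; \<xi> \<in> carrier E; \<zeta> \<in> carrier E|] ==> T (\<xi> \<oplus> \<zeta>) = T \<xi> \<oplus>\<^bsub>F\<^esub> T \<zeta>"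
 unfolding adjointable_def module_morphisms_def linear_on_def by auto

lemma adjointable_zero: "T \<in> adjointable B E F ==> T \<zero> = \<zero>\<^bsub>F\<^esub>"
 using adjointable_closed[of T "\<zero>"] unfolding adjointable_def module_morphisms_def linear_on_def
 by clarsimp (metis E.V.smult_zero_right E.E.M.zero_closed F.V.smult_zero_left)

lemma adjointable_smult:
 "[|T \<in> adjointable B E F; \<xi> \<in> carrier E|] ==> T (z \<odot> \<xi>) = z \<odot>\<^bsub>F\<^esub> T \<xi>"
 unfolding adjointable_def module_morphisms_def linear_on_def by auto

lemma adjointable_diff:
 assumes "T \<in> adjointable B E F" "\<xi> \<in> carrier E" "\<zeta> \<in> carrier E"
 shows "T (\<xi> \<ominus> \<zeta>) = T \<xi> \<ominus>\<^bsub>F\<^esub> T \<zeta>"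
 using adjointable_add[OF assms(1,2), of "\<ominus> \<zeta>"] adjointable_smult[OF assms(1,3), of "- 1"] assms
 by (simp add: E.V.smult_minus_1 F.V.smult_minus_1 E.E.M.minus_eq F.E.M.minus_eq adjointable_closed)

lemma adjointable_adjoint_pair: "T \<in> adjointable B E F ==> adjoint_pair T (adjoint B E F T)"
 unfolding adjoint_pair_def using adjointable_closed adjoint_closed ip_adjoint by blast

lemma adjoint_pair_swap:
 assumes "adjoint_pair T S" "\<xi> \<in> carrier E" "\<eta> \<in> carrier F"
 shows "ip E (S \<eta>) \<xi> = ip F \<eta> (T \<xi>)"
proof -
 have S: "S \<eta> \<in> carrier E" and T: "T \<xi> \<in> carrier F" and adj: "ip F (T \<xi>) \<eta> = ip E \<xi> (S \<eta>)"
  using assms unfolding adjoint_pair_def by blast+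
 have "ip E (S \<eta>) \<xi> = star B (ip E \<xi> (S \<eta>))" using E.E.ip_star[OF assms(2) S] by simp
 also have "... = ip F \<eta> (T \<xi>)" unfolding adj[symmetric] by (rule F.E.ip_star[OF T assms(3)])
 finally show ?thesis .
qed

end

sublocale hilbert_pair \<subseteq> flip: hilbert_pair B F E ..

context hilbert_pair
begin

lemma adjoint_pair_flip: "adjoint_pair T S ==> flip.adjoint_pair S T"
 unfolding flip.adjoint_pair_def using adjoint_pair_swap[of T S] by (auto simp: adjoint_pair_def)

lemma adjoint_pair_is_adjoint:
 assumes "adjoint_pair T S"
 shows "is_adjoint B E F (restrict T (carrier E)) (restrict S (carrier F))" unfolding is_adjoint_def
 using flip.adjoint_pair_morphism[OF adjoint_pair_flip[OF assms]] assms by (simp add: adjoint_pair_def)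

lemma adjoint_pair_adjointable:
 assumes "adjoint_pair T S"
 shows "restrict T (carrier E) \<in> adjointable B E F"
  "adjoint B E F (restrict T (carrier E)) = restrict S (carrier F)"
 using adjoint_pair_is_adjoint[OF assms] adjoint_pair_morphism[OF assms] adjoint_eqI unfolding adjointable_def by auto

end

context hilbert_pair
begin

lemma adjoint_adjointable:
 assumes "T \<in> adjointable B E F"
 shows "adjoint B E F T \<in> adjointable B F E" "adjoint B F E (adjoint B E F T) = T"
 using flip.adjoint_pair_adjointable[OF adjoint_pair_flip[OF adjointable_adjoint_pair[OF assms]]]
  extensional_restrict[OF adjoint_extensional[OF assms]] adjointable_restrict[OF assms] by simp_all

lemma adjointable_eqI:
 assumes "T \<in> adjointable B E F" "T' \<in> adjointable B E F" "!!\<xi>. \<xi> \<in> carrier E ==> T \<xi> = T' \<xi>"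
 shows "T = T'" using adjointable_extensional[OF assms(1)] adjointable_extensional[OF assms(2)] assms(3)
 by (rule extensionalityI)

lemma hm_norm_bounded:
 assumes T: "T \<in> adjointable B E F" and q: "q \<in> \<S> B"
 shows "\<exists>C\<ge>0. \<forall>\<xi>\<in>carrier E. hm_norm F q (T \<xi>) \<le> C * hm_norm E q \<xi>"
 by (rule E.adjointable_bounded[OF F.lc_pre_hilbert_axioms adjointable_closed[OF T] adjoint_closed[OF T]
    ip_adjoint[OF T] q])

lemma op_seminorm_bdd:
 assumes T: "T \<in> adjointable B E F" and q: "q \<in> \<S> B"
 shows "bdd_above ((\<lambda>\<xi>. hm_norm F q (T \<xi>)) ` {\<xi> \<in> carrier E. hm_norm E q \<xi> \<le> 1})"
proof -
 obtain C where C: "C \<ge> 0" "!!\<xi>. \<xi> \<in> carrier E ==> hm_norm F q (T \<xi>) \<le> C * hm_norm E q \<xi>"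
  using hm_norm_bounded[OF T q] by blast
 have "hm_norm F q (T \<xi>) \<le> C" if "\<xi> \<in> carrier E" "hm_norm E q \<xi> \<le> 1" for \<xi>
  using C(2)[OF that(1)] mult_left_mono[OF that(2) C(1)] by simp
 then show ?thesis by (intro bdd_aboveI[of _ C]) auto
qed

lemma hm_norm_le_op_seminorm:
 assumes T: "T \<in> adjointable B E F" and q: "q \<in> \<S> B" and \<xi>: "\<xi> \<in> carrier E"
 shows "hm_norm F q (T \<xi>) \<le> op_seminorm E F q T * hm_norm E q \<xi>"
proof -
 interpret qE: seminormed_module E "hm_norm E q" by (rule E.hm_norm_seminormed[OF q])
 interpret qF: seminormed_module F "hm_norm F q" by (rule F.hm_norm_seminormed[OF q])
 show ?thesis
 proof (cases "hm_norm E q \<xi> = 0")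
  case True
  obtain C where "hm_norm F q (T \<xi>) \<le> C * hm_norm E q \<xi>" using hm_norm_bounded[OF T q] \<xi> by blast
  with True show ?thesis by simp
 next
  case False
  with qE.nonneg[OF \<xi>] have pos: "hm_norm E q \<xi> > 0" by simp
  define \<eta> where "\<eta> = complex_of_real (1 / hm_norm E q \<xi>) \<odot> \<xi>"
  have \<eta>: "\<eta> \<in> carrier E" using \<xi> by (simp add: \<eta>_def)
  have c: "cmod (complex_of_real (1 / hm_norm E q \<xi>)) = 1 / hm_norm E q \<xi>" using pos by (simp add: norm_divide)
  have "hm_norm E q \<eta> = 1" unfolding \<eta>_def qE.homogeneous[OF \<xi>] c using pos by simp
  then have "hm_norm F q (T \<eta>) \<le> op_seminorm E F q T"
   unfolding op_seminorm_def by (intro cSUP_upper[OF _ op_seminorm_bdd[OF T q]]) (use \<eta> in simp)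
  moreover have "hm_norm F q (T \<eta>) = (1 / hm_norm E q \<xi>) * hm_norm F q (T \<xi>)"
   unfolding \<eta>_def adjointable_smult[OF T \<xi>] qF.homogeneous[OF adjointable_closed[OF T \<xi>]] c by simp
  ultimately show ?thesis using pos by (simp add: pos_divide_le_eq)
 qed
qed

lemma op_seminorm_le:
 assumes q: "q \<in> \<S> B" and C: "0 \<le> C" "!!\<xi>. \<xi> \<in> carrier E ==> hm_norm F q (T \<xi>) \<le> C * hm_norm E q \<xi>"
 shows "op_seminorm E F q T \<le> C" unfolding op_seminorm_def
proof (rule cSUP_least)
 interpret qE: seminormed_module E "hm_norm E q" by (rule E.hm_norm_seminormed[OF q])
 have "\<zero> \<in> {\<xi> \<in> carrier E. hm_norm E q \<xi> \<le> 1}" by simp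
 then show "{\<xi> \<in> carrier E. hm_norm E q \<xi> \<le> 1} \<noteq> {}" by blast
 fix \<xi> assume "\<xi> \<in> {\<xi> \<in> carrier E. hm_norm E q \<xi> \<le> 1}"
 then show "hm_norm F q (T \<xi>) \<le> C" using C(2)[of \<xi>] mult_left_mono[of "hm_norm E q \<xi>" 1 C] C(1) by auto
qed

lemma op_seminorm_nonneg:
 assumes T: "T \<in> adjointable B E F" and q: "q \<in> \<S> B"
 shows "0 \<le> op_seminorm E F q T"
proof -
 interpret qE: seminormed_module E "hm_norm E q" by (rule E.hm_norm_seminormed[OF q])
 have "hm_norm F q (T \<zero>) \<le> op_seminorm E F q T"
  unfolding op_seminorm_def by (intro cSUP_upper[OF _ op_seminorm_bdd[OF T q]]) simp
 moreover have "0 \<le> hm_norm F q (T \<zero>)" by (rule F.hm_norm_nonneg[OF q]) (simp add: adjointable_closed[OF T])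
 ultimately show ?thesis by linarith
qed

end

lemma compose_adjoint_pair:
 assumes "hilbert_pair B E F" "hilbert_pair B F G" "T \<in> adjointable B E F" "U \<in> adjointable B F G"
 shows "compose (carrier E) U T \<in> adjointable B E G"
  "adjoint B E G (compose (carrier E) U T) = compose (carrier G) (adjoint B E F T) (adjoint B F G U)"
proof -
 interpret EF: hilbert_pair B E F by fact
 interpret FG: hilbert_pair B F G by fact
 interpret EG: hilbert_pair B E G ..
 have "EG.adjoint_pair (\<lambda>\<xi>. U (T \<xi>)) (\<lambda>\<eta>. adjoint B E F T (adjoint B F G U \<eta>))" unfolding EG.adjoint_pair_def
  using assms(3,4) by (simp add: EF.adjointable_closed FG.adjointable_closed EF.adjoint_closed FG.adjoint_closed
    EF.ip_adjoint FG.ip_adjoint)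
 from EG.adjoint_pair_adjointable[OF this]
 show "compose (carrier E) U T \<in> adjointable B E G"
  "adjoint B E G (compose (carrier E) U T) = compose (carrier G) (adjoint B E F T) (adjoint B F G U)"
  by (simp_all add: compose_def)
qed

sublocale lc_hilbert \<subseteq> self: hilbert_pair B E E ..

section \<open>The algebra of adjointable operators\<close>

lemma operator_algebra_simps [simp]:
 "carrier (operator_algebra B E) = adjointable B E E"
 "mult (operator_algebra B E) = compose (carrier E)"
 "zero (operator_algebra B E) = (\<lambda>\<xi>\<in>carrier E. \<zero>\<^bsub>E\<^esub>)"
 "add (operator_algebra B E) = (\<lambda>S T. \<lambda>\<xi>\<in>carrier E. S \<xi> \<oplus>\<^bsub>E\<^esub> T \<xi>)"
 "smult (operator_algebra B E) = (\<lambda>z T. \<lambda>\<xi>\<in>carrier E. z \<odot>\<^bsub>E\<^esub> T \<xi>)"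
 "star (operator_algebra B E) = adjoint B E E"
 unfolding operator_algebra_def operator_module_def star_algebra.fields_def module.extend_def by simp_all

lemma seminorm_topology_cong:
 assumes "carrier M = carrier N" "!!x y. x \<ominus>\<^bsub>M\<^esub> y = x \<ominus>\<^bsub>N\<^esub> y"
 shows "seminorm_topology M P = seminorm_topology N P" unfolding seminorm_topology_def assms ..

lemma operator_algebra_minus: "T \<ominus>\<^bsub>operator_algebra B E\<^esub> S = T \<ominus>\<^bsub>operator_module B E\<^esub> S"
proof -
 have "m_inv (add_monoid (operator_algebra B E)) x = m_inv (add_monoid (operator_module B E)) x" for x
  unfolding m_inv_def by (simp add: operator_module_def)
 then show ?thesis unfolding a_minus_def a_inv_def by (simp add: operator_module_def)
qed

lemma topo_operator_algebra:
 "topo (operator_algebra B E) = seminorm_topology (operator_algebra B E) (op_seminorm E E ` \<S> B)"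
proof -
 have "topo (operator_algebra B E) = seminorm_topology (operator_module B E) (op_seminorm E E ` \<S> B)"
  unfolding operator_algebra_def operator_module_def star_algebra.fields_def module.extend_def by simp
 also have "... = seminorm_topology (operator_algebra B E) (op_seminorm E E ` \<S> B)"
  by (rule seminorm_topology_cong) (simp add: operator_module_def, simp add: operator_algebra_minus)
 finally show ?thesis .
qed

context lc_hilbert
begin

lemma operator_add_closed:
 assumes "S \<in> adjointable B E E" "T \<in> adjointable B E E"
 shows "(\<lambda>\<xi>\<in>carrier E. S \<xi> \<oplus> T \<xi>) \<in> adjointable B E E"
  "adjoint B E E (\<lambda>\<xi>\<in>carrier E. S \<xi> \<oplus> T \<xi>) = (\<lambda>\<xi>\<in>carrier E. adjoint B E E S \<xi> \<oplus> adjoint B E E T \<xi>)"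
proof -
 have "self.adjoint_pair (\<lambda>\<xi>. S \<xi> \<oplus> T \<xi>) (\<lambda>\<xi>. adjoint B E E S \<xi> \<oplus> adjoint B E E T \<xi>)" unfolding self.adjoint_pair_def
  by (simp add: self.adjointable_closed[OF assms(1)] self.adjointable_closed[OF assms(2)]
    self.adjoint_closed[OF assms(1)] self.adjoint_closed[OF assms(2)]
    self.ip_adjoint[OF assms(1)] self.ip_adjoint[OF assms(2)] ip_add_left E.ip_add)
 from self.adjoint_pair_adjointable[OF this]
 show "(\<lambda>\<xi>\<in>carrier E. S \<xi> \<oplus> T \<xi>) \<in> adjointable B E E"
  "adjoint B E E (\<lambda>\<xi>\<in>carrier E. S \<xi> \<oplus> T \<xi>) = (\<lambda>\<xi>\<in>carrier E. adjoint B E E S \<xi> \<oplus> adjoint B E E T \<xi>)" by simp_all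
qed

lemma operator_smult_closed:
 assumes "T \<in> adjointable B E E"
 shows "(\<lambda>\<xi>\<in>carrier E. z \<odot> T \<xi>) \<in> adjointable B E E"
  "adjoint B E E (\<lambda>\<xi>\<in>carrier E. z \<odot> T \<xi>) = (\<lambda>\<xi>\<in>carrier E. cnj z \<odot> adjoint B E E T \<xi>)"
proof -
 have "self.adjoint_pair (\<lambda>\<xi>. z \<odot> T \<xi>) (\<lambda>\<xi>. cnj z \<odot> adjoint B E E T \<xi>)" unfolding self.adjoint_pair_def
  by (simp add: self.adjointable_closed[OF assms(1)] self.adjoint_closed[OF assms(1)]
    self.ip_adjoint[OF assms(1)] ip_smult_left E.ip_smult)
 from self.adjoint_pair_adjointable[OF this]
 show "(\<lambda>\<xi>\<in>carrier E. z \<odot> T \<xi>) \<in> adjointable B E E"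
  "adjoint B E E (\<lambda>\<xi>\<in>carrier E. z \<odot> T \<xi>) = (\<lambda>\<xi>\<in>carrier E. cnj z \<odot> adjoint B E E T \<xi>)" by simp_all
qed

lemma operator_zero_closed: "(\<lambda>\<xi>\<in>carrier E. \<zero>) \<in> adjointable B E E"
proof -
 have "self.adjoint_pair (\<lambda>\<xi>. \<zero>) (\<lambda>\<xi>. \<zero>)" unfolding self.adjoint_pair_def by simp
 from self.adjoint_pair_adjointable(1)[OF this] show ?thesis .
qed

lemma operator_module: "Module.module complex_ring (operator_algebra B E)"
proof (rule moduleI[OF cring_from_type_algebra])
 note cl = self.adjointable_closed and eqI = self.adjointable_eqI
 show "abelian_group (operator_algebra B E)"
 proof (rule abelian_groupI; simp only: operator_algebra_simps)
  fix S T U assume S: "S \<in> adjointable B E E" and T: "T \<in> adjointable B E E" and U: "U \<in> adjointable B E E"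
  show "(\<lambda>\<xi>\<in>carrier E. S \<xi> \<oplus> T \<xi>) \<in> adjointable B E E" by (rule operator_add_closed[OF S T])
  show "(\<lambda>\<xi>\<in>carrier E. (\<lambda>\<xi>\<in>carrier E. S \<xi> \<oplus> T \<xi>) \<xi> \<oplus> U \<xi>) = (\<lambda>\<xi>\<in>carrier E. S \<xi> \<oplus> (\<lambda>\<xi>\<in>carrier E. T \<xi> \<oplus> U \<xi>) \<xi>)"
   by (rule restrict_ext) (simp add: cl[OF S] cl[OF T] cl[OF U] E.M.a_assoc)
  show "(\<lambda>\<xi>\<in>carrier E. S \<xi> \<oplus> T \<xi>) = (\<lambda>\<xi>\<in>carrier E. T \<xi> \<oplus> S \<xi>)" by (rule restrict_ext) (simp add: cl[OF S] cl[OF T] E.M.a_comm)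
  show "(\<lambda>\<xi>\<in>carrier E. (\<lambda>\<xi>\<in>carrier E. \<zero>) \<xi> \<oplus> S \<xi>) = S"
   by (rule extensionalityI[OF _ self.adjointable_extensional[OF S]]) (simp_all add: cl[OF S])
  show "\<exists>T\<in>adjointable B E E. (\<lambda>\<xi>\<in>carrier E. T \<xi> \<oplus> S \<xi>) = (\<lambda>\<xi>\<in>carrier E. \<zero>)"
   by (rule bexI[OF _ operator_smult_closed(1)[OF S, of "- 1"]], rule restrict_ext)
    (simp add: cl[OF S] V.smult_minus_1 E.M.l_neg)
 qed (rule operator_zero_closed)
 fix S T and z w :: complex assume S': "S \<in> carrier (operator_algebra B E)"
 then have S: "S \<in> adjointable B E E" by simp
 show "z \<odot>\<^bsub>operator_algebra B E\<^esub> S \<in> carrier (operator_algebra B E)" by (simp add: operator_smult_closed[OF S])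
 show "(z \<oplus>\<^bsub>complex_ring\<^esub> w) \<odot>\<^bsub>operator_algebra B E\<^esub> S =
   z \<odot>\<^bsub>operator_algebra B E\<^esub> S \<oplus>\<^bsub>operator_algebra B E\<^esub> w \<odot>\<^bsub>operator_algebra B E\<^esub> S"
  unfolding operator_algebra_simps by (rule restrict_ext) (simp add: cl[OF S] V.smult_add_left)
 show "(z \<otimes>\<^bsub>complex_ring\<^esub> w) \<odot>\<^bsub>operator_algebra B E\<^esub> S = z \<odot>\<^bsub>operator_algebra B E\<^esub> (w \<odot>\<^bsub>operator_algebra B E\<^esub> S)"
  unfolding operator_algebra_simps by (rule restrict_ext) (simp add: cl[OF S] V.smult_smult)
 show "\<one>\<^bsub>complex_ring\<^esub> \<odot>\<^bsub>operator_algebra B E\<^esub> S = S" unfolding operator_algebra_simps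
  by (rule extensionalityI[OF _ self.adjointable_extensional[OF S]]) (simp_all add: cl[OF S])
 assume "T \<in> carrier (operator_algebra B E)"
 then have T: "T \<in> adjointable B E E" by simp
 show "z \<odot>\<^bsub>operator_algebra B E\<^esub> (S \<oplus>\<^bsub>operator_algebra B E\<^esub> T) =
   z \<odot>\<^bsub>operator_algebra B E\<^esub> S \<oplus>\<^bsub>operator_algebra B E\<^esub> z \<odot>\<^bsub>operator_algebra B E\<^esub> T"
  unfolding operator_algebra_simps by (rule restrict_ext) (simp add: cl[OF S] cl[OF T] V.smult_add_right)
qed

lemma operator_complex_module: "complex_module (operator_algebra B E)" by (intro complex_module.intro operator_module)

lemma operator_minus_apply:
 assumes "S \<in> adjointable B E E" "T \<in> adjointable B E E" "\<xi> \<in> carrier E"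
 shows "(S \<ominus>\<^bsub>operator_algebra B E\<^esub> T) \<xi> = S \<xi> \<ominus> T \<xi>"
proof -
 interpret L: complex_module "operator_algebra B E" by (rule operator_complex_module)
 have "\<ominus>\<^bsub>operator_algebra B E\<^esub> T = (\<lambda>\<xi>\<in>carrier E. (- 1) \<odot> T \<xi>)" using L.smult_minus_1[of T] assms(2) by simp
 then show ?thesis unfolding a_minus_def[of "operator_algebra B E"]
  using assms(3) self.adjointable_closed[OF assms(2,3)] by (simp add: V.smult_minus_1 E.M.minus_eq)
qed

lemma operator_seminormed:
 assumes q: "q \<in> \<S> B"
 shows "seminormed_module (operator_algebra B E) (op_seminorm E E q)"
proof (intro seminormed_module.intro operator_complex_module seminormed_module_axioms.intro)
 interpret qE: seminormed_module E "hm_norm E q" by (rule hm_norm_seminormed[OF q])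
 note cl = self.adjointable_closed and bd = self.hm_norm_le_op_seminorm[OF _ q] and nn = self.op_seminorm_nonneg[OF _ q]
 fix S T and z :: complex assume "S \<in> carrier (operator_algebra B E)"
 then have S: "S \<in> adjointable B E E" by simp
 show "0 \<le> op_seminorm E E q S" by (rule nn[OF S])
 have le: "op_seminorm E E q (\<lambda>\<xi>\<in>carrier E. z \<odot> T \<xi>) \<le> cmod z * op_seminorm E E q T"
  if T: "T \<in> adjointable B E E" for z T
 proof (rule self.op_seminorm_le[OF q])
  fix \<xi> assume \<xi>: "\<xi> \<in> carrier E"
  show "hm_norm E q ((\<lambda>\<xi>\<in>carrier E. z \<odot> T \<xi>) \<xi>) \<le> cmod z * op_seminorm E E q T * hm_norm E q \<xi>"
   using bd[OF T \<xi>] \<xi> by (simp add: qE.homogeneous[OF cl[OF T \<xi>]] mult_left_mono mult.assoc)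
 qed (use nn[OF T] in simp)
 show "op_seminorm E E q (z \<odot>\<^bsub>operator_algebra B E\<^esub> S) = cmod z * op_seminorm E E q S"
 proof (cases "z = 0")
  case True
  then show ?thesis using le[OF S, of z] nn[OF operator_smult_closed(1)[OF S, of z]] by simp
 next
  case False
  let ?T = "\<lambda>\<xi>\<in>carrier E. z \<odot> S \<xi>"
  have "op_seminorm E E q (\<lambda>\<xi>\<in>carrier E. inverse z \<odot> ?T \<xi>) \<le> cmod (inverse z) * op_seminorm E E q ?T"
   by (rule le[OF operator_smult_closed(1)[OF S]])
  moreover have "(\<lambda>\<xi>\<in>carrier E. inverse z \<odot> ?T \<xi>) = S" by (rule extensionalityI[OF _ self.adjointable_extensional[OF S]])
    (use False in \<open>simp_all add: cl[OF S] V.smult_smult\<close>)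
  ultimately have "op_seminorm E E q S \<le> cmod (inverse z) * op_seminorm E E q ?T" by simp
  then have "cmod z * op_seminorm E E q S \<le> cmod z * (cmod (inverse z) * op_seminorm E E q ?T)" by (rule mult_left_mono) simp
  also have "... = op_seminorm E E q ?T" using False by (simp add: norm_inverse)
  finally show ?thesis using le[OF S, of z] by simp
 qed
 assume "T \<in> carrier (operator_algebra B E)"
 then have T: "T \<in> adjointable B E E" by simp
 show "op_seminorm E E q (S \<oplus>\<^bsub>operator_algebra B E\<^esub> T) \<le> op_seminorm E E q S + op_seminorm E E q T"
  unfolding operator_algebra_simps
 proof (rule self.op_seminorm_le[OF q])
  fix \<xi> assume \<xi>: "\<xi> \<in> carrier E"
  show "hm_norm E q ((\<lambda>\<xi>\<in>carrier E. S \<xi> \<oplus> T \<xi>) \<xi>) \<le> (op_seminorm E E q S + op_seminorm E E q T) * hm_norm E q \<xi>"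
   using qE.triangle[OF cl[OF S \<xi>] cl[OF T \<xi>]] bd[OF S \<xi>] bd[OF T \<xi>] \<xi> by (simp add: distrib_right)
 qed (use nn[OF S] nn[OF T] in simp)
qed

lemma operator_seminorm_family:
 "seminorm_family (operator_algebra B E) (op_seminorm E E ` \<S> B)"
 by (intro seminorm_family.intro operator_complex_module seminorm_family_axioms.intro) (use operator_seminormed in blast)

lemma strict_seminormed:
 assumes q: "q \<in> \<S> B" and \<xi>: "\<xi> \<in> carrier E"
 shows "seminormed_module (operator_algebra B E) (\<lambda>T. hm_norm E q (T \<xi>) + hm_norm E q (adjoint B E E T \<xi>))"
proof (intro seminormed_module.intro operator_complex_module seminormed_module_axioms.intro)
 interpret qE: seminormed_module E "hm_norm E q" by (rule hm_norm_seminormed[OF q])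
 fix S T and z :: complex assume "S \<in> carrier (operator_algebra B E)"
 then have S: "S \<in> adjointable B E E" by simp
 note cS = self.adjointable_closed[OF S \<xi>] self.adjoint_closed[OF S \<xi>]
 show "0 \<le> hm_norm E q (S \<xi>) + hm_norm E q (adjoint B E E S \<xi>)" by (intro add_nonneg_nonneg qE.nonneg cS)
 show "hm_norm E q ((z \<odot>\<^bsub>operator_algebra B E\<^esub> S) \<xi>) + hm_norm E q (adjoint B E E (z \<odot>\<^bsub>operator_algebra B E\<^esub> S) \<xi>) =
   cmod z * (hm_norm E q (S \<xi>) + hm_norm E q (adjoint B E E S \<xi>))"
  using \<xi> by (simp add: operator_smult_closed[OF S] qE.homogeneous[OF cS(1)] qE.homogeneous[OF cS(2)] distrib_left)
 assume "T \<in> carrier (operator_algebra B E)"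
 then have T: "T \<in> adjointable B E E" by simp
 note cT = self.adjointable_closed[OF T \<xi>] self.adjoint_closed[OF T \<xi>]
 show "hm_norm E q ((S \<oplus>\<^bsub>operator_algebra B E\<^esub> T) \<xi>) + hm_norm E q (adjoint B E E (S \<oplus>\<^bsub>operator_algebra B E\<^esub> T) \<xi>) \<le>
   (hm_norm E q (S \<xi>) + hm_norm E q (adjoint B E E S \<xi>)) + (hm_norm E q (T \<xi>) + hm_norm E q (adjoint B E E T \<xi>))"
  using \<xi> qE.triangle[OF cS(1) cT(1)] qE.triangle[OF cS(2) cT(2)] by (simp add: operator_add_closed[OF S T])
qed

lemma limitin_strict_topologyD:
 assumes lim: "limitin (strict_topology B E) f (id_on E) F" and f: "eventually (\<lambda>i. f i \<in> adjointable B E E) F"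
  and q: "q \<in> \<S> B" and \<xi>: "\<xi> \<in> carrier E" and eps: "eps > 0"
 shows "eventually (\<lambda>i. hm_norm E q (f i \<xi> \<ominus> \<xi>) < eps) F"
proof -
 define P where "P = {\<lambda>T. hm_norm E q (T \<xi>) + hm_norm E q (adjoint B E E T \<xi>) |q \<xi>. q \<in> \<S> B \<and> \<xi> \<in> carrier E}"
 interpret qE: seminormed_module E "hm_norm E q" by (rule hm_norm_seminormed[OF q])
 interpret L: complex_module "operator_algebra B E" by (rule operator_complex_module)
 interpret P: seminorm_family "operator_algebra B E" P
  by (intro seminorm_family.intro operator_complex_module seminorm_family_axioms.intro)
   (use strict_seminormed in \<open>auto simp: P_def\<close>)
 have idpair: "self.adjoint_pair (\<lambda>\<xi>. \<xi>) (\<lambda>\<xi>. \<xi>)" unfolding self.adjoint_pair_def by simp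
 have id: "id_on E \<in> adjointable B E E" using self.adjoint_pair_adjointable(1)[OF idpair] by (simp add: id_on_def)
 let ?p = "\<lambda>T. hm_norm E q (T \<xi>) + hm_norm E q (adjoint B E E T \<xi>)"
 have p: "?p \<in> P" using q \<xi> by (auto simp: P_def)
 have lim': "limitin (seminorm_topology (operator_algebra B E) P) f (id_on E) F"
  using lim by (simp add: strict_topology_def P_def)
 have "eventually (\<lambda>i. f i \<in> carrier (operator_algebra B E) \<and> ?p (f i \<ominus>\<^bsub>operator_algebra B E\<^esub> id_on E) < eps) F"
  by (rule P.limitin_seminorm_topologyD[OF lim' p eps])
 then show ?thesis
 proof (rule eventually_mono)
  fix i assume i: "f i \<in> carrier (operator_algebra B E) \<and> ?p (f i \<ominus>\<^bsub>operator_algebra B E\<^esub> id_on E) < eps"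
  then have fi: "f i \<in> adjointable B E E" by simp
  have d: "f i \<ominus>\<^bsub>operator_algebra B E\<^esub> id_on E \<in> adjointable B E E" using L.M.minus_closed[of "f i" "id_on E"] fi id by simp
  have "(f i \<ominus>\<^bsub>operator_algebra B E\<^esub> id_on E) \<xi> = f i \<xi> \<ominus> \<xi>" using operator_minus_apply[OF fi id \<xi>] \<xi> by (simp add: id_on_def)
  moreover have "0 \<le> hm_norm E q (adjoint B E E (f i \<ominus>\<^bsub>operator_algebra B E\<^esub> id_on E) \<xi>)"
   by (rule qE.nonneg[OF self.adjoint_closed[OF d \<xi>]])
  ultimately show "hm_norm E q (f i \<xi> \<ominus> \<xi>) < eps" using i by simp
 qed
qed

end

section \<open>Operators defined on generators\<close>

text \<open>
 A family \<open>\<iota>\<close> generates a Hilbert module if the sums of its values are dense. A vector is then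
 determined by its inner products with the generators, and an operator by its values on them.
\<close>

context lc_hilbert
begin

definition generating :: "'x set => ('x => 'e) => bool"
 where "generating \<Omega> \<iota> \<longleftrightarrow> (\<forall>x\<in>\<Omega>. \<iota> x \<in> carrier E) \<and>
  (\<forall>\<xi>\<in>carrier E. \<forall>q\<in>\<S> B. \<forall>eps>0. \<exists>l. set l \<subseteq> \<Omega> \<and> hm_norm E q (lsum E \<iota> l \<ominus> \<xi>) < eps)"

lemma generating_closed: "[|generating \<Omega> \<iota>; x \<in> \<Omega>|] ==> \<iota> x \<in> carrier E" by (simp add: generating_def)

lemma generating_lsum_closed: "[|generating \<Omega> \<iota>; set l \<subseteq> \<Omega>|] ==> lsum E \<iota> l \<in> carrier E"
 by (rule V.lsum_closed) (auto simp: generating_def)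

lemma generatingE:
 assumes "generating \<Omega> \<iota>" "\<xi> \<in> carrier E" "q \<in> \<S> B" "eps > 0"
 obtains l where "set l \<subseteq> \<Omega>" "hm_norm E q (lsum E \<iota> l \<ominus> \<xi>) < eps" using assms unfolding generating_def by blast

lemma ip_lsum_right:
 assumes "\<xi> \<in> carrier E" "!!x. x \<in> set l ==> f x \<in> carrier E"
 shows "ip E \<xi> (lsum E f l) = lsum B (\<lambda>x. ip E \<xi> (f x)) l"
 by (rule lsum_additive[where C = "carrier E"]) (use assms in \<open>simp_all add: E.ip_add\<close>)

lemma ip_lsum_left:
 assumes "\<xi> \<in> carrier E" "!!x. x \<in> set l ==> f x \<in> carrier E"
 shows "ip E (lsum E f l) \<xi> = lsum B (\<lambda>x. ip E (f x) \<xi>) l"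
 by (rule lsum_additive[where C = "carrier E" and h = "\<lambda>\<zeta>. ip E \<zeta> \<xi>"]) (use assms in \<open>simp_all add: ip_add_left\<close>)

lemma generating_eqI:
 assumes gen: "generating \<Omega> \<iota>" and \<xi>: "\<xi> \<in> carrier E" and \<eta>: "\<eta> \<in> carrier E"
  and eq: "!!x. x \<in> \<Omega> ==> ip E \<xi> (\<iota> x) = ip E \<eta> (\<iota> x)"
 shows "\<xi> = \<eta>"
proof -
 define \<zeta> where "\<zeta> = \<xi> \<ominus> \<eta>"
 have \<zeta>: "\<zeta> \<in> carrier E" using \<xi> \<eta> by (simp add: \<zeta>_def)
 have "\<zeta> = \<zero>"
 proof (rule hm_separated[OF \<zeta>])
  fix q assume q: "q \<in> \<S> B"
  interpret qE: seminormed_module E "hm_norm E q" by (rule hm_norm_seminormed[OF q])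
  have "hm_norm E q \<zeta> \<le> 0"
  proof (rule field_le_epsilon)
   fix eps :: real assume eps: "eps > 0"
   obtain l where l: "set l \<subseteq> \<Omega>" "hm_norm E q (lsum E \<iota> l \<ominus> \<zeta>) < eps" by (rule generatingE[OF gen \<zeta> q eps])
   note s = generating_lsum_closed[OF gen l(1)]
   have "ip E \<zeta> (lsum E \<iota> l) = lsum B (\<lambda>x. ip E \<zeta> (\<iota> x)) l"
    by (rule ip_lsum_right[OF \<zeta>]) (use l(1) generating_closed[OF gen] in blast)
   also have "... = lsum B (\<lambda>x. \<zero>\<^bsub>B\<^esub>) l"
   proof (rule lsum_cong)
    fix x assume "x \<in> set l"
    then have x: "x \<in> \<Omega>" using l(1) by blast
    show "ip E \<zeta> (\<iota> x) = \<zero>\<^bsub>B\<^esub>" unfolding \<zeta>_def using \<xi> \<eta> eq[OF x] generating_closed[OF gen x]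
     by (simp add: ip_diff_left B.M.minus_eq B.M.r_neg)
   qed
   also have "... = \<zero>\<^bsub>B\<^esub>" by (rule B.lsum_zero)
   finally have "ip E \<zeta> \<zeta> = \<ominus>\<^bsub>B\<^esub> ip E \<zeta> (lsum E \<iota> l \<ominus> \<zeta>)" using \<zeta> s by (simp add: ip_diff_right B.M.minus_eq)
   then have "(hm_norm E q \<zeta>)\<^sup>2 = q (ip E \<zeta> (lsum E \<iota> l \<ominus> \<zeta>))"
    using \<zeta> s hm_norm_square[OF q \<zeta>] seminormed_module.minus[OF B.cont_seminorm_seminormed[OF q]] by simp
   also have "... \<le> hm_norm E q \<zeta> * hm_norm E q (lsum E \<iota> l \<ominus> \<zeta>)" by (rule Cauchy_Schwarz[OF q \<zeta>]) (use s \<zeta> in simp)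
   also have "... \<le> hm_norm E q \<zeta> * eps" using l(2) qE.nonneg[OF \<zeta>] by (intro mult_left_mono) simp_all
   finally have "hm_norm E q \<zeta> * hm_norm E q \<zeta> \<le> hm_norm E q \<zeta> * eps" by (simp add: power2_eq_square)
   then show "hm_norm E q \<zeta> \<le> 0 + eps" using qE.nonneg[OF \<zeta>] eps by (cases "hm_norm E q \<zeta> = 0") simp_all
  qed
  then show "hm_norm E q \<zeta> = 0" using qE.nonneg[OF \<zeta>] by linarith
 qed
 then show ?thesis using \<xi> \<eta> by (simp add: \<zeta>_def E.M.diff_eq_zero_iff)
qed

end

lemma (in lc_hilbert) generating_filter:
 assumes gen: "generating \<Omega> \<iota>" and \<xi>: "\<xi> \<in> carrier E"
 obtains F where "F \<noteq> bot" "!!q eps. [|q \<in> \<S> B; eps > 0|] ==>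
  eventually (\<lambda>l. set l \<subseteq> \<Omega> \<and> hm_norm E q (lsum E \<iota> l \<ominus> \<xi>) < eps) F"
proof -
 let ?near = "\<lambda>q eps. {l. set l \<subseteq> \<Omega> \<and> hm_norm E q (lsum E \<iota> l \<ominus> \<xi>) < eps}"
 have mono: "?near r del \<subseteq> ?near q eps" if le: "!!b. b \<in> carrier B ==> q b \<le> r b" "del \<le> eps" for q r del eps
 proof
  fix l assume "l \<in> ?near r del"
  then have l: "set l \<subseteq> \<Omega>" "hm_norm E r (lsum E \<iota> l \<ominus> \<xi>) < del" by simp_all
  have "hm_norm E q (lsum E \<iota> l \<ominus> \<xi>) \<le> hm_norm E r (lsum E \<iota> l \<ominus> \<xi>)"
   by (rule hm_norm_mono) (use le(1) generating_lsum_closed[OF gen l(1)] \<xi> in simp_all)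
  then show "l \<in> ?near q eps" using l le(2) by simp
 qed
 have ne: "?near q eps \<noteq> {}" if "q \<in> \<S> B" "eps > 0" for q eps
 proof -
  note near = generatingE[OF gen \<xi> that]
  obtain l where "l \<in> ?near q eps" by (rule near) simp
  then show ?thesis by (rule ex_in_conv[THEN iffD1, OF exI])
 qed
 obtain F where "F \<noteq> bot" "!!q eps. [|q \<in> \<S> B; eps > 0|] ==> eventually (\<lambda>l. l \<in> ?near q eps) F"
  by (rule near_filter[of ?near, OF ne mono]) blast+
 then show thesis by (intro that) simp_all
qed

context hilbert_pair
begin

lemma lsum_neg:
 assumes \<iota>: "!!x. x \<in> \<Omega> ==> \<iota> x \<in> carrier E" and neg: "!!x. x \<in> \<Omega> ==> ng x \<in> \<Omega> \<and> \<iota> (ng x) = \<ominus> \<iota> x"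
  and l: "set l \<subseteq> \<Omega>" "set l' \<subseteq> \<Omega>"
 shows "lsum E \<iota> (l @ map ng l') = lsum E \<iota> l \<ominus> lsum E \<iota> l'"
proof -
 have "lsum E \<iota> (map ng l') = lsum E (\<lambda>x. \<ominus> \<iota> x) l'" unfolding lsum_map by (rule lsum_cong) (use l neg in blast)
 also have "... = \<ominus> lsum E \<iota> l'"
  by (rule lsum_additive[where C = "carrier E", symmetric]) (use l \<iota> in \<open>auto simp: E.E.M.minus_add E.E.M.a_comm\<close>)
 finally have "lsum E \<iota> (map ng l') = \<ominus> lsum E \<iota> l'" .
 moreover have "lsum E \<iota> (l @ map ng l') = lsum E \<iota> l \<oplus> lsum E \<iota> (map ng l')" by (rule E.V.lsum_append) (use l \<iota> neg in auto)
 ultimately show ?thesis by (simp add: E.E.M.minus_eq)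
qed

end

context hilbert_pair
begin

lemma extension_from_generators:
 assumes gen: "E.generating \<Omega> \<iota>" and \<tau>: "!!x. x \<in> \<Omega> ==> \<tau> x \<in> carrier F"
  and neg: "!!x. x \<in> \<Omega> ==> ng x \<in> \<Omega> \<and> \<iota> (ng x) = \<ominus> \<iota> x \<and> \<tau> (ng x) = \<ominus>\<^bsub>F\<^esub> \<tau> x"
  and bounded: "!!q. q \<in> \<S> B ==> C q \<ge> (0::real) \<and>
   (\<forall>l. set l \<subseteq> \<Omega> --> hm_norm F q (lsum F \<tau> l) \<le> C q * hm_norm E q (lsum E \<iota> l))"
  and \<xi>: "\<xi> \<in> carrier E"
 shows "\<exists>\<eta>. \<eta> \<in> carrier F \<and> (\<forall>q\<in>\<S> B. hm_norm F q \<eta> \<le> C q * hm_norm E q \<xi>) \<and>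
  (\<forall>y\<in>carrier F. \<forall>z\<in>carrier E. (\<forall>x\<in>\<Omega>. ip F (\<tau> x) y = ip E (\<iota> x) z) --> ip F \<eta> y = ip E \<xi> z)"
proof -
 note \<iota> = E.generating_closed[OF gen]
 have sE: "lsum E \<iota> l \<in> carrier E" and sF: "lsum F \<tau> l \<in> carrier F" if "set l \<subseteq> \<Omega>" for l
  using that \<iota> \<tau> by (auto intro!: E.V.lsum_closed F.V.lsum_closed)
 have diff_le: "hm_norm F q (lsum F \<tau> l \<ominus>\<^bsub>F\<^esub> lsum F \<tau> l') \<le> C q * hm_norm E q (lsum E \<iota> l \<ominus> lsum E \<iota> l')"
  if q: "q \<in> \<S> B" and l: "set l \<subseteq> \<Omega>" "set l' \<subseteq> \<Omega>" for q l l'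
 proof -
  have "set (l @ map ng l') \<subseteq> \<Omega>" using l neg by auto
  from bounded[OF q, THEN conjunct2, rule_format, OF this] show ?thesis
   using lsum_neg[of \<Omega> \<iota> ng l l'] flip.lsum_neg[of \<Omega> \<tau> ng l l'] \<iota> \<tau> neg l by simp
 qed
 obtain L where L: "L \<noteq> bot" "!!q eps. [|q \<in> \<S> B; eps > 0|] ==>
   eventually (\<lambda>l. set l \<subseteq> \<Omega> \<and> hm_norm E q (lsum E \<iota> l \<ominus> \<xi>) < eps) L" by (rule E.generating_filter[OF gen \<xi>]) blast
 have "\<exists>\<eta>\<in>carrier F. \<forall>q\<in>\<S> B. \<forall>eps>0. eventually (\<lambda>l. hm_norm F q (lsum F \<tau> l \<ominus>\<^bsub>F\<^esub> \<eta>) < eps) L"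
 proof (rule F.hm_complete_filter[OF L(1)])
  obtain q0 where "q0 \<in> \<S> B" using E.cont_seminorms_nonempty by blast
  from L(2)[OF this zero_less_one] show "eventually (\<lambda>l. lsum F \<tau> l \<in> carrier F) L"
   by (rule eventually_mono) (use sF in blast)
  fix q and eps :: real assume q: "q \<in> \<S> B" and eps: "eps > 0"
  interpret qE: seminormed_module E "hm_norm E q" by (rule E.hm_norm_seminormed[OF q])
  have C: "C q \<ge> 0" using bounded[OF q] by blast
  define del where "del = eps / (2 * (C q + 1))"
  have del: "del > 0" "2 * (C q + 1) * del = eps" using C eps by (simp_all add: del_def)
  have "hm_norm F q (lsum F \<tau> l \<ominus>\<^bsub>F\<^esub> lsum F \<tau> l') < eps"
   if l: "set l \<subseteq> \<Omega> \<and> hm_norm E q (lsum E \<iota> l \<ominus> \<xi>) < del" and l': "set l' \<subseteq> \<Omega> \<and> hm_norm E q (lsum E \<iota> l' \<ominus> \<xi>) < del" for l l'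
  proof -
   note s = sE[OF l[THEN conjunct1]] sE[OF l'[THEN conjunct1]]
   have "hm_norm E q (lsum E \<iota> l \<ominus> lsum E \<iota> l') \<le> del + del"
    using qE.diff_triangle[OF s(1) \<xi> s(2)] qE.diff_sym[OF \<xi> s(2)] l l' by linarith
   then have "C q * hm_norm E q (lsum E \<iota> l \<ominus> lsum E \<iota> l') \<le> C q * (del + del)" by (rule mult_left_mono[OF _ C])
   also have "... < 2 * (C q + 1) * del" using del(1) by (simp add: algebra_simps)
   finally show ?thesis using diff_le[OF q l[THEN conjunct1] l'[THEN conjunct1]] del(2) by linarith
  qed
  with L(2)[OF q del(1)]
  show "\<exists>Q. eventually Q L \<and> (\<forall>l l'. Q l --> Q l' --> hm_norm F q (lsum F \<tau> l \<ominus>\<^bsub>F\<^esub> lsum F \<tau> l') < eps)" by blast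
 qed
 then obtain \<eta> where \<eta>: "\<eta> \<in> carrier F" "!!q eps. [|q \<in> \<S> B; eps > 0|] ==>
  eventually (\<lambda>l. hm_norm F q (lsum F \<tau> l \<ominus>\<^bsub>F\<^esub> \<eta>) < eps) L" by blast
 have approx: "\<exists>l. set l \<subseteq> \<Omega> \<and> hm_norm E q (lsum E \<iota> l \<ominus> \<xi>) < eps \<and> hm_norm F q (\<eta> \<ominus>\<^bsub>F\<^esub> lsum F \<tau> l) < eps"
  if q: "q \<in> \<S> B" and eps: "eps > 0" for q eps
 proof -
  interpret qF: seminormed_module F "hm_norm F q" by (rule F.hm_norm_seminormed[OF q])
  from eventually_happens'[OF L(1) eventually_conj[OF L(2)[OF q eps] \<eta>(2)[OF q eps]]]
  obtain l where l: "set l \<subseteq> \<Omega>" "hm_norm E q (lsum E \<iota> l \<ominus> \<xi>) < eps" "hm_norm F q (lsum F \<tau> l \<ominus>\<^bsub>F\<^esub> \<eta>) < eps" by blast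
  then show ?thesis using qF.diff_sym[OF \<eta>(1) sF[OF l(1)]] by (intro exI[of _ l]) simp
 qed
 have "hm_norm F q \<eta> \<le> C q * hm_norm E q \<xi>" if q: "q \<in> \<S> B" for q
 proof (rule field_le_epsilon)
  fix eps :: real assume eps: "eps > 0"
  interpret qE: seminormed_module E "hm_norm E q" by (rule E.hm_norm_seminormed[OF q])
  interpret qF: seminormed_module F "hm_norm F q" by (rule F.hm_norm_seminormed[OF q])
  have C: "C q \<ge> 0" "!!l. set l \<subseteq> \<Omega> ==> hm_norm F q (lsum F \<tau> l) \<le> C q * hm_norm E q (lsum E \<iota> l)"
   using bounded[OF q] by blast+
  define del where "del = eps / (C q + 1)"
  have del: "del > 0" "(C q + 1) * del = eps" using C(1) eps by (simp_all add: del_def)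
  obtain l where l: "set l \<subseteq> \<Omega>" "hm_norm E q (lsum E \<iota> l \<ominus> \<xi>) < del" "hm_norm F q (\<eta> \<ominus>\<^bsub>F\<^esub> lsum F \<tau> l) < del"
   using approx[OF q del(1)] by blast
  have "C q * hm_norm E q (lsum E \<iota> l) \<le> C q * (del + hm_norm E q \<xi>)"
   using qE.le_diff_add[OF sE[OF l(1)] \<xi>] l(2) by (intro mult_left_mono[OF _ C(1)]) linarith
  then have "hm_norm F q \<eta> \<le> C q * hm_norm E q \<xi> + (C q + 1) * del"
   using qF.le_diff_add[OF \<eta>(1) sF[OF l(1)]] C(2)[OF l(1)] l(3) by (simp add: algebra_simps)
  then show "hm_norm F q \<eta> \<le> C q * hm_norm E q \<xi> + eps" using del(2) by simp
 qed
 moreover have "ip F \<eta> y = ip E \<xi> z"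
  if y: "y \<in> carrier F" and z: "z \<in> carrier E" and eq: "\<forall>x\<in>\<Omega>. ip F (\<tau> x) y = ip E (\<iota> x) z" for y z
 proof (rule E.eqI)
  show "ip F \<eta> y \<in> carrier B" "ip E \<xi> z \<in> carrier B" using \<xi> \<eta>(1) y z by simp_all
  fix q and eps :: real assume q: "q \<in> \<S> B" and eps: "eps > 0"
  interpret q: seminormed_module B q by (rule E.cont_seminorm_seminormed[OF q])
  note nn = F.hm_norm_nonneg[OF q y] E.hm_norm_nonneg[OF q z]
  define N where "N = hm_norm F q y + hm_norm E q z"
  define del where "del = eps / (N + 1)"
  have del: "del > 0" "(N + 1) * del = eps" using eps nn by (simp_all add: del_def N_def)
  obtain l where l: "set l \<subseteq> \<Omega>" "hm_norm E q (lsum E \<iota> l \<ominus> \<xi>) < del" "hm_norm F q (\<eta> \<ominus>\<^bsub>F\<^esub> lsum F \<tau> l) < del"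
   using approx[OF q del(1)] by blast
  note s = sE[OF l(1)] sF[OF l(1)]
  have "ip F (lsum F \<tau> l) y = lsum B (\<lambda>x. ip F (\<tau> x) y) l" by (rule F.ip_lsum_left[OF y]) (use l(1) \<tau> in blast)
  also have "... = lsum B (\<lambda>x. ip E (\<iota> x) z) l" by (rule lsum_cong) (use l(1) eq in blast)
  also have "... = ip E (lsum E \<iota> l) z" by (rule E.ip_lsum_left[OF z, symmetric]) (use l(1) \<iota> in blast)
  finally have "ip F \<eta> y \<ominus>\<^bsub>B\<^esub> ip E \<xi> z = ip F (\<eta> \<ominus>\<^bsub>F\<^esub> lsum F \<tau> l) y \<oplus>\<^bsub>B\<^esub> ip E (lsum E \<iota> l \<ominus> \<xi>) z"
   using \<xi> \<eta>(1) y z s E.B.M.diff_split[of "ip F \<eta> y" "ip E (lsum E \<iota> l) z" "ip E \<xi> z"]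
   by (simp add: E.ip_diff_left F.ip_diff_left)
  also have "q ... \<le> hm_norm F q (\<eta> \<ominus>\<^bsub>F\<^esub> lsum F \<tau> l) * hm_norm F q y + hm_norm E q (lsum E \<iota> l \<ominus> \<xi>) * hm_norm E q z"
   using s \<xi> \<eta>(1) y z by (intro order_trans[OF q.triangle add_mono] F.Cauchy_Schwarz E.Cauchy_Schwarz q) simp_all
  also have "... \<le> del * hm_norm F q y + del * hm_norm E q z" using l nn by (intro add_mono mult_right_mono) simp_all
  also have "... \<le> eps" using del by (simp add: N_def algebra_simps)
  finally show "q (ip F \<eta> y \<ominus>\<^bsub>B\<^esub> ip E \<xi> z) \<le> eps" .
 qed
 ultimately show ?thesis using \<eta>(1) by blast
qed

end

context hilbert_pair
begin

text \<open>
 The adjoint is bounded by the same constants as \<open>T\<close>, by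
 $\|s\|^2 = \langle t, Ts\rangle \le C\|t\|\|s\|$ for $s = \sum\sigma(y)$ and $t = \sum\iota(y)$. Hence
 it extends from the generators.
\<close>

lemma adjoint_from_generators:
 assumes T: "!!\<xi>. \<xi> \<in> carrier E ==> T \<xi> \<in> carrier F"
  and bounded: "!!q. q \<in> \<S> B ==> \<exists>C\<ge>0. \<forall>\<xi>\<in>carrier E. hm_norm F q (T \<xi>) \<le> C * hm_norm E q \<xi>"
  and gen: "F.generating \<Omega> \<iota>" and neg: "!!x. x \<in> \<Omega> ==> ng x \<in> \<Omega> \<and> \<iota> (ng x) = \<ominus>\<^bsub>F\<^esub> \<iota> x"
  and \<sigma>: "!!y. y \<in> \<Omega> ==> \<sigma> y \<in> carrier E"
  and adj: "!!\<xi> y. [|\<xi> \<in> carrier E; y \<in> \<Omega>|] ==> ip F (T \<xi>) (\<iota> y) = ip E \<xi> (\<sigma> y)"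
 shows "\<exists>S. adjoint_pair T S"
proof -
 note \<iota> = F.generating_closed[OF gen]
 have adj': "ip E (\<sigma> y) \<xi> = ip F (\<iota> y) (T \<xi>)" if "\<xi> \<in> carrier E" "y \<in> \<Omega>" for \<xi> y
  using adj[OF that] E.E.ip_star[OF that(1) \<sigma>[OF that(2)]] F.E.ip_star[OF T[OF that(1)] \<iota>[OF that(2)]] by simp
 obtain C where C: "!!q. q \<in> \<S> B ==> C q \<ge> 0 \<and> (\<forall>\<xi>\<in>carrier E. hm_norm F q (T \<xi>) \<le> C q * hm_norm E q \<xi>)" using bounded by metis
 have "\<exists>\<zeta>. \<zeta> \<in> carrier E \<and> (\<forall>q\<in>\<S> B. hm_norm E q \<zeta> \<le> C q * hm_norm F q \<eta>) \<and>
  (\<forall>y\<in>carrier E. \<forall>z\<in>carrier F. (\<forall>x\<in>\<Omega>. ip E (\<sigma> x) y = ip F (\<iota> x) z) --> ip E \<zeta> y = ip F \<eta> z)"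
  if \<eta>: "\<eta> \<in> carrier F" for \<eta>
 proof (rule flip.extension_from_generators[OF gen \<sigma> _ _ \<eta>])
  fix x assume x: "x \<in> \<Omega>"
  have nx: "ng x \<in> \<Omega>" "\<iota> (ng x) = \<ominus>\<^bsub>F\<^esub> \<iota> x" using neg[OF x] by simp_all
  have "\<sigma> (ng x) = \<ominus> \<sigma> x"
   by (rule E.hm_eqI) (use \<sigma>[OF x] \<sigma>[OF nx(1)] \<iota>[OF x] T nx(2) in \<open>simp_all add: adj' x nx(1) E.ip_minus_left F.ip_minus_left\<close>)
  with nx show "ng x \<in> \<Omega> \<and> \<iota> (ng x) = \<ominus>\<^bsub>F\<^esub> \<iota> x \<and> \<sigma> (ng x) = \<ominus> \<sigma> x" by simp
 next
  fix q assume q: "q \<in> \<S> B"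
  have "hm_norm E q (lsum E \<sigma> l) \<le> C q * hm_norm F q (lsum F \<iota> l)" if l: "set l \<subseteq> \<Omega>" for l
  proof -
   let ?s = "lsum E \<sigma> l" and ?t = "lsum F \<iota> l"
   have s: "?s \<in> carrier E" by (rule E.V.lsum_closed) (use l \<sigma> in blast)
   have t: "?t \<in> carrier F" by (rule F.generating_lsum_closed[OF gen l])
   have "ip E ?s ?s = lsum B (\<lambda>x. ip E (\<sigma> x) ?s) l" by (rule E.ip_lsum_left[OF s]) (use l \<sigma> in blast)
   also have "... = lsum B (\<lambda>x. ip F (\<iota> x) (T ?s)) l" by (rule lsum_cong, rule adj'[OF s]) (use l in blast)
   also have "... = ip F ?t (T ?s)" by (rule F.ip_lsum_left[OF T[OF s], symmetric]) (use l \<iota> in blast)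
   finally have "hm_norm E q ?s * hm_norm E q ?s \<le> hm_norm F q ?t * hm_norm F q (T ?s)"
    using E.hm_norm_square[OF q s] F.Cauchy_Schwarz[OF q t T[OF s]] by (simp add: power2_eq_square)
   also have "... \<le> hm_norm F q ?t * (C q * hm_norm E q ?s)"
    using C[OF q] s F.hm_norm_nonneg[OF q t] by (intro mult_left_mono) simp_all
   finally have "hm_norm E q ?s * hm_norm E q ?s \<le> hm_norm E q ?s * (C q * hm_norm F q ?t)" by (simp add: mult_ac)
   then show ?thesis using E.hm_norm_nonneg[OF q s] C[OF q] F.hm_norm_nonneg[OF q t] by (cases "hm_norm E q ?s = 0") simp_all
  qed
  then show "C q \<ge> 0 \<and> (\<forall>l. set l \<subseteq> \<Omega> --> hm_norm E q (lsum E \<sigma> l) \<le> C q * hm_norm F q (lsum F \<iota> l))" using C[OF q] by blast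
 qed
 then obtain S where S: "!!\<eta>. \<eta> \<in> carrier F ==> S \<eta> \<in> carrier E \<and>
  (\<forall>y\<in>carrier E. \<forall>z\<in>carrier F. (\<forall>x\<in>\<Omega>. ip E (\<sigma> x) y = ip F (\<iota> x) z) --> ip E (S \<eta>) y = ip F \<eta> z)" by metis
 have "flip.adjoint_pair S T" unfolding flip.adjoint_pair_def using S T adj' by blast
 from flip.adjoint_pair_flip[OF this] show ?thesis by blast
qed

text \<open>
 All operators of the dilation are built with this theorem. The functions \<open>ng\<close> and \<open>ng'\<close> express that
 the generators are closed under negation, which turns a bound on sums into a bound on differences.
\<close>

theorem operator_from_generators:
 assumes gen: "E.generating \<Omega> \<iota>" and gen': "F.generating \<Omega>' \<iota>'"
  and \<tau>: "!!x. x \<in> \<Omega> ==> \<tau> x \<in> carrier F" and \<sigma>: "!!y. y \<in> \<Omega>' ==> \<sigma> y \<in> carrier E"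
  and adj: "!!x y. [|x \<in> \<Omega>; y \<in> \<Omega>'|] ==> ip F (\<tau> x) (\<iota>' y) = ip E (\<iota> x) (\<sigma> y)"
  and neg: "!!x. x \<in> \<Omega> ==> ng x \<in> \<Omega> \<and> \<iota> (ng x) = \<ominus> \<iota> x \<and> \<tau> (ng x) = \<ominus>\<^bsub>F\<^esub> \<tau> x"
  and neg': "!!y. y \<in> \<Omega>' ==> ng' y \<in> \<Omega>' \<and> \<iota>' (ng' y) = \<ominus>\<^bsub>F\<^esub> \<iota>' y"
  and bounded: "!!q. q \<in> \<S> B ==> C q \<ge> (0::real) \<and>
   (\<forall>l. set l \<subseteq> \<Omega> --> hm_norm F q (lsum F \<tau> l) \<le> C q * hm_norm E q (lsum E \<iota> l))"
 shows "\<exists>T\<in>adjointable B E F. (\<forall>x\<in>\<Omega>. T (\<iota> x) = \<tau> x) \<and> (\<forall>y\<in>\<Omega>'. adjoint B E F T (\<iota>' y) = \<sigma> y) \<and>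
  (\<forall>q\<in>\<S> B. \<forall>\<xi>\<in>carrier E. hm_norm F q (T \<xi>) \<le> C q * hm_norm E q \<xi>)"
proof -
 note \<iota> = E.generating_closed[OF gen] and \<iota>' = F.generating_closed[OF gen']
 obtain T where T: "!!\<xi>. \<xi> \<in> carrier E ==> T \<xi> \<in> carrier F \<and> (\<forall>q\<in>\<S> B. hm_norm F q (T \<xi>) \<le> C q * hm_norm E q \<xi>) \<and>
  (\<forall>y\<in>carrier F. \<forall>z\<in>carrier E. (\<forall>x\<in>\<Omega>. ip F (\<tau> x) y = ip E (\<iota> x) z) --> ip F (T \<xi>) y = ip E \<xi> z)"
  using extension_from_generators[where C = C, OF gen \<tau> neg bounded] by metis
 have T_in: "T \<xi> \<in> carrier F" if "\<xi> \<in> carrier E" for \<xi> using T[OF that] by blast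
 have Tbd: "hm_norm F q (T \<xi>) \<le> C q * hm_norm E q \<xi>" if "q \<in> \<S> B" "\<xi> \<in> carrier E" for q \<xi> using T[OF that(2)] that(1) by blast
 have Tadj: "ip F (T \<xi>) (\<iota>' y) = ip E \<xi> (\<sigma> y)" if "\<xi> \<in> carrier E" "y \<in> \<Omega>'" for \<xi> y
  using T[OF that(1)] \<iota>'[OF that(2)] \<sigma>[OF that(2)] adj[OF _ that(2)] by blast
 have "\<exists>S. adjoint_pair T S" by (rule adjoint_from_generators[OF T_in _ gen' neg' \<sigma> Tadj]) (use Tbd bounded in blast)+
 then obtain S where S: "adjoint_pair T S" by blast
 let ?T = "restrict T (carrier E)"
 have "T (\<iota> x) = \<tau> x" if x: "x \<in> \<Omega>" for x
  by (rule F.generating_eqI[OF gen' T_in[OF \<iota>[OF x]] \<tau>[OF x]]) (simp add: Tadj[OF \<iota>[OF x]] adj[OF x])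
 moreover have "S (\<iota>' y) = \<sigma> y" if y: "y \<in> \<Omega>'" for y
 proof (rule E.hm_eqI[OF _ \<sigma>[OF y]])
  show Sy: "S (\<iota>' y) \<in> carrier E" using S \<iota>'[OF y] by (simp add: adjoint_pair_def)
  fix \<zeta> assume \<zeta>: "\<zeta> \<in> carrier E"
  have "ip E (S (\<iota>' y)) \<zeta> = ip F (\<iota>' y) (T \<zeta>)" by (rule adjoint_pair_swap[OF S \<zeta> \<iota>'[OF y]])
  also have "... = star B (ip F (T \<zeta>) (\<iota>' y))" using T_in \<zeta> \<iota>'[OF y] by (simp add: F.E.ip_star)
  also have "... = ip E (\<sigma> y) \<zeta>" using Tadj[OF \<zeta> y] \<zeta> \<sigma>[OF y] by (simp add: E.E.ip_star)
  finally show "ip E (S (\<iota>' y)) \<zeta> = ip E (\<sigma> y) \<zeta>" .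
 qed
 ultimately show ?thesis using adjoint_pair_adjointable[OF S] Tbd \<iota> \<iota>' by (intro bexI[of _ ?T]) simp_all
qed

lemma adjointable_eq_on_generators:
 assumes gen: "E.generating \<Omega> \<iota>" and T: "T \<in> adjointable B E F" and T': "T' \<in> adjointable B E F"
  and eq: "!!x. x \<in> \<Omega> ==> T (\<iota> x) = T' (\<iota> x)"
 shows "T = T'"
proof (rule adjointable_eqI[OF T T'])
 note \<iota> = E.generating_closed[OF gen]
 have "adjoint B E F T \<eta> = adjoint B E F T' \<eta>" if \<eta>: "\<eta> \<in> carrier F" for \<eta>
  by (rule E.generating_eqI[OF gen adjoint_closed[OF T \<eta>] adjoint_closed[OF T' \<eta>]])
   (simp add: ip_adjoint'[OF T \<iota> \<eta>] ip_adjoint'[OF T' \<iota> \<eta>] eq)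
 then show "T \<xi> = T' \<xi>" if "\<xi> \<in> carrier E" for \<xi>
  using that by (intro F.hm_eqI) (simp_all add: adjointable_closed[OF T] adjointable_closed[OF T'] ip_adjoint[OF T] ip_adjoint[OF T'])
qed

end

section \<open>The kernel of a completely positive map\<close>

lemma (in abelian_monoid) finsum_eq_lsum:
 "[|distinct l; !!x. x \<in> set l ==> f x \<in> carrier G|] ==> finsum G f (set l) = lsum G f l"
 by (induction l) (simp_all add: finsum_insert Pi_def)

lemma lsum_nth: "lsum M f l = lsum M (\<lambda>i. f (l ! i)) [0..<length l]"
 using lsum_map[of M f "\<lambda>i. l ! i" "[0..<length l]"] by (simp add: map_nth)

lemma operator_lsum_apply:
 assumes "\<xi> \<in> carrier E"
 shows "lsum (operator_algebra B E) f l \<xi> = lsum E (\<lambda>k. f k \<xi>) l" using assms by (induction l) simp_all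

lemma matrix_algebra_simps [simp]:
 "carrier (matrix_algebra n A) = ({..<n} \<times> {..<n}) \<rightarrow>\<^sub>E carrier A"
 "mult (matrix_algebra n A) M N = (\<lambda>(i, k)\<in>{..<n} \<times> {..<n}. \<Oplus>\<^bsub>A\<^esub>j\<in>{..<n}. M (i, j) \<otimes>\<^bsub>A\<^esub> N (j, k))"
 "star (matrix_algebra n A) M = (\<lambda>(i, j)\<in>{..<n} \<times> {..<n}. star A (M (j, i)))" by (simp_all add: matrix_algebra_def)

text \<open>
 The matrix $[a_i^*a_j]$ is $N^*N$ for the matrix \<open>N\<close> with first row $(a_j)$ and zeros elsewhere.
\<close>

lemma (in star_algebra) gram_matrix_positive:
 assumes a: "!!i. i < n ==> a i \<in> carrier A" and n: "n \<ge> 1"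
 shows "positive (matrix_algebra n A) (\<lambda>(i, j)\<in>{..<n} \<times> {..<n}. star A (a i) \<otimes> a j)"
proof -
 define N where "N = (\<lambda>(i, j)\<in>{..<n} \<times> {..<n}. if i = 0 then a j else \<zero>)"
 have N: "N \<in> carrier (matrix_algebra n A)" using a by (auto simp: N_def)
 have "(\<lambda>(i, j)\<in>{..<n} \<times> {..<n}. star A (a i) \<otimes> a j) = star (matrix_algebra n A) N \<otimes>\<^bsub>matrix_algebra n A\<^esub> N"
 proof (rule extensionalityI[of _ "{..<n} \<times> {..<n}"])
  fix x assume x: "x \<in> {..<n} \<times> {..<n}"
  obtain i j where ij: "x = (i, j)" "i < n" "j < n" using x by auto
  have "(\<Oplus>k\<in>{..<n}. star A (N (k, i)) \<otimes> N (k, j)) = (\<Oplus>k\<in>{..<n}. if 0 = k then star A (a i) \<otimes> a j else \<zero>)"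
   by (rule M.finsum_cong') (use ij a in \<open>auto simp: N_def\<close>)
  also have "... = star A (a i) \<otimes> a j" using M.finsum_singleton[of 0 "{..<n}" "\<lambda>_. star A (a i) \<otimes> a j"] ij a n by simp
  finally have "(\<Oplus>k\<in>{..<n}. star A (N (k, i)) \<otimes> N (k, j)) = star A (a i) \<otimes> a j" .
  moreover have "(\<Oplus>k\<in>{..<n}. (star (matrix_algebra n A) N) (i, k) \<otimes> N (k, j)) = (\<Oplus>k\<in>{..<n}. star A (N (k, i)) \<otimes> N (k, j))"
   by (rule M.finsum_cong') (use ij a in \<open>auto simp: N_def\<close>)
  ultimately show "(\<lambda>(i, j)\<in>{..<n} \<times> {..<n}. star A (a i) \<otimes> a j) x =
    (star (matrix_algebra n A) N \<otimes>\<^bsub>matrix_algebra n A\<^esub> N) x" using ij by simp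
 qed simp_all
 with N show ?thesis unfolding positive_def by blast
qed

locale cp_map = A: locally_cstar_algebra A + E: lc_hilbert B E
 for A :: "'a star_algebra" (structure) and B :: "'b star_algebra" and E :: "('b, 'e) hilbert_module" +
 fixes \<rho> :: "'a => 'e => 'e"
 assumes cp: "completely_positive A (operator_algebra B E) \<rho>"
  and cont: "continuous_map (topo A) (topo (operator_algebra B E)) \<rho>"
begin

lemma \<rho>_closed: "a \<in> carrier A ==> \<rho> a \<in> adjointable B E E" using cp unfolding completely_positive_def linear_on_def by auto

lemma \<rho>_in: "[|a \<in> carrier A; \<xi> \<in> carrier E|] ==> \<rho> a \<xi> \<in> carrier E" by (rule E.self.adjointable_closed[OF \<rho>_closed])

lemma \<rho>_add: "[|a \<in> carrier A; b \<in> carrier A; \<xi> \<in> carrier E|] ==> \<rho> (a \<oplus> b) \<xi> = \<rho> a \<xi> \<oplus>\<^bsub>E\<^esub> \<rho> b \<xi>"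
 using cp unfolding completely_positive_def linear_on_def by auto

lemma \<rho>_smult: "[|a \<in> carrier A; \<xi> \<in> carrier E|] ==> \<rho> (z \<odot> a) \<xi> = z \<odot>\<^bsub>E\<^esub> \<rho> a \<xi>"
 using cp unfolding completely_positive_def linear_on_def by auto

lemma \<rho>_diff:
 assumes "a \<in> carrier A" "b \<in> carrier A" "\<xi> \<in> carrier E"
 shows "\<rho> (a \<ominus> b) \<xi> = \<rho> a \<xi> \<ominus>\<^bsub>E\<^esub> \<rho> b \<xi>" using \<rho>_add[of a "\<ominus> b" \<xi>] \<rho>_smult[of b \<xi> "- 1"] assms \<rho>_in
 by (simp add: A.smult_minus_1 E.V.smult_minus_1 A.M.minus_eq E.E.M.minus_eq)

text \<open>
 This is how complete positivity enters: the matrix $[\rho(a_i^*a_j)]$ has the form $N^*N$.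
\<close>

lemma gram_matrix_factorizationE:
 assumes n: "n \<ge> 1" and a: "!!i. i < n ==> a i \<in> carrier A"
 obtains N where "!!k i. k < n ==> i < n ==> N k i \<in> adjointable B E E"
  "!!i j \<xi>. i < n ==> j < n ==> \<xi> \<in> carrier E ==> \<rho> (star A (a i) \<otimes> a j) \<xi> =
   lsum E (\<lambda>k. adjoint B E E (N k i) (N k j \<xi>)) [0..<n]"
proof -
 let ?L = "operator_algebra B E"
 let ?M = "\<lambda>(i, j)\<in>{..<n} \<times> {..<n}. star A (a i) \<otimes> a j"
 interpret L: complex_module ?L by (rule E.operator_complex_module)
 have "?M \<in> carrier (matrix_algebra n A)" using a by auto
 moreover have "positive (matrix_algebra n A) ?M" by (rule A.gram_matrix_positive) (use a n in simp_all)
 ultimately have "positive (matrix_algebra n ?L) (\<lambda>ij\<in>{..<n} \<times> {..<n}. \<rho> (?M ij))"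
  using n cp unfolding completely_positive_def by blast
 then obtain N where N: "N \<in> carrier (matrix_algebra n ?L)"
  "(\<lambda>ij\<in>{..<n} \<times> {..<n}. \<rho> (?M ij)) = star (matrix_algebra n ?L) N \<otimes>\<^bsub>matrix_algebra n ?L\<^esub> N" unfolding positive_def by blast
 have Nin: "N (k, i) \<in> adjointable B E E" if "k < n" "i < n" for k i using N(1) that by (auto simp: PiE_iff)
 have "\<rho> (star A (a i) \<otimes> a j) \<xi> = lsum E (\<lambda>k. adjoint B E E (N (k, i)) (N (k, j) \<xi>)) [0..<n]"
  if ij: "i < n" "j < n" and \<xi>: "\<xi> \<in> carrier E" for i j \<xi>
 proof -
  let ?f = "\<lambda>k. compose (carrier E) (adjoint B E E (N (k, i))) (N (k, j))"
  have f: "?f k \<in> carrier ?L" if "k < n" for k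
   using compose_adjoint_pair(1)[OF E.self.hilbert_pair_axioms E.self.hilbert_pair_axioms Nin[OF that ij(2)]
     E.self.adjoint_adjointable(1)[OF Nin[OF that ij(1)]]] by simp
  have "\<rho> (star A (a i) \<otimes> a j) = (\<lambda>ij\<in>{..<n} \<times> {..<n}. \<rho> (?M ij)) (i, j)" using ij by simp
  also have "... = (\<Oplus>\<^bsub>?L\<^esub>k\<in>{..<n}. (star (matrix_algebra n ?L) N) (i, k) \<otimes>\<^bsub>?L\<^esub> N (k, j))" unfolding N(2) using ij by simp
  also have "... = (\<Oplus>\<^bsub>?L\<^esub>k\<in>{..<n}. ?f k)" by (rule L.M.finsum_cong') (use ij f in auto)
  also have "... = lsum ?L ?f [0..<n]" using L.M.finsum_eq_lsum[of "[0..<n]" ?f] f by (simp add: atLeast0LessThan)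
  finally have eq: "\<rho> (star A (a i) \<otimes> a j) = lsum ?L ?f [0..<n]" .
  have "\<rho> (star A (a i) \<otimes> a j) \<xi> = lsum E (\<lambda>k. ?f k \<xi>) [0..<n]" by (simp only: eq operator_lsum_apply[OF \<xi>])
  then show ?thesis using \<xi> by (simp add: compose_eq)
 qed
 with Nin show ?thesis by (rule that[of "\<lambda>k i. N (k, i)"])
qed

definition \<Omega> :: "('a \<times> 'e) set"
 where "\<Omega> = carrier A \<times> carrier E"

text \<open>
 The inner product of $a \otimes \xi$ and $b \otimes \eta$ in Stinespring's construction.
\<close>

definition kern :: "'a \<times> 'e => 'a \<times> 'e => 'b"
 where "kern x y = ip E (snd x) (\<rho> (star A (fst x) \<otimes> fst y) (snd y))"

lemma positive_lsum:
 "(!!x. x \<in> set l ==> positive B (f x)) ==> positive B (lsum B f l)" by (induction l)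
  (simp_all add: E.positive_zero[unfolded E.positive_iff_spectrally_positive]
   E.positive_iff_spectrally_positive E.spectrally_positive_add)

lemma kern_positive:
 assumes l: "set l \<subseteq> \<Omega>"
 shows "positive B (lsum B (\<lambda>x. lsum B (kern x) l) l)"
proof (cases "l = []")
 case False
 define n where "n = length l"
 have n: "n \<ge> 1" using False by (cases l) (simp_all add: n_def)
 define a where "a i = fst (l ! i)" for i
 define \<xi> where "\<xi> i = snd (l ! i)" for i
 have a: "a i \<in> carrier A" and \<xi>: "\<xi> i \<in> carrier E" if "i < n" for i
 proof -
  have "l ! i \<in> \<Omega>" using nth_mem[of i l] that l unfolding n_def by blast
  then show "a i \<in> carrier A" "\<xi> i \<in> carrier E" by (auto simp: a_def \<xi>_def \<Omega>_def)
 qed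
 obtain N where N: "!!k i. k < n ==> i < n ==> N k i \<in> adjointable B E E"
  "!!i j \<xi>. i < n ==> j < n ==> \<xi> \<in> carrier E ==> \<rho> (star A (a i) \<otimes> a j) \<xi> =
   lsum E (\<lambda>k. adjoint B E E (N k i) (N k j \<xi>)) [0..<n]" by (rule gram_matrix_factorizationE[OF n, of a]) (use a in blast)+
 have Nin: "N k i (\<xi> j) \<in> carrier E" if "k < n" "i < n" "j < n" for k i j
  by (rule E.self.adjointable_closed[OF N(1)[OF that(1,2)] \<xi>[OF that(3)]])
 let ?Z = "\<lambda>k. lsum E (\<lambda>i. N k i (\<xi> i)) [0..<n]"
 have Z: "?Z k \<in> carrier E" if "k < n" for k by (rule E.V.lsum_closed) (use Nin that in simp)
 have "lsum B (\<lambda>x. lsum B (kern x) l) l = lsum B (\<lambda>i. lsum B (\<lambda>j. kern (l ! i) (l ! j)) [0..<n]) [0..<n]"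
  unfolding lsum_nth[of B "\<lambda>x. lsum B (kern x) l" l] n_def by (intro lsum_cong lsum_nth)
 also have "... = lsum B (\<lambda>i. lsum B (\<lambda>j. lsum B (\<lambda>k. ip E (N k i (\<xi> i)) (N k j (\<xi> j))) [0..<n]) [0..<n]) [0..<n]"
 proof (intro lsum_cong)
  fix i j assume "i \<in> set [0..<n]" "j \<in> set [0..<n]"
  then have ij: "i < n" "j < n" by simp_all
  have "kern (l ! i) (l ! j) = ip E (\<xi> i) (lsum E (\<lambda>k. adjoint B E E (N k i) (N k j (\<xi> j))) [0..<n])"
   using N(2)[OF ij \<xi>[OF ij(2)]] by (simp add: kern_def a_def \<xi>_def)
  also have "... = lsum B (\<lambda>k. ip E (\<xi> i) (adjoint B E E (N k i) (N k j (\<xi> j)))) [0..<n]"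
   by (rule E.ip_lsum_right[OF \<xi>[OF ij(1)]]) (use ij in \<open>simp add: E.self.adjoint_closed N(1) Nin\<close>)
  also have "... = lsum B (\<lambda>k. ip E (N k i (\<xi> i)) (N k j (\<xi> j))) [0..<n]"
   by (rule lsum_cong) (use ij in \<open>simp add: E.self.ip_adjoint N(1) Nin \<xi>\<close>)
  finally show "kern (l ! i) (l ! j) = lsum B (\<lambda>k. ip E (N k i (\<xi> i)) (N k j (\<xi> j))) [0..<n]" .
 qed
 also have "... = lsum B (\<lambda>i. lsum B (\<lambda>k. lsum B (\<lambda>j. ip E (N k i (\<xi> i)) (N k j (\<xi> j))) [0..<n]) [0..<n]) [0..<n]"
  by (intro lsum_cong E.lsum_swap) (simp add: Nin)
 also have "... = lsum B (\<lambda>k. lsum B (\<lambda>i. lsum B (\<lambda>j. ip E (N k i (\<xi> i)) (N k j (\<xi> j))) [0..<n]) [0..<n]) [0..<n]"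
  by (rule E.lsum_swap, rule E.lsum_closed) (simp add: Nin)
 also have "... = lsum B (\<lambda>k. ip E (?Z k) (?Z k)) [0..<n]"
 proof (rule lsum_cong)
  fix k assume "k \<in> set [0..<n]"
  then have k: "k < n" by simp
  have "ip E (?Z k) (?Z k) = lsum B (\<lambda>i. ip E (N k i (\<xi> i)) (?Z k)) [0..<n]"
   by (rule E.ip_lsum_left[OF Z[OF k]]) (use k in \<open>simp add: Nin\<close>)
  also have "... = lsum B (\<lambda>i. lsum B (\<lambda>j. ip E (N k i (\<xi> i)) (N k j (\<xi> j))) [0..<n]) [0..<n]"
   by (rule lsum_cong, rule E.ip_lsum_right) (use k in \<open>simp_all add: Nin\<close>)
  finally show "lsum B (\<lambda>i. lsum B (\<lambda>j. ip E (N k i (\<xi> i)) (N k j (\<xi> j))) [0..<n]) [0..<n] = ip E (?Z k) (?Z k)" ..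
 qed
 finally show ?thesis by (simp only:) (rule positive_lsum, rule E.E.ip_positive, simp add: Z)
qed (simp add: E.positive_zero)

lemma kern_star:
 assumes x: "x \<in> \<Omega>" and y: "y \<in> \<Omega>"
 shows "star B (kern x y) = kern y x"
proof -
 define a where "a i = (if i = 0 then fst x else fst y)" for i :: nat
 have a: "a i \<in> carrier A" for i using x y by (auto simp: a_def \<Omega>_def)
 note xy = x[unfolded \<Omega>_def mem_Times_iff] y[unfolded \<Omega>_def mem_Times_iff]
 have two: "(1::nat) \<le> 2" by simp
 obtain N where N: "!!k i. k < 2 ==> i < 2 ==> N k i \<in> adjointable B E E"
  "!!i j \<xi>. i < 2 ==> j < 2 ==> \<xi> \<in> carrier E ==> \<rho> (star A (a i) \<otimes> a j) \<xi> =
   lsum E (\<lambda>k. adjoint B E E (N k i) (N k j \<xi>)) [0..<2]" by (rule gram_matrix_factorizationE[OF two, of a]) (use a in blast)+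
 have Nin: "N k i \<xi> \<in> carrier E" if "k < 2" "i < 2" "\<xi> \<in> carrier E" for k i \<xi>
  by (rule E.self.adjointable_closed[OF N(1)[OF that(1,2)] that(3)])
 have eq: "ip E \<xi> (\<rho> (star A (a i) \<otimes> a j) \<eta>) = lsum B (\<lambda>k. ip E (N k i \<xi>) (N k j \<eta>)) [0..<2]"
  if "i < 2" "j < 2" "\<xi> \<in> carrier E" "\<eta> \<in> carrier E" for i j \<xi> \<eta>
 proof -
  have "ip E \<xi> (\<rho> (star A (a i) \<otimes> a j) \<eta>) = lsum B (\<lambda>k. ip E \<xi> (adjoint B E E (N k i) (N k j \<eta>))) [0..<2]"
   unfolding N(2)[OF that(1,2,4)]
   by (rule E.ip_lsum_right[OF that(3)]) (use that in \<open>simp add: E.self.adjoint_closed N(1) Nin\<close>)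
  also have "... = lsum B (\<lambda>k. ip E (N k i \<xi>) (N k j \<eta>)) [0..<2]"
   by (rule lsum_cong) (use that in \<open>simp add: E.self.ip_adjoint N(1) Nin\<close>)
  finally show ?thesis .
 qed
 have "kern x y = lsum B (\<lambda>k. ip E (N k 0 (snd x)) (N k 1 (snd y))) [0..<2]"
  using eq[of 0 1 "snd x" "snd y"] xy by (simp add: kern_def a_def)
 then have "star B (kern x y) = lsum B (\<lambda>k. star B (ip E (N k 0 (snd x)) (N k 1 (snd y)))) [0..<2]"
  by (simp only:) (rule lsum_additive[where C = "carrier B"], use xy in \<open>simp_all add: E.star_add Nin\<close>)
 also have "... = lsum B (\<lambda>k. ip E (N k 1 (snd y)) (N k 0 (snd x))) [0..<2]"
  by (rule lsum_cong) (use xy in \<open>simp add: E.E.ip_star Nin\<close>)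
 also have "... = kern y x" using eq[of 1 0 "snd y" "snd x"] xy by (simp add: kern_def a_def)
 finally show ?thesis .
qed

lemma kern_kernel:
 "positive_definite_kernel B \<Omega> kern (\<lambda>z x. (fst x, z \<odot>\<^bsub>E\<^esub> snd x)) (\<lambda>x b. (fst x, ract E (snd x) b))"
proof (intro positive_definite_kernel.intro E.B.locally_cstar_algebra_axioms positive_definite_kernel_axioms.intro)
 fix x y z b assume x: "x \<in> \<Omega>"
 then have x': "fst x \<in> carrier A" "snd x \<in> carrier E" by (auto simp: \<Omega>_def)
 show "(fst x, z \<odot>\<^bsub>E\<^esub> snd x) \<in> \<Omega>" using x' by (simp add: \<Omega>_def)
 show "(fst x, ract E (snd x) b) \<in> \<Omega>" if "b \<in> carrier B" using x' that by (simp add: \<Omega>_def)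
 assume y: "y \<in> \<Omega>"
 then have y': "fst y \<in> carrier A" "snd y \<in> carrier E" by (auto simp: \<Omega>_def)
 have ab: "star A (fst x) \<otimes> fst y \<in> carrier A" using x' y' by simp
 show "kern x y \<in> carrier B" using x' \<rho>_in[OF ab y'(2)] by (simp add: kern_def)
 show "star B (kern x y) = kern y x" by (rule kern_star[OF x y])
 have mor: "\<rho> (star A (fst x) \<otimes> fst y) \<in> adjointable B E E" by (rule \<rho>_closed[OF ab])
 show "kern x (fst y, z \<odot>\<^bsub>E\<^esub> snd y) = z \<odot>\<^bsub>B\<^esub> kern x y"
  using x' y' \<rho>_in[OF ab y'(2)] by (simp add: kern_def E.self.adjointable_smult[OF mor] E.E.ip_smult)
 show "kern x (fst y, ract E (snd y) b) = kern x y \<otimes>\<^bsub>B\<^esub> b" if b: "b \<in> carrier B"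
 proof -
  have "\<rho> (star A (fst x) \<otimes> fst y) (ract E (snd y) b) = ract E (\<rho> (star A (fst x) \<otimes> fst y) (snd y)) b"
   using mor y' b unfolding adjointable_def module_morphisms_def by blast
  then show ?thesis using x' \<rho>_in[OF ab y'(2)] b by (simp add: kern_def E.E.ip_ract)
 qed
qed (rule kern_positive)

text \<open>
 Near 0 the map \<open>\<rho>\<close> is bounded for \<open>q\<close> on a ball of some seminorm \<open>p\<close> of \<open>A\<close>, and homogeneity does the
 rest.
\<close>

lemma \<rho>_bound:
 assumes q: "q \<in> \<S> B"
 shows "\<exists>p\<in>\<S> A. \<exists>C\<ge>0. \<forall>a\<in>carrier A. op_seminorm E E q (\<rho> a) \<le> C * p a"
proof -
 let ?L = "operator_algebra B E"
 interpret Lq: seminormed_module ?L "op_seminorm E E q" by (rule E.operator_seminormed[OF q])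
 interpret F: seminorm_family ?L "op_seminorm E E ` \<S> B" by (rule E.operator_seminorm_family)
 have \<rho>L: "\<rho> a \<in> carrier ?L" if "a \<in> carrier A" for a using \<rho>_closed[OF that] by simp
 have \<rho>z: "\<rho> (z \<odot> a) = z \<odot>\<^bsub>?L\<^esub> \<rho> a" if "a \<in> carrier A" for z a
  using cp that unfolding completely_positive_def linear_on_def by blast
 have \<rho>0: "\<rho> \<zero> = \<zero>\<^bsub>?L\<^esub>" using \<rho>z[of "\<zero>" 0] Lq.smult_zero_left[OF \<rho>L[of "\<zero>"]] by simp
 let ?U = "{T \<in> carrier ?L. op_seminorm E E q (T \<ominus>\<^bsub>?L\<^esub> \<zero>\<^bsub>?L\<^esub>) < 1}"
 have "openin (topo ?L) ?U" unfolding topo_operator_algebra by (rule F.openin_seminorm_ball[OF imageI[OF q] Lq.M.zero_closed])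
 from openin_continuous_map_preimage[OF cont this]
 have op: "openin (topo A) {a \<in> carrier A. \<rho> a \<in> ?U}" by simp
 obtain P where P: "P \<noteq> {}" "P \<subseteq> \<S> A" "topo A = seminorm_topology A P"
  "!!p q. [|p \<in> P; q \<in> P|] ==> \<exists>r\<in>P. \<forall>a\<in>carrier A. p a \<le> r a \<and> q a \<le> r a" by (rule A.directed_basis) blast
 have "\<zero> \<in> {a \<in> carrier A. \<rho> a \<in> ?U}" using \<rho>0 Lq.diff_self[of "\<zero>\<^bsub>?L\<^esub>"] Lq.M.zero_closed by auto
 then obtain F eps where F: "finite F" "F \<subseteq> P" "eps > 0"
  "{y \<in> carrier A. \<forall>p\<in>F. p (y \<ominus> \<zero>) < eps} \<subseteq> {a \<in> carrier A. \<rho> a \<in> ?U}"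
  using op unfolding P(3) openin_seminorm_topology by meson
 obtain p where p: "p \<in> \<S> A" "\<forall>r\<in>F. \<forall>a\<in>carrier A. r a \<le> p a"
  using A.cont_seminorms_directed[OF F(1)] F(2) P(2) by (meson order_trans)
 interpret p: seminormed_module A p by (rule A.cont_seminorm_seminormed[OF p(1)])
 have small: "op_seminorm E E q (\<rho> a) < 1" if a: "a \<in> carrier A" "p a < eps" for a
 proof -
  have "a \<ominus> \<zero> = a" using a(1) by (simp add: A.M.minus_eq)
  moreover have "r a < eps" if "r \<in> F" for r using p(2) that a by (intro le_less_trans[of "r a" "p a" eps]) simp_all
  ultimately have "\<forall>r\<in>F. r (a \<ominus> \<zero>) < eps" by simp
  then have "\<rho> a \<in> ?U" using F(4) a(1) by blast
  moreover have "\<rho> a \<ominus>\<^bsub>?L\<^esub> \<zero>\<^bsub>?L\<^esub> = \<rho> a" 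
   by (rule trans[OF Lq.M.r_zero[OF Lq.M.minus_closed[OF \<rho>L[OF a(1)] Lq.M.zero_closed], symmetric]
      Lq.M.diff_add_cancel[OF \<rho>L[OF a(1)] Lq.M.zero_closed]])
  ultimately show ?thesis by simp
 qed
 have "op_seminorm E E q (\<rho> a) \<le> (2 / eps) * p a" if a: "a \<in> carrier A" for a
 proof (cases "p a = 0")
  case False
  with p.nonneg[OF a] have pa: "p a > 0" by simp
  define t where "t = eps / (2 * p a)"
  have t: "t > 0" using F(3) pa by (simp add: t_def)
  have "p (of_real t \<odot> a) = t * p a" using p.homogeneous[OF a, of "of_real t"] t unfolding norm_of_real by simp
  then have "p (of_real t \<odot> a) = eps / 2" using pa by (simp add: t_def)
  then have "op_seminorm E E q (\<rho> (of_real t \<odot> a)) < 1" using F(3) a by (intro small) simp_all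
  then have "t * op_seminorm E E q (\<rho> a) < 1" using Lq.homogeneous[OF \<rho>L[OF a], of "of_real t"] t unfolding \<rho>z[OF a] by simp
  then show ?thesis using pa F(3) by (simp add: t_def field_simps)
 next
  case True
  have "op_seminorm E E q (\<rho> a) \<le> 0"
  proof (rule ccontr)
   assume "\<not> ?thesis"
   then have s: "op_seminorm E E q (\<rho> a) > 0" by simp
   define t where "t = 1 / op_seminorm E E q (\<rho> a)"
   have t: "t > 0" using s by (simp add: t_def)
   have "p (of_real t \<odot> a) = 0" using p.homogeneous[OF a, of "of_real t"] True by simp
   then have "op_seminorm E E q (\<rho> (of_real t \<odot> a)) < 1" using F(3) a by (intro small) simp_all
   then have "t * op_seminorm E E q (\<rho> a) < 1" using Lq.homogeneous[OF \<rho>L[OF a], of "of_real t"] t unfolding \<rho>z[OF a] by simp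
   then show False using s by (simp add: t_def)
  qed
  then show ?thesis using True by simp
 qed
 then show ?thesis using p(1) F(3) by (intro bexI[of _ p] exI[of _ "2 / eps"]) simp_all
qed

end

section \<open>The representation on the kernel module\<close>

text \<open>
 The spectrum of \<open>d\<close> lies in $[0,1]$, so $d - d^2$ has the square root $\sqrt{|t-t^2|}$.
\<close>

lemma (in locally_cstar_algebra) contraction_diff_square:
 assumes d: "spectrally_positive d" and le: "!!q. q \<in> \<S> A ==> q d \<le> 1"
 shows "\<exists>c\<in>carrier A. d \<ominus> d \<otimes> d = star A c \<otimes> c"
proof -
 note d' = spectrally_positiveD[OF d]
 note h = d'(1,2)
 have "continuous_on UNIV (\<lambda>t::real. sqrt \<bar>t - t * t\<bar>)" by (intro continuous_intros)
 then obtain c where c: "cfc_rel d (\<lambda>t. sqrt \<bar>t - t * t\<bar>) c" using cfc_rel_exists[OF h, of "\<lambda>t. sqrt \<bar>t - t * t\<bar>"] by auto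
 have "cfc_rel d (\<lambda>t. sqrt \<bar>t - t * t\<bar> * sqrt \<bar>t - t * t\<bar>) (c \<otimes> c)" by (rule cfc_rel_mult[OF h c c])
 moreover have "cfc_rel d (\<lambda>t. sqrt \<bar>t - t * t\<bar> * sqrt \<bar>t - t * t\<bar>) (d \<ominus> d \<otimes> d)"
 proof (rule cfc_rel_cong[OF h cfc_rel_diff[OF h cfc_rel_id[OF h] cfc_rel_mult[OF h cfc_rel_id[OF h] cfc_rel_id[OF h]]]])
  fix q t assume qt: "q \<in> \<S> A" "t \<in> spectrum q d"
  have "0 \<le> t" by (rule d'(3)[OF qt])
  moreover have "t \<le> 1" using cfc_rel_le_norm[OF h cfc_rel_id[OF h] qt] le[OF qt(1)] by simp
  ultimately have "0 \<le> t - t * t" using mult_left_le[of t t] by simp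
  then show "t - t * t = sqrt \<bar>t - t * t\<bar> * sqrt \<bar>t - t * t\<bar>" by simp
 qed
 ultimately have "c \<otimes> c = d \<ominus> d \<otimes> d" by (rule cfc_rel_unique[OF h])
 then show ?thesis using cfc_rel_closed[OF h c] cfc_rel_selfadjoint[OF h c] by (intro bexI[of _ c]) simp_all
qed

text \<open>
 Iterating the first estimate gives $r_0^{2^j} n \le n^{2^j} r_j \le M(nP)^{2^j}$. The constant \<open>M\<close>
 disappears when roots are taken and $j \to \infty$.
\<close>

lemma power_trick:
 fixes r :: "nat => real"
 assumes r: "!!j. 0 \<le> r j" and n: "0 \<le> n" and P: "0 \<le> P"
  and step: "!!j. (r j)\<^sup>2 \<le> n * r (Suc j)" and bound: "!!j. r j \<le> M * P ^ (2 ^ j)"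
 shows "r 0 \<le> n * P"
proof (rule ccontr)
 assume "\<not> r 0 \<le> n * P"
 then have gt: "r 0 > n * P" by simp
 have n': "n > 0" using n gt step[of 0] r[of 0] P by (cases "n = 0") auto
 have pos: "r 0 > 0" using gt n P mult_nonneg_nonneg[of n P] by linarith
 have iter: "r 0 ^ (2 ^ j) * n \<le> n ^ (2 ^ j) * r j" for j
 proof (induction j)
  case (Suc j)
  have "(r 0 ^ 2 ^ Suc j * n) * n = (r 0 ^ 2 ^ j * n)\<^sup>2" by (simp add: power2_eq_square power_add mult_2 mult_ac)
  also have "... \<le> (n ^ 2 ^ j * r j)\<^sup>2" using Suc r[of 0] n by (intro power_mono) simp_all
  also have "... = n ^ 2 ^ Suc j * (r j)\<^sup>2" by (simp add: power_mult_distrib power_mult[symmetric] mult_ac)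
  also have "... \<le> n ^ 2 ^ Suc j * (n * r (Suc j))" using n by (intro mult_left_mono step) simp
  finally have "(r 0 ^ 2 ^ Suc j * n) * n \<le> (n ^ 2 ^ Suc j * r (Suc j)) * n" by (simp only: mult_ac)
  then show ?case using n' by (simp only: mult_le_cancel_right_pos)
 qed simp
 have le: "r 0 ^ (2 ^ j) * n \<le> M * (n * P) ^ (2 ^ j)" for j
 proof -
  have "n ^ (2 ^ j) * r j \<le> n ^ (2 ^ j) * (M * P ^ (2 ^ j))" using n by (intro mult_left_mono bound) simp
  with iter[of j] show ?thesis by (simp add: power_mult_distrib mult_ac)
 qed
 show False
 proof (cases "n * P = 0")
  case True
  then show False using le[of 0, unfolded True] mult_pos_pos[OF pos n'] by simp
 next
  case False
  then have x: "n * P > 0" using n P by (simp add: less_le)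
  define y where "y = r 0 / (n * P)"
  have y: "y > 1" using gt x by (simp add: y_def)
  obtain k where k: "M / n < y ^ k" using real_arch_pow[OF y] by blast
  have "k \<le> 2 ^ k" by (rule less_imp_le[OF less_exp])
  then have "y ^ k \<le> y ^ (2 ^ k)" using y by (intro power_increasing) simp_all
  with k have "M / n < y ^ (2 ^ k)" by simp
  then have "M < y ^ (2 ^ k) * n" using n' by (simp add: pos_divide_less_eq)
  then have "M * (n * P) ^ (2 ^ k) < (y ^ (2 ^ k) * n) * (n * P) ^ (2 ^ k)" using x by (intro mult_strict_right_mono) simp_all
  also have "... = r 0 ^ (2 ^ k) * n" using False by (simp add: y_def power_divide mult_ac)
  finally show False using le[of k] by simp
 qed
qed

text \<open>
 \<open>\<iota> (a, \<xi>)\<close> stands for the vector $\Phi(a)V\xi$ of a dilation. Existence and uniqueness both use only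
 these two axioms: the first interprets them in the kernel module, the second in two given dilations.
\<close>

locale cp_model = cp_map A B E \<rho> + H: lc_hilbert B H
 for A :: "'a star_algebra" (structure) and B :: "'b star_algebra" and E :: "('b, 'e) hilbert_module"
  and \<rho> and H :: "('b, 'h) hilbert_module" +
 fixes \<iota> :: "'a \<times> 'e => 'h"
 assumes generating: "H.generating \<Omega> \<iota>"
  and ip_\<iota>: "[|x \<in> \<Omega>; y \<in> \<Omega>|] ==> ip H (\<iota> x) (\<iota> y) = kern x y"
begin

lemma \<iota>_in [simp, intro]: "[|a \<in> carrier A; \<xi> \<in> carrier E|] ==> \<iota> (a, \<xi>) \<in> carrier H"
 by (rule H.generating_closed[OF generating]) (simp add: \<Omega>_def)

lemma ip_\<iota>_pair:
 "[|a \<in> carrier A; b \<in> carrier A; \<xi> \<in> carrier E; \<eta> \<in> carrier E|] ==>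
  ip H (\<iota> (a, \<xi>)) (\<iota> (b, \<eta>)) = ip E \<xi> (\<rho> (star A a \<otimes> b) \<eta>)" using ip_\<iota>[of "(a, \<xi>)" "(b, \<eta>)"] by (simp add: \<Omega>_def kern_def)

lemma \<iota>_eqI:
 assumes "\<zeta> \<in> carrier H" "\<zeta>' \<in> carrier H"
  and "!!b \<eta>. [|b \<in> carrier A; \<eta> \<in> carrier E|] ==> ip H \<zeta> (\<iota> (b, \<eta>)) = ip H \<zeta>' (\<iota> (b, \<eta>))"
 shows "\<zeta> = \<zeta>'" by (rule H.generating_eqI[OF generating assms(1,2)]) (use assms(3) in \<open>auto simp: \<Omega>_def\<close>)

lemmas \<iota>_rules = ip_\<iota>_pair \<rho>_in A.star_add A.star_smult A.mult_distr_left A.smult_mult_left \<rho>_add \<rho>_smult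
 E.ip_add_left E.ip_smult_left E.E.ip_add E.E.ip_smult H.ip_add_left H.ip_smult_left

lemma \<iota>_add: "[|a \<in> carrier A; b \<in> carrier A; \<xi> \<in> carrier E|] ==> \<iota> (a \<oplus> b, \<xi>) = \<iota> (a, \<xi>) \<oplus>\<^bsub>H\<^esub> \<iota> (b, \<xi>)"
 by (rule \<iota>_eqI) (simp_all add: \<iota>_rules)

lemma \<iota>_smult: "[|a \<in> carrier A; \<xi> \<in> carrier E|] ==> \<iota> (z \<odot> a, \<xi>) = z \<odot>\<^bsub>H\<^esub> \<iota> (a, \<xi>)" by (rule \<iota>_eqI) (simp_all add: \<iota>_rules)

lemma \<iota>_add_right: "[|a \<in> carrier A; \<eta> \<in> carrier E; \<xi> \<in> carrier E|] ==> \<iota> (a, \<xi> \<oplus>\<^bsub>E\<^esub> \<eta>) = \<iota> (a, \<xi>) \<oplus>\<^bsub>H\<^esub> \<iota> (a, \<eta>)"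
 by (rule \<iota>_eqI) (simp_all add: \<iota>_rules)

lemma \<iota>_smult_right: "[|a \<in> carrier A; \<xi> \<in> carrier E|] ==> \<iota> (a, z \<odot>\<^bsub>E\<^esub> \<xi>) = z \<odot>\<^bsub>H\<^esub> \<iota> (a, \<xi>)"
 by (rule \<iota>_eqI) (simp_all add: \<iota>_rules)

lemma \<iota>_diff: "[|a \<in> carrier A; b \<in> carrier A; \<xi> \<in> carrier E|] ==> \<iota> (a \<ominus> b, \<xi>) = \<iota> (a, \<xi>) \<ominus>\<^bsub>H\<^esub> \<iota> (b, \<xi>)"
 using \<iota>_add[of a "\<ominus> b" \<xi>] \<iota>_smult[of b \<xi> "- 1"] by (simp add: A.smult_minus_1 H.V.smult_minus_1 A.M.minus_eq H.E.M.minus_eq)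

lemma \<iota>_minus_right: "[|a \<in> carrier A; \<xi> \<in> carrier E|] ==> \<iota> (a, \<ominus>\<^bsub>E\<^esub> \<xi>) = \<ominus>\<^bsub>H\<^esub> \<iota> (a, \<xi>)"
 using \<iota>_smult_right[of a \<xi> "- 1"] by (simp add: E.V.smult_minus_1 H.V.smult_minus_1)

lemma \<iota>_diff_right: "[|a \<in> carrier A; \<eta> \<in> carrier E; \<xi> \<in> carrier E|] ==> \<iota> (a, \<xi> \<ominus>\<^bsub>E\<^esub> \<eta>) = \<iota> (a, \<xi>) \<ominus>\<^bsub>H\<^esub> \<iota> (a, \<eta>)"
 using \<iota>_add_right[of a "\<ominus>\<^bsub>E\<^esub> \<eta>" \<xi>] \<iota>_minus_right[of a \<eta>] by (simp add: E.E.M.minus_eq H.E.M.minus_eq)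

lemma \<iota>_bound:
 assumes q: "q \<in> \<S> B"
 shows "\<exists>p. p \<in> \<S> A \<and> (\<exists>K\<ge>0. \<forall>a\<in>carrier A. \<forall>\<xi>\<in>carrier E. hm_norm H q (\<iota> (a, \<xi>)) \<le> K * p a * hm_norm E q \<xi>)"
proof -
 obtain p C where p: "p \<in> \<S> A" and C: "C \<ge> 0" "\<forall>a\<in>carrier A. op_seminorm E E q (\<rho> a) \<le> C * p a" using \<rho>_bound[OF q] by blast
 interpret p: cstar_seminormed A p by (rule A.cont_seminormD[OF p])
 have "hm_norm H q (\<iota> (a, \<xi>)) \<le> sqrt C * p a * hm_norm E q \<xi>" if a: "a \<in> carrier A" and \<xi>: "\<xi> \<in> carrier E" for a \<xi>
 proof (rule power2_le_imp_le)
  note n = E.hm_norm_nonneg[OF q \<xi>]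
  have aa: "star A a \<otimes> a \<in> carrier A" using a by simp
  have "hm_norm E q (\<rho> (star A a \<otimes> a) \<xi>) \<le> (C * p (star A a \<otimes> a)) * hm_norm E q \<xi>"
   using E.self.hm_norm_le_op_seminorm[OF \<rho>_closed[OF aa] q \<xi>] mult_right_mono[OF C(2)[rule_format, OF aa] n] by linarith
  then have b: "hm_norm E q (\<rho> (star A a \<otimes> a) \<xi>) \<le> C * (p a)\<^sup>2 * hm_norm E q \<xi>" using p.cstar[OF a] by simp
  have "(hm_norm H q (\<iota> (a, \<xi>)))\<^sup>2 = q (ip E \<xi> (\<rho> (star A a \<otimes> a) \<xi>))"
   using H.hm_norm_square[OF q \<iota>_in[OF a \<xi>]] a \<xi> by (simp add: ip_\<iota>_pair)
  also have "... \<le> hm_norm E q \<xi> * hm_norm E q (\<rho> (star A a \<otimes> a) \<xi>)" by (rule E.Cauchy_Schwarz[OF q \<xi> \<rho>_in[OF aa \<xi>]])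
  also have "... \<le> hm_norm E q \<xi> * (C * (p a)\<^sup>2 * hm_norm E q \<xi>)" by (rule mult_left_mono[OF b n])
  also have "... = (sqrt C * p a * hm_norm E q \<xi>)\<^sup>2" using C(1) by (simp add: power_mult_distrib power2_eq_square)
  finally show "(hm_norm H q (\<iota> (a, \<xi>)))\<^sup>2 \<le> (sqrt C * p a * hm_norm E q \<xi>)\<^sup>2" .
  show "0 \<le> sqrt C * p a * hm_norm E q \<xi>" using C(1) p.nonneg[OF a] n by simp
 qed
 then show ?thesis using p C(1) by (intro exI[of _ p] conjI exI[of _ "sqrt C"]) simp_all
qed

text \<open>
 A seminorm of \<open>A\<close> that controls the seminorm \<open>q\<close> on the generators, hence also the operators
 $\Phi(a)$.
\<close>

definition dom :: "('b => real) => 'a => real"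
 where "dom q = (SOME p. p \<in> \<S> A \<and> (\<exists>K\<ge>0. \<forall>a\<in>carrier A. \<forall>\<xi>\<in>carrier E. hm_norm H q (\<iota> (a, \<xi>)) \<le> K * p a * hm_norm E q \<xi>))"

lemma dom:
 assumes q: "q \<in> \<S> B"
 shows "dom q \<in> \<S> A"
  "\<exists>K\<ge>0. \<forall>a\<in>carrier A. \<forall>\<xi>\<in>carrier E. hm_norm H q (\<iota> (a, \<xi>)) \<le> K * dom q a * hm_norm E q \<xi>"
 using someI_ex[OF \<iota>_bound[OF q]] unfolding dom_def by blast+

abbreviation translate :: "'a => 'a \<times> 'e => 'h"
 where "translate b x \<equiv> \<iota> (b \<otimes> fst x, snd x)"

lemma translate_adjoint:
 assumes "b \<in> carrier A" "x \<in> \<Omega>" "y \<in> \<Omega>"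
 shows "ip H (translate b x) (\<iota> y) = ip H (\<iota> x) (translate (star A b) y)"
 using assms by (cases x; cases y) (simp add: \<Omega>_def ip_\<iota>_pair A.star_mult A.mult_assoc)

lemma lsum_translate_adjoint:
 assumes b: "b \<in> carrier A" and c: "c \<in> carrier A" and l: "set l \<subseteq> \<Omega>"
 shows "ip H (lsum H (translate (b \<otimes> c)) l) (lsum H \<iota> l) = ip H (lsum H (translate c) l) (lsum H (translate (star A b)) l)"
  (is "?L = ?R")
proof -
 have cl: "translate d x \<in> carrier H" "\<iota> x \<in> carrier H" if "x \<in> set l" "d \<in> carrier A" for x d
  using l that by (auto simp: \<Omega>_def)
 have "?L = lsum B (\<lambda>x. ip H (translate (b \<otimes> c) x) (lsum H \<iota> l)) l"
  by (rule H.ip_lsum_left) (use cl b c in \<open>auto intro!: H.V.lsum_closed\<close>)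
 also have "... = lsum B (\<lambda>x. lsum B (\<lambda>y. ip H (translate (b \<otimes> c) x) (\<iota> y)) l) l"
  by (rule lsum_cong, rule H.ip_lsum_right) (use cl b c in auto)
 also have "... = lsum B (\<lambda>x. lsum B (\<lambda>y. ip H (translate c x) (translate (star A b) y)) l) l"
 proof (intro lsum_cong)
  fix x y assume "x \<in> set l" "y \<in> set l"
  then have "x \<in> \<Omega>" "y \<in> \<Omega>" using l by blast+
  then show "ip H (translate (b \<otimes> c) x) (\<iota> y) = ip H (translate c x) (translate (star A b) y)"
   using b c by (cases x; cases y) (simp add: \<Omega>_def ip_\<iota>_pair A.star_mult A.mult_assoc)
 qed
 also have "... = lsum B (\<lambda>x. ip H (translate c x) (lsum H (translate (star A b)) l)) l"
  by (rule lsum_cong, rule H.ip_lsum_right[symmetric]) (use cl b c in auto)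
 also have "... = ?R" by (rule H.ip_lsum_left[symmetric]) (use cl b c in \<open>auto intro!: H.V.lsum_closed\<close>)
 finally show ?thesis .
qed

text \<open>
 The operator norm of left multiplication by \<open>b\<close>, with constant 1. A bound with a constant that depends
 on the list is immediate; applied to $b^*b$ and its iterated squares, it improves to this one, by
 Cauchy-Schwarz and the $C^*$-identity.
\<close>

lemma translate_bound:
 assumes b: "b \<in> carrier A" and l: "set l \<subseteq> \<Omega>" and q: "q \<in> \<S> B"
 shows "hm_norm H q (lsum H (translate b) l) \<le> dom q b * hm_norm H q (lsum H \<iota> l)"
proof -
 interpret p: cstar_seminormed A "dom q" by (rule A.cont_seminormD[OF dom(1)[OF q]])
 interpret qH: seminormed_module H "hm_norm H q" by (rule H.hm_norm_seminormed[OF q])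
 obtain K where K: "K \<ge> 0" "\<forall>a\<in>carrier A. \<forall>\<xi>\<in>carrier E. hm_norm H q (\<iota> (a, \<xi>)) \<le> K * dom q a * hm_norm E q \<xi>"
  using dom(2)[OF q] by blast
 define n where "n c = hm_norm H q (lsum H (translate c) l)" for c
 define n0 where "n0 = hm_norm H q (lsum H \<iota> l)"
 define M where "M = sum_list (map (\<lambda>x. K * dom q (fst x) * hm_norm E q (snd x)) l)"
 have cl: "lsum H (translate c) l \<in> carrier H" if "c \<in> carrier A" for c
  by (rule H.V.lsum_closed) (use l that in \<open>auto simp: \<Omega>_def\<close>)
 have cl0: "lsum H \<iota> l \<in> carrier H" by (rule H.generating_lsum_closed[OF generating l])
 have square: "(n c)\<^sup>2 \<le> n0 * n (star A c \<otimes> c)" if c: "c \<in> carrier A" for c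
 proof -
  have "(n c)\<^sup>2 = q (ip H (lsum H (translate (star A c \<otimes> c)) l) (lsum H \<iota> l))"
   unfolding n_def H.hm_norm_square[OF q cl[OF c]] using lsum_translate_adjoint[OF A.star_closed[OF c] c l] c by simp
  also have "... \<le> n (star A c \<otimes> c) * n0" unfolding n_def n0_def by (rule H.Cauchy_Schwarz[OF q cl cl0]) (use c in simp)
  finally show ?thesis by (simp add: mult.commute)
 qed
 have bound: "n c \<le> M * dom q c" if c: "c \<in> carrier A" for c unfolding n_def M_def using l
 proof (induction l)
  case (Cons x l)
  obtain a \<xi> where x: "x = (a, \<xi>)" "a \<in> carrier A" "\<xi> \<in> carrier E" using Cons.prems by (cases x) (auto simp: \<Omega>_def)
  have "hm_norm H q (\<iota> (c \<otimes> a, \<xi>)) \<le> K * dom q (c \<otimes> a) * hm_norm E q \<xi>" using K(2) c x by simp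
  also have "... \<le> K * (dom q c * dom q a) * hm_norm E q \<xi>"
   using p.submultiplicative[OF c x(2)] K(1) E.hm_norm_nonneg[OF q x(3)] by (intro mult_right_mono mult_left_mono)
  finally have 1: "hm_norm H q (\<iota> (c \<otimes> a, \<xi>)) \<le> K * dom q a * hm_norm E q \<xi> * dom q c" by (simp only: mult_ac)
  have "hm_norm H q (lsum H (translate c) (x # l)) \<le> hm_norm H q (translate c x) + hm_norm H q (lsum H (translate c) l)"
   unfolding lsum_Cons by (rule qH.triangle) (use c x Cons.prems in \<open>auto intro!: H.V.lsum_closed simp: \<Omega>_def\<close>)
  with 1 Cons show ?case by (simp add: x(1) distrib_right)
 qed simp
 define d where "d = rec_nat (star A b \<otimes> b) (\<lambda>_ c. c \<otimes> c)"
 have d_simps: "d 0 = star A b \<otimes> b" "d (Suc j) = d j \<otimes> d j" for j by (simp_all add: d_def)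
 have d: "d j \<in> carrier A \<and> star A (d j) = d j \<and> dom q (d j) = ((dom q b)\<^sup>2) ^ (2 ^ j)" for j
 proof (induction j)
  case 0
  then show ?case using b p.cstar[OF b] by (simp add: d_simps A.star_mult)
 next
  case (Suc j)
  then have s: "d j \<in> carrier A" "star A (d j) = d j" by simp_all
  then show ?case using Suc p.cstar[OF s(1)] unfolding d_simps by (simp add: A.star_mult power_mult[symmetric] mult_ac)
 qed
 have nn: "0 \<le> n c" if "c \<in> carrier A" for c unfolding n_def by (rule qH.nonneg[OF cl[OF that]])
 have n0: "0 \<le> n0" unfolding n0_def by (rule qH.nonneg[OF cl0])
 have "n (d 0) \<le> n0 * (dom q b)\<^sup>2"
 proof (rule power_trick[of "\<lambda>j. n (d j)" n0 "(dom q b)\<^sup>2" M])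
  fix j
  show "0 \<le> n (d j)" using d nn by blast
  show "(n (d j))\<^sup>2 \<le> n0 * n (d (Suc j))" using square[of "d j"] d[of j] by (simp add: d_simps)
  show "n (d j) \<le> M * ((dom q b)\<^sup>2) ^ (2 ^ j)" using bound[of "d j"] d[of j] by simp
 qed (use n0 in simp_all)
 then have "(n b)\<^sup>2 \<le> n0 * (n0 * (dom q b)\<^sup>2)"
  using square[OF b] mult_left_mono[of "n (d 0)" "n0 * (dom q b)\<^sup>2" n0] n0 unfolding d_simps by linarith
 then have "(n b)\<^sup>2 \<le> (dom q b * n0)\<^sup>2" by (simp add: power2_eq_square mult_ac)
 then have "n b \<le> dom q b * n0" by (rule power2_le_imp_le) (use n0 p.nonneg[OF b] in simp)
 then show ?thesis unfolding n_def n0_def .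
qed

end

sublocale cp_model \<subseteq> EH: hilbert_pair B E H ..

context cp_model
begin

lemma \<Phi>_exists:
 assumes b: "b \<in> carrier A"
 shows "\<exists>T. T \<in> adjointable B H H \<and> (\<forall>x\<in>\<Omega>. T (\<iota> x) = translate b x) \<and>
  (\<forall>y\<in>\<Omega>. adjoint B H H T (\<iota> y) = translate (star A b) y) \<and>
  (\<forall>q\<in>\<S> B. \<forall>\<zeta>\<in>carrier H. hm_norm H q (T \<zeta>) \<le> dom q b * hm_norm H q \<zeta>)"
proof -
 have "\<exists>T\<in>adjointable B H H. (\<forall>x\<in>\<Omega>. T (\<iota> x) = translate b x) \<and>
  (\<forall>y\<in>\<Omega>. adjoint B H H T (\<iota> y) = translate (star A b) y) \<and>
  (\<forall>q\<in>\<S> B. \<forall>\<zeta>\<in>carrier H. hm_norm H q (T \<zeta>) \<le> dom q b * hm_norm H q \<zeta>)"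
 proof (rule H.self.operator_from_generators[OF generating generating])
  fix x y assume x: "x \<in> \<Omega>" and y: "y \<in> \<Omega>"
  show "translate b x \<in> carrier H" "translate (star A b) x \<in> carrier H" using x b by (auto simp: \<Omega>_def)
  show "ip H (translate b x) (\<iota> y) = ip H (\<iota> x) (translate (star A b) y)" by (rule translate_adjoint[OF b x y])
  show "(fst x, \<ominus>\<^bsub>E\<^esub> snd x) \<in> \<Omega> \<and> \<iota> (fst x, \<ominus>\<^bsub>E\<^esub> snd x) = \<ominus>\<^bsub>H\<^esub> \<iota> x \<and>
    translate b (fst x, \<ominus>\<^bsub>E\<^esub> snd x) = \<ominus>\<^bsub>H\<^esub> translate b x" using x b by (cases x) (simp add: \<Omega>_def \<iota>_minus_right)
  then show "(fst x, \<ominus>\<^bsub>E\<^esub> snd x) \<in> \<Omega> \<and> \<iota> (fst x, \<ominus>\<^bsub>E\<^esub> snd x) = \<ominus>\<^bsub>H\<^esub> \<iota> x" by blast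
 next
  fix q assume q: "q \<in> \<S> B"
  interpret p: cstar_seminormed A "dom q" by (rule A.cont_seminormD[OF dom(1)[OF q]])
  show "0 \<le> dom q b \<and> (\<forall>l. set l \<subseteq> \<Omega> --> hm_norm H q (lsum H (translate b) l) \<le> dom q b * hm_norm H q (lsum H \<iota> l))"
   using p.nonneg[OF b] translate_bound[OF b _ q] by blast
 qed
 then show ?thesis by blast
qed

definition \<Phi> :: "'a => 'h => 'h"
 where "\<Phi> b = (SOME T. T \<in> adjointable B H H \<and> (\<forall>x\<in>\<Omega>. T (\<iota> x) = translate b x) \<and>
  (\<forall>y\<in>\<Omega>. adjoint B H H T (\<iota> y) = translate (star A b) y) \<and>
  (\<forall>q\<in>\<S> B. \<forall>\<zeta>\<in>carrier H. hm_norm H q (T \<zeta>) \<le> dom q b * hm_norm H q \<zeta>))"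

lemma \<Phi>:
 assumes b: "b \<in> carrier A"
 shows "\<Phi> b \<in> adjointable B H H"
  "!!a \<xi>. [|a \<in> carrier A; \<xi> \<in> carrier E|] ==> \<Phi> b (\<iota> (a, \<xi>)) = \<iota> (b \<otimes> a, \<xi>)"
  "!!a \<xi>. [|a \<in> carrier A; \<xi> \<in> carrier E|] ==> adjoint B H H (\<Phi> b) (\<iota> (a, \<xi>)) = \<iota> (star A b \<otimes> a, \<xi>)"
  "!!q \<zeta>. [|q \<in> \<S> B; \<zeta> \<in> carrier H|] ==> hm_norm H q (\<Phi> b \<zeta>) \<le> dom q b * hm_norm H q \<zeta>"
 using someI_ex[OF \<Phi>_exists[OF b], folded \<Phi>_def] by (simp_all add: \<Omega>_def)

lemma \<Phi>_in: "[|b \<in> carrier A; \<zeta> \<in> carrier H|] ==> \<Phi> b \<zeta> \<in> carrier H" by (rule H.self.adjointable_closed[OF \<Phi>(1)])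

end

lemma (in hilbert_pair) adjointable_eq_on_pairs:
 assumes "E.generating (P \<times> Q) \<iota>" "T \<in> adjointable B E F" "T' \<in> adjointable B E F"
  and "!!a b. [|a \<in> P; b \<in> Q|] ==> T (\<iota> (a, b)) = T' (\<iota> (a, b))"
 shows "T = T'" by (rule adjointable_eq_on_generators[OF assms(1-3)]) (use assms(4) in auto)

context cp_model
begin

lemmas operator_eqI = H.self.adjointable_eq_on_pairs[OF generating[unfolded \<Omega>_def]]

lemma \<Phi>_add: "[|a \<in> carrier A; b \<in> carrier A|] ==> \<Phi> (a \<oplus> b) = \<Phi> a \<oplus>\<^bsub>operator_algebra B H\<^esub> \<Phi> b" by (rule operator_eqI)
  (simp_all add: H.operator_add_closed \<Phi> \<iota>_add A.mult_distr_left)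

lemma \<Phi>_smult: "a \<in> carrier A ==> \<Phi> (z \<odot> a) = z \<odot>\<^bsub>operator_algebra B H\<^esub> \<Phi> a" by (rule operator_eqI)
  (simp_all add: H.operator_smult_closed \<Phi> \<iota>_smult A.smult_mult_left)

lemma \<Phi>_mult: "[|a \<in> carrier A; b \<in> carrier A|] ==> \<Phi> (a \<otimes> b) = \<Phi> a \<otimes>\<^bsub>operator_algebra B H\<^esub> \<Phi> b" by (rule operator_eqI)
  (simp_all add: compose_adjoint_pair(1)[OF H.self.hilbert_pair_axioms H.self.hilbert_pair_axioms]
   \<Phi> compose_eq A.mult_assoc)

lemma \<Phi>_star: "a \<in> carrier A ==> \<Phi> (star A a) = adjoint B H H (\<Phi> a)"
 by (rule operator_eqI) (simp_all add: \<Phi> H.self.adjoint_adjointable(1))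

lemma \<Phi>_diff:
 assumes "a \<in> carrier A" "b \<in> carrier A" "\<zeta> \<in> carrier H"
 shows "\<Phi> (a \<ominus> b) \<zeta> = \<Phi> a \<zeta> \<ominus>\<^bsub>H\<^esub> \<Phi> b \<zeta>" using \<Phi>_add[of a "\<ominus> b"] \<Phi>_smult[of b "- 1"] assms \<Phi>_in
 by (simp add: A.smult_minus_1 H.V.smult_minus_1 A.M.minus_eq H.E.M.minus_eq)

lemma \<Phi>_continuous: "continuous_map (topo A) (topo (operator_algebra B H)) \<Phi>"
proof -
 interpret F: seminorm_family "operator_algebra B H" "op_seminorm H H ` \<S> B" by (rule H.operator_seminorm_family)
 show ?thesis unfolding topo_operator_algebra
 proof (rule F.continuous_map_into_seminorm_topology)
  fix a p and eps :: real
  assume "a \<in> topspace (topo A)" and p: "p \<in> op_seminorm H H ` \<S> B" and eps: "eps > 0"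
  then have a: "a \<in> carrier A" by simp
  obtain q where q: "q \<in> \<S> B" "p = op_seminorm H H q" using p by blast
  interpret dq: cstar_seminormed A "dom q" by (rule A.cont_seminormD[OF dom(1)[OF q(1)]])
  have "p (\<Phi> b \<ominus>\<^bsub>operator_algebra B H\<^esub> \<Phi> a) < eps" if b: "b \<in> carrier A" "dom q (b \<ominus> a) < eps" for b
  proof (rule le_less_trans[OF _ b(2)])
   show "p (\<Phi> b \<ominus>\<^bsub>operator_algebra B H\<^esub> \<Phi> a) \<le> dom q (b \<ominus> a)" unfolding q(2)
   proof (rule H.self.op_seminorm_le[OF q(1)])
    show "0 \<le> dom q (b \<ominus> a)" using a b(1) by (intro dq.nonneg) simp
    fix \<zeta> assume \<zeta>: "\<zeta> \<in> carrier H"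
    show "hm_norm H q ((\<Phi> b \<ominus>\<^bsub>operator_algebra B H\<^esub> \<Phi> a) \<zeta>) \<le> dom q (b \<ominus> a) * hm_norm H q \<zeta>"
     unfolding H.operator_minus_apply[OF \<Phi>(1)[OF b(1)] \<Phi>(1)[OF a] \<zeta>] \<Phi>_diff[OF b(1) a \<zeta>, symmetric]
     by (rule \<Phi>(4)[OF _ q(1) \<zeta>]) (use a b(1) in simp)
   qed
  qed
  then show "\<exists>U. openin (topo A) U \<and> a \<in> U \<and> (\<forall>b\<in>U. p (\<Phi> b \<ominus>\<^bsub>operator_algebra B H\<^esub> \<Phi> a) < eps)"
   using A.openin_cont_seminorm_ball[OF dom(1)[OF q(1)] a, of eps] a eps
   by (intro exI[of _ "{b \<in> carrier A. dom q (b \<ominus> a) < eps}"]) simp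
 qed (simp add: \<Phi>)
qed

theorem \<Phi>_morphism: "lc_morphism A (operator_algebra B H) \<Phi>" using \<Phi>(1) \<Phi>_add \<Phi>_smult \<Phi>_mult \<Phi>_star \<Phi>_continuous
 unfolding lc_morphism_def linear_on_def by (auto simp del: operator_algebra_simps(2-5))

text \<open>
 Since $d^2 \le d$, the square of the left side is at most $\|\langle\xi,\rho(d)\xi\rangle\|$.
\<close>

lemma \<iota>_norm_le:
 assumes d: "positive A d" and le: "!!p. p \<in> \<S> A ==> p d \<le> 1" and \<xi>: "\<xi> \<in> carrier E"
  and q: "q \<in> \<S> B"
 shows "(hm_norm H q (\<iota> (d, \<xi>)))\<^sup>2 \<le> hm_norm E q \<xi> * hm_norm E q (\<rho> d \<xi>)"
proof -
 note d' = d[unfolded A.positive_iff_spectrally_positive]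
 note h = A.spectrally_positiveD[OF d']
 obtain c where c: "c \<in> carrier A" "d \<ominus> d \<otimes> d = star A c \<otimes> c" using A.contraction_diff_square[OF d'] le by blast
 have sum: "d \<otimes> d \<oplus> star A c \<otimes> c = d"
  unfolding c(2)[symmetric] using h(1) A.M.diff_add_cancel[of d "d \<otimes> d"] by (simp add: A.M.a_comm)
 have pos: "E.spectrally_positive (ip H (\<iota> (a, \<xi>)) (\<iota> (a, \<xi>)))" if "a \<in> carrier A" for a
  using H.E.ip_positive[OF \<iota>_in[OF that \<xi>]] unfolding E.positive_iff_spectrally_positive .
 have "(hm_norm H q (\<iota> (d, \<xi>)))\<^sup>2 = q (ip H (\<iota> (d, \<xi>)) (\<iota> (d, \<xi>)))" by (rule H.hm_norm_square[OF q \<iota>_in[OF h(1) \<xi>]])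
 also have "... \<le> q (ip H (\<iota> (d, \<xi>)) (\<iota> (d, \<xi>)) \<oplus>\<^bsub>B\<^esub> ip H (\<iota> (c, \<xi>)) (\<iota> (c, \<xi>)))"
  by (rule E.spectrally_positive_norm_mono[OF pos[OF h(1)] pos[OF c(1)] q])
 also have "ip H (\<iota> (d, \<xi>)) (\<iota> (d, \<xi>)) \<oplus>\<^bsub>B\<^esub> ip H (\<iota> (c, \<xi>)) (\<iota> (c, \<xi>)) =
   ip E \<xi> (\<rho> (d \<otimes> d \<oplus> star A c \<otimes> c) \<xi>)" using h(1,2) c(1) \<xi> by (simp add: ip_\<iota>_pair \<rho>_add E.E.ip_add \<rho>_in)
 also have "q ... \<le> hm_norm E q \<xi> * hm_norm E q (\<rho> d \<xi>)" unfolding sum by (rule E.Cauchy_Schwarz[OF q \<xi> \<rho>_in[OF h(1) \<xi>]])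
 finally show ?thesis .
qed

end

locale cp_model_unit = cp_model A B E \<rho> H \<iota>
 for A :: "'a star_algebra" (structure) and B :: "'b star_algebra" and E :: "('b, 'e) hilbert_module"
  and \<rho> and H :: "('b, 'h) hilbert_module" and \<iota> :: "'a \<times> 'e => 'h" +
 fixes I :: "'i set" and prec e
 assumes unit: "approximate_unit A I prec e"
  and strict: "limitin (strict_topology B E) (\<lambda>i. \<rho> (e i)) (id_on E) (net_filter I prec)"
begin

abbreviation "net \<equiv> net_filter I prec"

lemma directed: "directed_index I prec" using unit unfolding approximate_unit_def by blast

lemma eventually_net: "eventually P net \<longleftrightarrow> (\<exists>i\<in>I. \<forall>j\<in>I. prec i j --> P j)"
proof -
 have "\<exists>k\<in>I. principal {j \<in> I. prec k j} \<le> inf (principal {j' \<in> I. prec i j'}) (principal {i \<in> I. prec j i})"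
  if ij: "i \<in> I" "j \<in> I" for i j
 proof -
  obtain k where k: "k \<in> I" "prec i k" "prec j k" using directed ij unfolding directed_index_def by blast
  have tr: "\<forall>i\<in>I. \<forall>j\<in>I. \<forall>k\<in>I. prec i j --> prec j k --> prec i k" using directed unfolding directed_index_def by blast
  have "{j \<in> I. prec k j} \<subseteq> {m \<in> I. prec i m} \<inter> {m \<in> I. prec j m}" using k tr ij by blast
  then show ?thesis using k(1) by (intro bexI[of _ k]) simp_all
 qed
 moreover have "I \<noteq> {}" using directed unfolding directed_index_def by blast
 ultimately show ?thesis unfolding net_filter_def by (subst eventually_INF_base) (auto simp: eventually_principal)
qed

lemma net_nontrivial: "net \<noteq> bot"
 unfolding trivial_limit_def eventually_net using directed unfolding directed_index_def by blast

lemma e_in: "i \<in> I ==> e i \<in> carrier A"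
 and e_positive: "i \<in> I ==> positive A (e i)"
 and e_mono: "[|i \<in> I; j \<in> I; prec i j|] ==> positive A (e j \<ominus> e i)"
 and e_le_1: "[|p \<in> \<S> A; i \<in> I|] ==> p (e i) \<le> 1" using unit unfolding approximate_unit_def by blast+

lemma eventually_in: "eventually (\<lambda>i. i \<in> I) net"
 unfolding eventually_net using directed unfolding directed_index_def by blast

lemma e_unit:
 assumes "p \<in> \<S> A" "a \<in> carrier A" "eps > 0"
 shows "eventually (\<lambda>i. p (e i \<otimes> a \<ominus> a) < eps) net"
proof -
 have "((\<lambda>i. p (e i \<otimes> a \<ominus> a)) \<longlongrightarrow> 0) net" using unit assms(1,2) unfolding approximate_unit_def by blast
 then show ?thesis by (rule order_tendstoD(2)[OF _ assms(3)])
qed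

lemma \<rho>_e:
 assumes "q \<in> \<S> B" "\<xi> \<in> carrier E" "eps > 0"
 shows "eventually (\<lambda>i. hm_norm E q (\<rho> (e i) \<xi> \<ominus>\<^bsub>E\<^esub> \<xi>) < eps) net" by (rule E.limitin_strict_topologyD[OF strict _ assms])
  (rule eventually_mono[OF eventually_in \<rho>_closed[OF e_in]])

lemma \<iota>_e:
 assumes q: "q \<in> \<S> B" and a: "a \<in> carrier A" and \<xi>: "\<xi> \<in> carrier E" and eps: "eps > 0"
 shows "eventually (\<lambda>i. hm_norm H q (\<iota> (e i \<otimes> a, \<xi>) \<ominus>\<^bsub>H\<^esub> \<iota> (a, \<xi>)) < eps) net"
proof -
 interpret p: cstar_seminormed A "dom q" by (rule A.cont_seminormD[OF dom(1)[OF q]])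
 obtain K where K: "K \<ge> 0" "\<forall>a\<in>carrier A. \<forall>\<xi>\<in>carrier E. hm_norm H q (\<iota> (a, \<xi>)) \<le> K * dom q a * hm_norm E q \<xi>"
  using dom(2)[OF q] by blast
 define N where "N = K * hm_norm E q \<xi>"
 have N: "N \<ge> 0" using K(1) E.hm_norm_nonneg[OF q \<xi>] by (simp add: N_def)
 define del where "del = eps / (N + 1)"
 have del: "del > 0" "(N + 1) * del = eps" using eps N by (simp_all add: del_def)
 have "hm_norm H q (\<iota> (e i \<otimes> a, \<xi>) \<ominus>\<^bsub>H\<^esub> \<iota> (a, \<xi>)) < eps"
  if i: "i \<in> I" "dom q (e i \<otimes> a \<ominus> a) < del" for i
 proof -
  let ?d = "e i \<otimes> a \<ominus> a"
  have d: "?d \<in> carrier A" using e_in[OF i(1)] a by simp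
  have "hm_norm H q (\<iota> (e i \<otimes> a, \<xi>) \<ominus>\<^bsub>H\<^esub> \<iota> (a, \<xi>)) = hm_norm H q (\<iota> (?d, \<xi>))" using e_in[OF i(1)] a \<xi> by (simp add: \<iota>_diff)
  also have "... \<le> N * dom q ?d" using K(2)[rule_format, OF d \<xi>] by (simp add: N_def mult_ac)
  also have "... \<le> N * del" using i(2) N by (intro mult_left_mono) simp_all
  also have "... < eps" using del by (simp add: algebra_simps)
  finally show ?thesis .
 qed
 then show ?thesis using eventually_conj[OF eventually_in e_unit[OF dom(1)[OF q] a del(1)]] by (elim eventually_mono) simp
qed

text \<open>
 $V\xi$ has to be the limit of $\Phi(e_i)V\xi = \iota(e_i,\xi)$. For $i \le j$ the element $e_j - e_i$ is a
 positive contraction, so \<open>\<iota>_norm_le\<close> bounds $\iota(e_j,\xi) - \iota(e_i,\xi)$ by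
 $\rho(e_j)\xi - \rho(e_i)\xi$, which tends to 0 because \<open>\<rho>\<close> is non-degenerate.
\<close>

lemma V_limit_exists:
 assumes \<xi>: "\<xi> \<in> carrier E"
 shows "\<exists>\<zeta>\<in>carrier H. \<forall>q\<in>\<S> B. \<forall>eps>0. eventually (\<lambda>i. hm_norm H q (\<iota> (e i, \<xi>) \<ominus>\<^bsub>H\<^esub> \<zeta>) < eps) net"
proof (rule H.hm_complete_filter[OF net_nontrivial])
 show "eventually (\<lambda>i. \<iota> (e i, \<xi>) \<in> carrier H) net" by (rule eventually_mono[OF eventually_in]) (use \<xi> in \<open>simp add: e_in\<close>)
 fix q and eps :: real assume q: "q \<in> \<S> B" and eps: "eps > 0"
 interpret qE: seminormed_module E "hm_norm E q" by (rule E.hm_norm_seminormed[OF q])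
 interpret qH: seminormed_module H "hm_norm H q" by (rule H.hm_norm_seminormed[OF q])
 define N where "N = 2 * hm_norm E q \<xi>"
 have N: "N \<ge> 0" using qE.nonneg[OF \<xi>] by (simp add: N_def)
 define del where "del = (eps / 2)\<^sup>2 / (N + 1)"
 have del: "del > 0" "(N + 1) * del = (eps / 2)\<^sup>2" using eps N by (simp_all add: del_def)
 obtain k where k: "k \<in> I" "\<forall>j\<in>I. prec k j --> hm_norm E q (\<rho> (e j) \<xi> \<ominus>\<^bsub>E\<^esub> \<xi>) < del"
  using \<rho>_e[OF q \<xi> del(1)] unfolding eventually_net by blast
 have kk: "prec k k" using directed k(1) unfolding directed_index_def by blast
 have near: "hm_norm H q (\<iota> (e j, \<xi>) \<ominus>\<^bsub>H\<^esub> \<iota> (e k, \<xi>)) < eps / 2" if j: "j \<in> I" "prec k j" for j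
 proof -
  note ej = e_in[OF j(1)] and ek = e_in[OF k(1)]
  let ?d = "e j \<ominus> e k"
  have pos: "positive A ?d" by (rule e_mono[OF k(1) j])
  have le: "p ?d \<le> 1" if p: "p \<in> \<S> A" for p
  proof -
   have "p ?d \<le> p (?d \<oplus> e k)" by (rule A.spectrally_positive_norm_mono[OF pos[unfolded A.positive_iff_spectrally_positive]
       e_positive[OF k(1), unfolded A.positive_iff_spectrally_positive] p])
   also have "?d \<oplus> e k = e j" using ej ek by (rule A.M.diff_add_cancel)
   finally show ?thesis using e_le_1[OF p j(1)] by linarith
  qed
  have "hm_norm E q (\<rho> ?d \<xi>) \<le> hm_norm E q (\<rho> (e j) \<xi> \<ominus>\<^bsub>E\<^esub> \<xi>) + hm_norm E q (\<xi> \<ominus>\<^bsub>E\<^esub> \<rho> (e k) \<xi>)"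
   unfolding \<rho>_diff[OF ej ek \<xi>] by (rule qE.diff_triangle[OF \<rho>_in[OF ej \<xi>] \<xi> \<rho>_in[OF ek \<xi>]])
  moreover have "hm_norm E q (\<xi> \<ominus>\<^bsub>E\<^esub> \<rho> (e k) \<xi>) = hm_norm E q (\<rho> (e k) \<xi> \<ominus>\<^bsub>E\<^esub> \<xi>)" by (rule qE.diff_sym[OF \<xi> \<rho>_in[OF ek \<xi>]])
  ultimately have "hm_norm E q (\<rho> ?d \<xi>) \<le> 2 * del" using k(2)[rule_format, OF j] k(2)[rule_format, OF k(1) kk] by linarith
  then have "hm_norm E q \<xi> * hm_norm E q (\<rho> ?d \<xi>) \<le> hm_norm E q \<xi> * (2 * del)" by (rule mult_left_mono[OF _ qE.nonneg[OF \<xi>]])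
  moreover have "(hm_norm H q (\<iota> (?d, \<xi>)))\<^sup>2 \<le> hm_norm E q \<xi> * hm_norm E q (\<rho> ?d \<xi>)"
   by (rule \<iota>_norm_le[OF pos _ \<xi> q]) (rule le)
  ultimately have "(hm_norm H q (\<iota> (?d, \<xi>)))\<^sup>2 \<le> N * del" by (simp add: N_def)
  also have "... < (eps / 2)\<^sup>2" using del by (simp add: algebra_simps)
  finally have "hm_norm H q (\<iota> (?d, \<xi>)) < eps / 2" by (rule power2_less_imp_less) (use eps in simp)
  then show ?thesis unfolding \<iota>_diff[OF ej ek \<xi>] .
 qed
 have "hm_norm H q (\<iota> (e i, \<xi>) \<ominus>\<^bsub>H\<^esub> \<iota> (e j, \<xi>)) < eps" if "i \<in> I" "prec k i" "j \<in> I" "prec k j" for i j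
 proof -
  note mem = \<iota>_in[OF e_in \<xi>]
  have "hm_norm H q (\<iota> (e i, \<xi>) \<ominus>\<^bsub>H\<^esub> \<iota> (e j, \<xi>)) \<le>
    hm_norm H q (\<iota> (e i, \<xi>) \<ominus>\<^bsub>H\<^esub> \<iota> (e k, \<xi>)) + hm_norm H q (\<iota> (e k, \<xi>) \<ominus>\<^bsub>H\<^esub> \<iota> (e j, \<xi>))"
   by (rule qH.diff_triangle[OF mem[OF that(1)] mem[OF k(1)] mem[OF that(3)]])
  moreover have "hm_norm H q (\<iota> (e k, \<xi>) \<ominus>\<^bsub>H\<^esub> \<iota> (e j, \<xi>)) = hm_norm H q (\<iota> (e j, \<xi>) \<ominus>\<^bsub>H\<^esub> \<iota> (e k, \<xi>))"
   by (rule qH.diff_sym[OF mem[OF k(1)] mem[OF that(3)]])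
  ultimately show ?thesis using near[OF that(1,2)] near[OF that(3,4)] by linarith
 qed
 then show "\<exists>Q. eventually Q net \<and> (\<forall>i j. Q i --> Q j --> hm_norm H q (\<iota> (e i, \<xi>) \<ominus>\<^bsub>H\<^esub> \<iota> (e j, \<xi>)) < eps)"
  using k(1) by (intro exI[of _ "\<lambda>i. i \<in> I \<and> prec k i"]) (auto simp: eventually_net)
qed

end

section \<open>The intertwining operator\<close>

context cp_model_unit
begin

definition V0 :: "'e => 'h"
 where "V0 \<xi> = (SOME \<zeta>. \<zeta> \<in> carrier H \<and>
  (\<forall>q\<in>\<S> B. \<forall>eps>0. eventually (\<lambda>i. hm_norm H q (\<iota> (e i, \<xi>) \<ominus>\<^bsub>H\<^esub> \<zeta>) < eps) net))"

lemma V0: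
 assumes "\<xi> \<in> carrier E"
 shows "V0 \<xi> \<in> carrier H"
  "!!q eps. [|q \<in> \<S> B; eps > 0|] ==> eventually (\<lambda>i. hm_norm H q (\<iota> (e i, \<xi>) \<ominus>\<^bsub>H\<^esub> V0 \<xi>) < eps) net"
 using someI_ex[OF V_limit_exists[OF assms, unfolded Bex_def]] unfolding V0_def by blast+

lemma V0_near:
 assumes \<xi>: "\<xi> \<in> carrier E" and q: "q \<in> \<S> B" and eps: "eps > 0" and P: "eventually P net"
 obtains i where "i \<in> I" "P i" "hm_norm H q (V0 \<xi> \<ominus>\<^bsub>H\<^esub> \<iota> (e i, \<xi>)) < eps"
proof -
 interpret qH: seminormed_module H "hm_norm H q" by (rule H.hm_norm_seminormed[OF q])
 have "eventually (\<lambda>i. i \<in> I \<and> P i \<and> hm_norm H q (\<iota> (e i, \<xi>) \<ominus>\<^bsub>H\<^esub> V0 \<xi>) < eps) net"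
  by (intro eventually_conj eventually_in P V0(2)[OF \<xi> q eps])
 from eventually_happens'[OF net_nontrivial this]
 obtain i where i: "i \<in> I" "P i" "hm_norm H q (\<iota> (e i, \<xi>) \<ominus>\<^bsub>H\<^esub> V0 \<xi>) < eps" by blast
 show ?thesis by (rule that[OF i(1,2)]) (use i(3) qH.diff_sym[OF V0(1)[OF \<xi>] \<iota>_in[OF e_in[OF i(1)] \<xi>]] in simp)
qed

lemma ip_V0:
 assumes \<xi>: "\<xi> \<in> carrier E" and a: "a \<in> carrier A" and \<eta>: "\<eta> \<in> carrier E"
 shows "ip H (V0 \<xi>) (\<iota> (a, \<eta>)) = ip E \<xi> (\<rho> a \<eta>)"
proof (rule E.eqI)
 let ?y = "\<iota> (a, \<eta>)"
 have y: "?y \<in> carrier H" using a \<eta> by simp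
 note V\<xi> = V0(1)[OF \<xi>]
 show "ip H (V0 \<xi>) ?y \<in> carrier B" "ip E \<xi> (\<rho> a \<eta>) \<in> carrier B" using V\<xi> y \<xi> \<rho>_in[OF a \<eta>] by simp_all
 fix q and eps :: real assume q: "q \<in> \<S> B" and eps: "eps > 0"
 interpret qB: cstar_seminormed B q by (rule E.cont_seminormD[OF q])
 obtain p C where p: "p \<in> \<S> A" and C: "C \<ge> 0" "\<forall>a\<in>carrier A. op_seminorm E E q (\<rho> a) \<le> C * p a" using \<rho>_bound[OF q] by blast
 define M where "M = hm_norm E q \<xi> * (C * hm_norm E q \<eta>)"
 have M: "M \<ge> 0" using C(1) E.hm_norm_nonneg[OF q \<xi>] E.hm_norm_nonneg[OF q \<eta>] by (simp add: M_def)
 have Y: "hm_norm H q ?y \<ge> 0" by (rule H.hm_norm_nonneg[OF q y])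
 define del where "del = eps / (hm_norm H q ?y + M + 1)"
 have del: "del > 0" "(hm_norm H q ?y + M + 1) * del = eps" using eps M Y by (simp_all add: del_def)
 obtain i where i: "i \<in> I" "p (e i \<otimes> a \<ominus> a) < del" "hm_norm H q (V0 \<xi> \<ominus>\<^bsub>H\<^esub> \<iota> (e i, \<xi>)) < del"
  by (rule V0_near[OF \<xi> q del(1) e_unit[OF p a del(1)]])
 note ei = e_in[OF i(1)]
 have sa: "star A (e i) = e i"
  by (rule A.spectrally_positiveD(2)[OF e_positive[OF i(1), unfolded A.positive_iff_spectrally_positive]])
 let ?d = "e i \<otimes> a \<ominus> a"
 have d: "?d \<in> carrier A" and ea: "e i \<otimes> a \<in> carrier A" using ei a by simp_all
 have x: "\<iota> (e i, \<xi>) \<in> carrier H" using ei \<xi> by simp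
 have "q (ip H (V0 \<xi>) ?y \<ominus>\<^bsub>B\<^esub> ip H (\<iota> (e i, \<xi>)) ?y) = q (ip H (V0 \<xi> \<ominus>\<^bsub>H\<^esub> \<iota> (e i, \<xi>)) ?y)"
  using V\<xi> x y by (simp add: H.ip_diff_left)
 also have "... \<le> hm_norm H q (V0 \<xi> \<ominus>\<^bsub>H\<^esub> \<iota> (e i, \<xi>)) * hm_norm H q ?y" by (rule H.Cauchy_Schwarz[OF q _ y]) (use V\<xi> x in simp)
 also have "... \<le> del * hm_norm H q ?y" using i(3) Y by (intro mult_right_mono) simp_all
 finally have 1: "q (ip H (V0 \<xi>) ?y \<ominus>\<^bsub>B\<^esub> ip H (\<iota> (e i, \<xi>)) ?y) \<le> del * hm_norm H q ?y" .
 have "q (ip H (\<iota> (e i, \<xi>)) ?y \<ominus>\<^bsub>B\<^esub> ip E \<xi> (\<rho> a \<eta>)) = q (ip E \<xi> (\<rho> ?d \<eta>))"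
  using ei ea a \<xi> \<eta> by (simp add: ip_\<iota>_pair sa \<rho>_diff E.ip_diff_right \<rho>_in)
 also have "... \<le> hm_norm E q \<xi> * hm_norm E q (\<rho> ?d \<eta>)" by (rule E.Cauchy_Schwarz[OF q \<xi> \<rho>_in[OF d \<eta>]])
 also have "... \<le> hm_norm E q \<xi> * ((C * p ?d) * hm_norm E q \<eta>)"
 proof (rule mult_left_mono[OF order_trans E.hm_norm_nonneg[OF q \<xi>]])
  show "hm_norm E q (\<rho> ?d \<eta>) \<le> op_seminorm E E q (\<rho> ?d) * hm_norm E q \<eta>"
   by (rule E.self.hm_norm_le_op_seminorm[OF \<rho>_closed[OF d] q \<eta>])
  show "... \<le> (C * p ?d) * hm_norm E q \<eta>" by (rule mult_right_mono[OF C(2)[rule_format, OF d] E.hm_norm_nonneg[OF q \<eta>]])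
 qed
 also have "... = M * p ?d" by (simp add: M_def mult_ac)
 also have "... \<le> M * del" using i(2) M by (intro mult_left_mono) simp_all
 finally have 2: "q (ip H (\<iota> (e i, \<xi>)) ?y \<ominus>\<^bsub>B\<^esub> ip E \<xi> (\<rho> a \<eta>)) \<le> M * del" .
 have "q (ip H (V0 \<xi>) ?y \<ominus>\<^bsub>B\<^esub> ip E \<xi> (\<rho> a \<eta>)) \<le> q (ip H (V0 \<xi>) ?y \<ominus>\<^bsub>B\<^esub> ip H (\<iota> (e i, \<xi>)) ?y) +
   q (ip H (\<iota> (e i, \<xi>)) ?y \<ominus>\<^bsub>B\<^esub> ip E \<xi> (\<rho> a \<eta>))" by (rule qB.diff_triangle) (use V\<xi> x y \<xi> \<rho>_in[OF a \<eta>] in simp_all)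
 also have "... \<le> del * hm_norm H q ?y + M * del" using 1 2 by linarith
 also have "... \<le> eps" using del by (simp add: algebra_simps)
 finally show "q (ip H (V0 \<xi>) ?y \<ominus>\<^bsub>B\<^esub> ip E \<xi> (\<rho> a \<eta>)) \<le> eps" .
qed

lemma V0_bounded:
 assumes q: "q \<in> \<S> B"
 shows "\<exists>C\<ge>0. \<forall>\<xi>\<in>carrier E. hm_norm H q (V0 \<xi>) \<le> C * hm_norm E q \<xi>"
proof -
 interpret qH: seminormed_module H "hm_norm H q" by (rule H.hm_norm_seminormed[OF q])
 obtain K where K: "K \<ge> 0" "\<forall>a\<in>carrier A. \<forall>\<xi>\<in>carrier E. hm_norm H q (\<iota> (a, \<xi>)) \<le> K * dom q a * hm_norm E q \<xi>"
  using dom(2)[OF q] by blast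
 have "hm_norm H q (V0 \<xi>) \<le> K * hm_norm E q \<xi>" if \<xi>: "\<xi> \<in> carrier E" for \<xi>
 proof (rule field_le_epsilon)
  fix eps :: real assume eps: "eps > 0"
  obtain i where i: "i \<in> I" "hm_norm H q (V0 \<xi> \<ominus>\<^bsub>H\<^esub> \<iota> (e i, \<xi>)) < eps" by (rule V0_near[OF \<xi> q eps, of "\<lambda>_. True"]) simp_all
  have "hm_norm H q (\<iota> (e i, \<xi>)) \<le> (K * dom q (e i)) * hm_norm E q \<xi>" using K(2) e_in[OF i(1)] \<xi> by simp
  also have "... \<le> (K * 1) * hm_norm E q \<xi>"
   using e_le_1[OF dom(1)[OF q] i(1)] K(1) E.hm_norm_nonneg[OF q \<xi>] by (intro mult_right_mono mult_left_mono) simp_all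
  finally show "hm_norm H q (V0 \<xi>) \<le> K * hm_norm E q \<xi> + eps"
   using qH.le_diff_add[OF V0(1)[OF \<xi>] \<iota>_in[OF e_in[OF i(1)] \<xi>]] i(2) by simp
 qed
 with K(1) show ?thesis by blast
qed

definition V :: "'e => 'h"
 where "V = restrict V0 (carrier E)"

lemma V_adjointable: "V \<in> adjointable B E H"
proof -
 have "\<exists>S. EH.adjoint_pair V0 S" by (rule EH.adjoint_from_generators[OF V0(1) V0_bounded generating,
     where \<sigma> = "\<lambda>y. \<rho> (fst y) (snd y)" and ng = "\<lambda>x. (fst x, \<ominus>\<^bsub>E\<^esub> snd x)"])
   (auto simp: \<Omega>_def \<rho>_in ip_V0 \<iota>_minus_right)
 then show ?thesis unfolding V_def using EH.adjoint_pair_adjointable(1) by blast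
qed

lemma V_in: "\<xi> \<in> carrier E ==> V \<xi> \<in> carrier H" by (rule EH.adjointable_closed[OF V_adjointable])

lemma ip_V:
 "[|\<xi> \<in> carrier E; a \<in> carrier A; \<eta> \<in> carrier E|] ==> ip H (V \<xi>) (\<iota> (a, \<eta>)) = ip E \<xi> (\<rho> a \<eta>)" by (simp add: V_def ip_V0)

lemma adjoint_V:
 assumes a: "a \<in> carrier A" and \<eta>: "\<eta> \<in> carrier E"
 shows "adjoint B E H V (\<iota> (a, \<eta>)) = \<rho> a \<eta>"
proof (rule E.hm_eqI[OF EH.adjoint_closed[OF V_adjointable \<iota>_in[OF a \<eta>]] \<rho>_in[OF a \<eta>]])
 fix \<xi> assume \<xi>: "\<xi> \<in> carrier E"
 have "ip E (adjoint B E H V (\<iota> (a, \<eta>))) \<xi> = star B (ip H (V \<xi>) (\<iota> (a, \<eta>)))"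
  using EH.ip_adjoint'[OF V_adjointable \<xi> \<iota>_in[OF a \<eta>]] a \<eta> \<xi> by (simp add: H.E.ip_star V_in)
 then show "ip E (adjoint B E H V (\<iota> (a, \<eta>))) \<xi> = ip E (\<rho> a \<eta>) \<xi>" using a \<eta> \<xi> by (simp add: ip_V E.E.ip_star \<rho>_in)
qed

lemma \<Phi>_V:
 assumes a: "a \<in> carrier A" and \<xi>: "\<xi> \<in> carrier E"
 shows "\<Phi> a (V \<xi>) = \<iota> (a, \<xi>)"
proof (rule \<iota>_eqI[OF \<Phi>_in[OF a V_in[OF \<xi>]] \<iota>_in[OF a \<xi>]])
 fix b \<eta> assume b: "b \<in> carrier A" and \<eta>: "\<eta> \<in> carrier E"
 show "ip H (\<Phi> a (V \<xi>)) (\<iota> (b, \<eta>)) = ip H (\<iota> (a, \<xi>)) (\<iota> (b, \<eta>))"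
  using a b \<xi> \<eta> H.self.ip_adjoint[OF \<Phi>(1)[OF a] V_in[OF \<xi>] \<iota>_in[OF b \<eta>]] by (simp add: \<Phi>(3) ip_V ip_\<iota>_pair)
qed

theorem \<rho>_dilation:
 assumes a: "a \<in> carrier A"
 shows "\<rho> a = compose (carrier E) (adjoint B E H V) (compose (carrier E) (\<Phi> a) V)"
 by (rule extensionalityI[OF E.self.adjointable_extensional[OF \<rho>_closed[OF a]] compose_extensional])
  (simp add: compose_eq \<Phi>_V[OF a] adjoint_V[OF a])

end

lemma (in complex_module) linear_span_eq_lsum:
 assumes f: "!!x. x \<in> D ==> f x \<in> carrier M"
  and scale: "!!x z. x \<in> D ==> \<exists>y\<in>D. f y = z \<odot> f x"
 shows "linear_span M (f ` D) = {lsum M f l |l. set l \<subseteq> D}" (is "_ = ?S")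
proof
 have cl: "lsum M f l \<in> carrier M" if "set l \<subseteq> D" for l using that f by blast
 have smult: "\<exists>l'. set l' \<subseteq> D \<and> lsum M f l' = z \<odot> lsum M f l" if "set l \<subseteq> D" for z l using that
 proof (induction l)
  case Nil
  then show ?case by (intro exI[of _ "[]"]) simp
 next
  case (Cons x l)
  then obtain l' y where "set l' \<subseteq> D" "lsum M f l' = z \<odot> lsum M f l" "y \<in> D" "f y = z \<odot> f x" using scale[of x z] by auto
  then show ?case using Cons.prems f cl[of l] by (intro exI[of _ "y # l'"]) (simp add: smult_add_right)
 qed
 have "submodule ?S complex_ring M"
 proof (rule submoduleI)
  show "?S \<subseteq> carrier M" using cl by blast
  show "\<zero> \<in> ?S" by (rule CollectI, rule exI[of _ "[]"]) simp
  fix a b z assume a: "a \<in> ?S"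
  show za: "w \<odot> a \<in> ?S" for w
  proof -
   obtain l where l: "set l \<subseteq> D" "a = lsum M f l" using a by blast
   obtain l' where "set l' \<subseteq> D" "lsum M f l' = w \<odot> lsum M f l" using smult[OF l(1)] by blast
   then show ?thesis unfolding l(2) by (intro CollectI exI[of _ l']) simp
  qed
  have "\<ominus> a = (- 1) \<odot> a" using a cl smult_minus_1[of a] by auto
  then show "\<ominus> a \<in> ?S" using za[of "- 1"] by (simp only:)
  assume b: "b \<in> ?S"
  obtain l l' where l: "set l \<subseteq> D" "a = lsum M f l" "set l' \<subseteq> D" "b = lsum M f l'" using a b by blast
  have "lsum M f (l @ l') = a \<oplus> b" unfolding l(2,4) by (rule lsum_append) (use l f in auto)
  then show "a \<oplus> b \<in> ?S" using l(1,3) by (intro CollectI exI[of _ "l @ l'"]) simp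
 qed
 moreover have "f ` D \<subseteq> ?S"
 proof
  fix y assume "y \<in> f ` D"
  then obtain x where "x \<in> D" "y = f x" by blast
  then show "y \<in> ?S" using f[of x] by (intro CollectI exI[of _ "[x]"]) simp
 qed
 ultimately show "linear_span M (f ` D) \<subseteq> ?S" unfolding linear_span_def by blast
 have "lsum M f l \<in> N" if l: "set l \<subseteq> D" and N: "submodule N complex_ring M" "f ` D \<subseteq> N" for l N using l
 proof (induction l)
  case Nil
  then show ?case using N(1) subgroup.one_closed[OF submodule.axioms(1)[OF N(1)]] by simp
 next
  case (Cons x l)
  then show ?case using N(2) submoduleE(5)[OF N(1), of "f x" "lsum M f l"] by auto
 qed
 then show "?S \<subseteq> linear_span M (f ` D)" unfolding linear_span_def by blast
qed

lemma (in lc_hilbert) generating_iff_dense_span: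
 assumes f: "!!x. x \<in> D ==> f x \<in> carrier E"
  and scale: "!!x z. x \<in> D ==> \<exists>y\<in>D. f y = z \<odot> f x"
 shows "generating D f \<longleftrightarrow> dense_in (hm_topology B E) (linear_span E (f ` D))"
proof -
 have eq: "linear_span E (f ` D) = {lsum E f l |l. set l \<subseteq> D}" by (rule V.linear_span_eq_lsum) (use f scale in blast)+
 have ex: "(\<exists>d\<in>{lsum E f l |l. set l \<subseteq> D}. P d) \<longleftrightarrow> (\<exists>l. set l \<subseteq> D \<and> P (lsum E f l))" for P by blast
 have "{lsum E f l |l. set l \<subseteq> D} \<subseteq> carrier E" using f by blast
 then show ?thesis unfolding eq dense_in_hm_topology generating_def ex using f by blast
qed

context cp_model_unit
begin

theorem \<Phi>_V_span_dense:
 "dense_in (hm_topology B H) (linear_span H {\<Phi> a (V \<xi>) |a \<xi>. a \<in> carrier A \<and> \<xi> \<in> carrier E})"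
proof -
 have "{\<Phi> a (V \<xi>) |a \<xi>. a \<in> carrier A \<and> \<xi> \<in> carrier E} = \<iota> ` \<Omega>" by (auto simp: \<Omega>_def \<Phi>_V image_iff) (use \<Phi>_V in force)+
 moreover have "dense_in (hm_topology B H) (linear_span H (\<iota> ` \<Omega>))"
 proof (rule iffD1[OF H.generating_iff_dense_span generating])
  show "\<exists>y\<in>\<Omega>. \<iota> y = z \<odot>\<^bsub>H\<^esub> \<iota> x" if "x \<in> \<Omega>" for x z
   using that by (intro bexI[of _ "(fst x, z \<odot>\<^bsub>E\<^esub> snd x)"]) (auto simp: \<Omega>_def \<iota>_smult_right)
 qed (auto simp: \<Omega>_def)
 ultimately show ?thesis by simp
qed

end

section \<open>The representation of the group\<close>

lemma (in lc_hilbert) id_on_adjointable: "id_on E \<in> adjointable B E E"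
 using self.adjoint_pair_adjointable(1)[of "\<lambda>\<xi>. \<xi>" "\<lambda>\<xi>. \<xi>"] unfolding self.adjoint_pair_def id_on_def by simp

lemma (in hilbert_pair) ip_lsum_cong:
 assumes f: "!!x. x \<in> set l ==> f x \<in> carrier E" and g: "!!x. x \<in> set l ==> g x \<in> carrier F"
  and eq: "!!x y. [|x \<in> set l; y \<in> set l|] ==> ip E (f x) (f y) = ip F (g x) (g y)"
 shows "ip E (lsum E f l) (lsum E f l) = ip F (lsum F g l) (lsum F g l)"
proof -
 have "ip E (lsum E f l) (lsum E f l) = lsum B (\<lambda>x. ip E (f x) (lsum E f l)) l"
  by (rule E.ip_lsum_left[OF E.V.lsum_closed[OF f] f])
 also have "... = lsum B (\<lambda>x. lsum B (\<lambda>y. ip E (f x) (f y)) l) l" by (rule lsum_cong, rule E.ip_lsum_right[OF f f])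
 also have "... = lsum B (\<lambda>x. lsum B (\<lambda>y. ip F (g x) (g y)) l) l" by (intro lsum_cong eq)
 also have "... = lsum B (\<lambda>x. ip F (g x) (lsum F g l)) l" by (rule lsum_cong, rule F.ip_lsum_right[OF g g, symmetric])
 also have "... = ip F (lsum F g l) (lsum F g l)" by (rule F.ip_lsum_left[OF F.V.lsum_closed[OF g] g, symmetric])
 finally show ?thesis .
qed

lemma (in lc_hilbert) generating_reindex:
 assumes gen: "generating \<Omega> \<iota>" and m: "!!x. x \<in> \<Omega> ==> m x \<in> \<Omega>" and m': "!!x. x \<in> \<Omega> ==> m' x \<in> \<Omega> \<and> m (m' x) = x"
 shows "generating \<Omega> (\<lambda>x. \<iota> (m x))" unfolding generating_def
proof (intro conjI ballI allI impI)
 show "\<iota> (m x) \<in> carrier E" if "x \<in> \<Omega>" for x by (rule generating_closed[OF gen m[OF that]])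
 fix \<xi> q and eps :: real assume "\<xi> \<in> carrier E" "q \<in> \<S> B" "eps > 0"
 then obtain l where l: "set l \<subseteq> \<Omega>" "hm_norm E q (lsum E \<iota> l \<ominus> \<xi>) < eps" by (rule generatingE[OF gen])
 have "lsum E (\<lambda>x. \<iota> (m x)) (map m' l) = lsum E \<iota> l" unfolding lsum_map by (rule lsum_cong) (use l(1) m' in auto)
 then show "\<exists>l. set l \<subseteq> \<Omega> \<and> hm_norm E q (lsum E (\<lambda>x. \<iota> (m x)) l \<ominus> \<xi>) < eps" using l m' by (intro exI[of _ "map m' l"]) auto
qed

text \<open>
 Two modules with the same kernel on their generators are unitarily equivalent. This produces the
 unitaries $v_g$ as well as the equivalence of two dilations.
\<close>

lemma (in hilbert_pair) unitary_from_generators: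
 assumes gen: "E.generating \<Omega> \<iota>" and gen': "F.generating \<Omega> \<kappa>"
  and ip: "!!x y. [|x \<in> \<Omega>; y \<in> \<Omega>|] ==> ip F (\<kappa> x) (\<kappa> y) = ip E (\<iota> x) (\<iota> y)"
  and neg: "!!x. x \<in> \<Omega> ==> ng x \<in> \<Omega> \<and> \<iota> (ng x) = \<ominus> \<iota> x \<and> \<kappa> (ng x) = \<ominus>\<^bsub>F\<^esub> \<kappa> x"
 shows "\<exists>U. unitary_op B E F U \<and> (\<forall>x\<in>\<Omega>. U (\<iota> x) = \<kappa> x \<and> adjoint B E F U (\<kappa> x) = \<iota> x)"
proof -
 note \<iota> = E.generating_closed[OF gen] and \<kappa> = F.generating_closed[OF gen']
 have "\<exists>U\<in>adjointable B E F. (\<forall>x\<in>\<Omega>. U (\<iota> x) = \<kappa> x) \<and> (\<forall>y\<in>\<Omega>. adjoint B E F U (\<kappa> y) = \<iota> y) \<and>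
  (\<forall>q\<in>\<S> B. \<forall>\<xi>\<in>carrier E. hm_norm F q (U \<xi>) \<le> 1 * hm_norm E q \<xi>)"
 proof (rule operator_from_generators[OF gen gen' \<kappa> \<iota> ip neg])
  show "ng y \<in> \<Omega> \<and> \<kappa> (ng y) = \<ominus>\<^bsub>F\<^esub> \<kappa> y" if "y \<in> \<Omega>" for y using neg[OF that] by blast
  fix q
  have "hm_norm F q (lsum F \<kappa> l) = hm_norm E q (lsum E \<iota> l)" if "set l \<subseteq> \<Omega>" for l
  proof -
   have l: "x \<in> \<Omega>" if "x \<in> set l" for x using that \<open>set l \<subseteq> \<Omega>\<close> by blast
   have "ip E (lsum E \<iota> l) (lsum E \<iota> l) = ip F (lsum F \<kappa> l) (lsum F \<kappa> l)" by (rule ip_lsum_cong) (simp_all add: \<iota> \<kappa> l ip)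
   then show ?thesis by (simp add: hm_norm_def)
  qed
  then show "0 \<le> (1::real) \<and> (\<forall>l. set l \<subseteq> \<Omega> --> hm_norm F q (lsum F \<kappa> l) \<le> 1 * hm_norm E q (lsum E \<iota> l))" by simp
 qed
 then obtain U where U: "U \<in> adjointable B E F" "!!x. x \<in> \<Omega> ==> U (\<iota> x) = \<kappa> x"
  "!!x. x \<in> \<Omega> ==> adjoint B E F U (\<kappa> x) = \<iota> x" by blast
 note U' = adjoint_adjointable(1)[OF U(1)]
 have "compose (carrier E) (adjoint B E F U) U = id_on E" by (rule E.self.adjointable_eq_on_generators[OF gen
     compose_adjoint_pair(1)[OF hilbert_pair_axioms flip.hilbert_pair_axioms U(1) U'] E.id_on_adjointable])
   (simp add: compose_eq U(2,3) \<iota> id_on_def)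
 moreover have "compose (carrier F) U (adjoint B E F U) = id_on F" by (rule F.self.adjointable_eq_on_generators[OF gen'
     compose_adjoint_pair(1)[OF flip.hilbert_pair_axioms hilbert_pair_axioms U' U(1)] F.id_on_adjointable])
   (simp add: compose_eq U(2,3) \<kappa> id_on_def)
 ultimately show ?thesis using U unfolding unitary_op_def by (intro exI[of _ U]) simp
qed

lemma (in lc_hilbert) contractions_converge:
 assumes gen: "generating \<Omega> \<iota>" and q: "q \<in> \<S> B"
  and T: "eventually (\<lambda>i. T i \<in> adjointable B E E \<and> (\<forall>\<zeta>\<in>carrier E. hm_norm E q (T i \<zeta>) \<le> hm_norm E q \<zeta>)) F"
  and S: "S \<in> adjointable B E E" "!!\<zeta>. \<zeta> \<in> carrier E ==> hm_norm E q (S \<zeta>) \<le> hm_norm E q \<zeta>"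
  and conv: "!!x eps. [|x \<in> \<Omega>; eps > 0|] ==> eventually (\<lambda>i. hm_norm E q (T i (\<iota> x) \<ominus> S (\<iota> x)) < eps) F"
  and \<zeta>: "\<zeta> \<in> carrier E" and eps: "eps > 0"
 shows "eventually (\<lambda>i. hm_norm E q (T i \<zeta> \<ominus> S \<zeta>) < eps) F"
proof -
 interpret q: seminormed_module E "hm_norm E q" by (rule hm_norm_seminormed[OF q])
 note cl = self.adjointable_closed and S_in = self.adjointable_closed[OF S(1)]
 have sums: "eventually (\<lambda>i. hm_norm E q (T i (lsum E \<iota> l) \<ominus> S (lsum E \<iota> l)) < eps) F"
  if "set l \<subseteq> \<Omega>" "eps > 0" for l eps using that
 proof (induction l arbitrary: eps)
  case Nil
  show ?case by (rule eventually_mono[OF T])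
    (use Nil in \<open>simp add: self.adjointable_zero[of "T _"] self.adjointable_zero[OF S(1)]\<close>)
 next
  case (Cons x l)
  have x: "x \<in> \<Omega>" and l: "set l \<subseteq> \<Omega>" and e2: "eps / 2 > 0" using Cons.prems by simp_all
  note s = generating_lsum_closed[OF gen l] and xE = generating_closed[OF gen x]
  show ?case
  proof (rule eventually_mono[OF eventually_conj[OF T eventually_conj[OF conv[OF x e2] Cons.IH[OF l e2]]]], elim conjE)
   fix i assume Ti: "T i \<in> adjointable B E E" and 1: "hm_norm E q (T i (\<iota> x) \<ominus> S (\<iota> x)) < eps / 2"
    and 2: "hm_norm E q (T i (lsum E \<iota> l) \<ominus> S (lsum E \<iota> l)) < eps / 2"
   have "hm_norm E q ((T i (\<iota> x) \<oplus> T i (lsum E \<iota> l)) \<ominus> (S (\<iota> x) \<oplus> S (lsum E \<iota> l))) \<le>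
     hm_norm E q (T i (\<iota> x) \<ominus> S (\<iota> x)) + hm_norm E q (T i (lsum E \<iota> l) \<ominus> S (lsum E \<iota> l))"
    by (intro q.add_diff_add_le cl[OF Ti] S_in xE s)
   then show "hm_norm E q (T i (lsum E \<iota> (x # l)) \<ominus> S (lsum E \<iota> (x # l))) < eps"
    unfolding lsum_Cons self.adjointable_add[OF Ti xE s] self.adjointable_add[OF S(1) xE s] using 1 2 by linarith
  qed
 qed
 have e3: "eps / 3 > 0" using eps by simp
 obtain l where l: "set l \<subseteq> \<Omega>" "hm_norm E q (lsum E \<iota> l \<ominus> \<zeta>) < eps / 3" by (rule generatingE[OF gen \<zeta> q e3])
 let ?s = "lsum E \<iota> l"
 have s: "?s \<in> carrier E" by (rule generating_lsum_closed[OF gen l(1)])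
 have near: "hm_norm E q (R ?s \<ominus> R \<zeta>) < eps / 3"
  if "R \<in> adjointable B E E" "!!\<zeta>. \<zeta> \<in> carrier E ==> hm_norm E q (R \<zeta>) \<le> hm_norm E q \<zeta>" for R
  using le_less_trans[OF that(2) l(2)] s \<zeta> by (simp add: self.adjointable_diff[OF that(1)])
 show ?thesis
 proof (rule eventually_mono[OF eventually_conj[OF T sums[OF l(1) e3]]], elim conjE)
  fix i assume Ti: "T i \<in> adjointable B E E" "\<forall>\<zeta>\<in>carrier E. hm_norm E q (T i \<zeta>) \<le> hm_norm E q \<zeta>"
   and 1: "hm_norm E q (T i ?s \<ominus> S ?s) < eps / 3"
  note c = cl[OF Ti(1) \<zeta>] cl[OF Ti(1) s] S_in[OF \<zeta>] S_in[OF s]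
  have 2: "hm_norm E q (T i ?s \<ominus> T i \<zeta>) < eps / 3" by (rule near[OF Ti(1)]) (use Ti(2) in blast)
  show "hm_norm E q (T i \<zeta> \<ominus> S \<zeta>) < eps"
   using 1 2 near[OF S] q.diff_triangle[OF c(1,2,3)] q.diff_triangle[OF c(2,4,3)] q.diff_sym[OF c(1,2)] by linarith
 qed
qed

context cp_model_unit
begin

theorem \<Phi>_nondegenerate: "nondegenerate_representation A B H \<Phi>"
 unfolding nondegenerate_representation_def H.dense_in_hm_topology
proof (intro conjI \<Phi>_morphism ballI allI impI)
 show "{\<Phi> a \<zeta> |a \<zeta>. a \<in> carrier A \<and> \<zeta> \<in> carrier H} \<subseteq> carrier H" using \<Phi>_in by blast
 fix \<zeta> q and eps :: real assume \<zeta>: "\<zeta> \<in> carrier H" and q: "q \<in> \<S> B" and eps: "eps > 0"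
 have contraction: "hm_norm H q (\<Phi> (e i) \<zeta>) \<le> hm_norm H q \<zeta>" if "i \<in> I" "\<zeta> \<in> carrier H" for i \<zeta>
  using \<Phi>(4)[OF e_in[OF that(1)] q that(2)]
   mult_right_mono[OF e_le_1[OF dom(1)[OF q] that(1)] H.hm_norm_nonneg[OF q that(2)]] by linarith
 have "eventually (\<lambda>i. hm_norm H q (\<Phi> (e i) \<zeta> \<ominus>\<^bsub>H\<^esub> id_on H \<zeta>) < eps) net"
 proof (rule H.contractions_converge[OF generating q _ H.id_on_adjointable _ _ \<zeta> eps])
  show "eventually (\<lambda>i. \<Phi> (e i) \<in> adjointable B H H \<and> (\<forall>\<zeta>\<in>carrier H. hm_norm H q (\<Phi> (e i) \<zeta>) \<le> hm_norm H q \<zeta>)) net"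
   by (rule eventually_mono[OF eventually_in]) (use contraction \<Phi>(1) e_in in blast)
  fix x and eps :: real assume x: "x \<in> \<Omega>" and eps: "eps > 0"
  obtain a \<xi> where x': "x = (a, \<xi>)" "a \<in> carrier A" "\<xi> \<in> carrier E" using x by (cases x) (auto simp: \<Omega>_def)
  show "eventually (\<lambda>i. hm_norm H q (\<Phi> (e i) (\<iota> x) \<ominus>\<^bsub>H\<^esub> id_on H (\<iota> x)) < eps) net"
   by (rule eventually_mono[OF eventually_conj[OF eventually_in \<iota>_e[OF q x'(2,3) eps]]])
    (use x' in \<open>simp add: \<Phi>(2) e_in id_on_def\<close>)
 qed (simp add: id_on_def)
 then have "eventually (\<lambda>i. i \<in> I \<and> hm_norm H q (\<Phi> (e i) \<zeta> \<ominus>\<^bsub>H\<^esub> \<zeta>) < eps) net"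
  using \<zeta> by (simp add: eventually_conj eventually_in id_on_def)
 from eventually_happens'[OF net_nontrivial this]
 show "\<exists>d\<in>{\<Phi> a \<zeta> |a \<zeta>. a \<in> carrier A \<and> \<zeta> \<in> carrier H}. hm_norm H q (d \<ominus>\<^bsub>H\<^esub> \<zeta>) < eps" using e_in \<zeta> by blast
qed

end

lemma compose_apply_eq: "[|compose S f g = h; x \<in> S|] ==> f (g x) = h x" by (auto simp: compose_eq)

locale unitary_group_rep = lc_hilbert B E + group G
 for B :: "'b star_algebra" and E :: "('b, 'e) hilbert_module" and G :: "('g, 'm) monoid_scheme" +
 fixes \<T> :: "'g topology" and u :: "'g => 'e => 'e"
 assumes rep: "unitary_representation G \<T> B E u"
begin

lemma u_adjointable: "g \<in> carrier G ==> u g \<in> adjointable B E E"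
 using rep unfolding unitary_representation_def unitary_op_def by blast

lemma u_in: "[|g \<in> carrier G; \<xi> \<in> carrier E|] ==> u g \<xi> \<in> carrier E" by (rule self.adjointable_closed[OF u_adjointable])

lemma u_mult: "[|g \<in> carrier G; t \<in> carrier G; \<xi> \<in> carrier E|] ==> u (g \<otimes>\<^bsub>G\<^esub> t) \<xi> = u g (u t \<xi>)"
 using rep unfolding unitary_representation_def by (simp add: compose_eq)

lemma adjoint_u_u: "[|g \<in> carrier G; \<xi> \<in> carrier E|] ==> adjoint B E E (u g) (u g \<xi>) = \<xi>"
 using rep compose_apply_eq[of "carrier E" "adjoint B E E (u g)" "u g" "id_on E" \<xi>]
 unfolding unitary_representation_def unitary_op_def id_on_def by simp

lemma u_one: "\<xi> \<in> carrier E ==> u \<one>\<^bsub>G\<^esub> \<xi> = \<xi>"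
 using adjoint_u_u[of "\<one>\<^bsub>G\<^esub>" "u \<one>\<^bsub>G\<^esub> \<xi>"] adjoint_u_u[of "\<one>\<^bsub>G\<^esub>" \<xi>] u_mult[of "\<one>\<^bsub>G\<^esub>" "\<one>\<^bsub>G\<^esub>" \<xi>] by (simp add: u_in)

lemma u_u_inv: "[|g \<in> carrier G; \<xi> \<in> carrier E|] ==> u g (u (inv\<^bsub>G\<^esub> g) \<xi>) = \<xi>"
 using u_mult[of g "inv\<^bsub>G\<^esub> g" \<xi>] by (simp add: u_one)

lemma adjoint_u: "[|g \<in> carrier G; \<xi> \<in> carrier E|] ==> adjoint B E E (u g) \<xi> = u (inv\<^bsub>G\<^esub> g) \<xi>"
 using adjoint_u_u[of g "u (inv\<^bsub>G\<^esub> g) \<xi>"] by (simp add: u_in u_u_inv)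

lemma ip_u: "[|g \<in> carrier G; \<xi> \<in> carrier E; \<eta> \<in> carrier E|] ==> ip E (u g \<xi>) (u g \<eta>) = ip E \<xi> \<eta>"
 using self.ip_adjoint[OF u_adjointable, of g \<xi> "u g \<eta>"] by (simp add: u_in adjoint_u_u)

lemma hm_norm_u: "[|g \<in> carrier G; \<xi> \<in> carrier E|] ==> hm_norm E q (u g \<xi>) = hm_norm E q \<xi>" by (simp add: hm_norm_def ip_u)

lemma covariant_intertwines:
 assumes cov: "covariant G A \<alpha> B E u \<rho>" and g: "g \<in> carrier G" and a: "a \<in> carrier A" and \<xi>: "\<xi> \<in> carrier E"
 shows "\<rho> (\<alpha> g a) (u g \<xi>) = u g (\<rho> a \<xi>)"
proof -
 have "\<rho> (\<alpha> g a) = compose (carrier E) (compose (carrier E) (u g) (\<rho> a)) (adjoint B E E (u g))"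
  using cov g a unfolding covariant_def by simp
 then show ?thesis using g \<xi> by (simp add: compose_eq u_in adjoint_u_u)
qed

end

locale covariant_cp_model = cp_model_unit A B E \<rho> H \<iota> I prec e + R: unitary_group_rep B E G \<T> u
 for A :: "'a star_algebra" (structure) and B :: "'b star_algebra" and E :: "('b, 'e) hilbert_module"
  and \<rho> and H :: "('b, 'h) hilbert_module" and \<iota> :: "'a \<times> 'e => 'h" and I :: "'i set" and prec e
  and G :: "('g, 'm) monoid_scheme" and \<T> u +
 fixes \<alpha> :: "'g => 'a => 'a"
 assumes dynamical: "dynamical_system G \<T> A \<alpha>"
  and covariant: "covariant G A \<alpha> B E u \<rho>"
begin

lemma topspace_group: "topspace \<T> = carrier G"
 using dynamical unfolding dynamical_system_def locally_compact_group_def by blast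

lemma \<alpha>_bij: "g \<in> carrier G ==> bij_betw (\<alpha> g) (carrier A) (carrier A)"
 using dynamical unfolding dynamical_system_def lc_isomorphism_def by blast

lemma \<alpha>_in [simp]: "[|g \<in> carrier G; a \<in> carrier A|] ==> \<alpha> g a \<in> carrier A" using bij_betw_apply[OF \<alpha>_bij] .

lemma \<alpha>_algebra:
 assumes "g \<in> carrier G" "a \<in> carrier A"
 shows "b \<in> carrier A ==> \<alpha> g (a \<otimes> b) = \<alpha> g a \<otimes> \<alpha> g b" "\<alpha> g (star A a) = star A (\<alpha> g a)"
 using dynamical assms unfolding dynamical_system_def lc_isomorphism_def lc_morphism_def by blast+

lemma \<alpha>_mult: "[|g \<in> carrier G; t \<in> carrier G; a \<in> carrier A|] ==> \<alpha> (g \<otimes>\<^bsub>G\<^esub> t) a = \<alpha> g (\<alpha> t a)"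
 using dynamical unfolding dynamical_system_def by blast

lemma \<alpha>_one: "a \<in> carrier A ==> \<alpha> \<one>\<^bsub>G\<^esub> a = a"
 using \<alpha>_mult[of "\<one>\<^bsub>G\<^esub>" "\<one>\<^bsub>G\<^esub>" a] inj_onD[OF bij_betw_imp_inj_on[OF \<alpha>_bij[of "\<one>\<^bsub>G\<^esub>"]], of "\<alpha> \<one>\<^bsub>G\<^esub> a" a] by simp

lemma \<alpha>_\<alpha>_inv: "[|g \<in> carrier G; a \<in> carrier A|] ==> \<alpha> g (\<alpha> (inv\<^bsub>G\<^esub> g) a) = a"
 using \<alpha>_mult[of g "inv\<^bsub>G\<^esub> g" a] by (simp add: \<alpha>_one)

lemma \<alpha>_continuous:
 assumes a: "a \<in> carrier A"
 shows "continuous_map \<T> (topo A) (\<lambda>g. \<alpha> g a)"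
proof -
 have "continuous_map \<T> (prod_topology \<T> (topo A)) (\<lambda>g. (g, a))" using a by (intro continuous_map_pairedI) auto
 moreover have "continuous_map (prod_topology \<T> (topo A)) (topo A) (\<lambda>(t, a). \<alpha> t a)"
  using dynamical unfolding dynamical_system_def by blast
 ultimately show ?thesis using continuous_map_compose by (fastforce simp: o_def)
qed

text \<open>
 $v_g\Phi(a)V\xi = \Phi(\alpha_g(a))Vu_g\xi$ dictates the action of the group on the generators, and
 covariance of \<open>\<rho>\<close> says that it preserves the kernel.
\<close>

definition move :: "'g => 'a \<times> 'e => 'a \<times> 'e"
 where "move g x = (\<alpha> g (fst x), u g (snd x))"

lemma move_in: "[|g \<in> carrier G; x \<in> \<Omega>|] ==> move g x \<in> \<Omega>" by (auto simp: move_def \<Omega>_def R.u_in)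

lemma move_inv: "[|g \<in> carrier G; x \<in> \<Omega>|] ==> move g (move (inv\<^bsub>G\<^esub> g) x) = x" by (auto simp: move_def \<Omega>_def R.u_u_inv \<alpha>_\<alpha>_inv)

lemma \<iota>_closed: "x \<in> \<Omega> ==> \<iota> x \<in> carrier H" by (rule H.generating_closed[OF generating])

lemma ip_move:
 assumes g: "g \<in> carrier G" and x: "x \<in> \<Omega>" and y: "y \<in> \<Omega>"
 shows "ip H (\<iota> (move g x)) (\<iota> (move g y)) = ip H (\<iota> x) (\<iota> y)"
proof -
 obtain a \<xi> b \<eta> where xy: "x = (a, \<xi>)" "a \<in> carrier A" "\<xi> \<in> carrier E" "y = (b, \<eta>)" "b \<in> carrier A" "\<eta> \<in> carrier E"
  using x y by (cases x; cases y) (auto simp: \<Omega>_def)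
 have "star A (\<alpha> g a) \<otimes> \<alpha> g b = \<alpha> g (star A a \<otimes> b)" using g xy by (simp add: \<alpha>_algebra)
 then show ?thesis using g xy R.covariant_intertwines[OF covariant g _ xy(6), of "star A a \<otimes> b"]
  by (simp add: move_def ip_\<iota>_pair R.u_in R.ip_u \<rho>_in)
qed

lemma v_exists:
 assumes g: "g \<in> carrier G"
 shows "\<exists>T. unitary_op B H H T \<and> (\<forall>x\<in>\<Omega>. T (\<iota> x) = \<iota> (move g x) \<and> adjoint B H H T (\<iota> (move g x)) = \<iota> x)"
proof (rule H.self.unitary_from_generators[OF generating])
 show "H.generating \<Omega> (\<lambda>x. \<iota> (move g x))" by (rule H.generating_reindex[OF generating, where m' = "move (inv\<^bsub>G\<^esub> g)"])
   (use g in \<open>simp_all add: move_in move_inv\<close>)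
 show "(fst x, \<ominus>\<^bsub>E\<^esub> snd x) \<in> \<Omega> \<and> \<iota> (fst x, \<ominus>\<^bsub>E\<^esub> snd x) = \<ominus>\<^bsub>H\<^esub> \<iota> x \<and>
   \<iota> (move g (fst x, \<ominus>\<^bsub>E\<^esub> snd x)) = \<ominus>\<^bsub>H\<^esub> \<iota> (move g x)" if "x \<in> \<Omega>" for x
  using that g E.self.adjointable_smult[OF R.u_adjointable[OF g], of "snd x" "- 1"]
  by (cases x) (simp add: \<Omega>_def move_def \<iota>_minus_right R.u_in E.V.smult_minus_1)
qed (rule ip_move[OF g])

definition v :: "'g => 'h => 'h"
 where "v g = (SOME T. unitary_op B H H T \<and>
  (\<forall>x\<in>\<Omega>. T (\<iota> x) = \<iota> (move g x) \<and> adjoint B H H T (\<iota> (move g x)) = \<iota> x))"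

lemma v_unitary: "g \<in> carrier G ==> unitary_op B H H (v g)" using someI_ex[OF v_exists, folded v_def] by blast

lemma v:
 assumes g: "g \<in> carrier G"
 shows "v g \<in> adjointable B H H" "!!x. x \<in> \<Omega> ==> v g (\<iota> x) = \<iota> (move g x)"
  "!!x. x \<in> \<Omega> ==> adjoint B H H (v g) (\<iota> x) = \<iota> (move (inv\<^bsub>G\<^esub> g) x)"
proof -
 note v = someI_ex[OF v_exists[OF g], folded v_def]
 show "v g \<in> adjointable B H H" using v unfolding unitary_op_def by blast
 show "v g (\<iota> x) = \<iota> (move g x)" if "x \<in> \<Omega>" for x using v that by blast
 show "adjoint B H H (v g) (\<iota> x) = \<iota> (move (inv\<^bsub>G\<^esub> g) x)" if x: "x \<in> \<Omega>" for x
  using v move_in[of "inv\<^bsub>G\<^esub> g" x] move_inv[OF g x] g x by (metis R.inv_closed)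
qed

lemma v_in: "[|g \<in> carrier G; \<zeta> \<in> carrier H|] ==> v g \<zeta> \<in> carrier H" by (rule H.self.adjointable_closed[OF v(1)])

lemmas compose_adjointable = compose_adjoint_pair(1)[OF H.self.hilbert_pair_axioms H.self.hilbert_pair_axioms]
 and v_eqI = H.self.adjointable_eq_on_generators[OF generating]

lemma v_mult:
 assumes "g \<in> carrier G" "t \<in> carrier G"
 shows "v (g \<otimes>\<^bsub>G\<^esub> t) = v g \<otimes>\<^bsub>operator_algebra B H\<^esub> v t"
proof (rule v_eqI)
 fix x assume x: "x \<in> \<Omega>"
 then have "move (g \<otimes>\<^bsub>G\<^esub> t) x = move g (move t x)" using assms by (auto simp: move_def \<Omega>_def \<alpha>_mult R.u_mult)
 then show "v (g \<otimes>\<^bsub>G\<^esub> t) (\<iota> x) = (v g \<otimes>\<^bsub>operator_algebra B H\<^esub> v t) (\<iota> x)"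
  using assms x by (simp add: v compose_eq \<iota>_closed move_in)
qed (use assms in \<open>simp_all add: v compose_adjointable\<close>)

lemma v_norm:
 assumes g: "g \<in> carrier G" and \<zeta>: "\<zeta> \<in> carrier H"
 shows "hm_norm H q (v g \<zeta>) = hm_norm H q \<zeta>"
proof -
 have "adjoint B H H (v g) (v g \<zeta>) = \<zeta>"
  using v_unitary[OF g] compose_apply_eq[of "carrier H" "adjoint B H H (v g)" "v g" "id_on H" \<zeta>] \<zeta>
  unfolding unitary_op_def id_on_def by simp
 then show ?thesis using H.self.ip_adjoint[OF v(1)[OF g] \<zeta> v_in[OF g \<zeta>]] by (simp add: hm_norm_def)
qed

lemma v_continuous_generator:
 assumes g: "g \<in> carrier G" and x: "x \<in> \<Omega>" and q: "q \<in> \<S> B" and eps: "eps > 0"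
 shows "\<exists>U. openin \<T> U \<and> g \<in> U \<and> (\<forall>t\<in>U. hm_norm H q (v t (\<iota> x) \<ominus>\<^bsub>H\<^esub> v g (\<iota> x)) < eps)"
proof -
 obtain a \<xi> where x': "x = (a, \<xi>)" "a \<in> carrier A" "\<xi> \<in> carrier E" using x by (cases x) (auto simp: \<Omega>_def)
 interpret p: cstar_seminormed A "dom q" by (rule A.cont_seminormD[OF dom(1)[OF q]])
 interpret qH: seminormed_module H "hm_norm H q" by (rule H.hm_norm_seminormed[OF q])
 interpret qE: seminormed_module E "hm_norm E q" by (rule E.hm_norm_seminormed[OF q])
 interpret FE: seminorm_family E "hm_norm E ` \<S> B" by (rule E.hm_seminorm_family)
 obtain K where K: "K \<ge> 0" "\<forall>a\<in>carrier A. \<forall>\<xi>\<in>carrier E. hm_norm H q (\<iota> (a, \<xi>)) \<le> K * dom q a * hm_norm E q \<xi>"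
  using dom(2)[OF q] by blast
 have ga: "\<alpha> g a \<in> carrier A" and g\<xi>: "u g \<xi> \<in> carrier E" using g x' by (simp_all add: R.u_in)
 define M where "M = K * hm_norm E q \<xi> + K * dom q (\<alpha> g a)"
 have M: "M \<ge> 0" using K(1) qE.nonneg[OF x'(3)] p.nonneg[OF ga] by (simp add: M_def)
 define del where "del = eps / (M + 1)"
 have del: "del > 0" "(M + 1) * del = eps" using eps M by (simp_all add: del_def)
 have o1: "openin \<T> {t \<in> topspace \<T>. \<alpha> t a \<in> {b \<in> carrier A. dom q (b \<ominus> \<alpha> g a) < del}}"
  by (rule openin_continuous_map_preimage[OF \<alpha>_continuous[OF x'(2)] A.openin_cont_seminorm_ball[OF dom(1)[OF q] ga]])
 have cu: "continuous_map \<T> (hm_topology B E) (\<lambda>t. u t \<xi>)" using R.rep x'(3) unfolding unitary_representation_def by blast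
 have o2: "openin \<T> {t \<in> topspace \<T>. u t \<xi> \<in> {\<eta> \<in> carrier E. hm_norm E q (\<eta> \<ominus>\<^bsub>E\<^esub> u g \<xi>) < del}}"
  by (rule openin_continuous_map_preimage[OF cu])
   (unfold hm_topology_def, rule FE.openin_seminorm_ball[OF imageI[OF q] g\<xi>])
 let ?U = "{t \<in> topspace \<T>. \<alpha> t a \<in> {b \<in> carrier A. dom q (b \<ominus> \<alpha> g a) < del}} \<inter>
  {t \<in> topspace \<T>. u t \<xi> \<in> {\<eta> \<in> carrier E. hm_norm E q (\<eta> \<ominus>\<^bsub>E\<^esub> u g \<xi>) < del}}"
 have "hm_norm H q (v t (\<iota> x) \<ominus>\<^bsub>H\<^esub> v g (\<iota> x)) < eps" if tU: "t \<in> ?U" for t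
 proof -
  have t: "t \<in> carrier G" "dom q (\<alpha> t a \<ominus> \<alpha> g a) < del" "hm_norm E q (u t \<xi> \<ominus>\<^bsub>E\<^esub> u g \<xi>) < del"
   using tU by (simp_all add: topspace_group)
  have ta: "\<alpha> t a \<in> carrier A" and t\<xi>: "u t \<xi> \<in> carrier E" using t(1) x' by (simp_all add: R.u_in)
  let ?d = "\<alpha> t a \<ominus> \<alpha> g a" and ?\<eta> = "u t \<xi> \<ominus>\<^bsub>E\<^esub> u g \<xi>"
  have d: "?d \<in> carrier A" and \<eta>: "?\<eta> \<in> carrier E" using ta ga t\<xi> g\<xi> by simp_all
  have "hm_norm H q (v t (\<iota> x) \<ominus>\<^bsub>H\<^esub> v g (\<iota> x)) = hm_norm H q (\<iota> (\<alpha> t a, u t \<xi>) \<ominus>\<^bsub>H\<^esub> \<iota> (\<alpha> g a, u g \<xi>))"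
   using t(1) g x x'(1) by (simp add: v move_def)
  also have "... \<le> hm_norm H q (\<iota> (\<alpha> t a, u t \<xi>) \<ominus>\<^bsub>H\<^esub> \<iota> (\<alpha> g a, u t \<xi>)) +
    hm_norm H q (\<iota> (\<alpha> g a, u t \<xi>) \<ominus>\<^bsub>H\<^esub> \<iota> (\<alpha> g a, u g \<xi>))"
   by (rule qH.diff_triangle[OF \<iota>_in[OF ta t\<xi>] \<iota>_in[OF ga t\<xi>] \<iota>_in[OF ga g\<xi>]])
  also have "... = hm_norm H q (\<iota> (?d, u t \<xi>)) + hm_norm H q (\<iota> (\<alpha> g a, ?\<eta>))"
   unfolding \<iota>_diff[OF ta ga t\<xi>] \<iota>_diff_right[OF ga g\<xi> t\<xi>] ..
  also have "... \<le> K * dom q ?d * hm_norm E q \<xi> + K * dom q (\<alpha> g a) * hm_norm E q ?\<eta>"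
   using K(2)[rule_format, OF d t\<xi>] K(2)[rule_format, OF ga \<eta>] unfolding R.hm_norm_u[OF t(1) x'(3)] by linarith
  also have "... \<le> K * del * hm_norm E q \<xi> + K * dom q (\<alpha> g a) * del"
   using K(1) t(2,3) p.nonneg[OF ga] qE.nonneg[OF x'(3)] by (intro add_mono mult_right_mono mult_left_mono) simp_all
  also have "... < eps" using del by (simp add: M_def algebra_simps)
  finally show ?thesis .
 qed
 moreover have "g \<in> ?U" using g ga g\<xi> del(1) by (simp add: topspace_group)
 ultimately show ?thesis using openin_Int[OF o1 o2] by blast
qed

lemma v_continuous:
 assumes \<zeta>: "\<zeta> \<in> carrier H"
 shows "continuous_map \<T> (hm_topology B H) (\<lambda>g. v g \<zeta>)"
proof -
 interpret F: seminorm_family H "hm_norm H ` \<S> B" by (rule H.hm_seminorm_family)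
 show ?thesis unfolding hm_topology_def
 proof (rule F.continuous_map_into_seminorm_topology)
  fix g p and eps :: real
  assume "g \<in> topspace \<T>" and p: "p \<in> hm_norm H ` \<S> B" and eps: "eps > 0"
  then have g: "g \<in> carrier G" by (simp add: topspace_group)
  obtain q where q: "q \<in> \<S> B" "p = hm_norm H q" using p by blast
  have ev: "eventually P (nhdsin \<T> g) \<longleftrightarrow> (\<exists>U. openin \<T> U \<and> g \<in> U \<and> (\<forall>t\<in>U. P t))" for P
   using g by (simp add: eventually_nhdsin topspace_group)
  have "eventually (\<lambda>t. hm_norm H q (v t \<zeta> \<ominus>\<^bsub>H\<^esub> v g \<zeta>) < eps) (nhdsin \<T> g)"
  proof (rule H.contractions_converge[OF generating q(1) _ v(1)[OF g] _ _ \<zeta> eps])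
   show "eventually (\<lambda>t. v t \<in> adjointable B H H \<and> (\<forall>\<zeta>\<in>carrier H. hm_norm H q (v t \<zeta>) \<le> hm_norm H q \<zeta>)) (nhdsin \<T> g)"
    unfolding ev by (rule exI[of _ "topspace \<T>"]) (use g openin_topspace[of \<T>] in \<open>auto simp: topspace_group v v_norm\<close>)
   show "eventually (\<lambda>t. hm_norm H q (v t (\<iota> x) \<ominus>\<^bsub>H\<^esub> v g (\<iota> x)) < eps) (nhdsin \<T> g)" if "x \<in> \<Omega>" "eps > 0" for x eps
    unfolding ev by (rule v_continuous_generator[OF g that(1) q(1) that(2)])
  qed (simp add: v_norm g)
  then show "\<exists>U. openin \<T> U \<and> g \<in> U \<and> (\<forall>t\<in>U. p (v t \<zeta> \<ominus>\<^bsub>H\<^esub> v g \<zeta>) < eps)" unfolding ev q(2) .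
 qed (use \<zeta> in \<open>simp add: topspace_group v_in\<close>)
qed

lemma v_representation: "unitary_representation G \<T> B H v"
 unfolding unitary_representation_def using v_unitary v_mult v_continuous by blast

lemma v_covariant: "covariant G A \<alpha> B H v \<Phi>" unfolding covariant_def
proof (intro ballI)
 fix g a assume g: "g \<in> carrier G" and a: "a \<in> carrier A"
 note c = compose_adjointable H.self.adjoint_adjointable(1) v(1)[OF g] \<Phi>(1)
 show "\<Phi> (\<alpha> g a) = v g \<otimes>\<^bsub>operator_algebra B H\<^esub> \<Phi> a \<otimes>\<^bsub>operator_algebra B H\<^esub> star (operator_algebra B H) (v g)"
 proof (rule v_eqI)
  fix x assume x: "x \<in> \<Omega>"
  obtain b \<xi> where x': "x = (b, \<xi>)" "b \<in> carrier A" "\<xi> \<in> carrier E" using x by (cases x) (auto simp: \<Omega>_def)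
  define b' \<xi>' where "b' = \<alpha> (inv\<^bsub>G\<^esub> g) b" and "\<xi>' = u (inv\<^bsub>G\<^esub> g) \<xi>"
  have b': "b' \<in> carrier A" "\<xi>' \<in> carrier E" "\<alpha> g b' = b" "u g \<xi>' = \<xi>"
   using g x' by (simp_all add: b'_def \<xi>'_def R.u_in R.u_u_inv \<alpha>_\<alpha>_inv)
  have "adjoint B H H (v g) (\<iota> x) = \<iota> (b', \<xi>')" unfolding v(3)[OF g x] by (simp add: move_def x'(1) b'_def \<xi>'_def)
  moreover have "v g (\<iota> (a \<otimes> b', \<xi>')) = \<iota> (\<alpha> g a \<otimes> b, \<xi>)" using g a b' by (simp add: v \<Omega>_def move_def \<alpha>_algebra)
  ultimately show "\<Phi> (\<alpha> g a) (\<iota> x) = (v g \<otimes>\<^bsub>operator_algebra B H\<^esub> \<Phi> a \<otimes>\<^bsub>operator_algebra B H\<^esub> star (operator_algebra B H) (v g)) (\<iota> x)"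
   using g a x' b' by (simp add: compose_eq \<Phi>)
 qed (use g a c in simp_all)
qed

lemma v_V:
 assumes g: "g \<in> carrier G"
 shows "compose (carrier E) (v g) V = compose (carrier E) V (u g)"
proof (rule extensionalityI[OF compose_extensional compose_extensional])
 fix \<xi> assume \<xi>: "\<xi> \<in> carrier E"
 have gi: "inv\<^bsub>G\<^esub> g \<in> carrier G" using g by simp
 have "v g (V \<xi>) = V (u g \<xi>)"
 proof (rule \<iota>_eqI[OF v_in[OF g V_in[OF \<xi>]] V_in[OF R.u_in[OF g \<xi>]]])
  fix b \<eta> assume b: "b \<in> carrier A" and \<eta>: "\<eta> \<in> carrier E"
  have "ip H (v g (V \<xi>)) (\<iota> (b, \<eta>)) = ip H (V \<xi>) (\<iota> (\<alpha> (inv\<^bsub>G\<^esub> g) b, u (inv\<^bsub>G\<^esub> g) \<eta>))"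
   using H.self.ip_adjoint[OF v(1)[OF g] V_in[OF \<xi>] \<iota>_in[OF b \<eta>]] b \<eta> g by (simp add: v \<Omega>_def move_def)
  also have "... = ip E \<xi> (adjoint B E E (u g) (\<rho> b \<eta>))"
   using gi g b \<eta> \<xi> R.covariant_intertwines[OF covariant gi b \<eta>] by (simp add: ip_V R.u_in R.adjoint_u \<rho>_in)
  also have "... = ip H (V (u g \<xi>)) (\<iota> (b, \<eta>))"
   using E.self.ip_adjoint[OF R.u_adjointable[OF g] \<xi> \<rho>_in[OF b \<eta>]] g b \<eta> \<xi> by (simp add: ip_V R.u_in)
  finally show "ip H (v g (V \<xi>)) (\<iota> (b, \<eta>)) = ip H (V (u g \<xi>)) (\<iota> (b, \<eta>))" .
 qed
 then show "compose (carrier E) (v g) V \<xi> = compose (carrier E) V (u g) \<xi>" using \<xi> by (simp add: compose_eq)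
qed

theorem covariant_dilation_model: "covariant_dilation G \<T> A \<alpha> B E u \<rho> H \<Phi> v V"
 unfolding covariant_dilation_def covariant_representation_def
 by (intro conjI ballI H.E.hilbert_module_axioms \<Phi>_nondegenerate v_representation v_covariant
   V_adjointable \<rho>_dilation \<Phi>_V_span_dense v_V)

end

section \<open>Comparison of dilations\<close>

lemma cp_models_unitarily_equivalent:
 assumes "cp_model A B E \<rho> H \<iota>" "cp_model A B E \<rho> F \<kappa>"
 shows "\<exists>U. unitary_op B H F U \<and> (\<forall>a\<in>carrier A. \<forall>\<xi>\<in>carrier E. U (\<iota> (a, \<xi>)) = \<kappa> (a, \<xi>) \<and> adjoint B H F U (\<kappa> (a, \<xi>)) = \<iota> (a, \<xi>))"
proof -
 interpret M: cp_model A B E \<rho> H \<iota> by fact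
 interpret N: cp_model A B E \<rho> F \<kappa> by fact
 interpret HF: hilbert_pair B H F ..
 have "\<exists>U. unitary_op B H F U \<and> (\<forall>x\<in>M.\<Omega>. U (\<iota> x) = \<kappa> x \<and> adjoint B H F U (\<kappa> x) = \<iota> x)"
 proof (rule HF.unitary_from_generators[OF M.generating N.generating])
  fix x y assume x: "x \<in> M.\<Omega>" and y: "y \<in> M.\<Omega>"
  show "ip F (\<kappa> x) (\<kappa> y) = ip H (\<iota> x) (\<iota> y)" unfolding M.ip_\<iota>[OF x y] N.ip_\<iota>[OF x y] ..
  show "(fst x, \<ominus>\<^bsub>E\<^esub> snd x) \<in> M.\<Omega> \<and> \<iota> (fst x, \<ominus>\<^bsub>E\<^esub> snd x) = \<ominus>\<^bsub>H\<^esub> \<iota> x \<and> \<kappa> (fst x, \<ominus>\<^bsub>E\<^esub> snd x) = \<ominus>\<^bsub>F\<^esub> \<kappa> x"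
   using x by (cases x) (simp add: M.\<Omega>_def M.\<iota>_minus_right N.\<iota>_minus_right)
 qed
 then show ?thesis by (simp add: M.\<Omega>_def)
qed

locale dilation = cp_map A B E \<rho> + F: lc_hilbert B F + R: unitary_group_rep B E G \<T> u
 for A :: "'a star_algebra" (structure) and B :: "'b star_algebra" and E :: "('b, 'e) hilbert_module"
  and \<rho> and F :: "('b, 'f) hilbert_module" and G :: "('g, 'm) monoid_scheme" and \<T> u +
 fixes \<alpha> :: "'g => 'a => 'a" and \<Phi> :: "'a => 'f => 'f" and v :: "'g => 'f => 'f" and W :: "'e => 'f"
 assumes dilation: "covariant_dilation G \<T> A \<alpha> B E u \<rho> F \<Phi> v W"
  and action: "dynamical_system G \<T> A \<alpha>"
begin

sublocale EF: hilbert_pair B E F ..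

sublocale S: unitary_group_rep B F G \<T> v
proof unfold_locales
 show "unitary_representation G \<T> B F v" using dilation by (simp add: covariant_dilation_def covariant_representation_def)
qed

definition gen :: "'a \<times> 'e => 'f"
 where "gen x = \<Phi> (fst x) (W (snd x))"

lemmas dilationD = dilation[unfolded covariant_dilation_def covariant_representation_def
  nondegenerate_representation_def]

lemma W: "W \<in> adjointable B E F" by (rule dilationD[THEN conjunct2, THEN conjunct1])

lemma W_in: "\<xi> \<in> carrier E ==> W \<xi> \<in> carrier F" by (rule EF.adjointable_closed[OF W])

lemma morphism: "lc_morphism A (operator_algebra B F) \<Phi>"
 by (rule dilationD[THEN conjunct1, THEN conjunct2, THEN conjunct1, THEN conjunct1])

lemma \<Phi>: "a \<in> carrier A ==> \<Phi> a \<in> adjointable B F F" using morphism unfolding lc_morphism_def linear_on_def by auto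

lemma \<Phi>_in: "[|a \<in> carrier A; \<zeta> \<in> carrier F|] ==> \<Phi> a \<zeta> \<in> carrier F" by (rule F.self.adjointable_closed[OF \<Phi>])

lemma \<Phi>_star: "a \<in> carrier A ==> adjoint B F F (\<Phi> a) = \<Phi> (star A a)" using morphism unfolding lc_morphism_def by simp

lemma \<Phi>_mult: "[|a \<in> carrier A; b \<in> carrier A; \<zeta> \<in> carrier F|] ==> \<Phi> a (\<Phi> b \<zeta>) = \<Phi> (a \<otimes> b) \<zeta>"
 using morphism unfolding lc_morphism_def by (simp add: compose_eq)

lemma ip_W_gen:
 assumes "\<xi> \<in> carrier E" "a \<in> carrier A" "\<eta> \<in> carrier E"
 shows "ip F (W \<xi>) (gen (a, \<eta>)) = ip E \<xi> (\<rho> a \<eta>)"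
proof -
 have "\<rho> a = compose (carrier E) (adjoint B E F W) (compose (carrier E) (\<Phi> a) W)"
  by (rule bspec[OF dilationD[THEN conjunct2, THEN conjunct2, THEN conjunct1] assms(2)])
 then have "\<rho> a \<eta> = adjoint B E F W (gen (a, \<eta>))" using assms(3) by (simp add: compose_eq gen_def)
 then show ?thesis using EF.ip_adjoint[OF W assms(1), of "gen (a, \<eta>)"] assms by (simp add: gen_def \<Phi>_in W_in)
qed

lemma \<Phi>_gen: "[|a \<in> carrier A; b \<in> carrier A; \<xi> \<in> carrier E|] ==> \<Phi> a (gen (b, \<xi>)) = gen (a \<otimes> b, \<xi>)"
 by (simp add: gen_def \<Phi>_mult W_in)

lemma \<alpha>_in: "[|g \<in> carrier G; a \<in> carrier A|] ==> \<alpha> g a \<in> carrier A"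
 using action bij_betw_apply[of "\<alpha> g" "carrier A" "carrier A" a] unfolding dynamical_system_def lc_isomorphism_def by simp

lemma v_gen:
 assumes g: "g \<in> carrier G" and a: "a \<in> carrier A" and \<xi>: "\<xi> \<in> carrier E"
 shows "v g (gen (a, \<xi>)) = gen (\<alpha> g a, u g \<xi>)"
proof -
 have cov: "covariant G A \<alpha> B F v \<Phi>" and vW: "compose (carrier E) (v g) W = compose (carrier E) W (u g)"
  by (rule dilationD[THEN conjunct1, THEN conjunct2, THEN conjunct2, THEN conjunct2])
   (rule bspec[OF dilationD[THEN conjunct2, THEN conjunct2, THEN conjunct2, THEN conjunct2] g])
 have "v g (W \<xi>) = W (u g \<xi>)" using compose_apply_eq[OF vW \<xi>] \<xi> by (simp add: compose_eq)
 then show ?thesis using S.covariant_intertwines[OF cov g a W_in[OF \<xi>]] by (simp add: gen_def)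
qed

lemma cp_model: "cp_model A B E \<rho> F gen"
proof unfold_locales
 have gen_in: "gen x \<in> carrier F" if "x \<in> \<Omega>" for x using that by (auto simp: gen_def \<Omega>_def \<Phi>_in W_in)
 have "dense_in (hm_topology B F) (linear_span F {\<Phi> a (W \<xi>) |a \<xi>. a \<in> carrier A \<and> \<xi> \<in> carrier E})"
  by (rule dilationD[THEN conjunct2, THEN conjunct2, THEN conjunct2, THEN conjunct1])
 moreover have "gen ` \<Omega> = {gen (a, \<xi>) |a \<xi>. a \<in> carrier A \<and> \<xi> \<in> carrier E}" unfolding \<Omega>_def by blast
 ultimately have "dense_in (hm_topology B F) (linear_span F (gen ` \<Omega>))" by (simp add: gen_def)
 moreover have "\<exists>y\<in>\<Omega>. gen y = z \<odot>\<^bsub>F\<^esub> gen x" if "x \<in> \<Omega>" for x z using that by (intro bexI[of _ "(fst x, z \<odot>\<^bsub>E\<^esub> snd x)"])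
   (auto simp: \<Omega>_def gen_def EF.adjointable_smult[OF W] F.self.adjointable_smult[OF \<Phi>] W_in)
 ultimately show "F.generating \<Omega> gen" using F.generating_iff_dense_span[of \<Omega> gen] gen_in by blast
 fix x y assume xy: "x \<in> \<Omega>" "y \<in> \<Omega>"
 obtain a \<xi> b \<eta> where x: "x = (a, \<xi>)" "a \<in> carrier A" "\<xi> \<in> carrier E" and y: "y = (b, \<eta>)" "b \<in> carrier A" "\<eta> \<in> carrier E"
  using xy by (cases x; cases y) (auto simp: \<Omega>_def)
 have "ip F (gen x) (gen y) = ip F (W \<xi>) (gen (star A a \<otimes> b, \<eta>))"
  using F.self.ip_adjoint[OF \<Phi>[OF x(2)] W_in[OF x(3)] gen_in[OF xy(2)]] x y by (simp add: \<Phi>_star \<Phi>_gen) (simp add: gen_def)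
 then show "ip F (gen x) (gen y) = kern x y" using x y by (simp add: ip_W_gen kern_def)
qed

end

section \<open>Covariant dilations\<close>

lemma covariant_dilation_exists:
 fixes E :: "('b, 'e) hilbert_module" and A :: "'a star_algebra"
 assumes "cp_map A B E \<rho>" and "dynamical_system G \<T> A \<alpha>" and "unitary_representation G \<T> B E u"
  and "nondegenerate_cp TYPE('i) A B E \<rho>" and "covariant G A \<alpha> B E u \<rho>"
 shows "\<exists>(H :: ('b, 'a \<times> 'e => 'b) hilbert_module) \<Phi> v V. covariant_dilation G \<T> A \<alpha> B E u \<rho> H \<Phi> v V"
proof -
 interpret cp_map A B E \<rho> by fact
 interpret K: positive_definite_kernel B \<Omega> kern "\<lambda>z x. (fst x, z \<odot>\<^bsub>E\<^esub> snd x)" "\<lambda>x b. (fst x, ract E (snd x) b)"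
  by (rule kern_kernel)
 interpret G: group G using assms(2) by (simp add: dynamical_system_def locally_compact_group_def)
 obtain H :: "('b, 'a \<times> 'e => 'b) hilbert_module" and \<iota> where H: "hilbert_module B H"
  "\<forall>x\<in>\<Omega>. \<iota> x \<in> carrier H" "\<forall>x\<in>\<Omega>. \<forall>y\<in>\<Omega>. ip H (\<iota> x) (\<iota> y) = kern x y"
  "\<forall>\<xi>\<in>carrier H. \<forall>q\<in>\<S> B. \<forall>eps>0. \<exists>l. set l \<subseteq> \<Omega> \<and> hm_norm H q (lsum H \<iota> l \<ominus>\<^bsub>H\<^esub> \<xi>) < eps" using K.kernel_realization by blast
 obtain I :: "'i set" and prec e where unit: "approximate_unit A I prec e"
  "limitin (strict_topology B E) (\<lambda>i. \<rho> (e i)) (id_on E) (net_filter I prec)"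
  using assms(4) unfolding nondegenerate_cp_def by blast
 interpret HH: lc_hilbert B H by (intro lc_hilbert.intro E.B.locally_cstar_algebra_axioms H(1))
 interpret M: covariant_cp_model A B E \<rho> H \<iota> I prec e G \<T> u \<alpha>
 proof unfold_locales
  show "HH.generating \<Omega> \<iota>" using H(2,4) unfolding HH.generating_def by blast
  show "ip H (\<iota> x) (\<iota> y) = kern x y" if "x \<in> \<Omega>" "y \<in> \<Omega>" for x y using H(3) that by blast
 qed (fact unit assms)+
 show ?thesis using M.covariant_dilation_model by blast
qed

lemma covariant_dilations_equivalent:
 assumes "cp_map A B E \<rho>" and "dynamical_system G \<T> A \<alpha>" and "unitary_representation G \<T> B E u"
  and "covariant_dilation G \<T> A \<alpha> B E u \<rho> H \<Phi>' v' V" and "covariant_dilation G \<T> A \<alpha> B E u \<rho> F \<Phi> v W"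
 shows "\<exists>U. unitary_op B H F U \<and>
  (\<forall>a\<in>carrier A. compose (carrier H) (\<Phi> a) U = compose (carrier H) U (\<Phi>' a)) \<and>
  (\<forall>g\<in>carrier G. compose (carrier H) (v g) U = compose (carrier H) U (v' g)) \<and>
  W = compose (carrier E) U V"
proof -
 interpret cp_map A B E \<rho> by fact
 interpret G: group G using assms(2) by (simp add: dynamical_system_def locally_compact_group_def)
 have hm: "hilbert_module B H" "hilbert_module B F"
  using assms(4,5) by (simp_all add: covariant_dilation_def covariant_representation_def)
 interpret H: lc_hilbert B H by (intro lc_hilbert.intro E.B.locally_cstar_algebra_axioms hm)
 interpret F: lc_hilbert B F by (intro lc_hilbert.intro E.B.locally_cstar_algebra_axioms hm)
 interpret D1: dilation A B E \<rho> H G \<T> u \<alpha> \<Phi>' v' V by unfold_locales (fact assms)+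
 interpret D2: dilation A B E \<rho> F G \<T> u \<alpha> \<Phi> v W by unfold_locales (fact assms)+
 interpret M1: cp_model A B E \<rho> H D1.gen by (rule D1.cp_model)
 interpret M2: cp_model A B E \<rho> F D2.gen by (rule D2.cp_model)
 interpret HF: hilbert_pair B H F ..
 obtain U where U: "unitary_op B H F U" "\<forall>a\<in>carrier A. \<forall>\<xi>\<in>carrier E. U (D1.gen (a, \<xi>)) = D2.gen (a, \<xi>) \<and>
   adjoint B H F U (D2.gen (a, \<xi>)) = D1.gen (a, \<xi>)" using cp_models_unitarily_equivalent[OF D1.cp_model D2.cp_model] by blast
 have Ua: "U \<in> adjointable B H F" using U(1) unfolding unitary_op_def by blast
 have left: "compose (carrier H) T U \<in> adjointable B H F" if "T \<in> adjointable B F F" for T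
  by (rule compose_adjoint_pair(1)[OF HF.hilbert_pair_axioms F.self.hilbert_pair_axioms Ua that])
 have right: "compose (carrier H) U T \<in> adjointable B H F" if "T \<in> adjointable B H H" for T
  by (rule compose_adjoint_pair(1)[OF H.self.hilbert_pair_axioms HF.hilbert_pair_axioms that Ua])
 note eqI = HF.adjointable_eq_on_pairs[OF M1.generating[unfolded \<Omega>_def]]
 have "compose (carrier H) (\<Phi> a) U = compose (carrier H) U (\<Phi>' a)" if a: "a \<in> carrier A" for a
 proof (rule eqI[OF left[OF D2.\<Phi>[OF a]] right[OF D1.\<Phi>[OF a]]])
  show "compose (carrier H) (\<Phi> a) U (D1.gen (b, \<xi>)) = compose (carrier H) U (\<Phi>' a) (D1.gen (b, \<xi>))"
   if "b \<in> carrier A" "\<xi> \<in> carrier E" for b \<xi> using that a U(2) by (simp add: compose_eq D1.\<Phi>_gen D2.\<Phi>_gen)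
 qed
 moreover have "compose (carrier H) (v g) U = compose (carrier H) U (v' g)" if g: "g \<in> carrier G" for g
 proof (rule eqI[OF left[OF D2.S.u_adjointable[OF g]] right[OF D1.S.u_adjointable[OF g]]])
  show "compose (carrier H) (v g) U (D1.gen (b, \<xi>)) = compose (carrier H) U (v' g) (D1.gen (b, \<xi>))"
   if "b \<in> carrier A" "\<xi> \<in> carrier E" for b \<xi> using that g U(2) by (simp add: compose_eq D1.v_gen D2.v_gen D1.\<alpha>_in D1.R.u_in)
 qed
 moreover have "W = compose (carrier E) U V"
 proof (rule extensionalityI[OF D2.EF.adjointable_extensional[OF D2.W] compose_extensional])
  fix \<xi> assume \<xi>: "\<xi> \<in> carrier E"
  have "W \<xi> = U (V \<xi>)"
  proof (rule M2.\<iota>_eqI[OF D2.W_in[OF \<xi>] HF.adjointable_closed[OF Ua D1.W_in[OF \<xi>]]])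
   show "ip F (W \<xi>) (D2.gen (b, \<eta>)) = ip F (U (V \<xi>)) (D2.gen (b, \<eta>))"
    if "b \<in> carrier A" "\<eta> \<in> carrier E" for b \<eta> using that \<xi> U(2) HF.ip_adjoint[OF Ua D1.W_in[OF \<xi>] M2.\<iota>_in[OF that]]
    by (simp add: D1.ip_W_gen D2.ip_W_gen)
  qed
  then show "W \<xi> = compose (carrier E) U V \<xi>" using \<xi> by (simp add: compose_eq)
 qed
 ultimately show ?thesis using U(1) by blast
qed

theorem theorem3p6:
  fixes G :: "('g, 'm) monoid_scheme" and \<T> :: "'g topology"
    and A :: "'a star_algebra" and \<alpha> :: "'g \<Rightarrow> 'a \<Rightarrow> 'a"
    and B :: "'b star_algebra" and E :: "('b, 'e) hilbert_module"
    and u :: "'g \<Rightarrow> 'e \<Rightarrow> 'e" and \<rho> :: "'a \<Rightarrow> 'e \<Rightarrow> 'e"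
  assumes "dynamical_system G \<T> A \<alpha>"
    and "locally_cstar_algebra B"
    and "hilbert_module B E"
    and "unitary_representation G \<T> B E u"
    and "completely_positive A (operator_algebra B E) \<rho>"
    and "continuous_map (topo A) (topo (operator_algebra B E)) \<rho>"
    and "nondegenerate_cp TYPE('i) A B E \<rho>"
    and "covariant G A \<alpha> B E u \<rho>"
  shows "(\<exists>(E\<^sub>\<rho> :: ('b, 'a \<times> 'e \<Rightarrow> 'b) hilbert_module) \<Phi>\<^sub>\<rho> v\<^sub>\<rho> V\<^sub>\<rho>.
            covariant_dilation G \<T> A \<alpha> B E u \<rho> E\<^sub>\<rho> \<Phi>\<^sub>\<rho> v\<^sub>\<rho> V\<^sub>\<rho>) \<and>
         (\<forall>(E\<^sub>\<rho> :: ('b, 'h) hilbert_module) \<Phi>\<^sub>\<rho> v\<^sub>\<rho> V\<^sub>\<rho> (F :: ('b, 'f) hilbert_module) \<Phi> v W.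
            covariant_dilation G \<T> A \<alpha> B E u \<rho> E\<^sub>\<rho> \<Phi>\<^sub>\<rho> v\<^sub>\<rho> V\<^sub>\<rho> \<longrightarrow>
            covariant_dilation G \<T> A \<alpha> B E u \<rho> F \<Phi> v W \<longrightarrow>
            (\<exists>U. unitary_op B E\<^sub>\<rho> F U \<and>
              (\<forall>a\<in>carrier A. compose (carrier E\<^sub>\<rho>) (\<Phi> a) U = compose (carrier E\<^sub>\<rho>) U (\<Phi>\<^sub>\<rho> a)) \<and>
              (\<forall>g\<in>carrier G. compose (carrier E\<^sub>\<rho>) (v g) U = compose (carrier E\<^sub>\<rho>) U (v\<^sub>\<rho> g)) \<and>
              W = compose (carrier E) U V\<^sub>\<rho>))"
proof -
 have "locally_cstar_algebra A" using assms(1) unfolding dynamical_system_def by blast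
 then have cp: "cp_map A B E \<rho>" by (intro cp_map.intro lc_hilbert.intro cp_map_axioms.intro assms(2,3,5,6))
 show ?thesis by (intro conjI allI impI covariant_dilation_exists[OF cp assms(1,4,7,8)]
    covariant_dilations_equivalent[OF cp assms(1,4)])
qed

end
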